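(* Let $n\ge 7$ be an integer and let $t\ge 3$ be the integer with $2^t-1\le n<2^{t+1}-1$. Then the height of $\widetilde w_3\in H^3(\widetilde G_{n,3};\mathbb Z_2)$ is \[\operatorname{ht}(\widetilde w_3)=\max\{2^{t-1}-2,\; n-2^t-1\}.\]
   Context: $\widetilde G_{n,3}$ is the Grassmann manifold of oriented $3$-dimensional linear subspaces of $\mathbb R^n$, and $\widetilde w_i\in H^i(\widetilde G_{n,3};\mathbb Z_2)$, $i=2,3$, are the Stiefel--Whitney classes of the canonical $3$-dimensional vector bundle over $\widetilde G_{n,3}$. The height $\operatorname{ht}(x)$ of a cohomology class $x$ is the supremum of all integers $m$ with $x^m\neq 0$. *)

theory Defs
  imports
    "HOL-Analysis.Analysis"
    "HOL-Homology.Homology"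
    "HOL-Algebra.QuotRing"
    "HOL-Library.Z2"
    "HOL-Library.Extended_Nat"
begin

section \<open>Quotient topologies\<close>

definition quotient_topology :: "'a topology \<Rightarrow> ('a \<Rightarrow> 'b) \<Rightarrow> 'b topology"
  where "quotient_topology X q =
    topology (\<lambda>U. U \<subseteq> q ` topspace X \<and> openin X {x \<in> topspace X. q x \<in> U})"

lemma openin_quotient_topology:
  "openin (quotient_topology X q) U \<longleftrightarrow>
     U \<subseteq> q ` topspace X \<and> openin X {x \<in> topspace X. q x \<in> U}"
proof -
  have "istopology (\<lambda>U. U \<subseteq> q ` topspace X \<and> openin X {x \<in> topspace X. q x \<in> U})"
    unfolding istopology_def
  proof (rule conjI; intro allI impI)
    fix S T
    assume S: "S \<subseteq> q ` topspace X \<and> openin X {x \<in> topspace X. q x \<in> S}"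
      and T: "T \<subseteq> q ` topspace X \<and> openin X {x \<in> topspace X. q x \<in> T}"
    have "{x \<in> topspace X. q x \<in> S \<inter> T} =
        {x \<in> topspace X. q x \<in> S} \<inter> {x \<in> topspace X. q x \<in> T}"
      by blast
    then show "S \<inter> T \<subseteq> q ` topspace X \<and> openin X {x \<in> topspace X. q x \<in> S \<inter> T}"
      using S T by (auto simp: openin_Int)
  next
    fix \<K>
    assume K: "\<forall>K\<in>\<K>. K \<subseteq> q ` topspace X \<and> openin X {x \<in> topspace X. q x \<in> K}"
    have "{x \<in> topspace X. q x \<in> \<Union>\<K>} = (\<Union>K\<in>\<K>. {x \<in> topspace X. q x \<in> K})"
      by blast
    then show "\<Union>\<K> \<subseteq> q ` topspace X \<and> openin X {x \<in> topspace X. q x \<in> \<Union>\<K>}"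
      using K by (auto simp: openin_Union)
  qed
  then show ?thesis
    by (simp add: quotient_topology_def)
qed

lemma topspace_quotient_topology [simp]:
  "topspace (quotient_topology X q) = q ` topspace X"
proof (rule antisym)
  show "topspace (quotient_topology X q) \<subseteq> q ` topspace X"
    using openin_quotient_topology openin_topspace by metis
  have "{x \<in> topspace X. q x \<in> q ` topspace X} = topspace X"
    by blast
  then have "openin (quotient_topology X q) (q ` topspace X)"
    by (simp add: openin_quotient_topology)
  then show "q ` topspace X \<subseteq> topspace (quotient_topology X q)"
    by (rule openin_subset)
qed

lemma quotient_map_quotient_topology: "quotient_map X (quotient_topology X q) q"
  by (auto simp: quotient_map_def openin_quotient_topology)


section \<open>The singular cohomology ring with coefficients in the field with two elements\<close>

text \<open>
  A cochain of mixed degree is a family indexed by the degree, the component in degree \<open>p\<close>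
  being a function on singular \<open>p\<close>-simplices (and \<open>0\<close> off them). The degree has to be kept
  as an argument: in the library's encoding by extensional functions, the same HOL function
  may be a singular simplex in two different dimensions.
\<close>

type_synonym 'a cochain = "nat \<Rightarrow> ((nat \<Rightarrow> real) \<Rightarrow> 'a) \<Rightarrow> bit"

definition cochains :: "'a topology \<Rightarrow> 'a cochain set"
  where "cochains X =
    {\<phi>. (\<forall>p \<sigma>. \<not> singular_simplex p X \<sigma> \<longrightarrow> \<phi> p \<sigma> = 0) \<and> finite {p. \<phi> p \<noteq> (\<lambda>_. 0)}}"

definition coboundary :: "'a topology \<Rightarrow> 'a cochain \<Rightarrow> 'a cochain"
  where "coboundary X \<phi> = (\<lambda>p \<sigma>.
    if 0 < p \<and> singular_simplex p X \<sigma> then \<Sum>k\<le>p. \<phi> (p - 1) (singular_face p k \<sigma>) else 0)"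

definition front_face :: "nat \<Rightarrow> ((nat \<Rightarrow> real) \<Rightarrow> 'a) \<Rightarrow> (nat \<Rightarrow> real) \<Rightarrow> 'a"
  where "front_face p \<sigma> = restrict \<sigma> (standard_simplex p)"

text \<open>The back \<open>q\<close>-face of a \<open>(p + q)\<close>-simplex, spanned by the vertices \<open>p, \<dots>, p + q\<close>.\<close>

definition back_face :: "nat \<Rightarrow> nat \<Rightarrow> ((nat \<Rightarrow> real) \<Rightarrow> 'a) \<Rightarrow> (nat \<Rightarrow> real) \<Rightarrow> 'a"
  where "back_face p q \<sigma> =
    restrict (\<lambda>x. \<sigma> (\<lambda>i. if i < p then 0 else x (i - p))) (standard_simplex q)"

definition cup :: "'a topology \<Rightarrow> 'a cochain \<Rightarrow> 'a cochain \<Rightarrow> 'a cochain"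
  where "cup X \<phi> \<psi> = (\<lambda>n \<sigma>.
    if singular_simplex n X \<sigma>
    then \<Sum>p\<le>n. \<phi> p (front_face p \<sigma>) * \<psi> (n - p) (back_face p (n - p) \<sigma>) else 0)"

definition cocycle_ring :: "'a topology \<Rightarrow> 'a cochain ring"
  where "cocycle_ring X =
    \<lparr>carrier = {\<phi> \<in> cochains X. coboundary X \<phi> = (\<lambda>p \<sigma>. 0)},
     monoid.mult = cup X,
     one = (\<lambda>p \<sigma>. if p = 0 \<and> singular_simplex 0 X \<sigma> then 1 else 0),
     zero = (\<lambda>p \<sigma>. 0),
     add = (\<lambda>\<phi> \<psi> p \<sigma>. \<phi> p \<sigma> + \<psi> p \<sigma>)\<rparr>"

definition coboundaries :: "'a topology \<Rightarrow> 'a cochain set"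
  where "coboundaries X = coboundary X ` cochains X"

definition cohomology_ring :: "'a topology \<Rightarrow> 'a cochain set ring"
  where "cohomology_ring X = cocycle_ring X Quot coboundaries X"

definition cohomology_class :: "'a topology \<Rightarrow> 'a cochain \<Rightarrow> 'a cochain set"
  where "cohomology_class X \<phi> = coboundaries X +>\<^bsub>cocycle_ring X\<^esub> \<phi>"

text \<open>The homogeneous part of degree \<open>p\<close>, as a subset of the total cohomology ring.\<close>

definition cohomology :: "nat \<Rightarrow> 'a topology \<Rightarrow> 'a cochain set set"
  where "cohomology p X =
    cohomology_class X ` {\<phi> \<in> carrier (cocycle_ring X). \<forall>q. q \<noteq> p \<longrightarrow> \<phi> q = (\<lambda>_. 0)}"

definition cochain_pullback :: "'a topology \<Rightarrow> ('a \<Rightarrow> 'b) \<Rightarrow> 'b cochain \<Rightarrow> 'a cochain"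
  where "cochain_pullback X f \<phi> =
    (\<lambda>p \<sigma>. if singular_simplex p X \<sigma> then \<phi> p (simplex_map p f \<sigma>) else 0)"

definition cohomology_pullback ::
    "'a topology \<Rightarrow> ('a \<Rightarrow> 'b) \<Rightarrow> 'b cochain set \<Rightarrow> 'a cochain set"
  where "cohomology_pullback X f a = (\<Union>\<phi>\<in>a. cohomology_class X (cochain_pullback X f \<phi>))"

definition height :: "('a, 'b) ring_scheme \<Rightarrow> 'a \<Rightarrow> enat"
  where "height R x = (SUP m \<in> {m::nat. x [^]\<^bsub>R\<^esub> m \<noteq> \<zero>\<^bsub>R\<^esub>}. enat m)"


section \<open>Stiefel--Whitney classes\<close>

text \<open>
  A real vector bundle of rank \<open>k\<close> over \<open>X\<close> is given as a subbundle of the trivial bundle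
  \<open>X \<times> \<real>\<^sup>n\<close>, by its fibres \<open>V b \<subseteq> \<real>\<^sup>n\<close> for \<open>b \<in> topspace X\<close>. Here \<open>\<real>\<^sup>n\<close> is
  the library's \<^const>\<open>Euclidean_space\<close> space, consisting of the sequences that vanish from index \<open>n\<close> on.
\<close>

definition nonzero_vectors ::
    "nat \<Rightarrow> 'b topology \<Rightarrow> ('b \<Rightarrow> (nat \<Rightarrow> real) set) \<Rightarrow> ('b \<times> (nat \<Rightarrow> real)) topology"
  where "nonzero_vectors n X V =
    subtopology (prod_topology X (Euclidean_space n)) {(b, v). v \<in> V b \<and> v \<noteq> (\<lambda>i. 0)}"

definition line_through :: "'b \<times> (nat \<Rightarrow> real) \<Rightarrow> 'b \<times> (nat \<Rightarrow> real) set"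
  where "line_through = (\<lambda>(b, v). (b, {\<lambda>i. c * v i |c. True}))"

definition projective_bundle ::
    "nat \<Rightarrow> 'b topology \<Rightarrow> ('b \<Rightarrow> (nat \<Rightarrow> real) set) \<Rightarrow> ('b \<times> (nat \<Rightarrow> real) set) topology"
  where "projective_bundle n X V = quotient_topology (nonzero_vectors n X V) line_through"

definition same_ray :: "'b \<times> (nat \<Rightarrow> real) \<Rightarrow> 'b \<times> (nat \<Rightarrow> real) \<Rightarrow> bool"
  where "same_ray u v \<longleftrightarrow> fst u = fst v \<and> (\<exists>c>0. snd u = (\<lambda>i. c * snd v i))"

text \<open>
  The first Stiefel--Whitney class of the tautological line bundle over the projective bundle,
  i.e. the class of the double covering by the rays in the lines. Choose a (not necessarily
  continuous) nonzero vector \<open>s \<ell>\<close> in every line \<open>\<ell>\<close>. A path \<open>\<sigma>\<close> of lines lifts to a path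
  of nonzero vectors starting on the ray of \<open>s (\<sigma>(0))\<close>; the cocycle takes the value \<open>0\<close> on
  \<open>\<sigma>\<close> if the lift ends on the ray of \<open>s (\<sigma>(1))\<close> and \<open>1\<close> if it ends on the opposite ray.
  Another choice of \<open>s\<close> changes the cocycle by a coboundary.
\<close>

definition tautological_cocycle ::
    "nat \<Rightarrow> 'b topology \<Rightarrow> ('b \<Rightarrow> (nat \<Rightarrow> real) set) \<Rightarrow> ('b \<times> (nat \<Rightarrow> real) set) cochain"
  where "tautological_cocycle n X V = (\<lambda>p \<sigma>.
    let E = nonzero_vectors n X V; s = inv_into (topspace E) line_through
    in if p = 1 \<and> singular_simplex 1 (projective_bundle n X V) \<sigma> \<and>
          \<not> (\<exists>\<tau>. singular_simplex 1 E \<tau> \<and> simplex_map 1 line_through \<tau> = \<sigma> \<and>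
                 same_ray (simplicial_vertex 0 \<tau>) (s (simplicial_vertex 0 \<sigma>)) \<and>
                 same_ray (simplicial_vertex 1 \<tau>) (s (simplicial_vertex 1 \<sigma>)))
       then 1 else 0)"

definition tautological_class ::
    "nat \<Rightarrow> 'b topology \<Rightarrow> ('b \<Rightarrow> (nat \<Rightarrow> real) set) \<Rightarrow> ('b \<times> (nat \<Rightarrow> real) set) cochain set"
  where "tautological_class n X V =
    cohomology_class (projective_bundle n X V) (tautological_cocycle n X V)"

text \<open>
  Stiefel--Whitney classes following Grothendieck, see Husemoller, Fibre Bundles, or Hatcher,
  Vector Bundles and K-Theory: with \<open>\<pi>\<close> the projection of the projective bundle and \<open>x\<close> the
  tautological class, \<open>w\<^sub>0 = 1\<close>, \<open>w\<^sub>1, \<dots>, w\<^sub>k\<close> are the unique homogeneous classes with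
  \<open>x\<^sup>k + \<pi>\<^sup>*w\<^sub>1 x\<^sup>k\<^sup>-\<^sup>1 + \<dots> + \<pi>\<^sup>*w\<^sub>k = 0\<close>.
\<close>

definition is_stiefel_whitney ::
    "nat \<Rightarrow> nat \<Rightarrow> 'b topology \<Rightarrow> ('b \<Rightarrow> (nat \<Rightarrow> real) set) \<Rightarrow> (nat \<Rightarrow> 'b cochain set) \<Rightarrow> bool"
  where "is_stiefel_whitney k n X V w \<longleftrightarrow>
    (let P = projective_bundle n X V; H = cohomology_ring P; x = tautological_class n X V
     in w 0 = \<one>\<^bsub>cohomology_ring X\<^esub> \<and>
        (\<forall>i. w i \<in> cohomology i X) \<and>
        (\<forall>i>k. w i = \<zero>\<^bsub>cohomology_ring X\<^esub>) \<and>
        (\<Oplus>\<^bsub>H\<^esub>i\<in>{..k}. cohomology_pullback P fst (w i) \<otimes>\<^bsub>H\<^esub> x [^]\<^bsub>H\<^esub> (k - i)) = \<zero>\<^bsub>H\<^esub>)"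

definition stiefel_whitney ::
    "nat \<Rightarrow> nat \<Rightarrow> 'b topology \<Rightarrow> ('b \<Rightarrow> (nat \<Rightarrow> real) set) \<Rightarrow> nat \<Rightarrow> 'b cochain set"
  where "stiefel_whitney k n X V = (THE w. is_stiefel_whitney k n X V w)"


section \<open>Oriented Grassmann manifolds\<close>

text \<open>
  The dimension \<open>k\<close> of the subspaces is the cardinality of the finite type \<open>'k\<close>. A family
  \<open>f\<close> of \<open>k\<close> vectors has \<open>j\<close>-th vector \<open>f j\<close>, with \<open>i\<close>-th coordinate \<open>f j i\<close>. The Stiefel
  manifold below consists of all linearly independent families, not only the orthonormal ones.
\<close>

definition linear_span :: "('k::finite \<Rightarrow> nat \<Rightarrow> real) \<Rightarrow> (nat \<Rightarrow> real) set"
  where "linear_span f = {\<lambda>i. \<Sum>j\<in>UNIV. c j * f j i |c. True}"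

definition lin_independent :: "('k::finite \<Rightarrow> nat \<Rightarrow> real) \<Rightarrow> bool"
  where "lin_independent f \<longleftrightarrow>
    (\<forall>c. (\<forall>i. (\<Sum>j\<in>UNIV. c j * f j i) = 0) \<longrightarrow> (\<forall>j. c j = 0))"

definition stiefel_manifold :: "nat \<Rightarrow> ('k::finite \<Rightarrow> nat \<Rightarrow> real) topology"
  where "stiefel_manifold n =
    subtopology (product_topology (\<lambda>_. Euclidean_space n) UNIV) {f. lin_independent f}"

text \<open>
  An oriented subspace is encoded as the set of all its positively oriented ordered bases, i.e.
  as an equivalence class of ordered bases under change of basis with positive determinant.
\<close>

type_synonym 'k oriented_subspace = "('k \<Rightarrow> nat \<Rightarrow> real) set"

definition oriented_span :: "('k::finite \<Rightarrow> nat \<Rightarrow> real) \<Rightarrow> 'k oriented_subspace"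
  where "oriented_span f =
    {\<lambda>j i. \<Sum>l\<in>UNIV. A $ j $ l * f l i |A :: real^'k^'k. 0 < det A}"

definition oriented_grassmannian ::
    "'k::finite itself \<Rightarrow> nat \<Rightarrow> 'k oriented_subspace topology"
  where "oriented_grassmannian _ n = quotient_topology (stiefel_manifold n) oriented_span"

text \<open>The fibre of the canonical bundle over an oriented subspace: the subspace itself.\<close>

definition underlying_subspace :: "'k::finite oriented_subspace \<Rightarrow> (nat \<Rightarrow> real) set"
  where "underlying_subspace P = (\<Union>f\<in>P. linear_span f)"

definition canonical_sw ::
    "'k::finite itself \<Rightarrow> nat \<Rightarrow> nat \<Rightarrow> 'k oriented_subspace cochain set"
  where "canonical_sw K n =
    stiefel_whitney CARD('k) n (oriented_grassmannian K n) underlying_subspace"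

end

theory Submission
 imports Defs "HOL-Library.Function_Algebras"
begin

text \<open>
 On triples of independent lines, \<open>w\<^sub>i\<close> becomes the \<open>i\<close>-th elementary symmetric polynomial \<open>e\<^sub>i\<close> of the three roots,
 the classes of the lines. There \<open>e\<^sub>1 = 0\<close> by orientability, and the complete symmetric polynomials of degree at least \<open>n - 2\<close>
 vanish, which kills a power of \<open>e\<^sub>3\<close>; the pullback to the flag bundle being injective, this bounds the height of \<open>w\<^sub>3\<close> from above.
 Nearly orthogonal triples are independent and suffice. For the lower bound, the Gysin sequence of the orientation covering is used to reach
 the top class of a product of projective spaces.
\<close>

section \<open>The cochain algebra\<close>

text \<open>The lines of a triple are chosen independently in a fibre: a threefold projective bundle
  avoids the complementary bundles that flags would need, but admits dependent triples. The sum x_i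
  + x_j of two roots vanishes where the lines i and j are not orthogonal. Hence multiplication by
  \<Delta> = (x0 + x1)(x0 + x2)(x1 + x2) leads from nearly orthogonal triples back to all triples,
  in both bounds. Modulo e1, squaring in characteristic 2 shows that the complete symmetric
  polynomial of degree 3 (2^s - 1) is the power 2^s - 1 of e3; this is the origin of the powers of 2
  in the upper bound. For the lower bound, an equation e3^m = v e1 with unknown v has to be refuted.
  The multiplier f is the complete symmetric polynomial of degree 2^(r+1) - 4 in the four variables
  a, b, c, a + b + c. Then e1 f is a complete symmetric polynomial in a, b, c of a degree in which
  these vanish, while \<Delta> f is the sum of the powers with exponent 2^(r+1) - 1 of the four
  variables. Its product with e3^m has a multiple equal to the top class of the product of three
  projective spaces of dimension m + 2^r.\<close>

abbreviation "pull \<equiv> cochain_pullback"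
abbreviation "cobs \<equiv> coboundaries"
abbreviation "pbundle \<equiv> projective_bundle"
abbreviation "ssimplex \<equiv> singular_simplex"
abbreviation "std_simplex \<equiv> standard_simplex"
abbreviation "cont_real X \<equiv> continuous_map X euclideanreal"

declare add_bit_eq_xor [simp del] mult_bit_eq_and [simp del]

lemma bit_double [simp]: "(a::bit) + a = 0" by (cases a) (simp_all add: add_bit_eq_xor)

lemma bit_cancel_left [simp]: "(a::bit) + (a + b) = b" by (cases a; cases b) (simp_all add: add_bit_eq_xor)

lemma cochain_double [simp]: "(\<phi>::'a cochain) + \<phi> = 0" by (simp add: fun_eq_iff)

lemma cochain_cancel_left [simp]: "(\<phi>::'a cochain) + (\<phi> + \<psi>) = \<psi>" by (simp add: fun_eq_iff)

lemma cochain_add_eq_0_iff: "(\<phi>::'a cochain) + \<psi> = 0 \<longleftrightarrow> \<phi> = \<psi>"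
 by (metis add.right_neutral cochain_cancel_left cochain_double)

lemma continuous_map_coordinate [simp]: "cont_real (powertop_real UNIV) (\<lambda>x. x i)"
 using continuous_map_product_projection[of i UNIV "\<lambda>_. euclideanreal"] by simp

section \<open>Front and back faces, and their behaviour under singular faces and maps\<close>

definition shift_point :: "nat => (nat => real) => nat => real"
 where "shift_point p x = (\<lambda>i. if i < p then 0 else x (i - p))"

lemma shift_point_in_simplex:
 assumes "x \<in> std_simplex q"
 shows "shift_point p x \<in> std_simplex (p + q)" proof -
 have "(\<Sum>i\<le>p + q. shift_point p x i) = (\<Sum>i\<in>{p..p + q}. shift_point p x i)" by (rule sum.mono_neutral_right) (auto simp: shift_point_def)
 also have "\<dots> = (\<Sum>i\<le>q. x i)" by (rule sum.reindex_bij_witness[of _ "\<lambda>i. i + p" "\<lambda>i. i - p"]) (auto simp: shift_point_def)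
 finally show ?thesis using assms by (auto simp: standard_simplex_def shift_point_def)
qed

lemma back_face_eq: "back_face p q \<sigma> = restrict (\<sigma> \<circ> shift_point p) (std_simplex q)" by (simp add: back_face_def shift_point_def o_def)

lemma ssimplex_reparam:
 assumes "ssimplex p X \<sigma>" and "g ` std_simplex q \<subseteq> std_simplex p"
  and "\<And>i. cont_real (powertop_real UNIV) (\<lambda>x. g x i)"
 shows "ssimplex q X (restrict (\<sigma> \<circ> g) (std_simplex q))" proof -
 have "continuous_map (subtopology (powertop_real UNIV) (std_simplex q))
   (subtopology (powertop_real UNIV) (std_simplex p)) g" using assms by (auto simp: continuous_map_in_subtopology continuous_map_componentwise_UNIV
    intro: continuous_map_from_subtopology)
 then show ?thesis using assms(1) by (auto simp: singular_simplex_def intro: continuous_map_compose)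
qed

lemma ssimplex_front_face:
 assumes "ssimplex n X \<sigma>" "p \<le> n"
 shows "ssimplex p X (front_face p \<sigma>)" using ssimplex_reparam[OF assms(1), of "\<lambda>x. x" p] standard_simplex_mono[OF assms(2)]
 by (simp add: front_face_def o_def)

lemma ssimplex_back_face:
 assumes "ssimplex (p + q) X \<sigma>"
 shows "ssimplex q X (back_face p q \<sigma>)" unfolding back_face_eq proof (rule ssimplex_reparam[OF assms])
 show "shift_point p ` std_simplex q \<subseteq> std_simplex (p + q)" using shift_point_in_simplex by blast
 show "cont_real (powertop_real UNIV) (\<lambda>x. shift_point p x i)" for i by (simp add: shift_point_def)
qed

lemma ssimplex_face:
 assumes "ssimplex (Suc m) X \<sigma>" "k \<le> Suc m"
 shows "ssimplex m X (singular_face (Suc m) k \<sigma>)" using singular_simplex_singular_face[OF assms(1) _ assms(2)] by simp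

lemma simplical_face_Suc_in_simplex:
 assumes "x \<in> std_simplex m" "k \<le> Suc m"
 shows "simplical_face k x \<in> std_simplex (Suc m)" using simplical_face_in_standard_simplex[of "Suc m" k x] assms by simp

lemma std_simplex_leD: "x \<in> std_simplex p ==> p \<le> q ==> x \<in> std_simplex q"
 using standard_simplex_mono by blast

lemma std_simplex_zero: "x \<in> std_simplex p ==> p < i ==> x i = 0" by (simp add: standard_simplex_def)

lemma front_face_singular_face_low:
 assumes "k \<le> p" "p \<le> m"
 shows "front_face p (singular_face (Suc m) k \<sigma>) = singular_face (Suc p) k (front_face (Suc p) \<sigma>)" using assms
 by (intro ext) (auto simp: restrict_def front_face_def singular_face_def restrict_def
   simplical_face_Suc_in_simplex std_simplex_leD)

lemma front_face_singular_face_high: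
 assumes "p < k" "k \<le> Suc m"
 shows "front_face p (singular_face (Suc m) k \<sigma>) = front_face p \<sigma>" proof -
 have "simplical_face k x = x" if "x \<in> std_simplex p" for x :: "nat => real"
  using that assms by (auto simp: simplical_face_def fun_eq_iff std_simplex_zero)
 then show ?thesis using assms by (intro ext) (auto simp: restrict_def front_face_def singular_face_def std_simplex_leD)
qed

lemma back_face_singular_face_low:
 assumes "k \<le> p"
 shows "back_face p q (singular_face (Suc (p + q)) k \<sigma>) = back_face (Suc p) q \<sigma>" proof -
 have "simplical_face k (shift_point p x) = shift_point (Suc p) x" for x :: "nat => real"
  using assms by (auto simp: simplical_face_def shift_point_def fun_eq_iff)
 then show ?thesis by (intro ext) (auto simp: restrict_def back_face_eq singular_face_def shift_point_in_simplex)
qed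

lemma back_face_singular_face_high:
 assumes "p < k" "k \<le> Suc (p + q)"
 shows "back_face p q (singular_face (Suc (p + q)) k \<sigma>) =
  singular_face (Suc q) (k - p) (back_face p (Suc q) \<sigma>)" proof -
 have "simplical_face k (shift_point p x) = shift_point p (simplical_face (k - p) x)"
  for x :: "nat => real" using assms by (auto simp: simplical_face_def shift_point_def fun_eq_iff)
 moreover have "k - p \<le> Suc q" using assms by auto
 ultimately show ?thesis by (intro ext) (auto simp: restrict_def back_face_eq singular_face_def shift_point_in_simplex
    simplical_face_Suc_in_simplex)
qed

lemma singular_face_front_face_last:
 "singular_face (Suc p) (Suc p) (front_face (Suc p) \<sigma>) = front_face p \<sigma>" proof -
 have "simplical_face (Suc p) x = x" if "x \<in> std_simplex p" for x :: "nat => real"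
  using that by (auto simp: simplical_face_def fun_eq_iff std_simplex_zero)
 then show ?thesis by (intro ext) (auto simp: restrict_def front_face_def singular_face_def std_simplex_leD)
qed

lemma singular_face_back_face_0:
 "singular_face (Suc q) 0 (back_face p (Suc q) \<sigma>) = back_face (Suc p) q \<sigma>" proof -
 have "shift_point p (simplical_face 0 x) = shift_point (Suc p) x" for x :: "nat => real"
  by (auto simp: simplical_face_def shift_point_def fun_eq_iff)
 then show ?thesis by (intro ext) (auto simp: restrict_def back_face_eq singular_face_def simplical_face_Suc_in_simplex)
qed

lemma front_face_front_face: "p \<le> q ==> front_face p (front_face q \<sigma>) = front_face p \<sigma>"
 by (intro ext) (auto simp: restrict_def front_face_def std_simplex_leD)

lemma back_face_back_face: "back_face q r (back_face p (q + r) \<sigma>) = back_face (p + q) r \<sigma>" proof -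
 have "shift_point p (shift_point q x) = shift_point (p + q) x" for x :: "nat => real" by (auto simp: shift_point_def fun_eq_iff)
 then show ?thesis by (intro ext) (auto simp: restrict_def back_face_eq shift_point_in_simplex)
qed

lemma front_face_back_face: "front_face q (back_face p (q + r) \<sigma>) = back_face p q (front_face (p + q) \<sigma>)"
 by (intro ext) (auto simp: restrict_def back_face_eq front_face_def shift_point_in_simplex std_simplex_leD)

lemma front_face_self: "ssimplex p X \<sigma> ==> front_face p \<sigma> = \<sigma>"
 by (simp add: front_face_def singular_simplex_def extensional_restrict)

lemma back_face_self: "ssimplex p X \<sigma> ==> back_face 0 p \<sigma> = \<sigma>"
 by (simp add: back_face_def singular_simplex_def extensional_restrict)

lemma simplex_map_front_face:
 "p \<le> n ==> simplex_map p g (front_face p \<sigma>) = front_face p (simplex_map n g \<sigma>)"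
 by (intro ext) (auto simp: restrict_def simplex_map_def front_face_def std_simplex_leD)

lemma simplex_map_back_face:
 "simplex_map q g (back_face p q \<sigma>) = back_face p q (simplex_map (p + q) g \<sigma>)"
 by (intro ext) (auto simp: restrict_def simplex_map_def back_face_eq shift_point_in_simplex)

lemma simplex_map_singular_face:
 "k \<le> Suc m ==> simplex_map m g (singular_face (Suc m) k \<sigma>) = singular_face (Suc m) k (simplex_map (Suc m) g \<sigma>)"
 by (intro ext) (auto simp: restrict_def simplex_map_def singular_face_def simplical_face_Suc_in_simplex)

section \<open>Cochains and the coboundary operator\<close>

lemma cochainsI:
 assumes "\<And>p \<sigma>. \<not> ssimplex p X \<sigma> ==> \<phi> p \<sigma> = 0" and "\<And>p \<sigma>. p > d ==> \<phi> p \<sigma> = 0"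
 shows "\<phi> \<in> cochains X" proof -
 have "{p. \<phi> p \<noteq> (\<lambda>_. 0)} \<subseteq> {..d}" using assms(2) by (force simp: not_less[symmetric])
 then show ?thesis using assms(1) finite_subset by (fastforce simp: cochains_def)
qed

lemma cochains_off: "\<phi> \<in> cochains X ==> \<not> ssimplex p X \<sigma> ==> \<phi> p \<sigma> = 0"
 by (simp add: cochains_def)

lemma cochains_bound:
 assumes "\<phi> \<in> cochains X"
 obtains d where "\<And>p \<sigma>. p > d ==> \<phi> p \<sigma> = 0" proof -
 have "finite {p. \<phi> p \<noteq> (\<lambda>_. 0)}" using assms by (simp add: cochains_def)
 then obtain d where "\<forall>p\<in>{p. \<phi> p \<noteq> (\<lambda>_. 0)}. p \<le> d" using finite_nat_set_iff_bounded_le by auto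
 then have "\<phi> p \<sigma> = 0" if "p > d" for p \<sigma> using that by (metis (mono_tags, lifting) leD mem_Collect_eq)
 then show thesis using that by blast
qed

lemma cochains_0 [simp]: "0 \<in> cochains X" by (rule cochainsI) auto

lemma cochains_add [intro]:
 assumes "\<phi> \<in> cochains X" "\<psi> \<in> cochains X"
 shows "\<phi> + \<psi> \<in> cochains X" proof -
 obtain d e where "\<And>p \<sigma>. p > d ==> \<phi> p \<sigma> = 0" "\<And>p \<sigma>. p > e ==> \<psi> p \<sigma> = 0"
  using assms cochains_bound by metis
 with assms show ?thesis by (intro cochainsI[where d = "max d e"]) (auto simp: cochains_off)
qed

lemma cochain_eqI:
 assumes "\<phi> \<in> cochains X" "\<psi> \<in> cochains X"
  and "\<And>p \<sigma>. ssimplex p X \<sigma> ==> \<phi> p \<sigma> = \<psi> p \<sigma>"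
 shows "\<phi> = \<psi>" using assms by (metis cochains_off ext)

lemma coboundary_Suc:
 "ssimplex (Suc m) X \<sigma> ==> coboundary X \<phi> (Suc m) \<sigma> = (\<Sum>k\<le>Suc m. \<phi> m (singular_face (Suc m) k \<sigma>))"
 by (simp add: coboundary_def)

lemma coboundary_degree_0 [simp]: "coboundary X \<phi> 0 \<sigma> = 0" by (simp add: coboundary_def)

lemma coboundary_off: "\<not> ssimplex p X \<sigma> ==> coboundary X \<phi> p \<sigma> = 0" by (simp add: coboundary_def)

lemma coboundary_cochains [intro]:
 assumes "\<phi> \<in> cochains X"
 shows "coboundary X \<phi> \<in> cochains X" proof -
 obtain d where "\<And>p \<sigma>. p > d ==> \<phi> p \<sigma> = 0" using assms cochains_bound by metis
 then show ?thesis by (intro cochainsI[where d = "Suc d"]) (auto simp: coboundary_def)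
qed

lemma coboundary_add: "coboundary X (\<phi> + \<psi>) = coboundary X \<phi> + coboundary X \<psi>" by (auto simp: coboundary_def fun_eq_iff sum.distrib)

lemma coboundary_0 [simp]: "coboundary X 0 = 0" by (auto simp: coboundary_def fun_eq_iff)

text \<open>Imports the library's chain-level results.\<close>

definition chain_eval :: "(((nat => real) => 'a) => bit) => 'a chain => bit"
 where "chain_eval f c = (\<Sum>\<sigma>\<in>Poly_Mapping.keys c. of_int (Poly_Mapping.lookup c \<sigma>) * f \<sigma>)"

lemma chain_eval_superset:
 assumes "finite S" "Poly_Mapping.keys c \<subseteq> S"
 shows "chain_eval f c = (\<Sum>\<sigma>\<in>S. of_int (Poly_Mapping.lookup c \<sigma>) * f \<sigma>)"
 unfolding chain_eval_def using assms by (intro sum.mono_neutral_left) (auto simp: in_keys_iff)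

lemma chain_eval_0 [simp]: "chain_eval f 0 = 0" by (simp add: chain_eval_def)

lemma chain_eval_of [simp]: "chain_eval f (frag_of \<sigma>) = f \<sigma>" proof -
 have "chain_eval f (frag_of \<sigma>) = of_int (Poly_Mapping.lookup (frag_of \<sigma>) \<sigma>) * f \<sigma>"
  by (simp only: chain_eval_def keys_frag_of sum.insert finite.emptyI empty_iff not_False_eq_True sum.empty add_0_right)
 then show ?thesis by simp
qed

lemma chain_eval_add: "chain_eval f (a + b) = chain_eval f a + chain_eval f b" proof -
 let ?S = "Poly_Mapping.keys a \<union> Poly_Mapping.keys b"
 have "chain_eval f (a + b) = (\<Sum>\<sigma>\<in>?S. of_int (Poly_Mapping.lookup (a + b) \<sigma>) * f \<sigma>)"
  by (rule chain_eval_superset) (auto simp: keys_add)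
 also have "\<dots> = chain_eval f a + chain_eval f b" by (simp only: lookup_add of_int_add distrib_right sum.distrib
    chain_eval_superset[of ?S a f, OF _ Un_upper1] chain_eval_superset[of ?S b f, OF _ Un_upper2]
    finite_UnI finite_keys)
 finally show ?thesis .
qed

lemma chain_eval_uminus: "chain_eval f (- a) = chain_eval f a" by (metis add.right_inverse bit_cancel_left chain_eval_0 chain_eval_add add.right_neutral)

lemma chain_eval_diff: "chain_eval f (a - b) = chain_eval f a + chain_eval f b" using chain_eval_add[of f a "- b"] by (simp add: chain_eval_uminus)

lemma chain_eval_sum: "chain_eval f (\<Sum>i\<in>I. g i) = (\<Sum>i\<in>I. chain_eval f (g i))"
 by (induction I rule: infinite_finite_induct) (auto simp: chain_eval_add)

lemma chain_eval_sign: "chain_eval f (frag_cmul ((-1) ^ k) c) = chain_eval f c"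
 using minus_one_power_iff[of k, where 'a = int] by (auto simp: chain_eval_uminus)

lemma chain_eval_eq_0:
 "(\<And>\<sigma>. \<sigma> \<in> Poly_Mapping.keys c ==> f \<sigma> = 0) ==> chain_eval f c = 0" by (simp add: chain_eval_def)

lemma chain_eval_coboundary:
 assumes "singular_chain (Suc m) X c"
 shows "chain_eval (coboundary X \<phi> (Suc m)) c = chain_eval (\<phi> m) (chain_boundary (Suc m) c)" using assms[unfolded singular_chain_def]
proof (induction c rule: frag_induction)
 case (one \<sigma>)
 then show ?case by (simp add: chain_boundary_of chain_eval_sum chain_eval_sign coboundary_Suc del: sum.atMost_Suc)
qed (auto simp: chain_eval_diff chain_boundary_diff)

lemma coboundary_eq_chain_eval:
 assumes "ssimplex (Suc m) X \<sigma>"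
 shows "coboundary X \<phi> (Suc m) \<sigma> = chain_eval (\<phi> m) (chain_boundary (Suc m) (frag_of \<sigma>))"
 using chain_eval_coboundary[of m X "frag_of \<sigma>"] assms by (simp add: singular_chain_of)

text \<open>Evaluation on chains reduces this to the vanishing of the iterated boundary; the signs
  there disappear mod 2.\<close>

lemma coboundary_coboundary [simp]: "coboundary X (coboundary X \<phi>) = 0" proof (intro ext)
 fix p \<sigma>
 show "coboundary X (coboundary X \<phi>) p \<sigma> = 0 p \<sigma>" proof (cases "ssimplex p X \<sigma>")
  case True
  then show ?thesis proof (cases p)
   case (Suc m)
   have ch: "singular_chain m X (chain_boundary (Suc m) (frag_of \<sigma>))" using True Suc by (simp add: singular_chain_boundary_alt singular_chain_of)
   show ?thesis proof (cases m)
    case 0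
    then show ?thesis using True Suc by (simp add: coboundary_eq_chain_eval chain_eval_eq_0)
   next
    case (Suc l)
    then show ?thesis using True \<open>p = Suc m\<close> ch chain_boundary_boundary_alt[of m X "frag_of \<sigma>"]
     by (simp add: coboundary_eq_chain_eval chain_eval_coboundary singular_chain_of)
   qed
  qed auto
 qed (simp add: coboundary_off)
qed

section \<open>The cup product\<close>

lemma cup_eval:
 "ssimplex n X \<sigma> ==>
  cup X \<phi> \<psi> n \<sigma> = (\<Sum>p\<le>n. \<phi> p (front_face p \<sigma>) * \<psi> (n - p) (back_face p (n - p) \<sigma>))" by (simp add: cup_def)

lemma cup_off: "\<not> ssimplex n X \<sigma> ==> cup X \<phi> \<psi> n \<sigma> = 0" by (simp add: cup_def)

lemma cup_cochains [intro]:
 assumes "\<phi> \<in> cochains X" "\<psi> \<in> cochains X"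
 shows "cup X \<phi> \<psi> \<in> cochains X" proof -
 obtain d e where "\<And>p \<sigma>. p > d ==> \<phi> p \<sigma> = 0" "\<And>p \<sigma>. p > e ==> \<psi> p \<sigma> = 0"
  using assms cochains_bound by metis
 moreover have "p > d \<or> n - p > e" if "n > d + e" for p n :: nat using that by auto
 ultimately have "\<phi> p \<alpha> * \<psi> (n - p) \<beta> = 0" if "n > d + e" for p n \<alpha> \<beta> using that by (metis mult_zero_left mult_zero_right)
 then have "cup X \<phi> \<psi> n \<sigma> = 0" if "n > d + e" for n \<sigma> using that unfolding cup_def by (auto intro!: sum.neutral)
 then show ?thesis by (intro cochainsI[where d = "d + e"]) (auto simp: cup_off)
qed

lemma cup_add_left: "cup X (\<phi> + \<phi>') \<psi> = cup X \<phi> \<psi> + cup X \<phi>' \<psi>" by (auto simp: cup_def fun_eq_iff distrib_right sum.distrib)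

lemma cup_add_right: "cup X \<phi> (\<psi> + \<psi>') = cup X \<phi> \<psi> + cup X \<phi> \<psi>'" by (auto simp: cup_def fun_eq_iff distrib_left sum.distrib)

lemma cup_0_left [simp]: "cup X 0 \<psi> = 0" by (auto simp: cup_def fun_eq_iff)

lemma cup_0_right [simp]: "cup X \<phi> 0 = 0" by (auto simp: cup_def fun_eq_iff)

text \<open>For fixed p, the faces of index k up to p change only the front factor and those above p
  only the back factor. Each group misses exactly one term of the corresponding coboundary: the last
  face of the front and the face 0 of the back. Both missing terms are the same product
  \<open>?G\<close> and cancel mod 2.\<close>

lemma coboundary_cup: "coboundary X (cup X \<phi> \<psi>) = cup X (coboundary X \<phi>) \<psi> + cup X \<phi> (coboundary X \<psi>)" proof (intro ext)
 fix n \<sigma>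
 show "coboundary X (cup X \<phi> \<psi>) n \<sigma> = (cup X (coboundary X \<phi>) \<psi> + cup X \<phi> (coboundary X \<psi>)) n \<sigma>"
 proof (cases "ssimplex n X \<sigma>")
  case ss: True
  show ?thesis proof (cases n)
   case (Suc m)
   define A where "A = (\<lambda>p. coboundary X \<phi> (Suc p) (front_face (Suc p) \<sigma>) * \<psi> (m - p) (back_face (Suc p) (m - p) \<sigma>))"
   define B where "B = (\<lambda>p. \<phi> p (front_face p \<sigma>) * coboundary X \<psi> (Suc m - p) (back_face p (Suc m - p) \<sigma>))"
   have main: "(\<Sum>k\<le>Suc m. \<phi> p (front_face p (singular_face (Suc m) k \<sigma>)) *
      \<psi> (m - p) (back_face p (m - p) (singular_face (Suc m) k \<sigma>))) = A p + B p"
    (is "(\<Sum>k\<le>Suc m. ?T k) = _") if "p \<le> m" for p proof -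
    note pm = that
    obtain q where q: "m = p + q" using le_Suc_ex[OF pm] by blast
    let ?G = "\<phi> p (front_face p \<sigma>) * \<psi> q (back_face (Suc p) q \<sigma>)"
    have "{..Suc m} = {..p} \<union> (\<lambda>k. p + Suc k) ` {..q}" proof (rule subset_antisym; rule subsetI)
     fix k assume "k \<in> {..Suc m}"
     then have "k \<le> p \<or> k = p + Suc (k - Suc p) \<and> k - Suc p \<le> q" using q by auto
     then show "k \<in> {..p} \<union> (\<lambda>k. p + Suc k) ` {..q}" by blast
    qed (use q in auto)
    moreover have "(\<Sum>k\<in>{..p} \<union> (\<lambda>k. p + Suc k) ` {..q}. ?T k) =
      (\<Sum>k\<le>p. ?T k) + (\<Sum>k\<in>(\<lambda>k. p + Suc k) ` {..q}. ?T k)" by (rule sum.union_disjoint) auto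
    moreover have "(\<Sum>k\<le>p. ?T k) = A p + ?G" proof -
     have fs: "ssimplex (Suc p) X (front_face (Suc p) \<sigma>)" using ss Suc that by (auto intro: ssimplex_front_face)
     have "(\<Sum>k\<le>p. ?T k) =
      (\<Sum>k\<le>p. \<phi> p (singular_face (Suc p) k (front_face (Suc p) \<sigma>)) * \<psi> q (back_face (Suc p) q \<sigma>))"
      using q by (intro sum.cong) (auto simp: front_face_singular_face_low back_face_singular_face_low)
     then show ?thesis using q unfolding A_def coboundary_Suc[OF fs]
      by (simp add: singular_face_front_face_last sum_distrib_right distrib_right add.assoc)
    qed
    moreover have "(\<Sum>k\<in>(\<lambda>k. p + Suc k) ` {..q}. ?T k) = B p + ?G" proof -
     have bs: "ssimplex (Suc q) X (back_face p (Suc q) \<sigma>)" using ss Suc q by (auto intro: ssimplex_back_face)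
     have "(\<Sum>k\<in>(\<lambda>k. p + Suc k) ` {..q}. ?T k) = (\<Sum>k\<le>q. ?T (p + Suc k))" by (subst sum.reindex) (auto simp: inj_on_def)
     also have "\<dots> = (\<Sum>k\<le>q. \<phi> p (front_face p \<sigma>) * \<psi> q (singular_face (Suc q) (Suc k) (back_face p (Suc q) \<sigma>)))"
      using q by (intro sum.cong) (auto simp: front_face_singular_face_high back_face_singular_face_high)
     finally show ?thesis using q unfolding B_def by (simp add: coboundary_Suc[OF bs] sum.atMost_Suc_shift singular_face_back_face_0
        sum_distrib_left distrib_left Suc_diff_le add.assoc add.commute add.left_commute
        del: sum.atMost_Suc)
    qed
    ultimately show ?thesis by (simp add: add.assoc add.left_commute)
   qed
   have "coboundary X (cup X \<phi> \<psi>) n \<sigma> = (\<Sum>k\<le>Suc m. cup X \<phi> \<psi> m (singular_face (Suc m) k \<sigma>))"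
    using ss Suc by (simp add: coboundary_Suc del: sum.atMost_Suc)
   also have "\<dots> = (\<Sum>k\<le>Suc m. \<Sum>p\<le>m. \<phi> p (front_face p (singular_face (Suc m) k \<sigma>)) *
      \<psi> (m - p) (back_face p (m - p) (singular_face (Suc m) k \<sigma>)))"
    using ss Suc by (intro sum.cong) (auto simp: cup_eval ssimplex_face)
   also have "\<dots> = (\<Sum>p\<le>m. A p + B p)" by (subst sum.swap) (intro sum.cong refl main, auto)
   finally have 1: "coboundary X (cup X \<phi> \<psi>) n \<sigma> = (\<Sum>p\<le>m. A p) + (\<Sum>p\<le>m. B p)" by (simp add: sum.distrib)
   have 2: "cup X (coboundary X \<phi>) \<psi> n \<sigma> = (\<Sum>p\<le>m. A p)"
    using ss Suc by (simp add: cup_eval sum.atMost_Suc_shift A_def del: sum.atMost_Suc)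
   have 3: "cup X \<phi> (coboundary X \<psi>) n \<sigma> = (\<Sum>p\<le>m. B p)" using ss Suc by (simp add: cup_eval B_def)
   show ?thesis by (simp add: 1 2 3)
  qed (simp add: cup_def)
 qed (simp add: coboundary_off cup_off)
qed

lemma cup_assoc: "cup X (cup X \<phi> \<psi>) \<theta> = cup X \<phi> (cup X \<psi> \<theta>)" proof (intro ext)
 fix n \<sigma>
 show "cup X (cup X \<phi> \<psi>) \<theta> n \<sigma> = cup X \<phi> (cup X \<psi> \<theta>) n \<sigma>" proof (cases "ssimplex n X \<sigma>")
  case ss: True
  define T where "T = (\<lambda>p q. \<phi> p (front_face p \<sigma>) * \<psi> q (back_face p q (front_face (p + q) \<sigma>)) *
    \<theta> (n - p - q) (back_face (p + q) (n - p - q) \<sigma>))"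
  have "cup X (cup X \<phi> \<psi>) \<theta> n \<sigma> = (\<Sum>m\<le>n. \<Sum>p\<le>m. T p (m - p))" unfolding cup_eval[OF ss] proof (intro sum.cong refl)
   fix m assume "m \<in> {..n}"
   then have "ssimplex m X (front_face m \<sigma>)" using ss by (auto intro: ssimplex_front_face)
   then show "cup X \<phi> \<psi> m (front_face m \<sigma>) * \<theta> (n - m) (back_face m (n - m) \<sigma>) = (\<Sum>p\<le>m. T p (m - p))"
    by (auto simp: cup_eval sum_distrib_right T_def front_face_front_face intro!: sum.cong)
  qed
  moreover have "cup X \<phi> (cup X \<psi> \<theta>) n \<sigma> = (\<Sum>p\<le>n. \<Sum>q\<le>n - p. T p q)" unfolding cup_eval[OF ss]
  proof (intro sum.cong refl)
   fix p assume p: "p \<in> {..n}"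
   then obtain r where r: "n = p + r" using nat_le_iff_add by auto
   then have bs: "ssimplex r X (back_face p r \<sigma>)" using ss by (auto intro: ssimplex_back_face)
   have "\<phi> p (front_face p \<sigma>) * (\<psi> q (front_face q (back_face p r \<sigma>)) * \<theta> (r - q) (back_face q (r - q) (back_face p r \<sigma>)))
     = T p q" if "q \<le> r" for q using that r front_face_back_face[of q p "r - q" \<sigma>] back_face_back_face[of q "r - q" p \<sigma>]
    by (simp add: T_def mult.assoc)
   then show "\<phi> p (front_face p \<sigma>) * cup X \<psi> \<theta> (n - p) (back_face p (n - p) \<sigma>) = (\<Sum>q\<le>n - p. T p q)"
    using r by (auto simp: cup_eval[OF bs] sum_distrib_left intro!: sum.cong)
  qed
  moreover have "(\<Sum>m\<le>n. \<Sum>p\<le>m. T p (m - p)) = (\<Sum>p\<le>n. \<Sum>q\<le>n - p. T p q)" proof -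
   have "(\<Sum>m\<le>n. \<Sum>p\<le>m. T p (m - p)) = (\<Sum>(m, p)\<in>(SIGMA m:{..n}. {..m}). T p (m - p))" by (simp add: sum.Sigma)
   also have "\<dots> = (\<Sum>(p, q)\<in>(SIGMA p:{..n}. {..n - p}). T p q)"
    by (rule sum.reindex_bij_witness[of _ "\<lambda>(p, q). (p + q, p)" "\<lambda>(m, p). (p, m - p)"]) auto
   finally show ?thesis by (simp add: sum.Sigma)
  qed
  ultimately show ?thesis by simp
 qed (simp add: cup_off)
qed

definition unit_cochain :: "'a topology => 'a cochain"
 where "unit_cochain X = (\<lambda>p \<sigma>. if p = 0 \<and> ssimplex 0 X \<sigma> then 1 else 0)"

lemma unit_cochain_cochains [simp]: "unit_cochain X \<in> cochains X" by (rule cochainsI[where d = 0]) (auto simp: unit_cochain_def)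

lemma coboundary_unit [simp]: "coboundary X (unit_cochain X) = 0" proof (intro ext)
 fix p \<sigma>
 show "coboundary X (unit_cochain X) p \<sigma> = 0 p \<sigma>" proof (cases "p = 1 \<and> ssimplex p X \<sigma>")
  case True
  then show ?thesis using ssimplex_face[of 0 X \<sigma>] by (auto simp: coboundary_def unit_cochain_def)
 next
  case False
  then show ?thesis by (cases "p = 1") (auto simp: coboundary_def unit_cochain_def intro!: sum.neutral)
 qed
qed

lemma cup_unit_left: "\<phi> \<in> cochains X ==> cup X (unit_cochain X) \<phi> = \<phi>" proof (intro ext)
 fix n \<sigma> assume \<phi>: "\<phi> \<in> cochains X"
 show "cup X (unit_cochain X) \<phi> n \<sigma> = \<phi> n \<sigma>" proof (cases "ssimplex n X \<sigma>")
  case True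
  have "cup X (unit_cochain X) \<phi> n \<sigma> =
   (\<Sum>p\<in>{0}. unit_cochain X p (front_face p \<sigma>) * \<phi> (n - p) (back_face p (n - p) \<sigma>))"
   unfolding cup_eval[OF True] by (rule sum.mono_neutral_right) (auto simp: unit_cochain_def)
  then show ?thesis using True by (simp add: unit_cochain_def ssimplex_front_face back_face_self)
 qed (use \<phi> in \<open>simp add: cup_off cochains_off\<close>)
qed

lemma cup_unit_right: "\<phi> \<in> cochains X ==> cup X \<phi> (unit_cochain X) = \<phi>" proof (intro ext)
 fix n \<sigma> assume \<phi>: "\<phi> \<in> cochains X"
 show "cup X \<phi> (unit_cochain X) n \<sigma> = \<phi> n \<sigma>" proof (cases "ssimplex n X \<sigma>")
  case True
  have "cup X \<phi> (unit_cochain X) n \<sigma> =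
   (\<Sum>p\<in>{n}. \<phi> p (front_face p \<sigma>) * unit_cochain X (n - p) (back_face p (n - p) \<sigma>))"
   unfolding cup_eval[OF True] by (rule sum.mono_neutral_right) (auto simp: unit_cochain_def)
  moreover have "ssimplex 0 X (back_face n 0 \<sigma>)" using True ssimplex_back_face[of n 0] by simp
  ultimately show ?thesis using True by (simp add: unit_cochain_def front_face_self)
 qed (use \<phi> in \<open>simp add: cup_off cochains_off\<close>)
qed

section \<open>The cohomology ring and pullbacks\<close>

definition cocycles :: "'a topology => 'a cochain set"
 where "cocycles X = {\<phi> \<in> cochains X. coboundary X \<phi> = 0}"

lemma cocycle_ring_simps:
 "carrier (cocycle_ring X) = cocycles X" "monoid.mult (cocycle_ring X) = cup X"
 "monoid.one (cocycle_ring X) = unit_cochain X" "ring.zero (cocycle_ring X) = 0"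
 "ring.add (cocycle_ring X) = (+)" by (auto simp: cocycle_ring_def cocycles_def unit_cochain_def plus_fun_def zero_fun_def fun_eq_iff)

lemma cocyclesD: "\<phi> \<in> cocycles X ==> \<phi> \<in> cochains X" "\<phi> \<in> cocycles X ==> coboundary X \<phi> = 0"
 by (auto simp: cocycles_def)

lemma cocyclesI: "\<phi> \<in> cochains X ==> coboundary X \<phi> = 0 ==> \<phi> \<in> cocycles X" by (auto simp: cocycles_def)

lemma cocycles_0 [simp]: "0 \<in> cocycles X" by (simp add: cocycles_def)

lemma cocycles_add [intro]: "\<phi> \<in> cocycles X ==> \<psi> \<in> cocycles X ==> \<phi> + \<psi> \<in> cocycles X"
 by (auto simp: cocycles_def coboundary_add)

lemma cocycles_cup [intro]: "\<phi> \<in> cocycles X ==> \<psi> \<in> cocycles X ==> cup X \<phi> \<psi> \<in> cocycles X"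
 by (auto simp: cocycles_def coboundary_cup)

lemma unit_cochain_cocycles [simp]: "unit_cochain X \<in> cocycles X" by (simp add: cocycles_def)

lemma cobsI [intro]: "\<psi> \<in> cochains X ==> coboundary X \<psi> \<in> cobs X" by (auto simp: coboundaries_def)

lemma cobsE:
 assumes "\<phi> \<in> cobs X"
 obtains \<psi> where "\<psi> \<in> cochains X" "\<phi> = coboundary X \<psi>" using assms by (auto simp: coboundaries_def)

lemma cobs_cocycles: "\<phi> \<in> cobs X ==> \<phi> \<in> cocycles X" by (auto simp: coboundaries_def cocycles_def)

lemma coboundary_in_cocycles [intro]: "\<phi> \<in> cochains X ==> coboundary X \<phi> \<in> cocycles X" by (auto simp: cocycles_def)

lemma cobs_0 [simp]: "0 \<in> cobs X" using cobsI[OF cochains_0, of X] by simp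

lemma cobs_add [intro]:
 "\<phi> \<in> cobs X ==> \<psi> \<in> cobs X ==> \<phi> + \<psi> \<in> cobs X"
 unfolding coboundaries_def by (force simp: image_iff simp flip: coboundary_add)

lemma cobs_cup_left:
 assumes "\<phi> \<in> cobs X" "\<psi> \<in> cocycles X"
 shows "cup X \<phi> \<psi> \<in> cobs X" proof -
 obtain \<eta> where "\<eta> \<in> cochains X" "\<phi> = coboundary X \<eta>" using assms by (auto elim: cobsE)
 then have "cup X \<phi> \<psi> = coboundary X (cup X \<eta> \<psi>)" using assms by (simp add: coboundary_cup cocyclesD)
 then show ?thesis using \<open>\<eta> \<in> cochains X\<close> assms by (simp add: cobsI cup_cochains cocyclesD)
qed

lemma cobs_cup_right:
 assumes "\<phi> \<in> cocycles X" "\<psi> \<in> cobs X"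
 shows "cup X \<phi> \<psi> \<in> cobs X" proof -
 obtain \<eta> where "\<eta> \<in> cochains X" "\<psi> = coboundary X \<eta>" using assms by (auto elim: cobsE)
 then have "cup X \<phi> \<psi> = coboundary X (cup X \<phi> \<eta>)" using assms by (simp add: coboundary_cup cocyclesD)
 then show ?thesis using \<open>\<eta> \<in> cochains X\<close> assms by (simp add: cobsI cup_cochains cocyclesD)
qed

lemma ring_cocycle_ring: "ring (cocycle_ring X)" proof (rule ringI)
 show "abelian_group (cocycle_ring X)" proof (rule abelian_groupI)
  show "\<exists>y\<in>carrier (cocycle_ring X). y \<oplus>\<^bsub>cocycle_ring X\<^esub> x = \<zero>\<^bsub>cocycle_ring X\<^esub>"
   if "x \<in> carrier (cocycle_ring X)" for x using that by (auto simp: cocycle_ring_simps intro!: bexI[of _ x])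
 qed (auto simp: cocycle_ring_simps add.assoc add.commute)
 show "monoid (cocycle_ring X)" by (rule monoidI) (auto simp: cocycle_ring_simps cup_assoc cup_unit_left cup_unit_right cocyclesD)
qed (auto simp: cocycle_ring_simps cup_add_left cup_add_right)

lemma ideal_cobs: "ideal (cobs X) (cocycle_ring X)" proof (rule idealI[OF ring_cocycle_ring])
 interpret ring "cocycle_ring X" by (rule ring_cocycle_ring)
 show "subgroup (cobs X) (add_monoid (cocycle_ring X))" proof (rule add.subgroupI)
  show "cobs X \<subseteq> carrier (cocycle_ring X)" using cobs_cocycles by (auto simp: cocycle_ring_simps)
  show "cobs X \<noteq> {}" using cobs_0 by blast
  show "\<ominus>\<^bsub>cocycle_ring X\<^esub> a \<in> cobs X" if "a \<in> cobs X" for a proof -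
   have "\<ominus>\<^bsub>cocycle_ring X\<^esub> a = a" using that cobs_cocycles by (intro minus_equality) (auto simp: cocycle_ring_simps)
   then show ?thesis using that by simp
  qed
 qed (auto simp: cocycle_ring_simps)
qed (auto simp: cocycle_ring_simps cobs_cup_left cobs_cup_right)

lemma ring_cohomology_ring: "ring (cohomology_ring X)" unfolding cohomology_ring_def by (rule ideal.quotient_is_ring[OF ideal_cobs])

lemma cohomology_class_hom: "cohomology_class X \<in> ring_hom (cocycle_ring X) (cohomology_ring X)" proof -
 have "cohomology_class X = (+>\<^bsub>cocycle_ring X\<^esub>) (cobs X)" by (simp add: cohomology_class_def fun_eq_iff)
 then show ?thesis unfolding cohomology_ring_def using ideal.rcos_ring_hom[OF ideal_cobs] by simp
qed

lemma cohomology_class_eq: "cohomology_class X \<phi> = {\<phi> + \<psi> |\<psi>. \<psi> \<in> cobs X}"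
 by (auto simp: cohomology_class_def a_r_coset_def' cocycle_ring_simps add.commute)

lemma cohomology_class_eq_iff:
 "cohomology_class X \<phi> = cohomology_class X \<psi> \<longleftrightarrow> \<phi> + \<psi> \<in> cobs X" proof
 assume eq: "cohomology_class X \<phi> = cohomology_class X \<psi>"
 have "\<phi> \<in> cohomology_class X \<phi>" unfolding cohomology_class_eq using cobs_0 by (force intro: exI[of _ 0])
 then have "\<phi> \<in> cohomology_class X \<psi>" by (simp add: eq)
 then obtain \<eta> where "\<phi> = \<psi> + \<eta>" "\<eta> \<in> cobs X" unfolding cohomology_class_eq by auto
 then show "\<phi> + \<psi> \<in> cobs X" by (simp add: add.commute add.left_commute)
next
 assume *: "\<phi> + \<psi> \<in> cobs X"
 have sub: "cohomology_class X \<alpha> \<subseteq> cohomology_class X \<beta>" if "\<alpha> + \<beta> \<in> cobs X" for \<alpha> \<beta> proof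
  fix \<gamma> assume "\<gamma> \<in> cohomology_class X \<alpha>"
  then obtain \<eta> where "\<gamma> = \<alpha> + \<eta>" "\<eta> \<in> cobs X" by (auto simp: cohomology_class_eq)
  moreover have "\<gamma> = \<beta> + ((\<alpha> + \<beta>) + \<eta>)" by (simp add: \<open>\<gamma> = \<alpha> + \<eta>\<close> add.commute add.left_commute)
  ultimately show "\<gamma> \<in> cohomology_class X \<beta>" unfolding cohomology_class_eq using that by blast
 qed
 show "cohomology_class X \<phi> = cohomology_class X \<psi>" using sub[of \<phi> \<psi>] sub[of \<psi> \<phi>] * by (simp add: add.commute)
qed

lemma zero_cohomology_ring: "\<zero>\<^bsub>cohomology_ring X\<^esub> = cohomology_class X 0"
 by (auto simp: cohomology_ring_def FactRing_def cohomology_class_eq)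

lemma one_cohomology_ring: "\<one>\<^bsub>cohomology_ring X\<^esub> = cohomology_class X (unit_cochain X)"
 by (metis cocycle_ring_simps(3) cohomology_class_hom ring_hom_one)

lemma cohomology_class_eq_0_iff:
 "cohomology_class X \<phi> = \<zero>\<^bsub>cohomology_ring X\<^esub> \<longleftrightarrow> \<phi> \<in> cobs X"
 using cohomology_class_eq_iff[of X \<phi> 0] by (simp add: zero_cohomology_ring)

lemma cohomology_class_closed: "\<phi> \<in> cocycles X ==> cohomology_class X \<phi> \<in> carrier (cohomology_ring X)"
 using ring_hom_closed[OF cohomology_class_hom] by (simp add: cocycle_ring_simps)

lemma cohomology_class_mult:
 assumes "\<phi> \<in> cocycles X" "\<psi> \<in> cocycles X"
 shows "cohomology_class X \<phi> \<otimes>\<^bsub>cohomology_ring X\<^esub> cohomology_class X \<psi> = cohomology_class X (cup X \<phi> \<psi>)"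
 using ring_hom_mult[OF cohomology_class_hom, of \<phi> X \<psi>] assms by (simp add: cocycle_ring_simps)

lemma cohomology_class_add:
 assumes "\<phi> \<in> cocycles X" "\<psi> \<in> cocycles X"
 shows "cohomology_class X \<phi> \<oplus>\<^bsub>cohomology_ring X\<^esub> cohomology_class X \<psi> = cohomology_class X (\<phi> + \<psi>)"
 using ring_hom_add[OF cohomology_class_hom, of \<phi> X \<psi>] assms by (simp add: cocycle_ring_simps)

section \<open>Pullback of cochains and of cohomology classes\<close>

lemma pull_eval:
 "ssimplex p X \<sigma> ==> pull X f \<phi> p \<sigma> = \<phi> p (simplex_map p f \<sigma>)"
 by (simp add: cochain_pullback_def)

lemma pull_off: "\<not> ssimplex p X \<sigma> ==> pull X f \<phi> p \<sigma> = 0"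
 by (simp add: cochain_pullback_def)

lemma pull_cochains [intro]:
 assumes "\<phi> \<in> cochains Y"
 shows "pull X f \<phi> \<in> cochains X" proof -
 obtain d where "\<And>p \<sigma>. p > d ==> \<phi> p \<sigma> = 0" using assms cochains_bound by blast
 then show ?thesis by (intro cochainsI[where d = d]) (auto simp: cochain_pullback_def)
qed

lemma pull_add: "pull X f (\<phi> + \<psi>) = pull X f \<phi> + pull X f \<psi>"
 by (auto simp: cochain_pullback_def fun_eq_iff)

lemma pull_0 [simp]: "pull X f 0 = 0" by (auto simp: cochain_pullback_def fun_eq_iff)

lemma pull_coboundary:
 assumes "continuous_map X Y f"
 shows "pull X f (coboundary Y \<phi>) = coboundary X (pull X f \<phi>)" proof (intro ext)
 fix p \<sigma>
 show "pull X f (coboundary Y \<phi>) p \<sigma> = coboundary X (pull X f \<phi>) p \<sigma>"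
 proof (cases "ssimplex p X \<sigma>")
  case True
  then have t: "ssimplex p Y (simplex_map p f \<sigma>)" using assms singular_simplex_simplex_map by blast
  show ?thesis proof (cases p)
   case (Suc m)
   then show ?thesis using True t by (auto simp: pull_eval coboundary_Suc ssimplex_face
      simplex_map_singular_face intro!: sum.cong simp del: sum.atMost_Suc)
  qed (use True t in \<open>simp add: pull_eval\<close>)
 qed (simp add: pull_off coboundary_off)
qed

lemma pull_cup:
 assumes "continuous_map X Y f"
 shows "pull X f (cup Y \<phi> \<psi>) = cup X (pull X f \<phi>) (pull X f \<psi>)" proof (intro ext)
 fix n \<sigma>
 show "pull X f (cup Y \<phi> \<psi>) n \<sigma> = cup X (pull X f \<phi>) (pull X f \<psi>) n \<sigma>"
 proof (cases "ssimplex n X \<sigma>")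
  case True
  then have t: "ssimplex n Y (simplex_map n f \<sigma>)" using assms singular_simplex_simplex_map by blast
  have "\<phi> p (front_face p (simplex_map n f \<sigma>)) * \<psi> (n - p) (back_face p (n - p) (simplex_map n f \<sigma>)) =
   pull X f \<phi> p (front_face p \<sigma>) * pull X f \<psi> (n - p) (back_face p (n - p) \<sigma>)"
   if "p \<le> n" for p proof -
   have "ssimplex p X (front_face p \<sigma>)" "ssimplex (n - p) X (back_face p (n - p) \<sigma>)"
    using True that ssimplex_front_face ssimplex_back_face[of p "n - p"] by auto
   then show ?thesis using that simplex_map_back_face[of "n - p" f p \<sigma>] simplex_map_front_face[of p n f \<sigma>]
    by (simp add: pull_eval)
  qed
  then show ?thesis using True t by (auto simp: pull_eval cup_eval intro!: sum.cong)
 qed (simp add: pull_off cup_off)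
qed

lemma pull_unit:
 assumes "continuous_map X Y f"
 shows "pull X f (unit_cochain Y) = unit_cochain X" using singular_simplex_simplex_map[OF _ assms]
 by (auto simp: cochain_pullback_def unit_cochain_def fun_eq_iff)

lemma pull_compose:
 assumes "continuous_map X Y f"
 shows "pull X f (pull Y g \<phi>) = pull X (g \<circ> f) \<phi>" using singular_simplex_simplex_map[OF _ assms]
 by (auto simp: cochain_pullback_def simplex_map_compose fun_eq_iff)

lemma simplex_map_ident: "ssimplex p X \<sigma> ==> simplex_map p (\<lambda>x. x) \<sigma> = \<sigma>"
 using simplex_map_id_gen[of p X \<sigma> "\<lambda>x. x"] by simp

lemma pull_ident: "\<phi> \<in> cochains X ==> pull X (\<lambda>x. x) \<phi> = \<phi>"
 by (auto simp: cochain_pullback_def simplex_map_ident cochains_off fun_eq_iff)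

lemma pull_cocycles [intro]:
 "\<phi> \<in> cocycles Y ==> continuous_map X Y f ==> pull X f \<phi> \<in> cocycles X"
 by (auto simp: cocycles_def simp flip: pull_coboundary)

lemma pull_cobs [intro]:
 "\<phi> \<in> cobs Y ==> continuous_map X Y f ==> pull X f \<phi> \<in> cobs X"
 by (auto simp: coboundaries_def pull_coboundary)

text \<open>\<open>cohomology_pullback\<close> takes the union over all representatives;
  cohomologous ones have cohomologous pullbacks, so the union is a single class.\<close>

lemma cohomology_pullback_class:
 assumes "continuous_map X Y f"
 shows "cohomology_pullback X f (cohomology_class Y \<phi>) = cohomology_class X (pull X f \<phi>)" proof -
 have *: "cohomology_class X (pull X f (\<phi> + \<psi>)) = cohomology_class X (pull X f \<phi>)"
  if "\<psi> \<in> cobs Y" for \<psi> using that assms pull_cobs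
  by (auto simp: cohomology_class_eq_iff pull_add add.commute)
 then show ?thesis unfolding cohomology_pullback_def cohomology_class_eq[of Y] using cobs_0[of Y] by (force intro: exI[of _ 0])
qed

section \<open>Homotopy invariance\<close>

text \<open>The \<open>i\<close>-th degeneracy, merging the coordinates \<open>i\<close> and \<open>i + 1\<close>.\<close>

definition merge_coords :: "nat => (nat => real) => nat => real"
 where "merge_coords i x = (\<lambda>j. if j < i then x j else if j = i then x i + x (Suc i) else x (Suc j))"

text \<open>Partial sums matter because the time coordinate of a prism simplex is a partial sum of
  barycentric coordinates; the zero inserted by a face map only shifts the bound.\<close>

lemma sum_simplical_face:
 fixes x :: "nat => real"
 shows "sum (simplical_face k x) {..<n} = (if k < n then sum x {..<n - 1} else sum x {..<n})" proof (induction n)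
 case (Suc n)
 then show ?case by (cases n) (auto simp: simplical_face_def)
qed simp

lemma sum_merge_coords: "sum (merge_coords i x) {..<n} = (if i < n then sum x {..<Suc n} else sum x {..<n})"
 by (induction n) (auto simp: merge_coords_def less_Suc_eq)

lemma std_simplexI:
 assumes "\<And>i. 0 \<le> x i" "\<And>i. i > p ==> x i = 0" "sum x {..<Suc p} = 1"
 shows "x \<in> std_simplex p" proof -
 have "x i \<le> 1" for i proof (cases "i \<le> p")
  case True
  then have "x i \<le> sum x {..<Suc p}" using assms(1) by (intro member_le_sum) auto
  then show ?thesis using assms by simp
 qed (use assms in auto)
 then show ?thesis using assms by (simp add: standard_simplex_def lessThan_Suc_atMost)
qed

lemma merge_coords_in_simplex:
 assumes "x \<in> std_simplex (Suc p)" "i \<le> p"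
 shows "merge_coords i x \<in> std_simplex p" proof (rule std_simplexI)
 show "sum (merge_coords i x) {..<Suc p} = 1" using assms sum_merge_coords[of i x "Suc p"]
  by (auto simp: standard_simplex_def simp flip: lessThan_Suc_atMost simp del: sum.lessThan_Suc)
qed (use assms in \<open>auto simp: standard_simplex_def merge_coords_def\<close>)

lemma merge_face_low:
 "k < i ==> merge_coords i (simplical_face k x) = simplical_face k (merge_coords (i - 1) x)"
 by (rule ext) (auto simp: merge_coords_def simplical_face_def)

lemma merge_face_same: "k = i \<or> k = Suc i ==> merge_coords i (simplical_face k x) = x"
 by (rule ext) (auto simp: merge_coords_def simplical_face_def)

lemma merge_face_high:
 "Suc i < k ==> merge_coords i (simplical_face k x) = simplical_face (k - 1) (merge_coords i x)"
 by (rule ext) (auto simp: merge_coords_def simplical_face_def)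

text \<open>The \<open>i\<close>-th simplex of the prism over \<open>\<sigma>\<close>; time is the sum of the first \<open>i + 1\<close> barycentric coordinates.\<close>

definition prism_simplex ::
  "(real \<times> 'a => 'b) => nat => nat => ((nat => real) => 'a) => (nat => real) => 'b"
 where "prism_simplex h p i \<sigma> =
  restrict (\<lambda>x. h (sum x {..<Suc i}, \<sigma> (merge_coords i x))) (std_simplex (Suc p))"

text \<open>The walls of the prism: \<open>prism_level h p i \<sigma>\<close> separates the prism
  simplices i - 1 and i. At i = 0 the time is constantly 0, and at i = p + 1 it is constantly
  1.\<close>

definition prism_level ::
  "(real \<times> 'a => 'b) => nat => nat => ((nat => real) => 'a) => (nat => real) => 'b"
 where "prism_level h p i \<sigma> = restrict (\<lambda>x. h (sum x {..<i}, \<sigma> x)) (std_simplex p)"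

lemma simplex_partial_sum:
 assumes "x \<in> std_simplex p"
 shows "0 \<le> sum x {..<i}" "sum x {..<i} \<le> 1" proof -
 have nn: "\<And>j. 0 \<le> x j" and z: "\<And>j. p < j ==> x j = 0" and s: "sum x {..p} = 1" using assms by (auto simp: standard_simplex_def)
 show "0 \<le> sum x {..<i}" using nn by (simp add: sum_nonneg)
 have "sum x {..<i} \<le> sum x ({..<i} \<union> {..p})" using nn by (intro sum_mono2) auto
 also have "\<dots> = sum x {..p}" using z by (intro sum.mono_neutral_right) auto
 finally show "sum x {..<i} \<le> 1" using s by simp
qed

lemma ssimplex_prism:
 assumes h: "continuous_map (prod_topology (top_of_set {0..1}) X) Y h"
  and \<sigma>: "ssimplex p X \<sigma>" and "i \<le> p"
 shows "ssimplex (Suc p) Y (prism_simplex h p i \<sigma>)" proof -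
 let ?S = "subtopology (powertop_real UNIV) (std_simplex (Suc p))"
 have "cont_real (powertop_real UNIV) (\<lambda>x. merge_coords i x j)" for j
  unfolding merge_coords_def by (cases "j < i"; cases "j = i") (auto intro!: continuous_map_add)
 moreover have "merge_coords i ` std_simplex (Suc p) \<subseteq> std_simplex p" using merge_coords_in_simplex assms by blast
 ultimately have "continuous_map ?S (subtopology (powertop_real UNIV) (std_simplex p)) (merge_coords i)"
  by (auto simp: continuous_map_in_subtopology continuous_map_componentwise_UNIV
    intro: continuous_map_from_subtopology)
 then have "continuous_map ?S X (\<sigma> \<circ> merge_coords i)" using \<sigma> by (auto simp: singular_simplex_def intro: continuous_map_compose)
 moreover have "continuous_map ?S (top_of_set {0..1}) (\<lambda>x. sum x {..<Suc i})" using simplex_partial_sum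
  by (auto simp: continuous_map_in_subtopology simp del: sum.lessThan_Suc
    intro!: continuous_map_sum continuous_map_from_subtopology)
 ultimately have "continuous_map ?S (prod_topology (top_of_set {0..1}) X) (\<lambda>x. (sum x {..<Suc i}, \<sigma> (merge_coords i x)))"
  by (simp add: continuous_map_pairwise o_def)
 then have "continuous_map ?S Y (h \<circ> (\<lambda>x. (sum x {..<Suc i}, \<sigma> (merge_coords i x))))" using h continuous_map_compose by blast
 then show ?thesis by (simp add: singular_simplex_def prism_simplex_def o_def)
qed

lemma prism_face_low:
 assumes "k < i" "i \<le> Suc m"
 shows "singular_face (Suc (Suc m)) k (prism_simplex h (Suc m) i \<sigma>) =
  prism_simplex h m (i - 1) (singular_face (Suc m) k \<sigma>)" using assms
 by (intro ext) (auto simp: singular_face_def prism_simplex_def restrict_def merge_face_low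
   simplical_face_Suc_in_simplex merge_coords_in_simplex sum_simplical_face simp del: sum.lessThan_Suc)

lemma prism_face_high:
 assumes "Suc i < k" "k \<le> Suc (Suc m)"
 shows "singular_face (Suc (Suc m)) k (prism_simplex h (Suc m) i \<sigma>) =
  prism_simplex h m i (singular_face (Suc m) (k - 1) \<sigma>)" using assms
 by (intro ext) (auto simp: singular_face_def prism_simplex_def restrict_def merge_face_high
   simplical_face_Suc_in_simplex merge_coords_in_simplex sum_simplical_face simp del: sum.lessThan_Suc)

lemma prism_face_same:
 assumes "k = i \<or> k = Suc i" "i \<le> p"
 shows "singular_face (Suc p) k (prism_simplex h p i \<sigma>) = prism_level h p k \<sigma>" using assms
 by (intro ext) (auto simp: singular_face_def prism_simplex_def prism_level_def restrict_def merge_face_same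
   simplical_face_Suc_in_simplex sum_simplical_face simp del: sum.lessThan_Suc)

definition prism_cochain :: "'a topology => (real \<times> 'a => 'b) => 'b cochain => 'a cochain"
 where "prism_cochain X h \<phi> =
  (\<lambda>p \<sigma>. if ssimplex p X \<sigma> then \<Sum>i\<le>p. \<phi> (Suc p) (prism_simplex h p i \<sigma>) else 0)"

lemma prism_cochain_cochains:
 assumes "\<phi> \<in> cochains Y"
 shows "prism_cochain X h \<phi> \<in> cochains X" proof -
 obtain d where "\<And>p \<sigma>. p > d ==> \<phi> p \<sigma> = 0" using assms cochains_bound by metis
 then show ?thesis by (intro cochainsI[where d = d]) (auto simp: prism_cochain_def)
qed

text \<open>Faces of the prism simplex i with k < i or k > i + 1 are prism simplices over faces of
  \<sigma> and reproduce the coboundary of the prism cochain. The faces k = i and k = i + 1 are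
  walls; each inner wall occurs twice, so that mod 2 only the bottom and the top remain.\<close>

lemma prism_cochain_homotopy:
 assumes h: "continuous_map (prod_topology (top_of_set {0..1}) X) Y h" and \<sigma>: "ssimplex p X \<sigma>"
 shows "coboundary X (prism_cochain X h \<phi>) p \<sigma> + prism_cochain X h (coboundary Y \<phi>) p \<sigma> =
  \<phi> p (prism_level h p 0 \<sigma>) + \<phi> p (prism_level h p (Suc p) \<sigma>)" proof -
 define a where "a = (\<lambda>i. \<phi> p (prism_level h p i \<sigma>))"
 define F where "F = (\<lambda>i k. \<phi> p (singular_face (Suc p) k (prism_simplex h p i \<sigma>)))"
 define G where "G = (\<lambda>i k. \<phi> p (prism_simplex h (p - 1) i (singular_face p k \<sigma>)))"
 have 1: "prism_cochain X h (coboundary Y \<phi>) p \<sigma> = (\<Sum>i\<le>p. \<Sum>k\<le>Suc p. F i k)" using ssimplex_prism[OF h \<sigma>] \<sigma>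
  by (simp add: prism_cochain_def coboundary_Suc F_def del: sum.atMost_Suc)
 have row: "(\<Sum>k\<le>Suc p. F i k) = (\<Sum>k<i. G (i - 1) k) + (a i + a (Suc i)) + (\<Sum>k\<in>{Suc i..p}. G i k)"
  if "i \<le> p" for i proof -
  note ip = that
  have "{..Suc p} = {..<i} \<union> {i, Suc i} \<union> {Suc (Suc i)..Suc p}" using that by auto
  then have "(\<Sum>k\<le>Suc p. F i k) = (\<Sum>k<i. F i k) + (\<Sum>k\<in>{i, Suc i}. F i k) + (\<Sum>k\<in>{Suc (Suc i)..Suc p}. F i k)"
   by (simp only:) (subst sum.union_disjoint; auto)+
  moreover have "(\<Sum>k<i. F i k) = (\<Sum>k<i. G (i - 1) k)" proof (rule sum.cong)
   fix k assume "k \<in> {..<i}"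
   then obtain m where "p = Suc m" using ip by (cases p) auto
   then show "F i k = G (i - 1) k" using \<open>k \<in> {..<i}\<close> that by (simp add: F_def G_def prism_face_low)
  qed simp
  moreover have "(\<Sum>k\<in>{Suc (Suc i)..Suc p}. F i k) = (\<Sum>k\<in>{Suc i..p}. G i k)" proof -
   have "(\<Sum>k\<in>{Suc (Suc i)..Suc p}. F i k) = (\<Sum>k\<in>{Suc i..p}. F i (Suc k))" by (simp only: sum.atLeast_Suc_atMost_Suc_shift o_def)
   also have "\<dots> = (\<Sum>k\<in>{Suc i..p}. G i k)" proof (rule sum.cong)
    fix k assume "k \<in> {Suc i..p}"
    then obtain m where "p = Suc m" by (cases p) auto
    then show "F i (Suc k) = G i k" using \<open>k \<in> {Suc i..p}\<close> by (simp add: F_def G_def prism_face_high)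
   qed simp
   finally show ?thesis .
  qed
  moreover have "(\<Sum>k\<in>{i, Suc i}. F i k) = a i + a (Suc i)" using that by (simp add: F_def a_def prism_face_same)
  ultimately show ?thesis by simp
 qed
 have tele: "(\<Sum>i\<le>n. a i + a (Suc i)) = a 0 + a (Suc n)" for n by (induction n) (auto simp: add.assoc)
 have "(\<Sum>i\<le>p. \<Sum>k\<le>Suc p. F i k) =
   (\<Sum>i\<le>p. \<Sum>k<i. G (i - 1) k) + (a 0 + a (Suc p)) + (\<Sum>i\<le>p. \<Sum>k\<in>{Suc i..p}. G i k)"
  by (simp add: row sum.distrib[symmetric] tele[symmetric] del: sum.atMost_Suc)
 moreover have "coboundary X (prism_cochain X h \<phi>) p \<sigma> =
   (\<Sum>i\<le>p. \<Sum>k<i. G (i - 1) k) + (\<Sum>i\<le>p. \<Sum>k\<in>{Suc i..p}. G i k)" proof (cases p)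
  case (Suc m)
  have "coboundary X (prism_cochain X h \<phi>) p \<sigma> = (\<Sum>k\<le>Suc m. \<Sum>i\<le>m. G i k)"
   using \<sigma> Suc by (simp add: coboundary_Suc prism_cochain_def ssimplex_face G_def del: sum.atMost_Suc)
  also have "\<dots> = (\<Sum>i\<le>m. \<Sum>k\<le>p. G i k)" unfolding Suc by (rule sum.swap)
  also have "\<dots> = (\<Sum>i\<le>m. (\<Sum>k<Suc i. G i k) + (\<Sum>k\<in>{Suc i..p}. G i k))" proof (rule sum.cong)
   fix i assume "i \<in> {..m}"
   then have "{..p} = {..<Suc i} \<union> {Suc i..p}" using Suc by auto
   then show "(\<Sum>k\<le>p. G i k) = (\<Sum>k<Suc i. G i k) + (\<Sum>k\<in>{Suc i..p}. G i k)" by (simp only:) (subst sum.union_disjoint; auto)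
  qed simp
  finally have "coboundary X (prism_cochain X h \<phi>) p \<sigma> =
    (\<Sum>i\<le>m. \<Sum>k<Suc i. G i k) + (\<Sum>i\<le>m. \<Sum>k\<in>{Suc i..p}. G i k)" by (simp only: sum.distrib)
  moreover have "(\<Sum>i\<le>p. \<Sum>k<i. G (i - 1) k) = (\<Sum>i\<le>m. \<Sum>k<Suc i. G i k)" unfolding Suc by (subst sum.atMost_Suc_shift) simp
  moreover have "(\<Sum>i\<le>p. \<Sum>k\<in>{Suc i..p}. G i k) = (\<Sum>i\<le>m. \<Sum>k\<in>{Suc i..p}. G i k)" unfolding Suc by (subst sum.atMost_Suc) simp
  ultimately show ?thesis by simp
 qed simp
 ultimately show ?thesis unfolding 1 by (simp add: a_def add.assoc add.left_commute add.commute del: sum.atMost_Suc)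
qed

theorem homotopic_pullback_cohomologous:
 assumes "homotopic_with (\<lambda>_. True) X Y f g" and \<phi>: "\<phi> \<in> cocycles Y"
 shows "pull X f \<phi> + pull X g \<phi> \<in> cobs X" proof -
 obtain h where h: "continuous_map (prod_topology (top_of_set {0..1::real}) X) Y h"
  and h0: "\<And>x. h (0, x) = f x" and h1: "\<And>x. h (1, x) = g x" using assms(1) by (auto simp: homotopic_with_def)
 have "pull X f \<phi> + pull X g \<phi> = coboundary X (prism_cochain X h \<phi>)" proof (intro ext)
  fix p \<sigma>
  show "(pull X f \<phi> + pull X g \<phi>) p \<sigma> = coboundary X (prism_cochain X h \<phi>) p \<sigma>"
  proof (cases "ssimplex p X \<sigma>")
   case True
   have "prism_level h p 0 \<sigma> = simplex_map p f \<sigma>" by (simp add: prism_level_def simplex_map_def h0 o_def)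
   moreover have "prism_level h p (Suc p) \<sigma> = simplex_map p g \<sigma>"
    by (intro ext) (auto simp: prism_level_def simplex_map_def restrict_def h1 standard_simplex_def
      lessThan_Suc_atMost simp del: sum.lessThan_Suc sum.atMost_Suc)
   moreover have "prism_cochain X h (coboundary Y \<phi>) p \<sigma> = 0" using \<phi> by (simp add: cocyclesD prism_cochain_def)
   ultimately show ?thesis using True prism_cochain_homotopy[OF h True, of \<phi>] by (simp add: pull_eval)
  qed (simp add: pull_off coboundary_off)
 qed
 then show ?thesis using \<phi> by (auto intro: prism_cochain_cochains cocyclesD)
qed

section \<open>Small simplices\<close>

definition small_simplex :: "'a set set => nat => ((nat => real) => 'a) => bool"
 where "small_simplex \<U> p \<sigma> \<longleftrightarrow> (\<exists>U\<in>\<U>. \<sigma> ` std_simplex p \<subseteq> U)"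

text \<open>With S the barycentric subdivision and h a chain homotopy between S and the identity,
  the primitive \<psi> sends \<sigma> to the sum of \<phi>(h(S^i \<sigma>)) over all i. The sum is
  finite since S^i \<sigma> consists of small simplices for large i, and h keeps these small. For
  small \<sigma> every term is zero; this relative form is what gluing requires.\<close>

theorem small_exact:
 assumes op: "\<And>U. U \<in> \<U> ==> openin X U" and cover: "topspace X \<subseteq> \<Union>\<U>"
  and \<phi>: "\<phi> \<in> cocycles X"
  and van: "\<And>p \<sigma>. ssimplex p X \<sigma> ==> small_simplex \<U> p \<sigma> ==> \<phi> p \<sigma> = 0"
 obtains \<psi> where "\<psi> \<in> cochains X" "coboundary X \<psi> = \<phi>"
  "\<And>p \<sigma>. ssimplex p X \<sigma> ==> small_simplex \<U> p \<sigma> ==> \<psi> p \<sigma> = 0" proof -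
 obtain h where h0: "\<And>p. h p 0 = (0 :: 'a chain)"
  and hdiff: "\<And>p c1 c2. h p (c1 - c2) = h p c1 - h p c2"
  and hch: "\<And>p Y c. singular_chain p Y c ==> singular_chain (Suc p) Y (h p c)"
  and hbd: "\<And>p Y c. singular_chain p Y c ==>
    chain_boundary (Suc p) (h p c) + h (p - Suc 0) (chain_boundary p c) = singular_subdivision p c - c" using chain_homotopic_singular_subdivision by metis
 define S where "S = (\<lambda>p i. singular_subdivision p ^^ i :: 'a chain => 'a chain)"
 have Sch: "singular_chain p Y (S p i c)" if "singular_chain p Y c" for p i Y c
  using that by (induction i) (auto simp: S_def singular_chain_singular_subdivision)
 have Sdiff: "S p i (c1 - c2) = S p i c1 - S p i c2" for p i c1 c2 by (simp add: S_def singular_subdivision_power_diff)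
 have S0: "S p i 0 = 0" for p i by (simp add: S_def)
 have Sbd: "chain_boundary p (S p i c) = S (p - 1) i (chain_boundary p c)" if "singular_chain p X c" for p i c proof (induction i)
  case (Suc i)
  show ?case using chain_boundary_singular_subdivision[OF Sch[OF that, of i]] Suc by (simp add: S_def)
 qed (simp add: S_def)
 define E where "E = (\<lambda>p N c. \<Sum>i<N. chain_eval (\<phi> (Suc p)) (h p (S p i c)))"
 have Ediff: "E p N (c1 - c2) = E p N c1 + E p N c2" for p N c1 c2 by (simp add: E_def Sdiff hdiff chain_eval_diff sum.distrib)
 have E0: "E p N 0 = 0" for p N by (simp add: E_def S0 h0)
 have Eneg: "E p N (- c) = E p N c" for p N c using Ediff[of p N 0 c] by (simp add: E0)
 have Eadd: "E p N (c1 + c2) = E p N c1 + E p N c2" for p N c1 c2 using Ediff[of p N c1 "- c2"] by (simp add: Eneg)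
 have Esum: "E p N (sum g I) = (\<Sum>i\<in>I. E p N (g i))" for p N I and g :: "nat => 'a chain"
  by (induction I rule: infinite_finite_induct) (auto simp: Eadd E0)
 have Esign: "E p N (frag_cmul ((-1) ^ k) c) = E p N c" for p N k c using minus_one_power_iff[of k, where 'a = int] by (auto simp: Eneg)
 \<comment> \<open>As \<open>hch\<close> holds for every space Y, it applies to the members of the
   cover: h sends a simplex inside U to a chain of simplices inside U.\<close>
 have eval_small: "chain_eval (\<phi> (Suc p)) (h p c) = 0"
  if "singular_chain p X c" "\<And>\<sigma>. \<sigma> \<in> Poly_Mapping.keys c ==> small_simplex \<U> p \<sigma>" for p c proof -
  have "Poly_Mapping.keys c \<subseteq> {\<sigma>. ssimplex p X \<sigma> \<and> small_simplex \<U> p \<sigma>}"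
   using that by (auto simp: singular_chain_def)
  then show ?thesis proof (induction c rule: frag_induction)
   case (one \<sigma>)
   then obtain U where U: "U \<in> \<U>" "\<sigma> ` std_simplex p \<subseteq> U" "ssimplex p X \<sigma>" by (auto simp: small_simplex_def)
   then have "singular_chain p (subtopology X U) (frag_of \<sigma>)" by (simp add: singular_chain_of singular_simplex_subtopology)
   then have "singular_chain (Suc p) (subtopology X U) (h p (frag_of \<sigma>))" by (rule hch)
   then have "ssimplex (Suc p) X \<tau> \<and> small_simplex \<U> (Suc p) \<tau>"
    if "\<tau> \<in> Poly_Mapping.keys (h p (frag_of \<sigma>))" for \<tau> using that U(1) unfolding singular_chain_def small_simplex_def
    by (metis mem_Collect_eq singular_simplex_subtopology subsetD)
   then show ?case by (intro chain_eval_eq_0 van) auto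
  qed (auto simp: h0 hdiff chain_eval_diff)
 qed
 have "\<exists>N. \<forall>m\<ge>N. \<forall>\<tau>\<in>Poly_Mapping.keys (S p m (frag_of \<sigma>)). small_simplex \<U> p \<tau>"
  if "ssimplex p X \<sigma>" for p \<sigma> proof -
  have "singular_chain p X (frag_of \<sigma>)" using that by (simp add: singular_chain_of)
  then obtain N where "\<And>m f. N \<le> m ==> f \<in> Poly_Mapping.keys ((singular_subdivision p ^^ m) (frag_of \<sigma>)) ==>
    \<exists>V \<in> \<U>. f \<in> std_simplex p \<rightarrow> V"
   using sufficient_iterated_singular_subdivision_exists[OF op cover] by metis
  then show ?thesis unfolding S_def small_simplex_def image_subset_iff_funcset by blast
 qed
 then obtain thr where thr: "\<And>p \<sigma> m \<tau>. ssimplex p X \<sigma> ==> thr p \<sigma> \<le> m ==>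
   \<tau> \<in> Poly_Mapping.keys (S p m (frag_of \<sigma>)) ==> small_simplex \<U> p \<tau>" by metis
 have stable: "E p N (frag_of \<sigma>) = E p (thr p \<sigma>) (frag_of \<sigma>)" if "ssimplex p X \<sigma>" "thr p \<sigma> \<le> N" for p N \<sigma>
 proof -
  have "chain_eval (\<phi> (Suc p)) (h p (S p i (frag_of \<sigma>))) = 0" if "thr p \<sigma> \<le> i" for i
   using that thr \<open>ssimplex p X \<sigma>\<close> by (intro eval_small) (auto intro: Sch simp: singular_chain_of)
  then show ?thesis using that unfolding E_def by (intro sum.mono_neutral_right) auto
 qed
 define \<psi> where "\<psi> = (\<lambda>p \<sigma>. if ssimplex p X \<sigma> then E p (thr p \<sigma>) (frag_of \<sigma>) else 0)"
 have "\<psi> \<in> cochains X" proof -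
  obtain d where d: "\<And>p \<sigma>. p > d ==> \<phi> p \<sigma> = 0" using \<phi> cochains_bound cocyclesD by metis
  show ?thesis by (rule cochainsI[where d = d]) (auto simp: \<psi>_def E_def chain_eval_def d)
 qed
 moreover have "coboundary X \<psi> = \<phi>" proof (rule cochain_eqI[of _ X])
  fix p \<sigma>
  assume \<sigma>: "ssimplex p X \<sigma>"
  show "coboundary X \<psi> p \<sigma> = \<phi> p \<sigma>" proof (cases p)
   case 0
   then obtain x where x: "std_simplex p = {x}" by (simp add: standard_simplex_0)
   then have "\<sigma> x \<in> topspace X" using \<sigma> by (auto simp: singular_simplex_def continuous_map_def)
   then have "small_simplex \<U> p \<sigma>" using cover x by (auto simp: small_simplex_def)
   then show ?thesis using van \<sigma> 0 by simp
  next
   case (Suc m)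
   define c where "c = frag_of \<sigma>"
   have c: "singular_chain (Suc m) X c" using \<sigma> Suc by (simp add: c_def singular_chain_of)
   \<comment> \<open>The sums defining \<psi> have a length depending on the simplex; N is long
     enough for \<sigma> and all its faces at once, and \<open>stable\<close> allows the longer
     sums.\<close>
   define N where "N = Max (insert (thr p \<sigma>) ((\<lambda>k. thr m (singular_face p k \<sigma>)) ` {..p}))"
   have N: "thr p \<sigma> \<le> N" "\<And>k. k \<le> p ==> thr m (singular_face p k \<sigma>) \<le> N"
    unfolding N_def by (intro Max_ge; simp)+
   \<comment> \<open>In the homotopy formula the term with the boundary of h vanishes under \<phi>,
     because \<phi> is a cocycle; summing over i then telescopes.\<close>
   have step: "chain_eval (\<phi> (Suc m)) (S (Suc m) (Suc i) c) + chain_eval (\<phi> (Suc m)) (S (Suc m) i c) =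
     chain_eval (\<phi> (Suc m)) (h m (S m i (chain_boundary (Suc m) c)))" for i proof -
    have ch: "singular_chain (Suc m) X (S (Suc m) i c)" by (rule Sch[OF c])
    have "chain_eval (\<phi> (Suc m)) (chain_boundary (Suc (Suc m)) (h (Suc m) (S (Suc m) i c))) = 0"
     using chain_eval_coboundary[OF hch[OF ch], of \<phi>] \<phi> by (simp add: cocyclesD chain_eval_def)
    moreover have "S (Suc m) (Suc i) c - S (Suc m) i c =
      chain_boundary (Suc (Suc m)) (h (Suc m) (S (Suc m) i c)) + h m (S m i (chain_boundary (Suc m) c))"
     using hbd[OF ch] Sbd[OF c, of i] by (simp add: S_def)
    ultimately show ?thesis by (metis add.left_neutral chain_eval_add chain_eval_diff)
   qed
   have "chain_eval (\<phi> (Suc m)) (S (Suc m) n c) + chain_eval (\<phi> (Suc m)) c = E m n (chain_boundary (Suc m) c)" for n proof (induction n)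
    case (Suc n)
    have "chain_eval (\<phi> (Suc m)) (S (Suc m) (Suc n) c) + chain_eval (\<phi> (Suc m)) c =
     (chain_eval (\<phi> (Suc m)) (S (Suc m) (Suc n) c) + chain_eval (\<phi> (Suc m)) (S (Suc m) n c)) +
     (chain_eval (\<phi> (Suc m)) (S (Suc m) n c) + chain_eval (\<phi> (Suc m)) c)" by (simp add: add.assoc)
    then show ?case unfolding step Suc.IH by (simp add: E_def add.commute)
   qed (simp add: E_def S_def)
   from this[of N] have "chain_eval (\<phi> (Suc m)) (S (Suc m) N c) + \<phi> p \<sigma> = E m N (chain_boundary (Suc m) c)" using Suc by (simp add: c_def)
   moreover have "chain_eval (\<phi> (Suc m)) (S (Suc m) N c) = 0" proof (rule chain_eval_eq_0)
    fix \<tau> assume \<tau>: "\<tau> \<in> Poly_Mapping.keys (S (Suc m) N c)"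
    then have "ssimplex (Suc m) X \<tau>" using Sch[OF c, of N] by (auto simp: singular_chain_def)
    then show "\<phi> (Suc m) \<tau> = 0" using \<tau> N(1) \<sigma> Suc by (intro van) (auto intro: thr simp: c_def)
   qed
   moreover have "E m N (chain_boundary (Suc m) c) = coboundary X \<psi> p \<sigma>" proof -
    have "E m N (chain_boundary (Suc m) c) = (\<Sum>k\<le>Suc m. E m N (frag_of (singular_face (Suc m) k \<sigma>)))"
     unfolding c_def chain_boundary_of by (simp add: Esum Esign del: sum.atMost_Suc)
    also have "\<dots> = (\<Sum>k\<le>Suc m. \<psi> m (singular_face (Suc m) k \<sigma>))"
     using \<sigma> Suc N(2) by (intro sum.cong) (auto simp: \<psi>_def ssimplex_face stable[where N = N])
    finally show ?thesis using \<sigma> Suc by (simp add: coboundary_Suc del: sum.atMost_Suc)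
   qed
   ultimately show ?thesis by simp
  qed
 qed (simp_all add: \<open>\<psi> \<in> cochains X\<close> coboundary_cochains cocyclesD(1)[OF \<phi>])
 moreover have "\<psi> p \<sigma> = 0" if \<sigma>: "ssimplex p X \<sigma>" and sm: "small_simplex \<U> p \<sigma>" for p \<sigma> proof -
  obtain U where U: "U \<in> \<U>" "\<sigma> ` std_simplex p \<subseteq> U" using sm by (auto simp: small_simplex_def)
  then have "singular_chain p (subtopology X U) (frag_of \<sigma>)" using \<sigma> by (simp add: singular_chain_of singular_simplex_subtopology)
  then have "singular_chain p (subtopology X U) (S p i (frag_of \<sigma>))" for i by (rule Sch)
  then have "ssimplex p X \<tau> \<and> small_simplex \<U> p \<tau>"
   if "\<tau> \<in> Poly_Mapping.keys (S p i (frag_of \<sigma>))" for \<tau> i using that U(1) unfolding singular_chain_def small_simplex_def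
   by (metis mem_Collect_eq singular_simplex_subtopology subsetD)
  then have "chain_eval (\<phi> (Suc p)) (h p (S p i (frag_of \<sigma>))) = 0" for i by (intro eval_small) (auto simp: singular_chain_def)
  then show ?thesis by (simp add: \<psi>_def E_def)
 qed
 ultimately show thesis using that by blast
qed

lemma small_coboundary:
 assumes "\<And>U. U \<in> \<U> ==> openin X U" "topspace X \<subseteq> \<Union>\<U>" "\<phi> \<in> cocycles X"
  "\<And>p \<sigma>. ssimplex p X \<sigma> ==> small_simplex \<U> p \<sigma> ==> \<phi> p \<sigma> = 0"
 shows "\<phi> \<in> cobs X" using small_exact[OF assms(1,2,3)] assms(4) by (metis cobsI)

section \<open>Products of classes vanishing on the sets of an open cover\<close>

lemma ssimplex_subtopologyD:
 "ssimplex p (subtopology X S) \<sigma> ==> ssimplex p X \<sigma>" by (simp add: singular_simplex_subtopology)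

text \<open>Extension by zero leaves the function unchanged, as cochains are zero off the simplices
  of their space.\<close>

lemma cochains_subtopology: "\<phi> \<in> cochains (subtopology X S) ==> \<phi> \<in> cochains X"
 by (auto simp: cochains_def singular_simplex_subtopology)

lemma coboundary_subtopology:
 "ssimplex p (subtopology X S) \<sigma> ==> coboundary (subtopology X S) \<phi> p \<sigma> = coboundary X \<phi> p \<sigma>"
 by (simp add: coboundary_def singular_simplex_subtopology)

abbreviation restr :: "'a topology => 'a cochain => 'a cochain"
 where "restr A \<phi> \<equiv> pull A (\<lambda>x. x) \<phi>"

lemma restr_eval: "ssimplex p A \<sigma> ==> restr A \<phi> p \<sigma> = \<phi> p \<sigma>"
 by (simp add: pull_eval simplex_map_ident)

lemma continuous_map_subtopology_ident [simp]: "continuous_map (subtopology X S) X (\<lambda>x. x)" by (simp add: continuous_map_from_subtopology)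

lemma small_simplex_front_face:
 assumes "small_simplex \<U> n \<sigma>" "p \<le> n"
 shows "small_simplex \<U> p (front_face p \<sigma>)" proof -
 obtain U where U: "U \<in> \<U>" "\<sigma> ` std_simplex n \<subseteq> U" using assms(1) unfolding small_simplex_def by blast
 have "\<sigma> x \<in> U" if "x \<in> std_simplex p" for x using U(2) std_simplex_leD[OF that assms(2)] by blast
 then show ?thesis using U(1) unfolding small_simplex_def front_face_def by (intro bexI[of _ U]) auto
qed

lemma small_simplex_back_face:
 assumes "small_simplex \<U> (p + q) \<sigma>"
 shows "small_simplex \<U> q (back_face p q \<sigma>)" proof -
 obtain U where U: "U \<in> \<U>" "\<sigma> ` std_simplex (p + q) \<subseteq> U" using assms unfolding small_simplex_def by blast
 have "\<sigma> (shift_point p x) \<in> U" if "x \<in> std_simplex q" for x using U(2) shift_point_in_simplex[OF that] by blast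
 then show ?thesis using U(1) unfolding small_simplex_def back_face_eq by (intro bexI[of _ U]) auto
qed

definition vanishes_on :: "'a topology => 'a set set => 'a cochain => bool"
 where "vanishes_on X \<U> \<phi> \<longleftrightarrow> (\<forall>p \<sigma>. ssimplex p X \<sigma> \<longrightarrow> small_simplex \<U> p \<sigma> \<longrightarrow> \<phi> p \<sigma> = 0)"

lemma vanishes_on_cup_right:
 assumes "vanishes_on X \<U> \<psi>"
 shows "vanishes_on X \<U> (cup X \<phi> \<psi>)" unfolding vanishes_on_def proof (intro allI impI)
 fix n \<sigma> assume ss: "ssimplex n X \<sigma>" "small_simplex \<U> n \<sigma>"
 have "\<psi> (n - p) (back_face p (n - p) \<sigma>) = 0" if "p \<le> n" for p
  using assms ss that ssimplex_back_face[of p "n - p" X \<sigma>] small_simplex_back_face[of \<U> p "n - p" \<sigma>]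
  unfolding vanishes_on_def by (simp only: le_add_diff_inverse)
 then show "cup X \<phi> \<psi> n \<sigma> = 0" using ss by (simp add: cup_eval)
qed

lemma vanishes_on_cup_left:
 assumes "vanishes_on X \<U> \<phi>"
 shows "vanishes_on X \<U> (cup X \<phi> \<psi>)" unfolding vanishes_on_def proof (intro allI impI)
 fix n \<sigma> assume ss: "ssimplex n X \<sigma>" "small_simplex \<U> n \<sigma>"
 have "\<phi> p (front_face p \<sigma>) = 0" if "p \<le> n" for p using assms ss that ssimplex_front_face small_simplex_front_face
  by (metis vanishes_on_def)
 then show "cup X \<phi> \<psi> n \<sigma> = 0" using ss by (simp add: cup_eval)
qed

lemma vanishes_on_Un: "vanishes_on X (\<U> \<union> \<W>) \<phi> \<longleftrightarrow> vanishes_on X \<U> \<phi> \<and> vanishes_on X \<W> \<phi>"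
 unfolding vanishes_on_def small_simplex_def by blast

text \<open>A primitive over U, extended by zero, has a coboundary on all of X; adding it makes the
  representative vanish exactly, not only up to coboundary, on the simplices inside U.\<close>

lemma vanishes_on_representative:
 assumes \<phi>: "\<phi> \<in> cocycles X" and "restr (subtopology X U) \<phi> \<in> cobs (subtopology X U)"
 obtains \<psi> where "\<psi> \<in> cocycles X" "\<phi> + \<psi> \<in> cobs X" "vanishes_on X {U} \<psi>" proof -
 obtain \<eta> where \<eta>: "\<eta> \<in> cochains (subtopology X U)"
  "restr (subtopology X U) \<phi> = coboundary (subtopology X U) \<eta>" using assms(2) by (auto elim: cobsE)
 then have \<eta>X: "\<eta> \<in> cochains X" using cochains_subtopology by blast
 have "(\<phi> + coboundary X \<eta>) p \<sigma> = 0"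
  if "ssimplex p X \<sigma>" "\<sigma> ` std_simplex p \<subseteq> U" for p \<sigma> proof -
  have s: "ssimplex p (subtopology X U) \<sigma>" using that singular_simplex_subtopology by blast
  have "\<phi> p \<sigma> = coboundary X \<eta> p \<sigma>" using fun_cong[OF fun_cong[OF \<eta>(2)], of p \<sigma>]
   by (simp add: restr_eval[OF s] coboundary_subtopology[OF s])
  then show ?thesis by simp
 qed
 then have "vanishes_on X {U} (\<phi> + coboundary X \<eta>)" by (simp add: vanishes_on_def small_simplex_def)
 then show thesis using that[of "\<phi> + coboundary X \<eta>"] \<phi> \<eta>X by auto
qed

lemma cobs_zero_fun [simp]: "(\<lambda>_ _. 0) \<in> cobs X" using cobs_0 by (simp add: zero_fun_def)

lemma coboundary_transfer:
 "\<phi> + \<psi> \<in> cobs X ==> \<psi> \<in> cobs X ==> \<phi> \<in> cobs X"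
 using cobs_add[of "\<phi> + \<psi>" X \<psi>] by (simp add: add.assoc)

lemma cohomologous_trans:
 "\<phi> + \<psi> \<in> cobs X ==> \<psi> + \<theta> \<in> cobs X ==> \<phi> + \<theta> \<in> cobs X"
 using cobs_add[of "\<phi> + \<psi>" X "\<psi> + \<theta>"] by (simp add: add.assoc)

lemma cohomologous_sym: "\<phi> + \<psi> \<in> cobs X ==> \<psi> + \<phi> \<in> cobs X" by (simp add: add.commute)

lemma cohomologous_cup:
 assumes "\<phi> + \<phi>' \<in> cobs X" "\<psi> + \<psi>' \<in> cobs X" "\<phi>' \<in> cocycles X" "\<psi> \<in> cocycles X"
 shows "cup X \<phi> \<psi> + cup X \<phi>' \<psi>' \<in> cobs X" proof -
 have "cup X (\<phi> + \<phi>') \<psi> + cup X \<phi>' (\<psi> + \<psi>') \<in> cobs X"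
  using assms cobs_cup_left cobs_cup_right by blast
 then show ?thesis by (simp add: cup_add_left cup_add_right add.assoc)
qed

definition cup_list :: "'a topology => 'a cochain list => 'a cochain"
 where "cup_list X \<phi>s = foldr (cup X) \<phi>s (unit_cochain X)"

lemma cup_list_simps [simp]:
 "cup_list X [] = unit_cochain X" "cup_list X (\<phi> # \<phi>s) = cup X \<phi> (cup_list X \<phi>s)" by (auto simp: cup_list_def)

lemma cup_list_cocycles: "set \<phi>s \<subseteq> cocycles X ==> cup_list X \<phi>s \<in> cocycles X" by (induction \<phi>s) auto

text \<open>The Lusternik-Schnirelmann argument: with representatives vanishing on the respective
  sets, the product vanishes on every simplex contained in some set of the cover, and such cocycles
  are exact by \<open>small_coboundary\<close>.\<close>

theorem cover_product_coboundary:
 assumes "list_all2 (\<lambda>\<phi> U. \<phi> \<in> cocycles X \<and> openin X U \<and>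
   restr (subtopology X U) \<phi> \<in> cobs (subtopology X U)) \<phi>s Us"
  and cover: "topspace X \<subseteq> \<Union>(set Us)"
 shows "cup_list X \<phi>s \<in> cobs X" proof -
 have "\<exists>\<psi>. \<psi> \<in> cocycles X \<and> cup_list X \<phi>s + \<psi> \<in> cobs X \<and> vanishes_on X (set Us) \<psi>" using assms(1)
 proof (induction rule: list_all2_induct)
  case Nil
  then show ?case by (intro exI[of _ "unit_cochain X"]) (auto simp: vanishes_on_def small_simplex_def)
 next
  case (Cons \<phi> \<phi>s U Us)
  obtain \<psi> where \<psi>: "\<psi> \<in> cocycles X" "cup_list X \<phi>s + \<psi> \<in> cobs X" "vanishes_on X (set Us) \<psi>"
   using Cons.IH by blast
  obtain \<phi>' where \<phi>': "\<phi>' \<in> cocycles X" "\<phi> + \<phi>' \<in> cobs X" "vanishes_on X {U} \<phi>'"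
   using Cons.hyps vanishes_on_representative by blast
  have "set \<phi>s \<subseteq> cocycles X" using Cons.hyps(2) by (auto simp: list_all2_conv_all_nth in_set_conv_nth)
  then have "cup X \<phi> (cup_list X \<phi>s) + cup X \<phi>' \<psi> \<in> cobs X" using \<psi> \<phi>' by (intro cohomologous_cup cup_list_cocycles)
  moreover have "vanishes_on X ({U} \<union> set Us) (cup X \<phi>' \<psi>)"
   using \<psi> \<phi>' by (simp only: vanishes_on_Un vanishes_on_cup_left vanishes_on_cup_right)
  ultimately show ?case using \<psi>(1) \<phi>'(1) by (intro exI[of _ "cup X \<phi>' \<psi>"] conjI)
    (simp_all only: cup_list_simps cocycles_cup list.set insert_is_Un[of U "set Us"])
 qed
 then obtain \<psi> where \<psi>: "\<psi> \<in> cocycles X" "cup_list X \<phi>s + \<psi> \<in> cobs X" "vanishes_on X (set Us) \<psi>" by blast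
 have "openin X U" if "U \<in> set Us" for U using assms(1) that by (auto simp: list_all2_conv_all_nth in_set_conv_nth)
 then have "\<psi> \<in> cobs X" using small_coboundary[of "set Us" X \<psi>] cover \<psi> by (simp add: vanishes_on_def)
 then show ?thesis using \<psi>(2) coboundary_transfer by blast
qed

section \<open>Cochains of low degree\<close>

abbreviation vertex :: "nat => nat => real"
 where "vertex i \<equiv> (\<lambda>j. if j = i then 1 else 0)"

lemma simplical_face_vertex: "simplical_face k (vertex i) = vertex (if i < k then i else Suc i)" by (rule ext) (auto simp: simplical_face_def)

lemma singular_face_vertex:
 "i \<le> m ==> singular_face (Suc m) k \<sigma> (vertex i) = \<sigma> (vertex (if i < k then i else Suc i))"
 by (simp add: singular_face_def simplical_face_vertex)

definition point_cochain :: "'a topology => ('a => bit) => 'a cochain"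
 where "point_cochain X f = (\<lambda>p \<sigma>. if p = 0 \<and> ssimplex 0 X \<sigma> then f (\<sigma> (vertex 0)) else 0)"

lemma point_cochain_cochains [simp]: "point_cochain X f \<in> cochains X" by (rule cochainsI[where d = 0]) (auto simp: point_cochain_def)

lemma coboundary_point_cochain:
 "coboundary X (point_cochain X f) = (\<lambda>p \<sigma>. if p = 1 \<and> ssimplex 1 X \<sigma>
  then f (\<sigma> (vertex 0)) + f (\<sigma> (vertex 1)) else 0)" proof (intro ext)
 fix p \<sigma>
 show "coboundary X (point_cochain X f) p \<sigma> = (if p = 1 \<and> ssimplex 1 X \<sigma>
  then f (\<sigma> (vertex 0)) + f (\<sigma> (vertex 1)) else 0)" proof (cases "p = 1 \<and> ssimplex 1 X \<sigma>")
  case True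
  then show ?thesis using ssimplex_face[of 0 X \<sigma>] by (simp add: coboundary_def point_cochain_def singular_face_vertex add.commute)
 next
  case False
  then show ?thesis by (cases "p = 1") (auto simp: coboundary_def point_cochain_def intro!: sum.neutral)
 qed
qed

lemma simplex_map_vertex: "i \<le> p ==> simplex_map p g \<sigma> (vertex i) = g (\<sigma> (vertex i))" by (simp add: simplex_map_def)

lemma coboundary_degree_2:
 assumes "ssimplex 2 X \<sigma>"
 shows "coboundary X \<phi> 2 \<sigma> =
  \<phi> 1 (singular_face 2 0 \<sigma>) + \<phi> 1 (singular_face 2 1 \<sigma>) + \<phi> 1 (singular_face 2 2 \<sigma>)" proof -
 have "{..2} = {0, 1, 2::nat}" by auto
 then show ?thesis using assms by (simp add: coboundary_def add.assoc)
qed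

lemma bit_sum3_eq_0_iff: "(a::bit) + b + c = 0 \<longleftrightarrow> b = a + c" by (cases a; cases b; cases c) (simp_all add: add_bit_eq_xor)

lemma bit_exchange: "(a::bit) + b + c = a' + b' + c' ==> (a + a') + (b + b') = c + c'"
 by (cases a; cases b; cases c; cases a'; cases b'; cases c') (simp_all add: add_bit_eq_xor)

text \<open>Steenrod's cup-1 product: the cochain \<eta> taking the value \<phi>(\<sigma>)
  \<psi>(\<sigma>) on an edge \<sigma> has the commutator as its coboundary. Degree 1 is enough,
  since the classes that have to commute below are roots and products of roots.\<close>

lemma degree_1_cup_commute:
 assumes \<phi>: "\<phi> \<in> cocycles X" "\<And>p. p \<noteq> 1 ==> \<phi> p = (\<lambda>_. 0)"
  and \<psi>: "\<psi> \<in> cocycles X" "\<And>p. p \<noteq> 1 ==> \<psi> p = (\<lambda>_. 0)"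
 shows "cup X \<phi> \<psi> + cup X \<psi> \<phi> \<in> cobs X" proof -
 define \<eta> where "\<eta> = (\<lambda>p \<sigma>. if p = 1 then \<phi> p \<sigma> * \<psi> p \<sigma> else 0)"
 have \<eta>: "\<eta> \<in> cochains X" by (rule cochainsI[where d = 1]) (auto simp: \<eta>_def cochains_off[OF cocyclesD(1)[OF \<phi>(1)]])
 have cup2: "cup X \<alpha> \<beta> n \<sigma> = (if n = 2 then \<alpha> 1 (singular_face 2 2 \<sigma>) * \<beta> 1 (singular_face 2 0 \<sigma>) else 0)"
  if "ssimplex n X \<sigma>" "\<And>p. p \<noteq> 1 ==> \<alpha> p = (\<lambda>_. 0)" "\<And>p. p \<noteq> 1 ==> \<beta> p = (\<lambda>_. 0)" for \<alpha> \<beta> n \<sigma>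
 proof -
  have "\<alpha> p (front_face p \<sigma>) * \<beta> (n - p) (back_face p (n - p) \<sigma>) = 0" if "p \<noteq> 1 \<or> n \<noteq> 2" "p \<le> n" for p
  proof (cases "p = 1")
   case True
   then have "n - p \<noteq> 1" using that by auto
   then show ?thesis using \<open>\<And>p. p \<noteq> 1 ==> \<beta> p = (\<lambda>_. 0)\<close> by simp
  qed (use \<open>\<And>p. p \<noteq> 1 ==> \<alpha> p = (\<lambda>_. 0)\<close> in simp)
  then have "cup X \<alpha> \<beta> n \<sigma> = (\<Sum>p\<in>(if n = 2 then {1} else {}). \<alpha> p (front_face p \<sigma>) * \<beta> (n - p) (back_face p (n - p) \<sigma>))"
   unfolding cup_eval[OF that(1)] by (intro sum.mono_neutral_right) auto
  moreover have "front_face 1 \<sigma> = singular_face 2 2 \<sigma>" "back_face 1 1 \<sigma> = singular_face 2 0 \<sigma>" if "n = 2"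
   using singular_face_front_face_last[of 1 \<sigma>] singular_face_back_face_0[of 1 0 \<sigma>]
    front_face_self[of 2 X \<sigma>] back_face_self[of 2 X \<sigma>] \<open>ssimplex n X \<sigma>\<close> that by (simp_all add: numeral_2_eq_2)
  ultimately show ?thesis by auto
 qed
 have "cup X \<phi> \<psi> + cup X \<psi> \<phi> = coboundary X \<eta>" proof (rule cochain_eqI[of _ X])
  fix n \<sigma> assume \<sigma>: "ssimplex n X \<sigma>"
  show "(cup X \<phi> \<psi> + cup X \<psi> \<phi>) n \<sigma> = coboundary X \<eta> n \<sigma>" proof (cases "n = 2")
   case True
   then have s2: "ssimplex 2 X \<sigma>" using \<sigma> by simp
   have "\<phi> 1 (singular_face 2 1 \<sigma>) = \<phi> 1 (singular_face 2 0 \<sigma>) + \<phi> 1 (singular_face 2 2 \<sigma>)"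
    "\<psi> 1 (singular_face 2 1 \<sigma>) = \<psi> 1 (singular_face 2 0 \<sigma>) + \<psi> 1 (singular_face 2 2 \<sigma>)"
    using coboundary_degree_2[OF s2, of \<phi>] coboundary_degree_2[OF s2, of \<psi>]
    by (simp_all only: cocyclesD(2)[OF \<phi>(1)] cocyclesD(2)[OF \<psi>(1)] zero_fun_apply
      eq_commute[of 0] bit_sum3_eq_0_iff)
   then show ?thesis using True cup2[OF \<sigma> \<phi>(2) \<psi>(2)] cup2[OF \<sigma> \<psi>(2) \<phi>(2)]
    by (simp add: coboundary_degree_2[OF s2] \<eta>_def algebra_simps)
  next
   case False
   then show ?thesis using cup2[OF \<sigma> \<phi>(2) \<psi>(2)] cup2[OF \<sigma> \<psi>(2) \<phi>(2)]
    by (auto simp: coboundary_def \<eta>_def intro!: sum.neutral)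
  qed
 qed (use \<phi> \<psi> \<eta> cocyclesD in blast)+
 then show ?thesis using \<eta> by auto
qed

section \<open>Line fields\<close>

definition dotn :: "nat => (nat => real) => (nat => real) => real"
 where "dotn n v w = (\<Sum>i<n. v i * w i)"

lemma dotn_scale_left [simp]: "dotn n (\<lambda>i. c * v i) w = c * dotn n v w" by (simp add: dotn_def sum_distrib_left mult.assoc)

lemma dotn_scale_right [simp]: "dotn n v (\<lambda>i. c * w i) = c * dotn n v w" by (simp add: dotn_def sum_distrib_left mult.left_commute)

lemma dotn_minus_left [simp]: "dotn n (\<lambda>i. - v i) w = - dotn n v w" by (simp add: dotn_def sum_negf)

lemma dotn_minus_right [simp]: "dotn n v (\<lambda>i. - w i) = - dotn n v w" by (simp add: dotn_def sum_negf)

lemma dotn_divide_left [simp]: "dotn n (\<lambda>i. v i / c) w = dotn n v w / c" by (simp add: dotn_def sum_divide_distrib)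

lemma dotn_divide_right [simp]: "dotn n v (\<lambda>i. w i / c) = dotn n v w / c" by (simp add: dotn_def sum_divide_distrib)

lemma dotn_commute: "dotn n v w = dotn n w v" by (simp add: dotn_def mult.commute)

lemma dotn_pos:
 assumes "\<And>i. i \<ge> n ==> v i = 0" "v \<noteq> (\<lambda>i. 0)"
 shows "0 < dotn n v v" proof -
 obtain i where "v i \<noteq> 0" "i < n" using assms by (metis ext linorder_not_le)
 then have "0 < v i * v i" by (metis not_real_square_gt_zero)
 also have "\<dots> \<le> dotn n v v" unfolding dotn_def using \<open>i < n\<close> by (intro member_le_sum) auto
 finally show ?thesis .
qed

lemma minus_vector_neq:
 assumes "dotn n v w \<noteq> 0"
 shows "(\<lambda>i. - v i) \<noteq> v" proof
 assume eq: "(\<lambda>i. - v i) = v"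
 show False using assms dotn_minus_left[of n v w] unfolding eq by simp
qed

text \<open>The square involves only the products \<open>v i * v j\<close> and
  \<open>w i * w j\<close>, the entries of the projections onto the two lines. Hence it is
  continuous for line fields, although the scalar product itself is defined only up to sign.\<close>

lemma dotn_square: "(dotn n v w)\<^sup>2 = (\<Sum>i<n. \<Sum>j<n. (v i * v j) * (w i * w j))"
 by (simp add: dotn_def power2_eq_square sum_product mult.assoc mult.left_commute)

abbreviation simplex_top :: "nat => (nat => real) topology"
 where "simplex_top p \<equiv> subtopology (powertop_real UNIV) (std_simplex p)"

lemma continuous_map_simplex: "cont_real (simplex_top p) f \<longleftrightarrow> continuous_on (std_simplex p) f"
 by (simp add: euclidean_product_topology)

lemma compact_std_simplex: "compact (std_simplex p)" using compactin_standard_simplex[of p] by (simp add: euclidean_product_topology)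

lemma connected_std_simplex: "connected (std_simplex p)" using connectedin_standard_simplex[of p] by (simp add: euclidean_product_topology)

lemma nonvanishing_constant_sign:
 fixes f :: "'a::topological_space => real"
 assumes "connected S" "continuous_on S f" "\<And>x. x \<in> S ==> f x \<noteq> 0"
 shows "(\<forall>x\<in>S. f x > 0) \<or> (\<forall>x\<in>S. f x < 0)" proof (rule ccontr)
 assume "\<not> ?thesis"
 then obtain x y where "x \<in> S" "y \<in> S" "f x \<le> 0" "f y \<ge> 0" by (metis linorder_not_less)
 moreover have "connected (f ` S)" using assms connected_continuous_image by blast
 ultimately have "0 \<in> f ` S" by (metis connectedD_interval image_eqI)
 then show False using assms(3) by auto
qed

text \<open>
 A field of lines in \<open>\<real>\<^sup>n\<close> is given by an arbitrary choice of unit vectors spanning the lines;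
 continuity of the field means continuity of the orthogonal projections onto the lines.
\<close>

definition line_field :: "nat => 'a topology => ('a => nat => real) => bool"
 where "line_field n Y u \<longleftrightarrow>
  (\<forall>y\<in>topspace Y. (\<forall>i\<ge>n. u y i = 0) \<and> dotn n (u y) (u y) = 1) \<and>
  (\<forall>i j. cont_real Y (\<lambda>y. u y i * u y j))"

lemma continuous_map_comp:
 "continuous_map Z Y g ==> continuous_map Y W f ==> continuous_map Z W (\<lambda>z. f (g z))"
 using continuous_map_compose by (fastforce simp: o_def)

lemma continuous_map_mem: "continuous_map X Y f ==> x \<in> topspace X ==> f x \<in> topspace Y" by (auto simp: continuous_map_def)

lemma line_field_compose:
 assumes "line_field n Y u" "continuous_map Z Y g"
 shows "line_field n Z (\<lambda>z. u (g z))" unfolding line_field_def proof (intro conjI allI ballI)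
 fix i j
 show "cont_real Z (\<lambda>z. u (g z) i * u (g z) j)"
  using continuous_map_comp[OF assms(2), of euclideanreal "\<lambda>y. u y i * u y j"] assms(1) by (simp add: line_field_def)
qed (use assms(1) continuous_map_mem[OF assms(2)] in \<open>auto simp: line_field_def\<close>)

lemma line_field_subtopology: "line_field n Y u ==> line_field n (subtopology Y S) u"
 using line_field_compose[of n Y u "subtopology Y S" "\<lambda>x. x"] by simp

text \<open>The function r is an arbitrary, possibly discontinuous choice of vectors in the lines; v
  is a continuous one over the simplex.\<close>

definition is_lift :: "nat => ((nat => real) => nat => real) => ((nat => real) => nat => real) => bool"
 where "is_lift p r v \<longleftrightarrow> (\<forall>i. cont_real (simplex_top p) (\<lambda>x. v x i)) \<and>
  (\<forall>x\<in>std_simplex p. v x = r x \<or> v x = (\<lambda>i. - r x i))"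

lemma is_lift_cong:
 assumes "\<And>x. x \<in> std_simplex p ==> r x = r' x"
 shows "is_lift p r v \<longleftrightarrow> is_lift p r' v" using assms by (simp add: is_lift_def)

lemma is_lift_minus: "is_lift p r v ==> is_lift p r (\<lambda>x i. - v x i)" by (auto simp: is_lift_def intro!: continuous_map_minus)

lemma is_lift_reparam:
 assumes "is_lift p r v" "continuous_map (simplex_top q) (simplex_top p) g"
 shows "is_lift q (\<lambda>x. r (g x)) (\<lambda>x. v (g x))" unfolding is_lift_def proof (intro conjI allI ballI)
 fix i
 show "cont_real (simplex_top q) (\<lambda>x. v (g x) i)"
  using continuous_map_comp[OF assms(2), of euclideanreal "\<lambda>x. v x i"] assms(1) by (simp add: is_lift_def)
qed (use assms(1) continuous_map_mem[OF assms(2)] in \<open>auto simp: is_lift_def\<close>)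

lemma is_lift_sign_constant:
 assumes "line_field n (simplex_top p) r" "line_field n (simplex_top p) r'"
  and v: "is_lift p r v" "is_lift p r' v'"
  and nz: "\<And>x. x \<in> std_simplex p ==> dotn n (r x) (r' x) \<noteq> 0"
 shows "(\<forall>x\<in>std_simplex p. dotn n (v x) (v' x) > 0) \<or> (\<forall>x\<in>std_simplex p. dotn n (v x) (v' x) < 0)"
proof (rule nonvanishing_constant_sign[OF connected_std_simplex])
 show "continuous_on (std_simplex p) (\<lambda>x. dotn n (v x) (v' x))"
  using v unfolding dotn_def is_lift_def continuous_map_simplex by (auto intro!: continuous_intros)
 show "dotn n (v x) (v' x) \<noteq> 0" if x: "x \<in> std_simplex p" for x proof -
  have "v x = r x \<or> v x = (\<lambda>i. - r x i)" "v' x = r' x \<or> v' x = (\<lambda>i. - r' x i)" using v x by (auto simp: is_lift_def)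
  then show ?thesis using nz[OF x] by auto
 qed
qed

lemma is_lift_unique:
 assumes lf: "line_field n (simplex_top p) r" and v: "is_lift p r v" "is_lift p r v'"
 shows "(\<forall>x\<in>std_simplex p. v' x = v x) \<or> (\<forall>x\<in>std_simplex p. v' x = (\<lambda>i. - v x i))" proof -
 have *: "v' x = v x \<and> dotn n (v x) (v' x) = 1 \<or> v' x = (\<lambda>i. - v x i) \<and> dotn n (v x) (v' x) = -1"
  if "x \<in> std_simplex p" for x proof -
  have "v x = r x \<or> v x = (\<lambda>i. - r x i)" "v' x = r x \<or> v' x = (\<lambda>i. - r x i)" "dotn n (r x) (r x) = 1"
   using that lf v by (auto simp: is_lift_def line_field_def)
  then show ?thesis by auto
 qed
 have "(\<forall>x\<in>std_simplex p. dotn n (v x) (v' x) > 0) \<or> (\<forall>x\<in>std_simplex p. dotn n (v x) (v' x) < 0)"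
  using is_lift_sign_constant[OF lf lf v] lf by (simp add: line_field_def)
 then show ?thesis using * by force
qed

lemma continuous_on_segment_point:
 fixes c :: "nat => real"
 assumes "continuous_on A f" "\<And>i. continuous_on A (\<lambda>z. g z i)"
 shows "continuous_on A (\<lambda>z i. (1 - f z) * c i + f z * g z i)" by (intro continuous_on_coordinatewise_then_product continuous_intros assms)

text \<open>
 Transport the vector at a vertex along the radii, in \<open>N\<close> orthogonal projections from one line
 to the next. By uniform continuity no two consecutive lines are orthogonal if \<open>N\<close> is large.
\<close>

lemma is_lift_exists:
 assumes lf: "line_field n (simplex_top p) r"
 obtains v where "is_lift p r v" proof -
 define S where "S = std_simplex p"
 define c where "c = vertex 0"
 define pt where "pt = (\<lambda>s x i. (1 - s) * c i + s * x i :: real)"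
 define M where "M = (\<lambda>i j x. r x i * r x j)"
 have c: "c \<in> S" by (simp add: c_def S_def)
 have pt: "pt s x \<in> S" if "x \<in> S" "0 \<le> s" "s \<le> 1" for s x using convex_standard_simplex[of c p x s] that c by (simp add: pt_def S_def)
 have unit: "dotn n (r x) (r x) = 1" and supp: "\<And>i. i \<ge> n ==> r x i = 0" if "x \<in> S" for x
  using lf that by (auto simp: line_field_def S_def)
 have contM: "continuous_on S (M i j)" for i j using lf by (simp add: line_field_def M_def S_def continuous_map_simplex)
 \<comment> \<open>The squared cosine of the angle between the lines at two points of the same
   radius. It is 1 for equal points, so uniform continuity keeps it positive for steps shorter than
   d.\<close>
 define Q where "Q = (\<lambda>(x, s, s'). \<Sum>i<n. \<Sum>j<n. M i j (pt s x) * M i j (pt s' x))"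
 have Q: "Q (x, s, s') = (dotn n (r (pt s x)) (r (pt s' x)))\<^sup>2" for x s s' by (simp add: Q_def M_def dotn_square)
 let ?K = "S \<times> {0..1::real} \<times> {0..1::real}"
 have c1: "continuous_on ?K (\<lambda>z. pt (fst (snd z)) (fst z))" unfolding pt_def by (intro continuous_on_segment_point continuous_intros
    continuous_on_product_then_coordinatewise[OF continuous_on_fst[OF continuous_on_id]])
 have c2: "continuous_on ?K (\<lambda>z. pt (snd (snd z)) (fst z))" unfolding pt_def by (intro continuous_on_segment_point continuous_intros
    continuous_on_product_then_coordinatewise[OF continuous_on_fst[OF continuous_on_id]])
 have c3: "continuous_on S (pt s)" for s unfolding pt_def by (intro continuous_on_segment_point continuous_intros
    continuous_on_product_then_coordinatewise[OF continuous_on_id])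
 have contQ: "continuous_on ?K Q" unfolding Q_def case_prod_unfold by (intro continuous_on_sum continuous_on_mult continuous_on_compose2[OF contM c1]
    continuous_on_compose2[OF contM c2]) (auto intro: pt)
 have "compact ?K" unfolding S_def by (intro compact_Times compact_std_simplex compact_Icc)
 then have "uniformly_continuous_on ?K Q" using contQ compact_uniformly_continuous by blast
 then obtain d where d: "d > 0" "\<And>z z'. z \<in> ?K ==> z' \<in> ?K ==> dist z' z < d ==> dist (Q z') (Q z) < 1"
  unfolding uniformly_continuous_on_def by (metis zero_less_one)
 obtain N where N: "N > 0" "1 / real N < d" using d(1) by (metis nat_approx_posE zero_less_Suc)
 have step: "dotn n (r (pt (real (Suc k) / N) x)) (r (pt (real k / N) x)) \<noteq> 0" if "x \<in> S" "k < N" for k x proof -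
  let ?s = "real k / N" and ?t = "real (Suc k) / N"
  have st: "0 \<le> ?s" "?s \<le> 1" "0 \<le> ?t" "?t \<le> 1" using that by auto
  have "dist (x, ?t, ?s) (x, ?s, ?s) = \<bar>?t - ?s\<bar>" by (simp add: dist_Pair_Pair dist_real_def)
  also have "\<dots> = 1 / N" by (simp add: add_divide_distrib)
  finally have "dist (Q (x, ?t, ?s)) (Q (x, ?s, ?s)) < 1" using d(2)[of "(x, ?s, ?s)" "(x, ?t, ?s)"] N(2) st that by auto
  moreover have "Q (x, ?s, ?s) = 1" unfolding Q using unit[OF pt[OF that(1) st(1,2)]] by simp
  ultimately have "Q (x, ?t, ?s) > 0" by (auto simp: dist_real_def)
  then show ?thesis unfolding Q by auto
 qed
 \<comment> \<open>The matrix with entries \<open>M i j\<close> is the orthogonal projection onto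
   the line and is continuous. Step k + 1 projects the transported vector onto the next line, where
   by \<open>step\<close> it does not become 0.\<close>
 define w where "w = rec_nat (\<lambda>x. r c) (\<lambda>k f x i. \<Sum>j<n. M i j (pt (real (Suc k) / N) x) * f x j)"
 have w0: "w 0 x = r c" and wSuc: "w (Suc k) x = (\<lambda>i. \<Sum>j<n. M i j (pt (real (Suc k) / N) x) * w k x j)" for k x by (simp_all add: w_def)
 have wcont: "continuous_on S (\<lambda>x. w k x i)" if "k \<le> N" for k i using that proof (induction k arbitrary: i)
  case (Suc k)
  then have "0 \<le> real (Suc k) / N" "real (Suc k) / N \<le> 1" by auto
  then show ?case unfolding wSuc using Suc by (intro continuous_on_sum continuous_on_mult continuous_on_compose2[OF contM c3]) (auto intro: pt)
 qed (simp add: w0)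
 have wval: "\<exists>l. l \<noteq> 0 \<and> w k x = (\<lambda>i. l * r (pt (real k / N) x) i)" if "x \<in> S" "k \<le> N" for k x using that
 proof (induction k)
  case 0
  have "pt 0 x = c" by (simp add: pt_def)
  then show ?case by (intro exI[of _ 1]) (simp add: w0)
 next
  case (Suc k)
  then obtain l where l: "l \<noteq> 0" "w k x = (\<lambda>i. l * r (pt (real k / N) x) i)" by auto
  let ?D = "dotn n (r (pt (real (Suc k) / N) x)) (r (pt (real k / N) x))"
  have "w (Suc k) x = (\<lambda>i. (l * ?D) * r (pt (real (Suc k) / N) x) i)"
   unfolding wSuc l(2) dotn_def M_def by (simp add: sum_distrib_left sum_distrib_right algebra_simps)
  then show ?case using step[of x k] Suc.prems l(1) by (intro exI[of _ "l * ?D"]) auto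
 qed
 have pt1: "pt (real N / N) x = x" for x using N by (simp add: pt_def)
 define v where "v = (\<lambda>x i. w N x i / sqrt (dotn n (w N x) (w N x)))"
 have vx: "v x = r x \<or> v x = (\<lambda>i. - r x i)" and nz: "dotn n (w N x) (w N x) \<noteq> 0" if "x \<in> S" for x proof -
  note xS = that
  obtain l where l: "l \<noteq> 0" "w N x = (\<lambda>i. l * r x i)" using wval[OF xS order_refl] pt1 by auto
  then have dl: "dotn n (w N x) (w N x) = l\<^sup>2" using unit[OF xS] by (simp add: power2_eq_square)
  then show "dotn n (w N x) (w N x) \<noteq> 0" using l(1) by simp
  have "v x i = l * r x i / \<bar>l\<bar>" for i unfolding v_def dl real_sqrt_abs using l(2) by simp
  then show "v x = r x \<or> v x = (\<lambda>i. - r x i)" using l(1) by (cases "l > 0") auto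
 qed
 have "continuous_on S (\<lambda>x. v x i)" for i unfolding v_def dotn_def using nz wcont by (intro continuous_intros) (auto simp: dotn_def)
 then have "is_lift p r v" using vx by (simp add: is_lift_def continuous_map_simplex S_def)
 then show thesis using that by blast
qed

section \<open>The cocycle of a line field\<close>

definition sign_bit :: "(nat => real) => (nat => real) => bit"
 where "sign_bit v w = (if v = w then 0 else 1)"

text \<open>The first Stiefel-Whitney class of a line field, by the same recipe as
  \<open>tautological_cocycle\<close> but over an arbitrary space and with unit vectors instead of
  rays. In this form it commutes with pullback on the level of cochains.\<close>

definition line_cocycle :: "'a topology => ('a => nat => real) => 'a cochain"
 where "line_cocycle Y u = (\<lambda>p \<sigma>. if p = 1 \<and> ssimplex 1 Y \<sigma> \<and>
   \<not> (\<exists>v. is_lift 1 (u \<circ> \<sigma>) v \<and> v (vertex 0) = u (\<sigma> (vertex 0)) \<and> v (vertex 1) = u (\<sigma> (vertex 1)))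
  then 1 else 0)"

lemma line_cocycle_degree: "p \<noteq> 1 ==> line_cocycle Y u p = (\<lambda>_. 0)" by (simp add: line_cocycle_def)

lemma line_cocycle_cochains [simp]: "line_cocycle Y u \<in> cochains Y" by (rule cochainsI[where d = 1]) (auto simp: line_cocycle_def)

lemma line_field_simplex:
 assumes "line_field n Y u" "ssimplex p Y \<sigma>"
 shows "line_field n (simplex_top p) (u \<circ> \<sigma>)" using line_field_compose[OF assms(1), of "simplex_top p" \<sigma>] assms(2)
 by (simp add: singular_simplex_def o_def)

text \<open>Any lift may be used: the only other one is its negative, which changes the bits at both
  ends.\<close>

lemma line_cocycle_lift:
 assumes lf: "line_field n Y u" and \<sigma>: "ssimplex 1 Y \<sigma>" and v: "is_lift 1 (u \<circ> \<sigma>) v"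
 shows "line_cocycle Y u 1 \<sigma> =
  sign_bit (v (vertex 0)) (u (\<sigma> (vertex 0))) + sign_bit (v (vertex 1)) (u (\<sigma> (vertex 1)))" proof -
 have lf': "line_field n (simplex_top 1) (u \<circ> \<sigma>)" using lf \<sigma> by (rule line_field_simplex)
 have v01: "v (vertex i) = u (\<sigma> (vertex i)) \<or> v (vertex i) = (\<lambda>k. - u (\<sigma> (vertex i)) k)" if "i \<le> 1" for i
  using v that by (simp add: is_lift_def)
 have ne: "(\<lambda>k. - u (\<sigma> (vertex i)) k) \<noteq> u (\<sigma> (vertex i))" if "i \<le> 1" for i
  using lf' that by (intro minus_vector_neq[of n _ "u (\<sigma> (vertex i))"]) (simp add: line_field_def)
 have in01: "vertex 0 \<in> std_simplex 1" "vertex 1 \<in> std_simplex 1" by auto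
 show ?thesis
 proof (cases "\<exists>v'. is_lift 1 (u \<circ> \<sigma>) v' \<and> v' (vertex 0) = u (\<sigma> (vertex 0)) \<and> v' (vertex 1) = u (\<sigma> (vertex 1))")
  case True
  then obtain v' where v': "is_lift 1 (u \<circ> \<sigma>) v'" "v' (vertex 0) = u (\<sigma> (vertex 0))" "v' (vertex 1) = u (\<sigma> (vertex 1))" by blast
  have "line_cocycle Y u 1 \<sigma> = 0" using True by (auto simp: line_cocycle_def)
  moreover have "sign_bit (v (vertex 0)) (u (\<sigma> (vertex 0))) = sign_bit (v (vertex 1)) (u (\<sigma> (vertex 1)))"
   using is_lift_unique[OF lf' v'(1) v] in01 v'(2,3) ne[of 0] ne[of 1] by (auto simp: sign_bit_def)
  ultimately show ?thesis by simp
 next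
  case False
  then have "line_cocycle Y u 1 \<sigma> = 1" using \<sigma> by (simp add: line_cocycle_def)
  moreover have "\<not> (v (vertex 0) = u (\<sigma> (vertex 0)) \<and> v (vertex 1) = u (\<sigma> (vertex 1)))" using False v by blast
  moreover have "\<not> (v (vertex 0) \<noteq> u (\<sigma> (vertex 0)) \<and> v (vertex 1) \<noteq> u (\<sigma> (vertex 1)))" proof
   assume "v (vertex 0) \<noteq> u (\<sigma> (vertex 0)) \<and> v (vertex 1) \<noteq> u (\<sigma> (vertex 1))"
   then have "v (vertex 0) = (\<lambda>k. - u (\<sigma> (vertex 0)) k)" "v (vertex 1) = (\<lambda>k. - u (\<sigma> (vertex 1)) k)"
    using v01[of 0] v01[of 1] by auto
   then have "(\<lambda>i. - v (vertex 0) i) = u (\<sigma> (vertex 0))" "(\<lambda>i. - v (vertex 1) i) = u (\<sigma> (vertex 1))" by simp_all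
   then show False using False is_lift_minus[OF v] by blast
  qed
  ultimately show ?thesis by (auto simp: sign_bit_def)
 qed
qed

lemma continuous_simplical_face:
 assumes "k \<le> Suc m"
 shows "continuous_map (simplex_top m) (simplex_top (Suc m)) (simplical_face k)" proof -
 have "cont_real (powertop_real UNIV) (\<lambda>x. simplical_face k x i)" for i
  unfolding simplical_face_def by (cases "i < k"; cases "i = k") auto
 then show ?thesis using assms simplical_face_Suc_in_simplex by (auto simp: continuous_map_in_subtopology continuous_map_componentwise_UNIV
    intro: continuous_map_from_subtopology)
qed

lemma line_cocycle_face:
 assumes lf: "line_field n Y u" and \<sigma>: "ssimplex 2 Y \<sigma>" and v: "is_lift 2 (u \<circ> \<sigma>) v" and "k \<le> 2"
 shows "line_cocycle Y u 1 (singular_face 2 k \<sigma>) =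
  sign_bit (v (vertex (if 0 < k then 0 else 1))) (u (\<sigma> (vertex (if 0 < k then 0 else 1)))) +
  sign_bit (v (vertex (if 1 < k then 1 else 2))) (u (\<sigma> (vertex (if 1 < k then 1 else 2))))" proof -
 have f: "ssimplex 1 Y (singular_face 2 k \<sigma>)"
  using ssimplex_face[of 1 Y \<sigma> k] \<sigma> \<open>k \<le> 2\<close> by (simp add: numeral_2_eq_2)
 have "is_lift 1 (\<lambda>x. (u \<circ> \<sigma>) (simplical_face k x)) (\<lambda>x. v (simplical_face k x))"
  using continuous_simplical_face[of k 1] \<open>k \<le> 2\<close>
  by (intro is_lift_reparam[OF v]) (simp add: numeral_2_eq_2)
 then have "is_lift 1 (u \<circ> singular_face 2 k \<sigma>) (\<lambda>x. v (simplical_face k x))" by (subst is_lift_cong) (auto simp: singular_face_def)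
 from line_cocycle_lift[OF lf f this] show ?thesis by (simp only: simplical_face_vertex numeral_2_eq_2 singular_face_vertex One_nat_def order_refl zero_le)
qed

text \<open>One lift over a 2-simplex computes the cocycle on all three edges, and each vertex bit
  then occurs twice.\<close>

lemma line_cocycle_cocycles:
 assumes lf: "line_field n Y u"
 shows "line_cocycle Y u \<in> cocycles Y" proof (rule cocyclesI)
 show "coboundary Y (line_cocycle Y u) = 0" proof (rule cochain_eqI[of _ Y])
  fix p \<sigma> assume \<sigma>: "ssimplex p Y \<sigma>"
  show "coboundary Y (line_cocycle Y u) p \<sigma> = 0 p \<sigma>" proof (cases "p = 2")
   case True
   then have \<sigma>2: "ssimplex 2 Y \<sigma>" using \<sigma> by simp
   obtain v where "is_lift 2 (u \<circ> \<sigma>) v" using is_lift_exists[OF line_field_simplex[OF lf \<sigma>2]] by blast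
   from line_cocycle_face[OF lf \<sigma>2 this] show ?thesis using True by (simp add: coboundary_degree_2[OF \<sigma>2] add.assoc add.left_commute)
  next
   case False
   then have "p - 1 \<noteq> 1 \<or> p = 0" by auto
   then show ?thesis by (auto simp: coboundary_def line_cocycle_degree)
  qed
 qed auto
qed auto

lemma line_cocycle_pullback:
 assumes "continuous_map Z Y g"
 shows "pull Z g (line_cocycle Y u) = line_cocycle Z (\<lambda>z. u (g z))" proof (intro ext)
 fix p \<sigma>
 show "pull Z g (line_cocycle Y u) p \<sigma> = line_cocycle Z (\<lambda>z. u (g z)) p \<sigma>"
 proof (cases "p = 1 \<and> ssimplex 1 Z \<sigma>")
  case True
  then have "ssimplex 1 Y (simplex_map 1 g \<sigma>)" using assms singular_simplex_simplex_map by blast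
  moreover have "is_lift 1 (u \<circ> simplex_map 1 g \<sigma>) v \<longleftrightarrow> is_lift 1 ((\<lambda>z. u (g z)) \<circ> \<sigma>) v" for v
   by (rule is_lift_cong) (simp add: simplex_map_def)
  ultimately show ?thesis using True by (simp add: pull_eval line_cocycle_def simplex_map_vertex)
 next
  case False
  then show ?thesis by (auto simp: cochain_pullback_def line_cocycle_def)
 qed
qed

text \<open>Lines that are nowhere orthogonal are identified by projection. The bit f records the
  sign of the scalar product of the two chosen vectors; for continuous lifts that sign is constant
  along a path, so the two cocycles differ by the coboundary of f.\<close>

lemma line_cocycle_nonorthogonal:
 assumes lf: "line_field n Y u" and lf': "line_field n Y u'"
  and nz: "\<And>y. y \<in> topspace Y ==> dotn n (u y) (u' y) \<noteq> 0"
 shows "line_cocycle Y u + line_cocycle Y u' \<in> cobs Y" proof -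
 define f where "f = (\<lambda>y. if dotn n (u y) (u' y) < 0 then 1 else 0 :: bit)"
 have "line_cocycle Y u + line_cocycle Y u' = coboundary Y (point_cochain Y f)" proof (rule cochain_eqI[of _ Y])
  fix p \<sigma> assume \<sigma>: "ssimplex p Y \<sigma>"
  show "(line_cocycle Y u + line_cocycle Y u') p \<sigma> = coboundary Y (point_cochain Y f) p \<sigma>" proof (cases "p = 1")
   case True
   then have \<sigma>1: "ssimplex 1 Y \<sigma>" using \<sigma> by simp
   have top: "\<sigma> x \<in> topspace Y" if "x \<in> std_simplex 1" for x using \<sigma>1 that by (auto simp: singular_simplex_def continuous_map_def)
   note l = line_field_simplex[OF lf \<sigma>1] and l' = line_field_simplex[OF lf' \<sigma>1]
   obtain v v' where v: "is_lift 1 (u \<circ> \<sigma>) v" and v': "is_lift 1 (u' \<circ> \<sigma>) v'"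
    using is_lift_exists[OF l] is_lift_exists[OF l'] by metis
   have sg: "(\<forall>x\<in>std_simplex 1. dotn n (v x) (v' x) > 0) \<or> (\<forall>x\<in>std_simplex 1. dotn n (v x) (v' x) < 0)"
    using nz top by (intro is_lift_sign_constant[OF l l' v v']) auto
   have key: "sign_bit (v x) (u (\<sigma> x)) + sign_bit (v' x) (u' (\<sigma> x)) + f (\<sigma> x) = (if dotn n (v x) (v' x) < 0 then 1 else 0)"
    if x: "x \<in> std_simplex 1" for x proof -
    have 1: "v x = u (\<sigma> x) \<or> v x = (\<lambda>i. - u (\<sigma> x) i)" "v' x = u' (\<sigma> x) \<or> v' x = (\<lambda>i. - u' (\<sigma> x) i)"
     using v v' x by (auto simp: is_lift_def)
    have 2: "(\<lambda>i. - u (\<sigma> x) i) \<noteq> u (\<sigma> x)" "(\<lambda>i. - u' (\<sigma> x) i) \<noteq> u' (\<sigma> x)"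
     using nz[OF top[OF x]] minus_vector_neq[of n "u (\<sigma> x)" "u' (\<sigma> x)"]
      minus_vector_neq[of n "u' (\<sigma> x)" "u (\<sigma> x)"] by (simp_all add: dotn_commute)
    show ?thesis using 1 2 nz[OF top[OF x]] by (auto simp: sign_bit_def f_def)
   qed
   have in01: "vertex 0 \<in> std_simplex 1" "vertex 1 \<in> std_simplex 1" by auto
   have same: "dotn n (v (vertex 0)) (v' (vertex 0)) < 0 \<longleftrightarrow> dotn n (v (vertex 1)) (v' (vertex 1)) < 0" using sg in01 by (metis less_asym)
   have "sign_bit (v (vertex 0)) (u (\<sigma> (vertex 0))) + sign_bit (v' (vertex 0)) (u' (\<sigma> (vertex 0))) + f (\<sigma> (vertex 0)) =
    sign_bit (v (vertex 1)) (u (\<sigma> (vertex 1))) + sign_bit (v' (vertex 1)) (u' (\<sigma> (vertex 1))) + f (\<sigma> (vertex 1))"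
    by (simp only: key[OF in01(1)] key[OF in01(2)] same)
   then have "line_cocycle Y u 1 \<sigma> + line_cocycle Y u' 1 \<sigma> = f (\<sigma> (vertex 0)) + f (\<sigma> (vertex 1))"
    unfolding line_cocycle_lift[OF lf \<sigma>1 v] line_cocycle_lift[OF lf' \<sigma>1 v'] by (rule bit_exchange)
   then show ?thesis using True \<sigma>1 by (simp add: coboundary_point_cochain)
  next
   case False
   then show ?thesis by (simp add: coboundary_point_cochain line_cocycle_degree)
  qed
 qed auto
 then show ?thesis by auto
qed

text \<open>The chosen vectors are themselves lifts, so the cocycle is 0 and not merely
  exact.\<close>

lemma line_cocycle_section:
 assumes "\<And>i. cont_real Y (\<lambda>y. u y i)"
 shows "line_cocycle Y u = 0" proof (intro ext)
 fix p \<sigma>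
 have "is_lift 1 (u \<circ> \<sigma>) (u \<circ> \<sigma>)" if "ssimplex 1 Y \<sigma>"
  using that continuous_map_comp[OF _ assms, of "simplex_top 1" \<sigma>] by (simp add: is_lift_def singular_simplex_def)
 then show "line_cocycle Y u p \<sigma> = 0 p \<sigma>" unfolding line_cocycle_def by (auto simp: o_def)
qed

section \<open>Projective bundles\<close>

lemma continuous_map_locally:
 assumes "\<And>x. x \<in> topspace X ==> \<exists>U. openin X U \<and> x \<in> U \<and> continuous_map (subtopology X U) Y f"
 shows "continuous_map X Y f" proof -
 obtain U where U: "\<And>x. x \<in> topspace X ==> openin X (U x) \<and> x \<in> U x \<and> continuous_map (subtopology X (U x)) Y f"
  using assms by metis
 show ?thesis by (rule pasting_lemma[where I = "topspace X" and T = U and f = "\<lambda>_. f"]) (use U in auto)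
qed

definition line_of :: "(nat => real) => (nat => real) set"
 where "line_of v = {\<lambda>i. c * v i |c. True}"

lemma line_through_eq: "line_through (b, v) = (b, line_of v)" by (simp add: line_through_def line_of_def)

lemma line_of_scale:
 assumes "c \<noteq> 0"
 shows "line_of (\<lambda>i. c * v i) = line_of v" proof -
 have "(\<lambda>i. d * (c * v i)) \<in> line_of v" for d unfolding line_of_def by (rule CollectI, rule exI[of _ "d * c"]) (simp add: mult.assoc)
 moreover have "(\<lambda>i. d * v i) \<in> line_of (\<lambda>i. c * v i)" for d
  unfolding line_of_def by (rule CollectI, rule exI[of _ "d / c"]) (use assms in simp)
 ultimately show ?thesis by (auto simp: line_of_def[of v] line_of_def[of "\<lambda>i. c * v i"])
qed

lemma line_of_minus: "line_of (\<lambda>i. - v i) = line_of v" using line_of_scale[of "-1" v] by simp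

definition unit_of :: "nat => (nat => real) set => nat => real"
 where "unit_of n L = (SOME v. v \<in> L \<and> dotn n v v = 1)"

lemma unit_of_line_of:
 assumes "dotn n v v > 0"
 obtains c where "c \<noteq> 0" "unit_of n (line_of v) = (\<lambda>i. c * v i)" "c\<^sup>2 * dotn n v v = 1" proof -
 define c where "c = 1 / sqrt (dotn n v v)"
 have "c\<^sup>2 * dotn n v v = 1" using assms by (simp add: c_def power_divide)
 then have "(\<lambda>i. c * v i) \<in> line_of v \<and> dotn n (\<lambda>i. c * v i) (\<lambda>i. c * v i) = 1"
  by (auto simp: line_of_def power2_eq_square mult.assoc)
 then have "unit_of n (line_of v) \<in> line_of v \<and> dotn n (unit_of n (line_of v)) (unit_of n (line_of v)) = 1"
  unfolding unit_of_def by (rule someI[where P = "\<lambda>w. w \<in> line_of v \<and> dotn n w w = 1"])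
 then obtain d where d: "unit_of n (line_of v) = (\<lambda>i. d * v i)" "dotn n (\<lambda>i. d * v i) (\<lambda>i. d * v i) = 1" by (auto simp: line_of_def)
 then have "d\<^sup>2 * dotn n v v = 1" by (simp add: power2_eq_square mult.assoc)
 moreover from this have "d \<noteq> 0" by auto
 ultimately show thesis using that[of d] d(1) by blast
qed

lemma unit_of_line_of_unit:
 assumes "dotn n v v = 1"
 shows "unit_of n (line_of v) = v \<or> unit_of n (line_of v) = (\<lambda>i. - v i)" proof -
 obtain c where c: "unit_of n (line_of v) = (\<lambda>i. c * v i)" "c\<^sup>2 * dotn n v v = 1" using unit_of_line_of[of n v] assms by auto
 then have "c = 1 \<or> c = -1" using assms by (simp add: power2_eq_1_iff)
 then show ?thesis using c(1) by auto
qed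

definition lin_closed :: "(nat => real) set => bool"
 where "lin_closed W \<longleftrightarrow> (\<forall>v\<in>W. \<forall>w\<in>W. \<forall>a c. (\<lambda>i. a * v i + c * w i) \<in> W)"

lemma lin_closed_scale: "lin_closed W ==> v \<in> W ==> (\<lambda>i. c * v i) \<in> W"
 unfolding lin_closed_def by (drule bspec, assumption, drule bspec, assumption, drule spec[of _ c], drule spec[of _ 0]) simp

lemma lin_closed_minus: "lin_closed W ==> v \<in> W ==> (\<lambda>i. - v i) \<in> W" using lin_closed_scale[of W v "-1"] by simp

lemma continuous_map_Euclidean_space_eq:
 "continuous_map Z (Euclidean_space n) f \<longleftrightarrow>
  (\<forall>i. cont_real Z (\<lambda>z. f z i)) \<and> (\<forall>z\<in>topspace Z. \<forall>i\<ge>n. f z i = 0)"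
 unfolding Euclidean_space_def continuous_map_in_subtopology by (auto simp: continuous_map_componentwise_UNIV)

lemma topspace_nonzero_vectors:
 "topspace (nonzero_vectors n X V) =
  {(b, v). b \<in> topspace X \<and> (\<forall>i\<ge>n. v i = 0) \<and> v \<in> V b \<and> v \<noteq> (\<lambda>i. 0)}"
 by (auto simp: nonzero_vectors_def topspace_Euclidean_space)

lemma continuous_map_vector_bundle:
 "continuous_map Z (subtopology (prod_topology X (Euclidean_space n)) A) g \<longleftrightarrow>
  continuous_map Z X (\<lambda>z. fst (g z)) \<and> (\<forall>i. cont_real Z (\<lambda>z. snd (g z) i)) \<and>
  (\<forall>z\<in>topspace Z. g z \<in> A \<and> (\<forall>i\<ge>n. snd (g z) i = 0))"
 unfolding continuous_map_in_subtopology continuous_map_pairwise continuous_map_Euclidean_space_eq o_def by (auto simp: Pi_iff)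

lemma continuous_map_nonzero_vectors:
 "continuous_map Z (nonzero_vectors n X V) g \<longleftrightarrow> continuous_map Z X (\<lambda>z. fst (g z)) \<and>
  (\<forall>i. cont_real Z (\<lambda>z. snd (g z) i)) \<and>
  (\<forall>z\<in>topspace Z. snd (g z) \<in> V (fst (g z)) \<and> snd (g z) \<noteq> (\<lambda>i. 0) \<and> (\<forall>i\<ge>n. snd (g z) i = 0))"
 unfolding nonzero_vectors_def continuous_map_vector_bundle by (simp add: case_prod_unfold)

lemma nonzero_vectors_coordinates:
 "continuous_map (nonzero_vectors n X V) X fst"
 "cont_real (nonzero_vectors n X V) (\<lambda>z. snd z i)"
 using continuous_map_nonzero_vectors[of "nonzero_vectors n X V" n X V "\<lambda>z. z"] by simp_all

lemma nonzero_vectors_dotn: "(b, v) \<in> topspace (nonzero_vectors n X V) ==> dotn n v v > 0"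
 by (auto simp: topspace_nonzero_vectors intro: dotn_pos)

lemma quotient_map_line_through: "quotient_map (nonzero_vectors n X V) (pbundle n X V) line_through"
 unfolding projective_bundle_def by (rule quotient_map_quotient_topology)

lemma continuous_line_through: "continuous_map (nonzero_vectors n X V) (pbundle n X V) line_through"
 using quotient_map_line_through quotient_imp_continuous_map by blast

lemma topspace_pbundle:
 "topspace (pbundle n X V) = line_through ` topspace (nonzero_vectors n X V)" by (simp add: projective_bundle_def)

lemma pbundleE:
 assumes "p \<in> topspace (pbundle n X V)"
 obtains b v where "p = (b, line_of v)" "b \<in> topspace X" "v \<in> V b" "v \<noteq> (\<lambda>i. 0)" "\<forall>i\<ge>n. v i = 0" proof -
 obtain b v where "p = line_through (b, v)" "(b, v) \<in> topspace (nonzero_vectors n X V)" using assms unfolding topspace_pbundle by auto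
 then show thesis using that[of b v] by (simp add: topspace_nonzero_vectors line_through_eq)
qed

lemma continuous_pbundle_fst: "continuous_map (pbundle n X V) X fst" proof -
 have "continuous_map (nonzero_vectors n X V) X (fst \<circ> line_through)"
  using nonzero_vectors_coordinates(1) by (simp add: o_def line_through_def case_prod_unfold)
 then show ?thesis using continuous_compose_quotient_map_eq[OF quotient_map_line_through] by blast
qed

abbreviation fibre_unit :: "nat => 'b \<times> (nat => real) set => nat => real"
 where "fibre_unit n p \<equiv> unit_of n (snd p)"

lemma fibre_unit_props:
 assumes "p \<in> topspace (pbundle n X V)" "\<And>b. b \<in> topspace X ==> lin_closed (V b)"
 shows "dotn n (fibre_unit n p) (fibre_unit n p) = 1" "\<And>i. i \<ge> n ==> fibre_unit n p i = 0"
  "fibre_unit n p \<in> V (fst p)" "line_of (fibre_unit n p) = snd p" proof -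
 obtain b v where p: "p = (b, line_of v)" "b \<in> topspace X" "v \<in> V b" "v \<noteq> (\<lambda>i. 0)" "\<forall>i\<ge>n. v i = 0"
  using assms(1) by (rule pbundleE)
 then have "dotn n v v > 0" by (intro dotn_pos) auto
 then obtain c where c: "c \<noteq> 0" "unit_of n (line_of v) = (\<lambda>i. c * v i)" "c\<^sup>2 * dotn n v v = 1" by (rule unit_of_line_of)
 show "dotn n (fibre_unit n p) (fibre_unit n p) = 1" using p c by (simp add: power2_eq_square mult.assoc)
 show "\<And>i. i \<ge> n ==> fibre_unit n p i = 0" using p c by simp
 show "fibre_unit n p \<in> V (fst p)" using p c assms(2) by (simp add: lin_closed_scale)
 show "line_of (fibre_unit n p) = snd p" using p c by (simp add: line_of_scale)
qed

text \<open>The projection matrix of a line does not depend on the vector spanning it. The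
  right-hand side is continuous on nonzero vectors, so the left-hand side is continuous on the
  quotient.\<close>

lemma fibre_unit_product:
 assumes "dotn n v v > 0"
 shows "unit_of n (line_of v) i * unit_of n (line_of v) j = v i * v j / dotn n v v" proof -
 obtain c where c: "unit_of n (line_of v) = (\<lambda>i. c * v i)" "c\<^sup>2 * dotn n v v = 1" using unit_of_line_of[OF assms] by blast
 then have "c * c = 1 / dotn n v v" using assms by (simp add: power2_eq_square field_simps)
 then have "(c * c) * (v i * v j) = v i * v j / dotn n v v" by simp
 then show ?thesis using c(1) by (simp add: algebra_simps)
qed

lemma line_field_pbundle:
 assumes lin: "\<And>b. b \<in> topspace X ==> lin_closed (V b)"
 shows "line_field n (pbundle n X V) (fibre_unit n)" unfolding line_field_def proof (intro conjI allI ballI impI)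
 fix i j
 let ?E = "nonzero_vectors n X V"
 have "cont_real ?E (\<lambda>z. snd z i * snd z j / dotn n (snd z) (snd z))" using nonzero_vectors_dotn[of _ _ n X V] unfolding dotn_def
  by (intro continuous_map_real_divide continuous_map_real_mult continuous_map_sum nonzero_vectors_coordinates)
   (force simp: dotn_def)+
 then have "cont_real ?E ((\<lambda>p. fibre_unit n p i * fibre_unit n p j) \<circ> line_through)"
  by (rule continuous_map_eq) (auto simp: line_through_eq fibre_unit_product nonzero_vectors_dotn)
 then show "cont_real (pbundle n X V) (\<lambda>p. fibre_unit n p i * fibre_unit n p j)"
  using continuous_compose_quotient_map_eq[OF quotient_map_line_through] by blast
qed (simp_all add: fibre_unit_props[OF _ lin])

text \<open>The vectors u y need not be continuous in y, but near a point y0 with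
  \<open>u y0 j\<close> nonzero their multiples with coordinates \<open>u y i * u y j\<close> are,
  and these span the same lines.\<close>

lemma continuous_map_pbundle:
 assumes b: "continuous_map Y X b" and u: "line_field n Y u"
  and uV: "\<And>y. y \<in> topspace Y ==> u y \<in> V (b y)" and lin: "\<And>b. b \<in> topspace X ==> lin_closed (V b)"
 shows "continuous_map Y (pbundle n X V) (\<lambda>y. (b y, line_of (u y)))" proof (rule continuous_map_locally)
 fix y0 assume y0: "y0 \<in> topspace Y"
 have unit: "\<And>y. y \<in> topspace Y ==> dotn n (u y) (u y) = 1" and supp: "\<And>y i. y \<in> topspace Y ==> i \<ge> n ==> u y i = 0"
  and cont: "\<And>i j. cont_real Y (\<lambda>y. u y i * u y j)" using u by (auto simp: line_field_def)
 obtain j where j: "u y0 j \<noteq> 0" using unit[OF y0] by (force simp: dotn_def)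
 define U where "U = {y \<in> topspace Y. u y j * u y j \<in> - {0}}"
 have "openin Y U" unfolding U_def by (rule openin_continuous_map_preimage[OF cont]) auto
 moreover have "y0 \<in> U" using y0 j by (simp add: U_def)
 moreover have "continuous_map (subtopology Y U) (pbundle n X V) (\<lambda>y. (b y, line_of (u y)))" proof -
  have "(\<lambda>i. u y i * u y j) \<noteq> (\<lambda>i. 0)" if "y \<in> U" for y
   using that by (metis (mono_tags, lifting) ComplD U_def mem_Collect_eq singletonI)
  moreover have "(\<lambda>i. u y i * u y j) \<in> V (b y)" if "y \<in> topspace Y" for y
   using lin_closed_scale[OF lin uV[OF that], of "u y j"] continuous_map_mem[OF b that] by (simp add: mult.commute)
  ultimately have "continuous_map (subtopology Y U) (nonzero_vectors n X V) (\<lambda>y. (b y, (\<lambda>i. u y i * u y j)))"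
   unfolding continuous_map_nonzero_vectors using b cont supp by (auto intro: continuous_map_from_subtopology)
  then have "continuous_map (subtopology Y U) (pbundle n X V) (\<lambda>y. line_through (b y, (\<lambda>i. u y i * u y j)))"
   using continuous_line_through by (rule continuous_map_comp)
  then show ?thesis proof (rule continuous_map_eq)
   fix y assume "y \<in> topspace (subtopology Y U)"
   then have "u y j \<noteq> 0" by (simp add: U_def)
   then show "line_through (b y, (\<lambda>i. u y i * u y j)) = (b y, line_of (u y))"
    using line_of_scale[of "u y j" "u y"] by (simp add: line_through_eq mult.commute)
  qed
 qed
 ultimately show "\<exists>U. openin Y U \<and> y0 \<in> U \<and> continuous_map (subtopology Y U) (pbundle n X V) (\<lambda>y. (b y, line_of (u y)))"
  by blast
qed

lemma quotient_map_unique: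
 assumes "quotient_map X Y f" "quotient_map X Y' f"
 shows "Y = Y'" proof -
 have *: "openin Z U \<longleftrightarrow> U \<subseteq> f ` topspace X \<and> openin X {x \<in> topspace X. f x \<in> U}" if "quotient_map X Z f" for Z U
  using that openin_subset[of Z U] unfolding quotient_map_def by blast
 show ?thesis unfolding topology_eq using * [OF assms(1)] * [OF assms(2)] by simp
qed

text \<open>The part over an open U is a saturated open set, and quotient maps restrict to such
  sets; both sides are then quotients of the same space by the same map.\<close>

lemma pbundle_subtopology:
 assumes "openin X U"
 shows "subtopology (pbundle n X V) {p \<in> topspace (pbundle n X V). fst p \<in> U} =
  pbundle n (subtopology X U) V" proof -
 let ?E = "nonzero_vectors n X V" and ?P = "pbundle n X V"
 let ?W = "{p \<in> topspace ?P. fst p \<in> U}"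
 have op: "openin ?P ?W" using openin_continuous_map_preimage[OF continuous_pbundle_fst assms] .
 have "quotient_map (subtopology ?E {z \<in> topspace ?E. line_through z \<in> ?W}) (subtopology ?P ?W) line_through"
  using quotient_map_line_through[of n X V] op by (intro quotient_map_restriction) auto
 moreover have "subtopology ?E {z \<in> topspace ?E. line_through z \<in> ?W} = nonzero_vectors n (subtopology X U) V" proof -
  have "{z \<in> topspace ?E. line_through z \<in> ?W} = topspace ?E \<inter> (U \<times> UNIV)"
   unfolding topspace_pbundle by (auto simp: line_through_eq)
  then have "subtopology ?E {z \<in> topspace ?E. line_through z \<in> ?W} = subtopology ?E (U \<times> UNIV)" by (simp add: subtopology_restrict)
  also have "\<dots> = nonzero_vectors n (subtopology X U) V" proof -
   let ?PT = "prod_topology X (Euclidean_space n)" and ?A = "{(b, v). v \<in> V b \<and> v \<noteq> (\<lambda>i. 0)}"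
   have "subtopology ?PT (?A \<inter> (U \<times> UNIV)) = subtopology ?PT (topspace ?PT \<inter> (?A \<inter> (U \<times> UNIV)))"
    by (simp only: subtopology_restrict)
   also have "topspace ?PT \<inter> (?A \<inter> (U \<times> UNIV)) = topspace ?PT \<inter> ((U \<times> topspace (Euclidean_space n)) \<inter> ?A)" by auto
   finally show ?thesis unfolding nonzero_vectors_def prod_topology_subtopology by (simp only: subtopology_subtopology subtopology_restrict)
  qed
  finally show ?thesis .
 qed
 ultimately have q: "quotient_map (nonzero_vectors n (subtopology X U) V) (subtopology ?P ?W) line_through" by simp
 show ?thesis using q quotient_map_line_through by (rule quotient_map_unique)
qed

section \<open>Double coverings\<close>

text \<open>Covering theory enters only through the two lifts of every simplex. The label \<epsilon>
  tells the two points of a fibre apart without any continuity, like a discontinuous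
  section.\<close>

locale double_covering =
 fixes S :: "'s topology" and P :: "'p topology" and q :: "'s => 'p" and \<epsilon> :: "'s => bit"
 assumes cont: "continuous_map S P q"
  and lifting: "ssimplex p P \<sigma> ==> \<exists>\<tau>1 \<tau>2.
   {\<tau>. ssimplex p S \<tau> \<and> simplex_map p q \<tau> = \<sigma>} = {\<tau>1, \<tau>2} \<and>
   (\<forall>i\<le>p. \<epsilon> (\<tau>1 (vertex i)) + \<epsilon> (\<tau>2 (vertex i)) = 1)"
begin

definition lifts :: "nat => ((nat => real) => 'p) => ((nat => real) => 's) set"
 where "lifts p \<sigma> = {\<tau>. ssimplex p S \<tau> \<and> simplex_map p q \<tau> = \<sigma>}"

lemma lifts_pair:
 assumes "ssimplex p P \<sigma>"
 obtains \<tau>1 \<tau>2 where "lifts p \<sigma> = {\<tau>1, \<tau>2}" "\<tau>1 \<noteq> \<tau>2"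
  "\<forall>i\<le>p. \<epsilon> (\<tau>1 (vertex i)) + \<epsilon> (\<tau>2 (vertex i)) = 1"
  "\<forall>i\<le>p. \<tau>1 (vertex i) \<noteq> \<tau>2 (vertex i)"
  "ssimplex p S \<tau>1" "ssimplex p S \<tau>2" "simplex_map p q \<tau>1 = \<sigma>" "simplex_map p q \<tau>2 = \<sigma>" proof -
 obtain \<tau>1 \<tau>2 where t: "lifts p \<sigma> = {\<tau>1, \<tau>2}" "\<forall>i\<le>p. \<epsilon> (\<tau>1 (vertex i)) + \<epsilon> (\<tau>2 (vertex i)) = 1"
  using lifting[OF assms, folded lifts_def] by blast
 have "\<tau>1 \<in> lifts p \<sigma>" "\<tau>2 \<in> lifts p \<sigma>" using t(1) by auto
 moreover have ne: "\<tau>1 (vertex i) \<noteq> \<tau>2 (vertex i)" if "i \<le> p" for i proof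
  assume "\<tau>1 (vertex i) = \<tau>2 (vertex i)"
  then show False using t(2) that by auto
 qed
 moreover have "\<tau>1 \<noteq> \<tau>2" using ne[of 0] by auto
 ultimately show thesis using that[OF t(1) _ t(2)] by (simp add: lifts_def)
qed

lemma lifts_eq:
 assumes "ssimplex p P \<sigma>" "ssimplex p S \<alpha>" "ssimplex p S \<beta>"
  "simplex_map p q \<alpha> = \<sigma>" "simplex_map p q \<beta> = \<sigma>" "\<alpha> \<noteq> \<beta>"
 shows "lifts p \<sigma> = {\<alpha>, \<beta>}" proof -
 obtain \<tau>1 \<tau>2 where t: "lifts p \<sigma> = {\<tau>1, \<tau>2}" "\<tau>1 \<noteq> \<tau>2"
    "\<forall>i\<le>p. \<epsilon> (\<tau>1 (vertex i)) + \<epsilon> (\<tau>2 (vertex i)) = 1"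
    "\<forall>i\<le>p. \<tau>1 (vertex i) \<noteq> \<tau>2 (vertex i)"
    "ssimplex p S \<tau>1" "ssimplex p S \<tau>2" "simplex_map p q \<tau>1 = \<sigma>" "simplex_map p q \<tau>2 = \<sigma>"
   by (rule lifts_pair[OF assms(1)])
 moreover have "\<alpha> \<in> lifts p \<sigma>" "\<beta> \<in> lifts p \<sigma>" using assms by (auto simp: lifts_def)
 ultimately show ?thesis using assms(6) by auto
qed

definition transfer :: "'s cochain => 'p cochain"
 where "transfer u = (\<lambda>p \<sigma>. if ssimplex p P \<sigma> then \<Sum>\<tau>\<in>lifts p \<sigma>. u p \<tau> else 0)"

lemma transfer_eval:
 assumes "ssimplex p P \<sigma>" "lifts p \<sigma> = {\<alpha>, \<beta>}" "\<alpha> \<noteq> \<beta>"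
 shows "transfer u p \<sigma> = u p \<alpha> + u p \<beta>" using assms by (simp add: transfer_def)

lemma transfer_cochains [intro]:
 assumes "u \<in> cochains S"
 shows "transfer u \<in> cochains P" proof -
 obtain d where "\<And>p \<sigma>. p > d ==> u p \<sigma> = 0" using assms cochains_bound by blast
 then show ?thesis by (intro cochainsI[where d = d]) (auto simp: transfer_def)
qed

lemma transfer_add: "transfer (u + v) = transfer u + transfer v" by (intro ext) (simp add: transfer_def sum.distrib)

lemma transfer_0 [simp]: "transfer 0 = 0" by (intro ext) (simp add: transfer_def)

text \<open>Both lifts of a face or a subsimplex are the faces of the two lifts.\<close>

lemma lifts_sub:
 assumes \<sigma>: "ssimplex p P \<sigma>"
  and t: "ssimplex p S \<tau>1" "ssimplex p S \<tau>2" "simplex_map p q \<tau>1 = \<sigma>" "simplex_map p q \<tau>2 = \<sigma>"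
   "\<forall>i\<le>p. \<tau>1 (vertex i) \<noteq> \<tau>2 (vertex i)"
  and F: "\<And>\<tau>. ssimplex p S \<tau> ==> ssimplex r S (F \<tau>)" "ssimplex r P (G \<sigma>)"
   "\<And>\<tau>. simplex_map r q (F \<tau>) = G (simplex_map p q \<tau>)" "\<And>\<tau>. F \<tau> (vertex 0) = \<tau> (vertex i)" "i \<le> p"
 shows "transfer u r (G \<sigma>) = u r (F \<tau>1) + u r (F \<tau>2)" proof -
 have ne: "F \<tau>1 \<noteq> F \<tau>2" using t(5) F(5) F(4)[of \<tau>1] F(4)[of \<tau>2] by auto
 have "lifts r (G \<sigma>) = {F \<tau>1, F \<tau>2}" using F t by (intro lifts_eq ne) auto
 then show ?thesis using transfer_eval[OF F(2) _ ne] by blast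
qed

lemma coboundary_transfer_eq: "coboundary P (transfer u) = transfer (coboundary S u)" proof (intro ext)
 fix p \<sigma>
 show "coboundary P (transfer u) p \<sigma> = transfer (coboundary S u) p \<sigma>" proof (cases "ssimplex p P \<sigma>")
  case \<sigma>: True
  show ?thesis proof (cases p)
   case (Suc m)
   obtain \<tau>1 \<tau>2 where t: "lifts p \<sigma> = {\<tau>1, \<tau>2}" "\<tau>1 \<noteq> \<tau>2"
    "\<forall>i\<le>p. \<epsilon> (\<tau>1 (vertex i)) + \<epsilon> (\<tau>2 (vertex i)) = 1"
    "\<forall>i\<le>p. \<tau>1 (vertex i) \<noteq> \<tau>2 (vertex i)"
    "ssimplex p S \<tau>1" "ssimplex p S \<tau>2" "simplex_map p q \<tau>1 = \<sigma>" "simplex_map p q \<tau>2 = \<sigma>"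
   by (rule lifts_pair[OF \<sigma>])
   have "transfer u m (singular_face (Suc m) k \<sigma>) =
     u m (singular_face (Suc m) k \<tau>1) + u m (singular_face (Suc m) k \<tau>2)" if "k \<le> Suc m" for k using that \<sigma> t(4-8) Suc
    by (intro lifts_sub[where p = p and i = "if 0 < k then 0 else 1"])
     (auto simp: ssimplex_face simplex_map_singular_face singular_face_vertex)
   then show ?thesis using \<sigma> t Suc transfer_eval[OF \<sigma> t(1,2), of "coboundary S u"]
    by (simp add: coboundary_Suc sum.distrib del: sum.atMost_Suc)
  qed (simp add: transfer_def)
 qed (simp add: coboundary_off transfer_def)
qed

lemma transfer_cocycles [intro]: "u \<in> cocycles S ==> transfer u \<in> cocycles P" by (auto simp: cocycles_def coboundary_transfer_eq)

lemma transfer_cobs [intro]: "u \<in> cobs S ==> transfer u \<in> cobs P"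
 by (auto simp: coboundaries_def simp flip: coboundary_transfer_eq)

lemma transfer_pullback [simp]: "transfer (pull S q \<phi>) = 0" proof (intro ext)
 fix p \<sigma>
 show "transfer (pull S q \<phi>) p \<sigma> = 0 p \<sigma>" proof (cases "ssimplex p P \<sigma>")
  case \<sigma>: True
  obtain \<tau>1 \<tau>2 where t: "lifts p \<sigma> = {\<tau>1, \<tau>2}" "\<tau>1 \<noteq> \<tau>2"
    "\<forall>i\<le>p. \<epsilon> (\<tau>1 (vertex i)) + \<epsilon> (\<tau>2 (vertex i)) = 1"
    "\<forall>i\<le>p. \<tau>1 (vertex i) \<noteq> \<tau>2 (vertex i)"
    "ssimplex p S \<tau>1" "ssimplex p S \<tau>2" "simplex_map p q \<tau>1 = \<sigma>" "simplex_map p q \<tau>2 = \<sigma>"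
   by (rule lifts_pair[OF \<sigma>])
  then show ?thesis using transfer_eval[OF \<sigma> t(1,2), of "pull S q \<phi>"] t by (simp add: pull_eval)
 qed (simp add: transfer_def)
qed

lemma transfer_cup: "transfer (cup S (pull S q \<phi>) u) = cup P \<phi> (transfer u)" proof (intro ext)
 fix n \<sigma>
 show "transfer (cup S (pull S q \<phi>) u) n \<sigma> = cup P \<phi> (transfer u) n \<sigma>" proof (cases "ssimplex n P \<sigma>")
  case \<sigma>: True
  obtain \<tau>1 \<tau>2 where t: "lifts n \<sigma> = {\<tau>1, \<tau>2}" "\<tau>1 \<noteq> \<tau>2"
    "\<forall>i\<le>n. \<epsilon> (\<tau>1 (vertex i)) + \<epsilon> (\<tau>2 (vertex i)) = 1"
    "\<forall>i\<le>n. \<tau>1 (vertex i) \<noteq> \<tau>2 (vertex i)"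
    "ssimplex n S \<tau>1" "ssimplex n S \<tau>2" "simplex_map n q \<tau>1 = \<sigma>" "simplex_map n q \<tau>2 = \<sigma>"
   by (rule lifts_pair[OF \<sigma>])
  have *: "pull S q \<phi> p (front_face p \<tau>) = \<phi> p (front_face p \<sigma>)"
   if "p \<le> n" "\<tau> \<in> {\<tau>1, \<tau>2}" for p \<tau> using that t(5-8) simplex_map_front_face[of p n q \<tau>]
   by (auto simp: pull_eval ssimplex_front_face)
  have **: "transfer u (n - p) (back_face p (n - p) \<sigma>) =
    u (n - p) (back_face p (n - p) \<tau>1) + u (n - p) (back_face p (n - p) \<tau>2)" if "p \<le> n" for p
  proof (rule lifts_sub[where p = n and i = p, OF \<sigma> t(5-8) t(4)])
   show "ssimplex (n - p) S (back_face p (n - p) \<tau>)" if "ssimplex n S \<tau>" for \<tau>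
    using that \<open>p \<le> n\<close> by (auto intro!: ssimplex_back_face)
   show "ssimplex (n - p) P (back_face p (n - p) \<sigma>)" using \<sigma> \<open>p \<le> n\<close> by (auto intro!: ssimplex_back_face)
   show "simplex_map (n - p) q (back_face p (n - p) \<tau>) = back_face p (n - p) (simplex_map n q \<tau>)" for \<tau>
    using simplex_map_back_face[of "n - p" q p \<tau>] \<open>p \<le> n\<close> by simp
   have "shift_point p (vertex 0) = vertex p" by (rule ext) (auto simp: shift_point_def)
   then show "back_face p (n - p) \<tau> (vertex 0) = \<tau> (vertex p)" for \<tau> by (simp add: back_face_eq)
  qed (use that in auto)
  show ?thesis using transfer_eval[OF \<sigma> t(1,2), of "cup S (pull S q \<phi>) u"] t(5,6) \<sigma> * **
   by (simp add: cup_eval distrib_left sum.distrib)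
 qed (simp add: transfer_def cup_off)
qed

lemma pullback_eq_0:
 assumes "\<phi> \<in> cochains P" "pull S q \<phi> = 0"
 shows "\<phi> = 0" proof (rule cochain_eqI[OF assms(1)])
 fix p \<sigma> assume \<sigma>: "ssimplex p P \<sigma>"
 obtain \<tau> where "ssimplex p S \<tau>" "simplex_map p q \<tau> = \<sigma>" using lifts_pair[OF \<sigma>] by blast
 then show "\<phi> p \<sigma> = 0 p \<sigma>" using fun_cong[OF fun_cong[OF assms(2)], of p \<tau>] by (simp add: pull_eval)
qed auto

text \<open>Exactness in the middle of 0 -> C(P) -> C(S) -> C(P) -> 0, the sequence mod 2 behind the
  Gysin sequence: a cochain with transfer 0 takes the same value on both lifts and therefore
  descends.\<close>

lemma transfer_eq_0:
 assumes u: "u \<in> cochains S" "transfer u = 0"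
 obtains \<phi> where "\<phi> \<in> cochains P" "u = pull S q \<phi>" proof -
 define \<phi> where "\<phi> = (\<lambda>p \<sigma>. if ssimplex p P \<sigma> then u p (SOME \<tau>. \<tau> \<in> lifts p \<sigma>) else 0)"
 obtain d where "\<And>p \<sigma>. p > d ==> u p \<sigma> = 0" using u cochains_bound by blast
 then have "\<phi> \<in> cochains P" by (intro cochainsI[where d = d]) (auto simp: \<phi>_def)
 moreover have "u = pull S q \<phi>" proof (rule cochain_eqI[OF u(1)])
  fix p \<tau> assume \<tau>: "ssimplex p S \<tau>"
  define \<sigma> where "\<sigma> = simplex_map p q \<tau>"
  have \<sigma>: "ssimplex p P \<sigma>" unfolding \<sigma>_def using \<tau> cont by (rule singular_simplex_simplex_map)
  obtain \<tau>1 \<tau>2 where t: "lifts p \<sigma> = {\<tau>1, \<tau>2}" "\<tau>1 \<noteq> \<tau>2"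
    "\<forall>i\<le>p. \<epsilon> (\<tau>1 (vertex i)) + \<epsilon> (\<tau>2 (vertex i)) = 1"
    "\<forall>i\<le>p. \<tau>1 (vertex i) \<noteq> \<tau>2 (vertex i)"
    "ssimplex p S \<tau>1" "ssimplex p S \<tau>2" "simplex_map p q \<tau>1 = \<sigma>" "simplex_map p q \<tau>2 = \<sigma>"
   by (rule lifts_pair[OF \<sigma>])
  then have "u p \<tau>1 + u p \<tau>2 = 0" using transfer_eval[OF \<sigma> t(1,2), of u] u(2) by simp
  then have "u p \<tau>1 = u p \<tau>2" by (metis add.right_neutral bit_cancel_left)
  moreover have "\<tau> \<in> lifts p \<sigma>" using \<tau> by (simp add: lifts_def \<sigma>_def)
  moreover from this have "(SOME \<tau>. \<tau> \<in> lifts p \<sigma>) \<in> lifts p \<sigma>"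
   by (rule someI[where P = "\<lambda>\<tau>. \<tau> \<in> lifts p \<sigma>"])
  ultimately have "u p \<tau> = \<phi> p \<sigma>" using t \<sigma> by (auto simp: \<phi>_def)
  then show "u p \<tau> = pull S q \<phi> p \<tau>" using \<tau> by (simp add: pull_eval \<sigma>_def)
 qed (use \<open>\<phi> \<in> cochains P\<close> in auto)
 ultimately show thesis using that by blast
qed

lemma transfer_label: "transfer (point_cochain S \<epsilon>) = unit_cochain P" proof (intro ext)
 fix p \<sigma>
 show "transfer (point_cochain S \<epsilon>) p \<sigma> = unit_cochain P p \<sigma>" proof (cases "ssimplex p P \<sigma> \<and> p = 0")
  case True
  then have \<sigma>: "ssimplex 0 P \<sigma>" by auto
  obtain \<tau>1 \<tau>2 where t: "lifts 0 \<sigma> = {\<tau>1, \<tau>2}" "\<tau>1 \<noteq> \<tau>2"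
    "\<forall>i\<le>0. \<epsilon> (\<tau>1 (vertex i)) + \<epsilon> (\<tau>2 (vertex i)) = 1"
    "\<forall>i\<le>0. \<tau>1 (vertex i) \<noteq> \<tau>2 (vertex i)"
    "ssimplex 0 S \<tau>1" "ssimplex 0 S \<tau>2" "simplex_map 0 q \<tau>1 = \<sigma>" "simplex_map 0 q \<tau>2 = \<sigma>"
   by (rule lifts_pair[OF \<sigma>])
  then show ?thesis
   using True \<sigma> transfer_eval[OF \<sigma> t(1,2), of "point_cochain S \<epsilon>"] t by (simp add: point_cochain_def unit_cochain_def)
 next
  case False
  then show ?thesis by (auto simp: transfer_def unit_cochain_def point_cochain_def)
 qed
qed

text \<open>The label cochain has transfer 1 and its coboundary descends to w, so w represents the
  image of 1 under the connecting map, that is, the class of the covering. Multiplication by the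
  label splits the transfer.\<close>

context
 fixes w
 assumes w: "w \<in> cocycles P" "pull S q w = coboundary S (point_cochain S \<epsilon>)"
begin

lemma coboundary_label:
 assumes "v \<in> cocycles P"
 shows "coboundary S (cup S (pull S q v) (point_cochain S \<epsilon>)) = pull S q (cup P v w)"
 using assms pull_coboundary[OF cont, of v, symmetric] by (simp add: coboundary_cup pull_cup[OF cont] w(2) cocyclesD)

lemma transfer_cup_label:
 assumes "v \<in> cochains P"
 shows "transfer (cup S (pull S q v) (point_cochain S \<epsilon>)) = v" using assms by (simp add: transfer_cup transfer_label cup_unit_right)

text \<open>The class v is the transfer of a primitive u of the pullback of y. Adding to u the
  standard cochain with the same transfer, built from v and the label, gives a cochain that comes
  from P; its coboundary there relates y to the product of v and w.\<close>

theorem gysin_pullback_kernel: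
 assumes y: "y \<in> cocycles P" "pull S q y \<in> cobs S"
 obtains v where "v \<in> cocycles P" "y + cup P v w \<in> cobs P" proof -
 obtain u where u: "u \<in> cochains S" "pull S q y = coboundary S u" using y(2) by (rule cobsE)
 define v where "v = transfer u"
 have "coboundary P v = transfer (pull S q y)" by (simp add: v_def coboundary_transfer_eq u(2))
 then have v: "v \<in> cocycles P" using u(1) by (simp add: cocycles_def v_def transfer_cochains)
 let ?c = "cup S (pull S q v) (point_cochain S \<epsilon>)"
 have c: "?c \<in> cochains S" by (intro cup_cochains pull_cochains[of v P] point_cochain_cochains cocyclesD v)
 have "transfer (u + ?c) = 0" using v by (simp add: transfer_add transfer_cup_label cocyclesD) (simp add: v_def)
 then obtain b where b: "b \<in> cochains P" "u + ?c = pull S q b" using transfer_eq_0 u(1) c by blast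
 have "pull S q (y + cup P v w + coboundary P b) =
   coboundary S u + coboundary S ?c + coboundary S (u + ?c)"
  by (simp add: pull_add u(2) coboundary_label[OF v] b(2) pull_coboundary[OF cont])
 then have "pull S q (y + cup P v w + coboundary P b) = 0" by (simp add: coboundary_add)
 moreover have "y + cup P v w + coboundary P b \<in> cochains P" using y(1) v w(1) b(1) by (simp add: cochains_add cup_cochains coboundary_cochains cocyclesD)
 ultimately have "y + cup P v w + coboundary P b = 0" using pullback_eq_0 by blast
 then have "y + cup P v w = coboundary P b" by (simp add: cochain_add_eq_0_iff)
 then show thesis using that[OF v] b(1) by auto
qed

text \<open>If the product of v and w is the coboundary of b, then the pullback of b corrects the
  standard cochain with transfer v to a cocycle.\<close>

theorem gysin_cup_kernel:
 assumes v: "v \<in> cocycles P" "cup P v w \<in> cobs P"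
 obtains u where "u \<in> cocycles S" "transfer u = v" proof -
 obtain b where b: "b \<in> cochains P" "cup P v w = coboundary P b" using v(2) by (rule cobsE)
 let ?c = "cup S (pull S q v) (point_cochain S \<epsilon>)"
 define u where "u = ?c + pull S q b"
 have "u \<in> cochains S" unfolding u_def by (intro cochains_add cup_cochains pull_cochains[of _ P] point_cochain_cochains cocyclesD v b)
 moreover have "coboundary S u = 0" by (simp add: u_def coboundary_add coboundary_label[OF v(1)] b(2) pull_coboundary[OF cont])
 moreover have "transfer u = v" using v(1) by (simp add: u_def transfer_add transfer_cup_label cocyclesD)
 ultimately show thesis using that by (simp add: cocycles_def)
qed

end

end

text \<open>Injectivity of g on the fibres ensures that the two lifts of a simplex go to the two
  different lifts of its image.\<close>

lemma transfer_natural: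
 assumes "double_covering S P q \<epsilon>" "double_covering S' P' q' \<epsilon>'"
  and g: "continuous_map S S' g" and f: "continuous_map P P' f"
  and comm: "\<And>s. s \<in> topspace S ==> q' (g s) = f (q s)"
  and inj: "\<And>s t. s \<in> topspace S ==> t \<in> topspace S ==> q s = q t ==> g s = g t ==> s = t"
 shows "pull P f (double_covering.transfer S' P' q' u) =
  double_covering.transfer S P q (pull S g u)" proof -
 interpret A: double_covering S P q \<epsilon> by fact
 interpret B: double_covering S' P' q' \<epsilon>' by fact
 show ?thesis proof (intro ext)
  fix p \<sigma>
  show "pull P f (B.transfer u) p \<sigma> = A.transfer (pull S g u) p \<sigma>" proof (cases "ssimplex p P \<sigma>")
   case \<sigma>: True
   obtain \<tau>1 \<tau>2 where t: "A.lifts p \<sigma> = {\<tau>1, \<tau>2}" "\<tau>1 \<noteq> \<tau>2"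
    "\<forall>i\<le>p. \<epsilon> (\<tau>1 (vertex i)) + \<epsilon> (\<tau>2 (vertex i)) = 1"
    "\<forall>i\<le>p. \<tau>1 (vertex i) \<noteq> \<tau>2 (vertex i)"
    "ssimplex p S \<tau>1" "ssimplex p S \<tau>2" "simplex_map p q \<tau>1 = \<sigma>" "simplex_map p q \<tau>2 = \<sigma>"
   by (rule A.lifts_pair[OF \<sigma>])
   have v0: "vertex 0 \<in> std_simplex p" by simp
   have top: "\<tau>1 x \<in> topspace S" "\<tau>2 x \<in> topspace S" if "x \<in> std_simplex p" for x
    using t(5,6) that by (auto simp: singular_simplex_def continuous_map_def)
   have "q (\<tau>1 (vertex 0)) = q (\<tau>2 (vertex 0))" using simplex_map_vertex[of 0 p q \<tau>1] simplex_map_vertex[of 0 p q \<tau>2] t(7,8) by simp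
   moreover have "\<tau>1 (vertex 0) \<noteq> \<tau>2 (vertex 0)" using t(4) by blast
   ultimately have "g (\<tau>1 (vertex 0)) \<noteq> g (\<tau>2 (vertex 0))" using inj[OF top(1)[OF v0] top(2)[OF v0]] by metis
   then have ne: "simplex_map p g \<tau>1 \<noteq> simplex_map p g \<tau>2"
    using simplex_map_vertex[of 0 p g \<tau>1] simplex_map_vertex[of 0 p g \<tau>2] by auto
   have sm: "simplex_map p q' (simplex_map p g \<tau>) = simplex_map p f (simplex_map p q \<tau>)"
    if "\<And>x. x \<in> std_simplex p ==> \<tau> x \<in> topspace S" for \<tau>
    using that comm by (intro ext) (simp add: simplex_map_def)
   have fs: "ssimplex p P' (simplex_map p f \<sigma>)" using \<sigma> f by (rule singular_simplex_simplex_map)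
   have l: "B.lifts p (simplex_map p f \<sigma>) = {simplex_map p g \<tau>1, simplex_map p g \<tau>2}" proof (rule B.lifts_eq[OF fs _ _ _ _ ne])
    show "simplex_map p q' (simplex_map p g \<tau>1) = simplex_map p f \<sigma>" using sm[of \<tau>1] top(1) t(7) by simp
    show "simplex_map p q' (simplex_map p g \<tau>2) = simplex_map p f \<sigma>" using sm[of \<tau>2] top(2) t(8) by simp
   qed (use t g singular_simplex_simplex_map in blast)+
   show ?thesis using \<sigma> t B.transfer_eval[OF fs l ne] A.transfer_eval[OF \<sigma> t(1,2), of "pull S g u"]
    by (auto simp: pull_eval)
  qed (simp add: pull_off A.transfer_def)
 qed
qed

section \<open>Sphere bundles\<close>

definition sbundle :: "nat => 'b topology => ('b => (nat => real) set) => ('b \<times> (nat => real)) topology"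
 where "sbundle n X V =
  subtopology (prod_topology X (Euclidean_space n)) {(b, v). v \<in> V b \<and> dotn n v v = 1}"

lemma topspace_sbundle:
 "topspace (sbundle n X V) =
  {(b, v). b \<in> topspace X \<and> (\<forall>i\<ge>n. v i = 0) \<and> v \<in> V b \<and> dotn n v v = 1}"
 by (auto simp: sbundle_def topspace_Euclidean_space)

lemma continuous_map_sbundle:
 "continuous_map Z (sbundle n X V) g \<longleftrightarrow> continuous_map Z X (\<lambda>z. fst (g z)) \<and>
  (\<forall>i. cont_real Z (\<lambda>z. snd (g z) i)) \<and>
  (\<forall>z\<in>topspace Z. snd (g z) \<in> V (fst (g z)) \<and> dotn n (snd (g z)) (snd (g z)) = 1 \<and> (\<forall>i\<ge>n. snd (g z) i = 0))"
 unfolding sbundle_def continuous_map_vector_bundle by (simp add: case_prod_unfold)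

lemma sbundle_coordinates:
 "continuous_map (sbundle n X V) X fst"
 "cont_real (sbundle n X V) (\<lambda>z. snd z i)"
 using continuous_map_sbundle[of "sbundle n X V" n X V "\<lambda>z. z"] by simp_all

lemma sbundleD:
 assumes "z \<in> topspace (sbundle n X V)"
 shows "fst z \<in> topspace X" "snd z \<in> V (fst z)" "dotn n (snd z) (snd z) = 1" "\<And>i. i \<ge> n ==> snd z i = 0"
 using assms by (auto simp: topspace_sbundle)

lemma dotn_zero [simp]: "dotn n (\<lambda>i. 0) v = 0" "dotn n v (\<lambda>i. 0) = 0" by (simp_all add: dotn_def)

lemma continuous_sphere_line_through: "continuous_map (sbundle n X V) (pbundle n X V) line_through" proof -
 have "continuous_map (sbundle n X V) (nonzero_vectors n X V) (\<lambda>z. z)" unfolding continuous_map_nonzero_vectors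
 proof (intro conjI allI ballI impI)
  fix z assume z: "z \<in> topspace (sbundle n X V)"
  show "snd z \<noteq> (\<lambda>i. 0)" using sbundleD(3)[OF z] by auto
 qed (simp_all add: sbundle_coordinates sbundleD)
 from continuous_map_comp[OF this continuous_line_through] show ?thesis .
qed

definition sphere_label :: "nat => 'b \<times> (nat => real) => bit"
 where "sphere_label n z = sign_bit (snd z) (unit_of n (line_of (snd z)))"

lemma line_through_eq': "line_through z = (fst z, line_of (snd z))" using line_through_eq[of "fst z" "snd z"] by simp

lemma sphere_lift:
 assumes lin: "\<And>b. b \<in> topspace X ==> lin_closed (V b)"
  and \<tau>: "ssimplex p (sbundle n X V) \<tau>"
 shows "is_lift p (fibre_unit n \<circ> simplex_map p line_through \<tau>) (\<lambda>x. snd (\<tau> x))" unfolding is_lift_def proof (intro conjI allI ballI)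
 have c: "continuous_map (simplex_top p) (sbundle n X V) \<tau>" using \<tau> by (simp add: singular_simplex_def)
 show "cont_real (simplex_top p) (\<lambda>x. snd (\<tau> x) i)" for i using continuous_map_comp[OF c sbundle_coordinates(2)] .
 fix x assume x: "x \<in> std_simplex p"
 then have "\<tau> x \<in> topspace (sbundle n X V)" using continuous_map_mem[OF c] by simp
 then have "dotn n (snd (\<tau> x)) (snd (\<tau> x)) = 1" by (rule sbundleD)
 from unit_of_line_of_unit[OF this]
 show "snd (\<tau> x) = (fibre_unit n \<circ> simplex_map p line_through \<tau>) x \<or>
   snd (\<tau> x) = (\<lambda>i. - (fibre_unit n \<circ> simplex_map p line_through \<tau>) x i)" using x by (auto simp: simplex_map_def line_through_eq')
qed

lemma sphere_simplex_of_lift: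
 assumes lin: "\<And>b. b \<in> topspace X ==> lin_closed (V b)"
  and \<sigma>: "ssimplex p (pbundle n X V) \<sigma>" and w: "is_lift p (fibre_unit n \<circ> \<sigma>) w"
 defines "\<tau> \<equiv> restrict (\<lambda>x. (fst (\<sigma> x), w x)) (std_simplex p)"
 shows "ssimplex p (sbundle n X V) \<tau>" "simplex_map p line_through \<tau> = \<sigma>"
  "x \<in> std_simplex p ==> sphere_label n (\<tau> x) = sign_bit (w x) (fibre_unit n (\<sigma> x))" proof -
 let ?P = "pbundle n X V"
 have c: "continuous_map (simplex_top p) ?P \<sigma>" using \<sigma> by (simp add: singular_simplex_def)
 have top: "\<sigma> x \<in> topspace ?P" if "x \<in> std_simplex p" for x using continuous_map_mem[OF c] that by simp
 note fu = fibre_unit_props[OF top lin]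
 have wx: "w x = fibre_unit n (\<sigma> x) \<or> w x = (\<lambda>i. - fibre_unit n (\<sigma> x) i)" if "x \<in> std_simplex p" for x
  using w that by (simp add: is_lift_def)
 have lw: "line_of (w x) = snd (\<sigma> x)" if "x \<in> std_simplex p" for x using wx[OF that] fu(4)[OF that] line_of_minus by metis
 have "continuous_map (simplex_top p) (sbundle n X V) (\<lambda>x. (fst (\<sigma> x), w x))" unfolding continuous_map_sbundle
 proof (intro conjI allI ballI impI)
  show "continuous_map (simplex_top p) X (\<lambda>x. fst (fst (\<sigma> x), w x))" using continuous_map_comp[OF c continuous_pbundle_fst] by simp
  show "cont_real (simplex_top p) (\<lambda>x. snd (fst (\<sigma> x), w x) i)" for i using w by (simp add: is_lift_def)
  fix x assume "x \<in> topspace (simplex_top p)"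
  then have x: "x \<in> std_simplex p" by simp
  have "fst (\<sigma> x) \<in> topspace X" using continuous_map_mem[OF continuous_pbundle_fst top[OF x]] .
  then show "snd (fst (\<sigma> x), w x) \<in> V (fst (fst (\<sigma> x), w x))" using wx[OF x] fu(3)[OF x] lin_closed_minus[OF lin fu(3)[OF x]] by auto
  show "dotn n (snd (fst (\<sigma> x), w x)) (snd (fst (\<sigma> x), w x)) = 1" using wx[OF x] fu(1)[OF x] by auto
  show "snd (fst (\<sigma> x), w x) i = 0" if "i \<ge> n" for i using wx[OF x] fu(2)[OF x _ that] by auto
 qed
 then show "ssimplex p (sbundle n X V) \<tau>" by (simp add: singular_simplex_def \<tau>_def)
 show "simplex_map p line_through \<tau> = \<sigma>" proof
  fix x
  show "simplex_map p line_through \<tau> x = \<sigma> x" proof (cases "x \<in> std_simplex p")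
   case True
   then show ?thesis using lw[OF True] by (simp add: simplex_map_def \<tau>_def line_through_eq)
  next
   case False
   then show ?thesis using \<sigma> by (simp add: simplex_map_def singular_simplex_def extensional_def)
  qed
 qed
 show "sphere_label n (\<tau> x) = sign_bit (w x) (fibre_unit n (\<sigma> x))" if "x \<in> std_simplex p"
  using that lw[OF that] by (simp add: sphere_label_def \<tau>_def)
qed

lemma double_covering_sbundle:
 assumes lin: "\<And>b. b \<in> topspace X ==> lin_closed (V b)"
 shows "double_covering (sbundle n X V) (pbundle n X V) line_through (sphere_label n)" proof
 show "continuous_map (sbundle n X V) (pbundle n X V) line_through" by (rule continuous_sphere_line_through)
 let ?S = "sbundle n X V" and ?P = "pbundle n X V"
 fix p \<sigma> assume \<sigma>: "ssimplex p ?P \<sigma>"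
 have lf: "line_field n (simplex_top p) (fibre_unit n \<circ> \<sigma>)" using line_field_simplex[OF line_field_pbundle[OF lin] \<sigma>] by simp
 obtain v where v: "is_lift p (fibre_unit n \<circ> \<sigma>) v" using is_lift_exists[OF lf] by blast
 let ?T = "\<lambda>w. restrict (\<lambda>x. (fst (\<sigma> x), w x)) (std_simplex p)"
 let ?m = "\<lambda>x i. - v x i"
 note v' = is_lift_minus[OF v]
 have "\<tau> = ?T v \<or> \<tau> = ?T ?m" if \<tau>: "ssimplex p ?S \<tau>" "simplex_map p line_through \<tau> = \<sigma>" for \<tau> proof -
  have "is_lift p (fibre_unit n \<circ> \<sigma>) (\<lambda>x. snd (\<tau> x))" using sphere_lift[OF lin \<tau>(1)] \<tau>(2) by simp
  from is_lift_unique[OF lf v this]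
  have *: "(\<forall>x\<in>std_simplex p. snd (\<tau> x) = v x) \<or> (\<forall>x\<in>std_simplex p. snd (\<tau> x) = ?m x)" by simp
  have f: "fst (\<tau> x) = fst (\<sigma> x)" if "x \<in> std_simplex p" for x using that \<tau>(2) by (auto simp: simplex_map_def line_through_eq')
  have e: "\<tau> x = undefined" if "x \<notin> std_simplex p" for x using that \<tau>(1) by (simp add: singular_simplex_def extensional_def)
  from * show ?thesis using f e by (elim disjE) (intro disjI1 disjI2 ext; simp add: prod_eq_iff restrict_def)+
 qed
 moreover note sphere_simplex_of_lift[OF lin \<sigma> v] sphere_simplex_of_lift[OF lin \<sigma> v']
 ultimately have E: "{\<tau>. ssimplex p ?S \<tau> \<and> simplex_map p line_through \<tau> = \<sigma>} = {?T v, ?T ?m}" by blast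
 have L: "sphere_label n (?T v (vertex i)) + sphere_label n (?T ?m (vertex i)) = 1" if "i \<le> p" for i proof -
  have x: "vertex i \<in> std_simplex p" using that by simp
  have "dotn n (fibre_unit n (\<sigma> (vertex i))) (fibre_unit n (\<sigma> (vertex i))) \<noteq> 0" using lf x by (simp add: line_field_def)
  then have "(\<lambda>k. - fibre_unit n (\<sigma> (vertex i)) k) \<noteq> fibre_unit n (\<sigma> (vertex i))" by (rule minus_vector_neq)
  moreover have "v (vertex i) = fibre_unit n (\<sigma> (vertex i)) \<or> v (vertex i) = (\<lambda>k. - fibre_unit n (\<sigma> (vertex i)) k)"
   using v x by (simp add: is_lift_def)
  moreover have "sphere_label n (?T v (vertex i)) = sign_bit (v (vertex i)) (fibre_unit n (\<sigma> (vertex i)))"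
   by (rule sphere_simplex_of_lift(3)[OF lin \<sigma> v x])
  moreover have "sphere_label n (?T ?m (vertex i)) = sign_bit (?m (vertex i)) (fibre_unit n (\<sigma> (vertex i)))"
   by (rule sphere_simplex_of_lift(3)[OF lin \<sigma> v' x])
  ultimately show ?thesis by (elim disjE) (simp_all only: sign_bit_def if_True if_False minus_minus refl add_0_left add_0_right)
 qed
 show "\<exists>\<tau>1 \<tau>2. {\<tau>. ssimplex p ?S \<tau> \<and> simplex_map p line_through \<tau> = \<sigma>} = {\<tau>1, \<tau>2} \<and>
   (\<forall>i\<le>p. sphere_label n (\<tau>1 (vertex i)) + sphere_label n (\<tau>2 (vertex i)) = 1)"
 proof (rule exI[of _ "?T v"], rule exI[of _ "?T ?m"], intro conjI allI impI)
  show "{\<tau>. ssimplex p ?S \<tau> \<and> simplex_map p line_through \<tau> = \<sigma>} = {?T v, ?T ?m}" by (rule E)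
  show "sphere_label n (?T v (vertex i)) + sphere_label n (?T ?m (vertex i)) = 1" if "i \<le> p" for i by (rule L[OF that])
 qed
qed

abbreviation taut :: "nat => 'b topology => ('b => (nat => real) set) => ('b \<times> (nat => real) set) cochain"
 where "taut n X V \<equiv> line_cocycle (pbundle n X V) (fibre_unit n)"

lemma taut_cocycle:
 assumes lin: "\<And>b. b \<in> topspace X ==> lin_closed (V b)"
 shows "taut n X V \<in> cocycles (pbundle n X V)" using line_cocycle_cocycles[OF line_field_pbundle[of X V n]] lin by blast

text \<open>Over the sphere bundle the tautological line contains a distinguished unit vector, which
  lifts every path; what remains of the cocycle is the difference of the labels at the ends.\<close>

lemma taut_pullback_sphere:
 assumes lin: "\<And>b. b \<in> topspace X ==> lin_closed (V b)"
 shows "pull (sbundle n X V) line_through (taut n X V) =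
  coboundary (sbundle n X V) (point_cochain (sbundle n X V) (sphere_label n))" proof (rule cochain_eqI[of _ "sbundle n X V"])
 let ?S = "sbundle n X V" and ?P = "pbundle n X V"
 fix p \<tau> assume \<tau>: "ssimplex p ?S \<tau>"
 show "pull ?S line_through (taut n X V) p \<tau> = coboundary ?S (point_cochain ?S (sphere_label n)) p \<tau>" proof (cases "p = 1")
  case True
  then have \<tau>1: "ssimplex 1 ?S \<tau>" using \<tau> by simp
  have s: "ssimplex 1 ?P (simplex_map 1 line_through \<tau>)" using \<tau>1 continuous_sphere_line_through by (rule singular_simplex_simplex_map)
  show ?thesis using line_cocycle_lift[OF line_field_pbundle[OF lin] s sphere_lift[OF lin \<tau>1]] True \<tau>1
   by (simp add: pull_eval coboundary_point_cochain simplex_map_vertex sphere_label_def line_through_eq')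
 next
  case False
  then show ?thesis using \<tau> by (simp add: pull_eval coboundary_point_cochain line_cocycle_degree)
 qed
qed (auto intro!: pull_cochains[of _ "pbundle n X V"])

section \<open>Homotopies in sphere bundles by normalization\<close>

definition normalize_vec :: "nat => (nat => real) => nat => real"
 where "normalize_vec n v = (\<lambda>i. v i / sqrt (dotn n v v))"

lemma normalize_vec_unit: "dotn n v v > 0 ==> dotn n (normalize_vec n v) (normalize_vec n v) = 1" by (simp add: normalize_vec_def)

lemma normalize_vec_scale: "normalize_vec n v = (\<lambda>i. (1 / sqrt (dotn n v v)) * v i)" by (simp add: normalize_vec_def)

lemma normalize_vec_of_unit: "dotn n v v = 1 ==> normalize_vec n v = v" by (simp add: normalize_vec_def)

lemma line_of_normalize: "dotn n v v > 0 ==> line_of (normalize_vec n v) = line_of v" unfolding normalize_vec_scale by (rule line_of_scale) simp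

lemma continuous_normalize_vec:
 assumes "\<And>i. cont_real Z (\<lambda>z. v z i)" "\<And>z. z \<in> topspace Z ==> dotn n (v z) (v z) > 0"
 shows "cont_real Z (\<lambda>z. normalize_vec n (v z) i)" proof -
 have "cont_real Z (\<lambda>z. dotn n (v z) (v z))" unfolding dotn_def by (intro continuous_map_sum continuous_map_real_mult assms) auto
 then have "cont_real Z (\<lambda>z. sqrt (dotn n (v z) (v z)))" by (rule continuous_map_comp) (simp add: continuous_on_real_sqrt)
 then show ?thesis unfolding normalize_vec_def using assms by (intro continuous_map_real_divide) (auto simp: less_le)
qed

text \<open>Straight lines in the fibre, followed by normalization. The set D is a part of the
  sphere bundle that the homotopy must not leave.\<close>

lemma sphere_homotopy:
 assumes g: "continuous_map Z (sbundle n X V) g" and h: "continuous_map Z (sbundle n X V) h"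
  and base: "\<And>z. z \<in> topspace Z ==> fst (h z) = fst (g z)"
  and lin: "\<And>b. b \<in> topspace X ==> lin_closed (V b)"
  and nz: "\<And>z t. z \<in> topspace Z ==> 0 \<le> t ==> t \<le> 1 ==> (\<lambda>i. (1 - t) * snd (g z) i + t * snd (h z) i) \<noteq> (\<lambda>i. 0)"
  and D: "\<And>z t. z \<in> topspace Z ==> 0 \<le> t ==> t \<le> 1 ==>
   (fst (g z), normalize_vec n (\<lambda>i. (1 - t) * snd (g z) i + t * snd (h z) i)) \<in> D"
 shows "homotopic_with (\<lambda>_. True) Z (subtopology (sbundle n X V) D) g h" proof -
 let ?Z = "prod_topology (top_of_set {0..1::real}) Z"
 define w where "w = (\<lambda>y i. (1 - fst y) * snd (g (snd y)) i + fst y * snd (h (snd y)) i)"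
 define H where "H = (\<lambda>y. (fst (g (snd y)), normalize_vec n (w y)))"
 have gc: "continuous_map Z X (\<lambda>z. fst (g z))" "\<And>i. cont_real Z (\<lambda>z. snd (g z) i)"
  and gt: "\<And>z i. z \<in> topspace Z ==> i \<ge> n ==> snd (g z) i = 0" "\<And>z. z \<in> topspace Z ==> snd (g z) \<in> V (fst (g z))"
   "\<And>z. z \<in> topspace Z ==> dotn n (snd (g z)) (snd (g z)) = 1" using g by (auto simp: continuous_map_sbundle)
 have hc: "\<And>i. cont_real Z (\<lambda>z. snd (h z) i)"
  and ht: "\<And>z i. z \<in> topspace Z ==> i \<ge> n ==> snd (h z) i = 0" "\<And>z. z \<in> topspace Z ==> snd (h z) \<in> V (fst (h z))"
   "\<And>z. z \<in> topspace Z ==> dotn n (snd (h z)) (snd (h z)) = 1" using h by (auto simp: continuous_map_sbundle)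
 have sn: "continuous_map ?Z Z snd" by (rule continuous_map_snd)
 have fs: "cont_real ?Z fst" using continuous_map_into_fulltopology[OF continuous_map_fst] by blast
 have wc: "cont_real ?Z (\<lambda>y. w y i)" for i unfolding w_def
  by (intro continuous_map_add continuous_map_real_mult continuous_map_diff fs
    continuous_map_comp[OF sn gc(2)] continuous_map_comp[OF sn hc]) auto
 have wz: "\<And>i. i \<ge> n ==> w y i = 0" "dotn n (w y) (w y) > 0" "w y \<in> V (fst (g (snd y)))" if y: "y \<in> topspace ?Z" for y proof -
  have yz: "snd y \<in> topspace Z" "0 \<le> fst y" "fst y \<le> 1" using y by auto
  show wi: "\<And>i. i \<ge> n ==> w y i = 0" using yz gt(1) ht(1) by (simp add: w_def)
  show "dotn n (w y) (w y) > 0" using nz[OF yz] wi by (intro dotn_pos) (auto simp: w_def)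
  have "fst (g (snd y)) \<in> topspace X" using continuous_map_mem[OF gc(1) yz(1)] .
  then show "w y \<in> V (fst (g (snd y)))" using lin gt(2)[OF yz(1)] ht(2)[OF yz(1)] base[OF yz(1)] unfolding w_def lin_closed_def by simp
 qed
 have "continuous_map ?Z (sbundle n X V) H" unfolding continuous_map_sbundle proof (intro conjI allI ballI impI)
  show "continuous_map ?Z X (\<lambda>y. fst (H y))" using continuous_map_comp[OF sn gc(1)] by (simp add: H_def)
  show "cont_real ?Z (\<lambda>y. snd (H y) i)" for i unfolding H_def snd_conv by (rule continuous_normalize_vec[OF wc wz(2)])
  fix y assume y: "y \<in> topspace ?Z"
  then have "fst (g (snd y)) \<in> topspace X" using continuous_map_mem[OF gc(1)] by auto
  then show "snd (H y) \<in> V (fst (H y))" unfolding H_def fst_conv snd_conv normalize_vec_scale using wz(3)[OF y] lin by (intro lin_closed_scale)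
  show "dotn n (snd (H y)) (snd (H y)) = 1" unfolding H_def snd_conv by (rule normalize_vec_unit[OF wz(2)[OF y]])
  show "snd (H y) i = 0" if "i \<ge> n" for i using wz(1)[OF y that] by (simp add: H_def normalize_vec_def)
 qed
 moreover have "H y \<in> D" if "y \<in> topspace ?Z" for y using that D[of "snd y" "fst y"] by (auto simp: H_def w_def)
 ultimately have cH: "continuous_map ?Z (subtopology (sbundle n X V) D) H" by (auto simp: continuous_map_in_subtopology)
 show ?thesis proof (subst homotopic_with)
  have "H (0, z) = g z" "H (1, z) = h z" if "z \<in> topspace Z" for z using gt(3)[OF that] ht(3)[OF that] base[OF that]
   by (simp_all add: H_def w_def normalize_vec_of_unit prod_eq_iff)
  then show "\<exists>H. continuous_map ?Z (subtopology (sbundle n X V) D) H \<and>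
   (\<forall>z\<in>topspace Z. H (0, z) = g z) \<and> (\<forall>z\<in>topspace Z. H (1, z) = h z) \<and> (\<forall>t\<in>{0..1}. True)" using cH by blast
 qed auto
qed

section \<open>Powers of the tautological class of a framed bundle\<close>

primrec cup_pow :: "'a topology => 'a cochain => nat => 'a cochain"
 where "cup_pow X \<phi> 0 = unit_cochain X"
 | "cup_pow X \<phi> (Suc m) = cup X (cup_pow X \<phi> m) \<phi>"

lemma cup_pow_cocycles [intro]: "\<phi> \<in> cocycles X ==> cup_pow X \<phi> m \<in> cocycles X" by (induction m) auto

lemma cup_pow_pullback:
 assumes "continuous_map X Y f"
 shows "pull X f (cup_pow Y \<phi> m) = cup_pow X (pull X f \<phi>) m"
 by (induction m) (simp_all add: pull_unit[OF assms] pull_cup[OF assms])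

lemma cup_pow_shift: "\<phi> \<in> cochains X ==> cup X \<phi> (cup_pow X \<phi> m) = cup_pow X \<phi> (Suc m)"
 by (induction m) (simp_all add: cup_unit_left cup_unit_right flip: cup_assoc)

lemma cup_list_replicate: "\<phi> \<in> cochains X ==> cup_list X (replicate m \<phi>) = cup_pow X \<phi> m"
 by (induction m) (simp_all add: cup_pow_shift del: cup_pow.simps(2))

definition frame_span :: "(nat => 'b => nat => real) => nat => 'b => (nat => real) set"
 where "frame_span f k b = {\<lambda>i. \<Sum>j<k. c j * f j b i |c. True}"

definition frame :: "nat => 'b topology => nat => (nat => 'b => nat => real) => bool"
 where "frame n X r f \<longleftrightarrow> (\<forall>j<r. \<forall>i. cont_real X (\<lambda>b. f j b i)) \<and>
  (\<forall>j<r. \<forall>b\<in>topspace X. \<forall>i\<ge>n. f j b i = 0) \<and>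
  (\<forall>b\<in>topspace X. \<forall>c. (\<forall>i. (\<Sum>j<r. c j * f j b i) = 0) \<longrightarrow> (\<forall>j<r. c j = 0))"

lemma frame_spanI: "(\<lambda>i. \<Sum>j<k. c j * f j b i) \<in> frame_span f k b" by (auto simp: frame_span_def)

lemma lin_closed_frame_span: "lin_closed (frame_span f k b)" unfolding lin_closed_def proof (intro ballI allI)
 fix v w :: "nat => real" and a c :: real assume "v \<in> frame_span f k b" "w \<in> frame_span f k b"
 then obtain d e where "v = (\<lambda>i. \<Sum>j<k. d j * f j b i)" "w = (\<lambda>i. \<Sum>j<k. e j * f j b i)" by (auto simp: frame_span_def)
 then have "(\<lambda>i. a * v i + c * w i) = (\<lambda>i. \<Sum>j<k. (a * d j + c * e j) * f j b i)"
  by (simp add: sum_distrib_left sum.distrib distrib_right mult.assoc)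
 then show "(\<lambda>i. a * v i + c * w i) \<in> frame_span f k b"
  using frame_spanI[where k = k and c = "\<lambda>j. a * d j + c * e j" and f = f and b = b] by (simp only:)
qed

lemma frame_span_member: "j < k ==> f j b \<in> frame_span f k b"
 using frame_spanI[where k = k and c = "\<lambda>i. if i = j then 1 else 0" and f = f and b = b] by (simp add: if_distrib[of "\<lambda>x. x * _"] cong: if_cong)

lemma frame_span_mono:
 assumes "v \<in> frame_span f k b" "k \<le> m"
 shows "v \<in> frame_span f m b" proof -
 obtain c where c: "v = (\<lambda>i. \<Sum>j<k. c j * f j b i)" using assms(1) by (auto simp: frame_span_def)
 have "(\<Sum>j<k. c j * f j b i) = (\<Sum>j<m. (if j < k then c j else 0) * f j b i)" for i using assms(2) by (intro sum.mono_neutral_cong_left) auto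
 then have "v = (\<lambda>i. \<Sum>j<m. (if j < k then c j else 0) * f j b i)" by (simp add: c)
 then show ?thesis using frame_spanI[where k = m and c = "\<lambda>j. if j < k then c j else 0" and f = f and b = b] by (simp only:)
qed

lemma frame_nonzero:
 assumes "frame n X r f" "j < r" "b \<in> topspace X"
 shows "f j b \<noteq> (\<lambda>i. 0)" "dotn n (f j b) (f j b) > 0" "\<And>i. i \<ge> n ==> f j b i = 0" proof -
 show "f j b \<noteq> (\<lambda>i. 0)" proof
  assume eq: "f j b = (\<lambda>i. 0)"
  define c where "c = (\<lambda>l. if l = j then 1 else 0 :: real)"
  have "\<forall>i. (\<Sum>l<r. c l * f l b i) = 0" using eq by (auto simp: c_def intro!: sum.neutral)
  then have "c j = 0" using assms unfolding frame_def by blast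
  then show False by (simp add: c_def)
 qed
 moreover show "\<And>i. i \<ge> n ==> f j b i = 0" using assms by (simp add: frame_def)
 ultimately show "dotn n (f j b) (f j b) > 0" by (intro dotn_pos) auto
qed

text \<open>Used to see that segments from the span of the earlier frame vectors to the next one
  avoid 0.\<close>

lemma frame_span_combination_nonzero:
 assumes fr: "frame n X r f" and "k < r" "b \<in> topspace X" "v \<in> frame_span f k b" "v \<noteq> (\<lambda>i. 0)" "a \<noteq> 0 \<or> c \<noteq> 0"
 shows "(\<lambda>i. a * v i + c * f k b i) \<noteq> (\<lambda>i. 0)" proof
 assume eq: "(\<lambda>i. a * v i + c * f k b i) = (\<lambda>i. 0)"
 obtain d where d: "v = (\<lambda>i. \<Sum>j<k. d j * f j b i)" using assms(4) by (auto simp: frame_span_def)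
 define e where "e = (\<lambda>j. if j < k then a * d j else if j = k then c else 0)"
 have "(\<Sum>j<r. e j * f j b i) = (\<Sum>j<Suc k. e j * f j b i)" for i using \<open>k < r\<close> by (intro sum.mono_neutral_right) (auto simp: e_def)
 also have "(\<Sum>j<Suc k. e j * f j b i) = a * v i + c * f k b i" for i by (simp add: e_def d sum_distrib_left mult.assoc)
 also have "a * v i + c * f k b i = 0" for i using fun_cong[OF eq] .
 finally have "\<forall>j<r. e j = 0" using fr \<open>b \<in> topspace X\<close> by (simp add: frame_def)
 then have z: "c = 0" "\<And>j. j < k ==> a * d j = 0" using \<open>k < r\<close> unfolding e_def by (metis less_irrefl, metis less_trans)
 then have "a * (d j * f j b i) = 0" if jk: "j < k" for i j using z(2)[OF jk] by auto
 then have "a * v i = 0" for i unfolding d sum_distrib_left by (intro sum.neutral) auto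
 then show False using assms(5,6) \<open>c = 0\<close> by auto
qed

lemma continuous_frame_section:
 assumes fr: "frame n X r f" and "j < k" "k \<le> r"
 shows "continuous_map X (sbundle n X (frame_span f k)) (\<lambda>b. (b, normalize_vec n (f j b)))" unfolding continuous_map_sbundle
proof (intro conjI allI ballI impI)
 have jr: "j < r" using assms by simp
 note nz = frame_nonzero[OF fr jr]
 show "continuous_map X X (\<lambda>b. fst (b, normalize_vec n (f j b)))" by simp
 show "cont_real X (\<lambda>b. snd (b, normalize_vec n (f j b)) i)" for i
  unfolding snd_conv using fr jr nz by (intro continuous_normalize_vec) (auto simp: frame_def)
 fix b assume b: "b \<in> topspace X"
 show "snd (b, normalize_vec n (f j b)) \<in> frame_span f k (fst (b, normalize_vec n (f j b)))" unfolding fst_conv snd_conv normalize_vec_scale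
  by (intro lin_closed_scale lin_closed_frame_span frame_span_member \<open>j < k\<close>)
 show "dotn n (snd (b, normalize_vec n (f j b))) (snd (b, normalize_vec n (f j b))) = 1" unfolding snd_conv by (rule normalize_vec_unit[OF nz(2)[OF b]])
 show "snd (b, normalize_vec n (f j b)) i = 0" if "i \<ge> n" for i using nz(3)[OF b that] by (simp add: normalize_vec_def)
qed

lemma continuous_projective_inclusion:
 assumes "\<And>b. b \<in> topspace X ==> V b \<subseteq> V' b" "\<And>b. b \<in> topspace X ==> lin_closed (V b)"
  "\<And>b. b \<in> topspace X ==> lin_closed (V' b)"
 shows "continuous_map (pbundle n X V) (pbundle n X V') (\<lambda>p. p)" proof -
 let ?P = "pbundle n X V"
 have "continuous_map ?P (pbundle n X V') (\<lambda>p. (fst p, line_of (fibre_unit n p)))"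
  using assms fibre_unit_props(3)[of _ n X V] continuous_map_mem[OF continuous_pbundle_fst, of _ n X V]
  by (intro continuous_map_pbundle continuous_pbundle_fst line_field_pbundle) blast+
 then show ?thesis by (rule continuous_map_eq) (simp add: fibre_unit_props(4)[OF _ assms(2)])
qed

text \<open>
 If \<open>a x\<^sup>k\<^sup>+\<^sup>1 = 0\<close> over the bundle of rank \<open>k + 2\<close>, then \<open>a x\<^sup>k\<close> is the transfer of a class on the
 sphere bundle. The restriction to the subbundle of rank \<open>k + 1\<close> is the transfer of a class pulled back from
 the base, as the smaller sphere bundle can be contracted to a section; hence it vanishes.
\<close>

theorem framed_top_power_injective:
 assumes fr: "frame n X r f" and "Suc k \<le> r" and a: "a \<in> cocycles X"
  and "cup (pbundle n X (frame_span f (Suc k)))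
   (pull (pbundle n X (frame_span f (Suc k))) fst a)
   (cup_pow (pbundle n X (frame_span f (Suc k))) (taut n X (frame_span f (Suc k))) k)
   \<in> cobs (pbundle n X (frame_span f (Suc k)))"
 shows "a \<in> cobs X" using assms(2,4) proof (induction k)
 case 0
 let ?V = "frame_span f (Suc 0)"
 let ?P = "pbundle n X ?V"
 have s: "continuous_map X ?P (\<lambda>b. line_through (b, normalize_vec n (f 0 b)))"
  using continuous_map_comp[OF continuous_frame_section[OF fr, of 0 "Suc 0"] continuous_sphere_line_through] 0(1) by simp
 have "pull ?P fst a \<in> cochains ?P" using pull_cochains[OF cocyclesD(1)[OF a]] .
 then have "pull ?P fst a \<in> cobs ?P" using 0(2) by (simp add: cup_unit_right)
 then have "pull X (\<lambda>b. line_through (b, normalize_vec n (f 0 b))) (pull ?P fst a) \<in> cobs X"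
  using s by (rule pull_cobs)
 also have "pull X (\<lambda>b. line_through (b, normalize_vec n (f 0 b))) (pull ?P fst a) = a"
  using pull_compose[OF s, of fst a] pull_ident[OF cocyclesD(1)[OF a]] by (simp add: o_def line_through_eq)
 finally show ?case .
next
 case (Suc k)
 let ?V = "frame_span f (Suc (Suc k))" and ?W = "frame_span f (Suc k)"
 let ?P = "pbundle n X ?V" and ?Q = "pbundle n X ?W"
 let ?S = "sbundle n X ?V" and ?R = "sbundle n X ?W"
 interpret P: double_covering ?S ?P line_through "sphere_label n" by (rule double_covering_sbundle) (rule lin_closed_frame_span)
 interpret Q: double_covering ?R ?Q line_through "sphere_label n" by (rule double_covering_sbundle) (rule lin_closed_frame_span)
 have tP: "taut n X ?V \<in> cocycles ?P" and tQ: "taut n X ?W \<in> cocycles ?Q" by (rule taut_cocycle, rule lin_closed_frame_span)+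
 have aP: "pull ?P fst a \<in> cocycles ?P" using a continuous_pbundle_fst by (rule pull_cocycles)
 define y where "y = cup ?P (pull ?P fst a) (cup_pow ?P (taut n X ?V) k)"
 have y: "y \<in> cocycles ?P" unfolding y_def using aP tP by blast
 have "cup ?P y (taut n X ?V) \<in> cobs ?P" using Suc.prems(2) by (simp add: y_def cup_assoc)
 then obtain U where U: "U \<in> cocycles ?S" "P.transfer U = y" using P.gysin_cup_kernel[OF tP taut_pullback_sphere y] lin_closed_frame_span by metis
 have sub: "?W b \<subseteq> ?V b" for b using frame_span_mono by (metis Suc_n_not_le_n nat_le_linear subsetI)
 have inP: "continuous_map ?Q ?P (\<lambda>p. p)" by (rule continuous_projective_inclusion) (use sub lin_closed_frame_span in auto)
 have inS: "continuous_map ?R ?S (\<lambda>p. p)" unfolding continuous_map_sbundle using sbundleD(2)[of _ n X ?W] sub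
  by (simp add: sbundle_coordinates sbundleD subset_iff)
 have kr: "Suc k < r" using Suc.prems(1) by simp
 define sec where "sec = (\<lambda>b. (b, normalize_vec n (f (Suc k) b)))"
 have sec: "continuous_map X ?S sec" unfolding sec_def using continuous_frame_section[OF fr lessI Suc.prems(1)] .
 have "homotopic_with (\<lambda>_. True) ?R (subtopology ?S UNIV) (\<lambda>z. z) (\<lambda>z. sec (fst z))" proof (rule sphere_homotopy[OF inS])
  show "continuous_map ?R ?S (\<lambda>z. sec (fst z))" using sbundle_coordinates(1) sec by (rule continuous_map_comp)
  fix z and t :: real assume z: "z \<in> topspace ?R" and t: "0 \<le> t" "t \<le> 1"
  note zD = sbundleD[OF z]
  have "snd z \<noteq> (\<lambda>i. 0)" using zD(3) by auto
  moreover have "sqrt (dotn n (f (Suc k) (fst z)) (f (Suc k) (fst z))) \<noteq> 0" using frame_nonzero(2)[OF fr kr zD(1)] by simp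
  then have "1 - t \<noteq> 0 \<or> t / sqrt (dotn n (f (Suc k) (fst z)) (f (Suc k) (fst z))) \<noteq> 0" by auto
  ultimately have "(\<lambda>i. (1 - t) * snd z i + t / sqrt (dotn n (f (Suc k) (fst z)) (f (Suc k) (fst z))) * f (Suc k) (fst z) i) \<noteq> (\<lambda>i. 0)"
   by (intro frame_span_combination_nonzero[OF fr kr zD(1,2)])
  then show "(\<lambda>i. (1 - t) * snd z i + t * snd (sec (fst z)) i) \<noteq> (\<lambda>i. 0)" by (simp add: sec_def normalize_vec_def)
 qed (auto simp: sec_def lin_closed_frame_span)
 then have "pull ?R (\<lambda>z. z) U + pull ?R (\<lambda>z. sec (fst z)) U \<in> cobs ?R"
  using U(1) by (simp add: homotopic_pullback_cohomologous)
 then have "Q.transfer (pull ?R (\<lambda>z. z) U + pull ?R (\<lambda>z. sec (fst z)) U) \<in> cobs ?Q"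
  by (rule Q.transfer_cobs)
 \<comment> \<open>This class is pulled back from the projective bundle along
   \<open>line_through\<close>, hence has transfer 0.\<close>
 moreover have "pull ?R (\<lambda>z. sec (fst z)) U = pull ?R line_through (pull ?Q (\<lambda>p. sec (fst p)) U)"
  unfolding pull_compose[OF continuous_sphere_line_through] by (simp add: o_def line_through_eq')
 ultimately have "Q.transfer (pull ?R (\<lambda>z. z) U) \<in> cobs ?Q" by (simp add: Q.transfer_add)
 also have "Q.transfer (pull ?R (\<lambda>z. z) U) = pull ?Q (\<lambda>p. p) y" unfolding U(2)[symmetric]
  by (rule transfer_natural[symmetric, OF Q.double_covering_axioms P.double_covering_axioms inS inP]) auto
 also have "\<dots> = cup ?Q (pull ?Q fst a) (cup_pow ?Q (taut n X ?W) k)"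
  unfolding y_def pull_cup[OF inP] cup_pow_pullback[OF inP] pull_compose[OF inP]
   line_cocycle_pullback[OF inP] by (simp add: o_def)
 finally show ?case using Suc by simp
qed

text \<open>The cocycles of u and u' differ by a coboundary on the open set where the lines are not
  orthogonal, and these sets cover Y, so that \<open>cover_product_coboundary\<close>
  applies.\<close>

theorem line_fields_product:
 assumes u: "line_field n Y u" and us: "\<And>u'. u' \<in> set us ==> line_field n Y u'"
  and cover: "\<And>y. y \<in> topspace Y ==> \<exists>u'\<in>set us. dotn n (u y) (u' y) \<noteq> 0"
 shows "cup_list Y (map (\<lambda>u'. line_cocycle Y u + line_cocycle Y u') us) \<in> cobs Y" proof -
 define U where "U = (\<lambda>u'. {y \<in> topspace Y. (dotn n (u y) (u' y))\<^sup>2 \<in> - {0}})"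
 have op: "openin Y (U u')" if "u' \<in> set us" for u' proof -
  have "cont_real Y (\<lambda>y. (dotn n (u y) (u' y))\<^sup>2)" unfolding dotn_square using u us[OF that]
   by (intro continuous_map_sum continuous_map_real_mult[where f = "\<lambda>y. u y _ * u y _"]) (auto simp: line_field_def)
  then show ?thesis unfolding U_def by (rule openin_continuous_map_preimage) auto
 qed
 have exact: "restr (subtopology Y (U u')) (line_cocycle Y u + line_cocycle Y u') \<in> cobs (subtopology Y (U u'))"
  if "u' \<in> set us" for u'
  using line_cocycle_nonorthogonal[OF line_field_subtopology[OF u, of "U u'"] line_field_subtopology[OF us[OF that], of "U u'"]]
  by (simp add: pull_add line_cocycle_pullback U_def)
 show ?thesis proof (rule cover_product_coboundary)
  show "list_all2 (\<lambda>\<phi> U. \<phi> \<in> cocycles Y \<and> openin Y U \<and>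
    restr (subtopology Y U) \<phi> \<in> cobs (subtopology Y U))
   (map (\<lambda>u'. line_cocycle Y u + line_cocycle Y u') us) (map U us)" using op exact line_cocycle_cocycles[OF u] line_cocycle_cocycles[OF us]
   by (simp add: list_all2_map1 list_all2_map2 list_all2_same cocycles_add)
  show "topspace Y \<subseteq> \<Union> (set (map U us))" using cover by (fastforce simp: U_def)
 qed
qed

text \<open>A line field spanned by a continuous vector field has cocycle 0, so in
  \<open>line_fields_product\<close> with r such fields every factor becomes the class of u.\<close>

lemma framed_power_zero:
 assumes u: "line_field n Y u" and f: "\<And>j i. j < r ==> cont_real Y (\<lambda>y. f j y i)"
  and nz: "\<And>j y. j < r ==> y \<in> topspace Y ==> dotn n (f j y) (f j y) > 0"
  and supp: "\<And>j y i. j < r ==> y \<in> topspace Y ==> i \<ge> n ==> f j y i = 0"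
  and cover: "\<And>y. y \<in> topspace Y ==> \<exists>j<r. dotn n (u y) (f j y) \<noteq> 0"
 shows "cup_pow Y (line_cocycle Y u) r \<in> cobs Y" proof -
 define g where "g = (\<lambda>j y. normalize_vec n (f j y))"
 have gc: "cont_real Y (\<lambda>y. g j y i)" if "j < r" for j i unfolding g_def using f nz that by (intro continuous_normalize_vec) auto
 have "line_field n Y (g j)" if "j < r" for j unfolding line_field_def proof (intro conjI allI ballI impI)
  fix y assume y: "y \<in> topspace Y"
  show "g j y i = 0" if "i \<ge> n" for i using supp[OF \<open>j < r\<close> y that] by (simp add: g_def normalize_vec_def)
  show "dotn n (g j y) (g j y) = 1" unfolding g_def by (rule normalize_vec_unit[OF nz[OF \<open>j < r\<close> y]])
 qed (intro continuous_map_real_mult gc that)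
 moreover have "\<exists>u'\<in>set (map g [0..<r]). dotn n (u y) (u' y) \<noteq> 0" if y: "y \<in> topspace Y" for y proof -
  obtain j where j: "j < r" "dotn n (u y) (f j y) \<noteq> 0" using cover[OF y] by blast
  then have "dotn n (u y) (g j y) \<noteq> 0" using nz[OF j(1) y] by (simp add: g_def normalize_vec_def)
  then show ?thesis using j(1) by auto
 qed
 ultimately have "cup_list Y (map (\<lambda>u'. line_cocycle Y u + line_cocycle Y u') (map g [0..<r])) \<in> cobs Y"
  by (intro line_fields_product[OF u]) auto
 moreover have "map (\<lambda>u'. line_cocycle Y u + line_cocycle Y u') (map g [0..<r]) = replicate r (line_cocycle Y u)"
  by (rule nth_equalityI) (auto simp: line_cocycle_section gc)
 ultimately show ?thesis by (simp add: cup_list_replicate)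
qed

section \<open>Gluing cochains over two open sets\<close>

lemma restrict_pullback:
 "restr (subtopology X A) (pull X f \<phi>) = pull (subtopology X A) f \<phi>" by (simp add: pull_compose o_def)

lemma restrict_restrict:
 assumes "A \<subseteq> B"
 shows "restr (subtopology X A) (restr (subtopology X B) \<phi>) = restr (subtopology X A) \<phi>" proof -
 have "subtopology X A = subtopology (subtopology X B) A" using assms by (simp add: subtopology_subtopology inf.absorb2)
 then show ?thesis by (metis restrict_pullback)
qed

lemmas restrict_algebra = pull_add restrict_pullback
 pull_coboundary[OF continuous_map_subtopology_ident]
 pull_cup[OF continuous_map_subtopology_ident]

lemma restr_eqD:
 "restr A \<phi> = restr A \<psi> ==> ssimplex p A \<sigma> ==> \<phi> p \<sigma> = \<psi> p \<sigma>"
 by (metis restr_eval)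

lemma ssimplex_Int:
 "ssimplex p (subtopology X A) \<sigma> ==> ssimplex p (subtopology X B) \<sigma> ==>
  ssimplex p (subtopology X (A \<inter> B)) \<sigma>" by (auto simp: singular_simplex_subtopology)

lemmas cochain_ac = cochain_double cochain_cancel_left add_ac

lemma glue_cochains:
 assumes "\<alpha> \<in> cochains (subtopology X A)" "\<beta> \<in> cochains (subtopology X B)"
  and eq: "restr (subtopology X (A \<inter> B)) \<alpha> = restr (subtopology X (A \<inter> B)) \<beta>"
 obtains \<omega> where "\<omega> \<in> cochains X" "restr (subtopology X A) \<omega> = \<alpha>" "restr (subtopology X B) \<omega> = \<beta>"
proof -
 define \<omega> where "\<omega> = (\<lambda>p \<sigma>. if ssimplex p (subtopology X A) \<sigma> then \<alpha> p \<sigma> else \<beta> p \<sigma>)"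
 obtain d where d: "\<And>p \<sigma>. p > d ==> \<alpha> p \<sigma> = 0" using cochains_bound[OF assms(1)] by metis
 obtain d' where d': "\<And>p \<sigma>. p > d' ==> \<beta> p \<sigma> = 0" using cochains_bound[OF assms(2)] by metis
 have "\<omega> \<in> cochains X" proof (rule cochainsI[where d = "max d d'"])
  show "\<omega> p \<sigma> = 0" if "\<not> ssimplex p X \<sigma>" for p \<sigma>
   using that cochains_off[OF assms(2)] ssimplex_subtopologyD unfolding \<omega>_def by metis
  show "\<omega> p \<sigma> = 0" if "p > max d d'" for p \<sigma> using that d d' by (simp add: \<omega>_def)
 qed
 moreover have "restr (subtopology X A) \<omega> = \<alpha>"
  using cochains_off[OF assms(1)] by (intro ext) (simp add: \<omega>_def cochain_pullback_def simplex_map_ident)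
 moreover have "restr (subtopology X B) \<omega> p \<sigma> = \<beta> p \<sigma>" for p \<sigma>
 proof (cases "ssimplex p (subtopology X B) \<sigma>")
  case True
  then show ?thesis using restr_eqD[OF eq ssimplex_Int] by (simp add: restr_eval \<omega>_def)
 next
  case False
  then show ?thesis by (simp add: pull_off cochains_off[OF assms(2)])
 qed
 ultimately show ?thesis using that by blast
qed

lemma restrict_eq_0D: "restr A \<phi> = 0 ==> ssimplex p A \<sigma> ==> \<phi> p \<sigma> = 0"
 by (metis restr_eval zero_fun_apply)

lemma small_pair:
 assumes "restr (subtopology X A) \<phi> = 0" "restr (subtopology X B) \<phi> = 0"
  "ssimplex p X \<sigma>" "small_simplex {A, B} p \<sigma>"
 shows "\<phi> p \<sigma> = 0" proof -
 have "ssimplex p (subtopology X A) \<sigma> \<or> ssimplex p (subtopology X B) \<sigma>"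
  using assms(3,4) by (auto simp: small_simplex_def singular_simplex_subtopology)
 then show ?thesis using restrict_eq_0D assms(1,2) by metis
qed

lemma small_simplex_in:
 assumes "ssimplex p (subtopology X A) \<sigma>" "A \<in> \<U>"
 shows "small_simplex \<U> p \<sigma>" using assms by (auto simp: small_simplex_def singular_simplex_subtopology)

lemma two_open_coboundary:
 assumes "openin X A" "openin X B" "topspace X \<subseteq> A \<union> B" "\<phi> \<in> cocycles X"
  "restr (subtopology X A) \<phi> = 0" "restr (subtopology X B) \<phi> = 0"
 obtains \<psi> where "\<psi> \<in> cochains X" "coboundary X \<psi> = \<phi>"
  "restr (subtopology X A) \<psi> = 0" "restr (subtopology X B) \<psi> = 0" proof -
 obtain \<psi> where \<psi>: "\<psi> \<in> cochains X" "coboundary X \<psi> = \<phi>"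
  "\<And>p \<sigma>. ssimplex p X \<sigma> ==> small_simplex {A, B} p \<sigma> ==> \<psi> p \<sigma> = 0"
  by (rule small_exact[of "{A, B}" X \<phi>]) (use assms small_pair[OF assms(5,6)] in auto)
 have "restr (subtopology X C) \<psi> = 0" if "C \<in> {A, B}" for C proof (intro ext)
  fix p \<sigma>
  show "restr (subtopology X C) \<psi> p \<sigma> = 0 p \<sigma>" using \<psi>(3)[OF ssimplex_subtopologyD small_simplex_in[OF _ that]]
   by (simp add: cochain_pullback_def simplex_map_ident)
 qed
 then show ?thesis using that \<psi> by simp
qed

text \<open>The coboundary of \<phi> may be nonzero on simplices contained in neither set; a cochain
  that vanishes over both sets corrects this.\<close>

lemma two_open_cocycle:
 assumes "openin X A" "openin X B" "topspace X \<subseteq> A \<union> B" "\<phi> \<in> cochains X"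
  "restr (subtopology X A) (coboundary X \<phi>) = 0" "restr (subtopology X B) (coboundary X \<phi>) = 0"
 obtains \<psi> where "\<psi> \<in> cocycles X"
  "restr (subtopology X A) \<psi> = restr (subtopology X A) \<phi>"
  "restr (subtopology X B) \<psi> = restr (subtopology X B) \<phi>" proof -
 obtain \<theta> where \<theta>: "\<theta> \<in> cochains X" "coboundary X \<theta> = coboundary X \<phi>"
  "restr (subtopology X A) \<theta> = 0" "restr (subtopology X B) \<theta> = 0"
  by (rule two_open_coboundary[OF assms(1-3) _ assms(5,6)]) (use assms(4) in auto)
 have "\<phi> + \<theta> \<in> cocycles X" using assms(4) \<theta> by (intro cocyclesI) (auto simp: coboundary_add cochain_double)
 then show ?thesis using that[of "\<phi> + \<theta>"] \<theta> by (simp add: pull_add)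
qed

definition degree_part :: "nat => 'a cochain => 'a cochain"
 where "degree_part d \<phi> = (\<lambda>p. if p = d then \<phi> p else (\<lambda>_. 0))"

lemma degree_part_cochains: "\<phi> \<in> cochains X ==> degree_part d \<phi> \<in> cochains X"
 by (rule cochainsI[where d = d]) (auto simp: degree_part_def cochains_off)

lemma degree_part_add: "degree_part d (\<phi> + \<psi>) = degree_part d \<phi> + degree_part d \<psi>" by (auto simp: degree_part_def fun_eq_iff)

lemma coboundary_degree_part: "coboundary X (degree_part d \<phi>) = degree_part (Suc d) (coboundary X \<phi>)"
 by (auto simp: degree_part_def coboundary_def fun_eq_iff intro!: sum.neutral)

lemma degree_part_0_coboundary: "degree_part 0 (coboundary X \<phi>) = 0" by (auto simp: degree_part_def coboundary_def fun_eq_iff)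

lemma degree_part_cocycles: "\<phi> \<in> cocycles X ==> degree_part d \<phi> \<in> cocycles X"
 by (auto simp: cocycles_def degree_part_cochains coboundary_degree_part) (auto simp: degree_part_def fun_eq_iff)

lemma degree_part_cobs:
 assumes "\<phi> \<in> cobs X"
 shows "degree_part d \<phi> \<in> cobs X" proof -
 obtain \<psi> where \<psi>: "\<psi> \<in> cochains X" "\<phi> = coboundary X \<psi>" using assms by (rule cobsE)
 show ?thesis proof (cases d)
  case 0
  then show ?thesis by (simp add: \<psi> degree_part_0_coboundary)
 next
  case (Suc e)
  then show ?thesis using cobsI[OF degree_part_cochains[OF \<psi>(1)], of e] by (simp add: \<psi> coboundary_degree_part)
 qed
qed

lemma degree_part_pullback: "degree_part d (pull X f \<phi>) = pull X f (degree_part d \<phi>)"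
 by (auto simp: degree_part_def cochain_pullback_def fun_eq_iff)

lemma degree_part_cup_right:
 assumes "degree_part e \<psi> = \<psi>"
 shows "degree_part (d + e) (cup X \<phi> \<psi>) = cup X (degree_part d \<phi>) \<psi>" proof (intro ext)
 fix n \<sigma>
 have z: "\<psi> p \<tau> = 0" if "p \<noteq> e" for p \<tau>
  using that fun_cong[OF fun_cong[OF assms, of p], of \<tau>] by (simp add: degree_part_def split: if_splits)
 have "degree_part d \<phi> p \<tau> * \<psi> (n - p) \<tau>' = (if n = d + e then \<phi> p \<tau> * \<psi> (n - p) \<tau>' else 0)" if "p \<le> n" for p \<tau> \<tau>'
  using that z by (auto simp: degree_part_def)
 then show "degree_part (d + e) (cup X \<phi> \<psi>) n \<sigma> = cup X (degree_part d \<phi>) \<psi> n \<sigma>"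
  by (simp add: cup_def degree_part_def[of "d + e"])
qed

text \<open>
 The Mayer--Vietoris argument computing the cohomology of a fibrewise suspension: every class on \<open>Z\<close>
 is of the form \<open>q\<^sup>*a + q\<^sup>*b s'\<close>, where \<open>s'\<close> is the image of \<open>s\<close> under the connecting map.
\<close>

theorem fibrewise_suspension:
 fixes q :: "'z => 'x"
 assumes q: "continuous_map Z X q" and D: "openin Z A" "openin Z B" "topspace Z \<subseteq> A \<union> B"
  and A: "\<And>u. u \<in> cocycles (subtopology Z A) ==>
   \<exists>a\<in>cocycles X. u + pull (subtopology Z A) q a \<in> cobs (subtopology Z A)"
  and B: "\<And>u. u \<in> cocycles (subtopology Z B) ==>
   \<exists>a\<in>cocycles X. u + pull (subtopology Z B) q a \<in> cobs (subtopology Z B)"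
  and s: "s \<in> cocycles (subtopology Z (A \<inter> B))" "degree_part d s = s"
  and M: "\<And>u. u \<in> cocycles (subtopology Z (A \<inter> B)) ==> \<exists>a\<in>cocycles X. \<exists>b\<in>cocycles X.
   u + pull (subtopology Z (A \<inter> B)) q a + cup (subtopology Z (A \<inter> B)) (pull (subtopology Z (A \<inter> B)) q b) s
   \<in> cobs (subtopology Z (A \<inter> B))"
  and inj: "\<And>c. c \<in> cocycles X ==>
   pull (subtopology Z (A \<inter> B)) q c \<in> cobs (subtopology Z (A \<inter> B)) ==> c \<in> cobs X"
 obtains s' where "s' \<in> cocycles Z" "degree_part (Suc d) s' = s'"
  "\<forall>u\<in>cocycles Z. \<exists>a\<in>cocycles X. \<exists>b\<in>cocycles X.
   u + pull Z q a + cup Z (pull Z q b) s' \<in> cobs Z" proof -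
 let ?A = "subtopology Z A" and ?B = "subtopology Z B" and ?M = "subtopology Z (A \<inter> B)"
 let ?rA = "restr (subtopology Z A)" and ?rB = "restr (subtopology Z B)"
  and ?rM = "restr (subtopology Z (A \<inter> B))"
 have MA: "?rM (?rA \<phi>) = ?rM \<phi>" and MB: "?rM (?rB \<phi>) = ?rM \<phi>" for \<phi> by (simp_all add: restrict_restrict)
 have MAc: "continuous_map ?M ?A (\<lambda>x. x)" and MBc: "continuous_map ?M ?B (\<lambda>x. x)" by (auto simp: continuous_map_in_subtopology)
 have qMA: "?rM (pull ?A q \<phi>) = pull ?M q \<phi>"
  "?rM (pull ?B q \<phi>) = pull ?M q \<phi>" for \<phi>
  by (simp_all add: pull_compose[OF MAc] pull_compose[OF MBc] o_def)
 have ext: "\<phi> \<in> cochains Z" "?rM \<phi> = \<phi>" if "\<phi> \<in> cochains ?M" for \<phi>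
  using that by (auto intro: cochains_subtopology pull_ident)
 have qA: "continuous_map ?A X q" and qB: "continuous_map ?B X q" and qM: "continuous_map ?M X q" using q by (auto intro: continuous_map_from_subtopology)
 have sZ: "s \<in> cochains Z" and sM: "?rM s = s" using ext[OF cocyclesD(1)[OF s(1)]] by auto
 have "?rM (coboundary Z s) = 0" by (simp add: restrict_algebra sM cocyclesD(2)[OF s(1)])
 then have "?rM 0 = ?rM (?rB (coboundary Z s))" by (simp add: MB)
 \<comment> \<open>The connecting map: s is extended by zero to Z, and t is 0 over A and the
   coboundary of s over B. The two agree over the intersection because s is a cocycle there.\<close>
 then obtain t where t: "t \<in> cochains Z" "?rA t = 0" "?rB t = ?rB (coboundary Z s)"
  by (rule glue_cochains[of 0 Z A "?rB (coboundary Z s)" B, rotated 2]) (use sZ in auto)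
 obtain s'' where s'': "s'' \<in> cocycles Z" "?rA s'' = ?rA t" "?rB s'' = ?rB t"
  by (rule two_open_cocycle[OF D t(1)]) (use t in \<open>simp_all add: restrict_algebra\<close>)
 define s' where "s' = degree_part (Suc d) s''"
 have s': "s' \<in> cocycles Z" "?rA s' = 0" "?rB s' = ?rB (coboundary Z s)" "degree_part (Suc d) s' = s'" proof -
  show "s' \<in> cocycles Z" using s''(1) by (simp add: s'_def degree_part_cocycles)
  show "?rA s' = 0" by (simp add: s'_def s''(2) t(2) flip: degree_part_pullback) (simp add: degree_part_def fun_eq_iff)
  show "?rB s' = ?rB (coboundary Z s)"
   by (simp add: s'_def s''(3) t(3) flip: degree_part_pullback) (simp add: degree_part_pullback s(2) flip: coboundary_degree_part)
  show "degree_part (Suc d) s' = s'" by (auto simp: s'_def degree_part_def fun_eq_iff)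
 qed
 have "\<exists>a\<in>cocycles X. \<exists>b\<in>cocycles X. u + pull Z q a + cup Z (pull Z q b) s' \<in> cobs Z"
  if u: "u \<in> cocycles Z" for u proof -
  have uA: "?rA u \<in> cocycles ?A" and uB: "?rB u \<in> cocycles ?B" using u by (auto intro: pull_cocycles)
  obtain a1 where a1: "a1 \<in> cocycles X" "?rA u + pull ?A q a1 \<in> cobs ?A" using A[OF uA] by auto
  obtain a2 where a2: "a2 \<in> cocycles X" "?rB u + pull ?B q a2 \<in> cobs ?B" using B[OF uB] by auto
  have "?rM (?rA u + pull ?A q a1) \<in> cobs ?M" "?rM (?rB u + pull ?B q a2) \<in> cobs ?M"
   by (rule pull_cobs[OF a1(2) MAc], rule pull_cobs[OF a2(2) MBc])
  \<comment> \<open>Over the intersection the pullbacks of a1 and a2 are cohomologous, and by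
    injectivity a1 and a2 are so on X; thus a1 serves for both sets.\<close>
  from cobs_add[OF this] have "pull ?M q (a1 + a2) \<in> cobs ?M" by (simp add: pull_add MA MB qMA cochain_ac)
  then have "a1 + a2 \<in> cobs X" using a1(1) a2(1) by (intro inj) auto
  then have "pull ?B q (a1 + a2) \<in> cobs ?B" using qB by (rule pull_cobs)
  from cobs_add[OF a2(2) this] have "?rB u + pull ?B q a1 \<in> cobs ?B" by (simp add: pull_add cochain_ac)
  then obtain l2 where l2: "l2 \<in> cochains ?B" "?rB u + pull ?B q a1 = coboundary ?B l2" by (rule cobsE)
  obtain l1 where l1: "l1 \<in> cochains ?A" "?rA u + pull ?A q a1 = coboundary ?A l1" using a1(2) by (rule cobsE)
  have "?rM (?rA u + pull ?A q a1) = coboundary ?M (?rM l1)" "?rM (?rB u + pull ?B q a1) = coboundary ?M (?rM l2)"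
   unfolding l1 l2 by (rule pull_coboundary[OF MAc], rule pull_coboundary[OF MBc])
  then have "coboundary ?M (?rM l1) = coboundary ?M (?rM l2)" by (simp add: pull_add MA MB qMA)
  then have "?rM l1 + ?rM l2 \<in> cocycles ?M" using l1(1) l2(1) by (intro cocyclesI) (auto simp: coboundary_add cochain_double)
  then obtain a b where ab: "a \<in> cocycles X" "b \<in> cocycles X"
   "?rM l1 + ?rM l2 + pull ?M q a + cup ?M (pull ?M q b) s \<in> cobs ?M" using M by blast
  then obtain \<nu> where \<nu>: "\<nu> \<in> cochains ?M"
   "?rM l1 + ?rM l2 + pull ?M q a + cup ?M (pull ?M q b) s = coboundary ?M \<nu>" using cobsE by blast
  \<comment> \<open>Over the intersection l1 and l2 differ by m, a cochain of the form provided by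
    \<open>M\<close>. As m is defined on all of Z, it can be added to l2 over B, after which the
    primitives glue to \<omega>.\<close>
  define m where "m = pull Z q a + cup Z (pull Z q b) s + coboundary Z \<nu>"
  have m: "m \<in> cochains Z" using cocyclesD(1)[OF ab(1)] cocyclesD(1)[OF ab(2)] sZ ext(1)[OF \<nu>(1)] by (auto simp: m_def)
  have rm: "?rM m = pull ?M q a + cup ?M (pull ?M q b) s + coboundary ?M \<nu>"
   by (simp add: m_def restrict_algebra sM ext(2)[OF \<nu>(1)])
  have "?rM l1 + (?rM l1 + ?rM l2 + pull ?M q a + cup ?M (pull ?M q b) s) = ?rM l1 + coboundary ?M \<nu>" by (simp add: \<nu>(2))
  then have "?rM l1 = ?rM (l2 + ?rB m)" by (simp add: pull_add MB rm cochain_ac)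
  then obtain \<omega> where \<omega>: "\<omega> \<in> cochains Z" "?rA \<omega> = l1" "?rB \<omega> = l2 + ?rB m"
   by (rule glue_cochains[OF l1(1), of "l2 + ?rB m" B, rotated]) (use l2 m in auto)
  \<comment> \<open>Over B the coboundary of m is the pullback of b times the coboundary of s, which
    is exactly what the term with s' contributes there; so y vanishes over both sets.\<close>
  define y where "y = u + pull Z q a1 + cup Z (pull Z q b) s' + coboundary Z \<omega>"
  have "y \<in> cocycles Z" using u a1(1) ab(2) s'(1) \<omega>(1) q unfolding y_def by (intro cocycles_add cocycles_cup) auto
  moreover have "?rA y = 0" unfolding y_def by (simp add: restrict_algebra s' \<omega> l1)
  moreover have "?rB y = 0" proof -
   have "coboundary ?B (?rB m) = ?rB (coboundary Z m)" by (simp add: restrict_algebra)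
   also have "coboundary Z m = cup Z (pull Z q b) (coboundary Z s)" using cocyclesD(2)[OF ab(1)] cocyclesD(2)[OF ab(2)]
    by (simp add: m_def coboundary_add coboundary_cup flip: pull_coboundary[OF q])
   finally show ?thesis unfolding y_def using l2(2)[symmetric] s'(3) by (simp add: restrict_algebra coboundary_add \<omega> cochain_ac)
  qed
  ultimately have "y \<in> cobs Z" using two_open_coboundary[OF D] cobsI by metis
  then have "u + pull Z q a1 + cup Z (pull Z q b) s' \<in> cobs Z"
   using coboundary_transfer[of "u + pull Z q a1 + cup Z (pull Z q b) s'" "coboundary Z \<omega>" Z] \<omega>(1) by (auto simp: y_def)
  then show ?thesis using a1(1) ab(2) by blast
 qed
 then show ?thesis using that s' by blast
qed

section \<open>The cohomology of trivialized sphere bundles\<close>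

text \<open>A frame in reduced echelon form: in the columns I 0, ..., I (r - 1) it is the identity
  matrix. The coefficients of a vector in the frame are therefore among its coordinates, hence
  continuous.\<close>

definition chart :: "nat => 'b topology => nat => (nat => nat) => (nat => 'b => nat => real) => bool"
 where "chart n X r I f \<longleftrightarrow> (\<forall>j<r. \<forall>i. cont_real X (\<lambda>b. f j b i)) \<and>
  (\<forall>j<r. \<forall>b\<in>topspace X. \<forall>i\<ge>n. f j b i = 0) \<and>
  (\<forall>j<r. \<forall>k<r. \<forall>b\<in>topspace X. f j b (I k) = (if j = k then 1 else 0))"

lemma chartD:
 assumes "chart n X r I f" "j < r"
 shows "cont_real X (\<lambda>b. f j b i)" "b \<in> topspace X ==> i \<ge> n ==> f j b i = 0"
  "k < r ==> b \<in> topspace X ==> f j b (I k) = (if j = k then 1 else 0)" using assms by (auto simp: chart_def)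

lemma chart_span_coordinate:
 assumes "chart n X r I f" "k \<le> r" "j < k" "b \<in> topspace X"
 shows "(\<Sum>l<k. c l * f l b (I j)) = c j" proof -
 have "(\<Sum>l<k. c l * f l b (I j)) = (\<Sum>l<k. if l = j then c l else 0)" using assms by (intro sum.cong) (auto simp: chart_def)
 then show ?thesis using assms(3) by simp
qed

lemma chart_frame:
 assumes "chart n X r I f"
 shows "frame n X r f" unfolding frame_def proof (intro conjI allI impI ballI)
 fix b c j assume b: "b \<in> topspace X" and z: "\<forall>i. (\<Sum>j<r. c j * f j b i) = 0" and "j < r"
 then show "c j = 0" using chart_span_coordinate[OF assms order_refl \<open>j < r\<close> b, of c] by simp
qed (use assms in \<open>auto simp: chart_def\<close>)

lemma chart_span_eq:
 assumes "chart n X r I f" "k \<le> r" "b \<in> topspace X" "v \<in> frame_span f k b"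
 shows "v = (\<lambda>i. \<Sum>l<k. v (I l) * f l b i)" proof -
 obtain c where c: "v = (\<lambda>i. \<Sum>l<k. c l * f l b i)" using assms(4) by (auto simp: frame_span_def)
 then have "v (I l) = c l" if "l < k" for l using chart_span_coordinate[OF assms(1,2) that assms(3), of c] by simp
 then show ?thesis using c by simp
qed

lemma chart_span_nonzero:
 assumes "chart n X r I f" "k \<le> r" "b \<in> topspace X" "v \<in> frame_span f k b" "v \<noteq> (\<lambda>i. 0)"
 shows "\<exists>j<k. v (I j) \<noteq> 0" proof (rule ccontr)
 assume "\<not> ?thesis"
 then have "v = (\<lambda>i. 0)" by (subst chart_span_eq[OF assms(1-4)]) simp
 then show False using assms(5) by simp
qed

lemma frame_span_Suc_remove:
 assumes "chart n X r I f" "Suc k \<le> r" "b \<in> topspace X" "v \<in> frame_span f (Suc k) b"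
 shows "(\<lambda>i. v i - v (I k) * f k b i) \<in> frame_span f k b" proof -
 have "v i - v (I k) * f k b i = (\<Sum>l<k. v (I l) * f l b i)" for i using fun_cong[OF chart_span_eq[OF assms], of i] by simp
 then show ?thesis using frame_spanI[where k = k and c = "\<lambda>l. v (I l)" and f = f and b = b] by simp
qed

lemma ssimplex_continuous:
 assumes "ssimplex p Z \<sigma>" "cont_real Z g"
 shows "continuous_on (std_simplex p) (\<lambda>x. g (\<sigma> x))" using assms(1) continuous_map_comp[OF _ assms(2)]
 by (auto simp: singular_simplex_def simp flip: continuous_map_simplex)

lemma vertex_in_simplex: "i \<le> p ==> vertex i \<in> std_simplex p"
 by (simp add: standard_simplex_def if_distrib[of "\<lambda>x. x \<le> _"] cong: if_cong)

text \<open>Only generation by 1 and a class s of degree d over the base is recorded; what is needed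
  of uniqueness comes from \<open>framed_top_power_injective\<close>.\<close>

definition sphere_classes :: "nat => 'b topology => ('b => (nat => real) set) => nat => bool"
 where "sphere_classes n X V d \<longleftrightarrow> (\<exists>s\<in>cocycles (sbundle n X V). degree_part d s = s \<and>
  (\<forall>u\<in>cocycles (sbundle n X V). \<exists>a\<in>cocycles X. \<exists>b\<in>cocycles X.
   u + pull (sbundle n X V) fst a + cup (sbundle n X V) (pull (sbundle n X V) fst b) s
   \<in> cobs (sbundle n X V)))"

lemma simplex_map_eq:
 assumes "ssimplex p Z \<tau>" "\<And>x. x \<in> std_simplex p ==> g (\<tau> x) = \<tau> x"
 shows "simplex_map p g \<tau> = \<tau>" using assms by (auto simp: simplex_map_def singular_simplex_def extensional_def fun_eq_iff)

text \<open>The sphere bundle of a framed line bundle is two copies of the base, told apart by the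
  sign of the coordinate \<open>I 0\<close>. With s the indicator of the positive copy, the
  decomposition is an identity of cochains.\<close>

lemma sphere_classes_1:
 assumes ch: "chart n X r I f" and "0 < r"
 shows "sphere_classes n X (frame_span f (Suc 0)) 0" proof -
 let ?V = "frame_span f (Suc 0)"
 let ?S = "sbundle n X ?V"
 note fr = chart_frame[OF ch]
 define sec where "sec = (\<lambda>e::real. \<lambda>b. (b, \<lambda>i. e * normalize_vec n (f 0 b) i))"
 have sec: "continuous_map X ?S (sec e)" if "e = 1 \<or> e = -1" for e proof -
  have c: "continuous_map X ?S (\<lambda>b. (b, normalize_vec n (f 0 b)))" using continuous_frame_section[OF fr, of 0 "Suc 0"] \<open>0 < r\<close> by simp
  then show ?thesis unfolding sec_def continuous_map_sbundle using that by (auto intro!: continuous_intros lin_closed_minus lin_closed_frame_span)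
 qed
 define pos where "pos = (\<lambda>z :: 'a \<times> (nat => real). if snd z (I 0) > 0 then 1 else 0 :: bit)"
 have nz: "snd z (I 0) \<noteq> 0" if "z \<in> topspace ?S" for z proof -
  note zD = sbundleD[OF that]
  have "snd z \<noteq> (\<lambda>i. 0)" using zD(3) by auto
  then show ?thesis using chart_span_nonzero[OF ch _ zD(1,2)] \<open>0 < r\<close> by auto
 qed
 have sgn: "pos (\<tau> x) = pos (\<tau> y)" if \<tau>: "ssimplex p ?S \<tau>" and xy: "x \<in> std_simplex p" "y \<in> std_simplex p" for p \<tau> x y
 proof -
  have "\<tau> w \<in> topspace ?S" if "w \<in> std_simplex p" for w using \<tau> that by (auto simp: singular_simplex_def continuous_map_def)
  then show ?thesis
   using nonvanishing_constant_sign[OF connected_std_simplex ssimplex_continuous[OF \<tau> sbundle_coordinates(2)], of "I 0"] nz xy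
   unfolding pos_def by (smt (verit))
 qed
 have secpos: "z = sec (if pos z = 1 then 1 else -1) (fst z)" if "z \<in> topspace ?S" for z proof -
  note zD = sbundleD[OF that]
  define c where "c = snd z (I 0)"
  have v: "snd z = (\<lambda>i. c * f 0 (fst z) i)" using chart_span_eq[OF ch _ zD(1,2)] \<open>0 < r\<close> by (simp add: c_def)
  have "dotn n (f 0 (fst z)) (f 0 (fst z)) > 0" using frame_nonzero(2)[OF fr \<open>0 < r\<close> zD(1)] .
  moreover have "c\<^sup>2 * dotn n (f 0 (fst z)) (f 0 (fst z)) = 1" using zD(3) by (simp add: v power2_eq_square mult.assoc)
  ultimately have "\<bar>c\<bar> = 1 / sqrt (dotn n (f 0 (fst z)) (f 0 (fst z)))"
   by (metis nonzero_eq_divide_eq less_irrefl real_sqrt_abs real_sqrt_divide real_sqrt_one)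
  then have ceq: "c = (if c > 0 then 1 else -1) * (1 / sqrt (dotn n (f 0 (fst z)) (f 0 (fst z))))" by (auto split: if_splits)
  have "snd z i = (if c > 0 then 1 else -1) * normalize_vec n (f 0 (fst z)) i" for i proof -
   have "snd z i = (if c > 0 then 1 else -1) * (1 / sqrt (dotn n (f 0 (fst z)) (f 0 (fst z)))) * f 0 (fst z) i"
    using fun_cong[OF v, of i] arg_cong[OF ceq, of "\<lambda>c. c * f 0 (fst z) i"] by (rule trans)
   then show ?thesis by (simp add: normalize_vec_def)
  qed
  then have "snd z = (\<lambda>i. (if c > 0 then 1 else -1) * normalize_vec n (f 0 (fst z)) i)" by (rule ext)
  moreover have "(if pos z = 1 then 1 else -1) = (if c > 0 then 1 else -1 :: real)" by (simp add: pos_def c_def)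
  ultimately show ?thesis unfolding sec_def by (intro prod_eqI) (simp_all only: fst_conv snd_conv)
 qed
 define s where "s = point_cochain ?S pos"
 have "pos (\<tau> (vertex 0)) + pos (\<tau> (vertex 1)) = 0" if "ssimplex 1 ?S \<tau>" for \<tau>
  using sgn[OF that vertex_in_simplex vertex_in_simplex, of 0 1] by (simp add: bit_double)
 then have "coboundary ?S s = 0" unfolding s_def coboundary_point_cochain by (intro ext) simp
 then have s: "s \<in> cocycles ?S" by (simp add: s_def cocyclesI)
 moreover have "degree_part 0 s = s" by (auto simp: degree_part_def s_def point_cochain_def fun_eq_iff)
 moreover have "\<exists>a\<in>cocycles X. \<exists>b\<in>cocycles X.
   u + pull ?S fst a + cup ?S (pull ?S fst b) s \<in> cobs ?S"
  if u: "u \<in> cocycles ?S" for u proof -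
  define a where "a = pull X (sec (-1)) u"
  define b where "b = a + pull X (sec 1) u"
  have ab: "a \<in> cocycles X" "b \<in> cocycles X" using u sec by (auto simp: a_def b_def)
  have "(u + pull ?S fst a + cup ?S (pull ?S fst b) s) p \<tau> = 0" for p \<tau> proof (cases "ssimplex p ?S \<tau>")
   case \<tau>: True
   have top: "\<tau> w \<in> topspace ?S" if "w \<in> std_simplex p" for w using \<tau> that by (auto simp: singular_simplex_def continuous_map_def)
   let ?e = "if pos (\<tau> (vertex p)) = 1 then 1 else -1"
   have q: "ssimplex p X (simplex_map p fst \<tau>)" using \<tau> sbundle_coordinates(1) by (rule singular_simplex_simplex_map)
   have "simplex_map p (sec e) (simplex_map p fst \<tau>) = simplex_map p (sec e \<circ> fst) \<tau>" for e by (simp add: simplex_map_compose)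
   moreover have "simplex_map p (sec ?e \<circ> fst) \<tau> = \<tau>" proof (rule simplex_map_eq[OF \<tau>])
    fix x assume x: "x \<in> std_simplex p"
    show "(sec ?e \<circ> fst) (\<tau> x) = \<tau> x"
     using secpos[OF top[OF x], symmetric] unfolding o_def sgn[OF \<tau> x vertex_in_simplex[OF order_refl]] .
   qed
   ultimately have e: "simplex_map p (sec ?e) (simplex_map p fst \<tau>) = \<tau>" by simp
   have "cup ?S (pull ?S fst b) s p \<tau> = (\<Sum>i\<le>p. if i = p then pull ?S fst b p \<tau> * pos (\<tau> (vertex p)) else 0)"
   proof -
    have "s (p - i) \<rho> = 0" if "i < p" for i \<rho> using that by (simp add: s_def point_cochain_def)
    moreover have "front_face p \<tau> = \<tau>" using \<tau> by (auto simp: front_face_def singular_simplex_def extensional_restrict)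
    moreover have "ssimplex 0 ?S (back_face p 0 \<tau>)" using ssimplex_back_face[of p 0 ?S \<tau>] \<tau> by simp
    moreover have "back_face p 0 \<tau> (vertex 0) = \<tau> (vertex p)"
     using vertex_in_simplex[of 0 0] by (auto simp: back_face_def intro!: arg_cong[of _ _ \<tau>])
    ultimately show ?thesis unfolding cup_eval[OF \<tau>] by (intro sum.cong) (auto simp: s_def point_cochain_def)
   qed
   then show ?thesis using e q by (cases "pos (\<tau> (vertex p)) = 1") (auto simp: \<tau> pull_eval a_def b_def bit_double)
  qed (simp add: cochains_off[OF cocyclesD(1)[OF u]] pull_off cup_off)
  then have "u + pull ?S fst a + cup ?S (pull ?S fst b) s = 0" by (intro ext) simp
  then show ?thesis using ab by (metis cobs_0)
 qed
 ultimately show ?thesis unfolding sphere_classes_def by blast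
qed

text \<open>For e = 1 and e = -1, \<open>D e\<close> is the sphere bundle without the section
  opposite to e times the last frame vector, and contracts onto the section in that direction. The
  two sets meet in a set that retracts onto the sphere bundle of one rank less, so
  \<open>fibrewise_suspension\<close> applies and raises the degree of s by one.\<close>

lemma sphere_classes_Suc:
 assumes ch: "chart n X r I f" and k: "Suc k < r" and S: "sphere_classes n X (frame_span f (Suc k)) k"
 shows "sphere_classes n X (frame_span f (Suc (Suc k))) (Suc k)" proof -
 let ?m = "Suc k"
 let ?W = "frame_span f ?m" and ?V = "frame_span f (Suc ?m)"
 let ?Z = "sbundle n X ?V" and ?R = "sbundle n X ?W"
 note fr = chart_frame[OF ch] and lin = lin_closed_frame_span
 define D where "D = (\<lambda>e::real. {z \<in> topspace ?Z. e * snd z (I ?m) > 0 \<or> (\<exists>j<?m. snd z (I j) \<noteq> 0)})"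
 have fm: "f ?m b (I ?m) = 1" "j < ?m ==> f ?m b (I j) = 0" if "b \<in> topspace X" for b j using chartD(3)[OF ch k _ that] k by auto
 have nf: "dotn n (f ?m b) (f ?m b) > 0" if "b \<in> topspace X" for b using frame_nonzero(2)[OF fr k that] .
 have opD: "openin ?Z (D e)" for e proof -
  have "D e = {z \<in> topspace ?Z. e * snd z (I ?m) \<in> {0<..}} \<union> (\<Union>j\<in>{..<?m}. {z \<in> topspace ?Z. snd z (I j) \<in> - {0}})"
   by (auto simp: D_def)
  also have "openin ?Z \<dots>" proof (intro openin_Un openin_Union)
   show "openin ?Z {z \<in> topspace ?Z. e * snd z (I ?m) \<in> {0<..}}" by (rule openin_continuous_map_preimage[where Y = euclideanreal])
     (auto intro!: continuous_intros sbundle_coordinates)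
   have "openin ?Z {z \<in> topspace ?Z. snd z (I j) \<in> - {0}}" for j by (rule openin_continuous_map_preimage[OF sbundle_coordinates(2)]) auto
   then show "openin ?Z U" if "U \<in> (\<lambda>j. {z \<in> topspace ?Z. snd z (I j) \<in> - {0}}) ` {..<?m}" for U using that by blast
  qed
  finally show ?thesis .
 qed
 have cover: "topspace ?Z \<subseteq> D 1 \<union> D (-1)" proof
  fix z assume z: "z \<in> topspace ?Z"
  note zD = sbundleD[OF z]
  have "snd z \<noteq> (\<lambda>i. 0)" using zD(3) by auto
  then obtain j where "j < Suc ?m" "snd z (I j) \<noteq> 0" using chart_span_nonzero[OF ch _ zD(1,2)] k by auto
  then show "z \<in> D 1 \<union> D (-1)" using z by (cases "j = ?m") (auto simp: D_def)
 qed
 have DD: "D 1 \<inter> D (-1) = {z \<in> topspace ?Z. \<exists>j<?m. snd z (I j) \<noteq> 0}" by (auto simp: D_def)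
 have one: "\<exists>a\<in>cocycles X. u + pull (subtopology ?Z (D e)) fst a \<in> cobs (subtopology ?Z (D e))"
  if u: "u \<in> cocycles (subtopology ?Z (D e))" and e: "e\<^sup>2 = 1" for u and e :: real proof -
  let ?D = "subtopology ?Z (D e)"
  have e0: "e * e = 1" "e \<noteq> 0" using e by (auto simp: power2_eq_square)
  define sec where "sec = (\<lambda>b. (b, normalize_vec n (\<lambda>i. e * f ?m b i)))"
  have sz: "continuous_map X ?Z sec" unfolding continuous_map_sbundle proof (intro conjI allI ballI impI)
   show "continuous_map X X (\<lambda>b. fst (sec b))" by (simp add: sec_def)
   show "cont_real X (\<lambda>b. snd (sec b) i)" for i unfolding sec_def snd_conv using chartD(1)[OF ch k] nf e0
    by (intro continuous_normalize_vec continuous_intros) (auto simp: mult.assoc[symmetric])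
   fix b assume b: "b \<in> topspace X"
   show "snd (sec b) \<in> ?V (fst (sec b))" unfolding sec_def fst_conv snd_conv normalize_vec_scale by (intro lin_closed_scale lin frame_span_member lessI)
   show "dotn n (snd (sec b)) (snd (sec b)) = 1"
    unfolding sec_def snd_conv using nf[OF b] e0 by (intro normalize_vec_unit) (simp add: mult.assoc[symmetric])
   show "snd (sec b) i = 0" if "i \<ge> n" for i using chartD(2)[OF ch k b that] by (simp add: sec_def normalize_vec_def)
  qed
  have sD: "sec b \<in> D e" if b: "b \<in> topspace X" for b proof -
   have "e * (e * f ?m b (I ?m)) / sqrt (dotn n (\<lambda>i. e * f ?m b i) (\<lambda>i. e * f ?m b i)) > 0"
    using fm(1)[OF b] nf[OF b] e0 by (simp add: mult.assoc[symmetric])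
   then show ?thesis using continuous_map_mem[OF sz b] by (simp add: D_def sec_def normalize_vec_def)
  qed
  have sec: "continuous_map X ?D sec" using sz sD by (auto simp: continuous_map_in_subtopology)
  have top: "z \<in> topspace ?D ==> z \<in> topspace ?Z \<and> z \<in> D e" for z by simp
  have "homotopic_with (\<lambda>_. True) ?D ?D (\<lambda>z. z) (\<lambda>z. sec (fst z))" proof (rule sphere_homotopy)
   show "continuous_map ?D ?Z (\<lambda>z. sec (fst z))"
    using continuous_map_comp[OF continuous_map_from_subtopology[OF sbundle_coordinates(1)] sz] .
   fix z and t :: real assume z: "z \<in> topspace ?D" and t: "0 \<le> t" "t \<le> 1"
   note zD = sbundleD[OF conjunct1[OF top[OF z]]]
   define c where "c = t / sqrt (dotn n (f ?m (fst z)) (f ?m (fst z)))"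
   define w where "w = (\<lambda>i. (1 - t) * snd z i + t * snd (sec (fst z)) i)"
   have se: "snd (sec (fst z)) i = e * f ?m (fst z) i / sqrt (dotn n (f ?m (fst z)) (f ?m (fst z)))" for i
    using e0 by (simp add: sec_def normalize_vec_def mult.assoc[symmetric])
   have wj: "j < ?m ==> w (I j) = (1 - t) * snd z (I j)" and wm: "e * w (I ?m) = (1 - t) * (e * snd z (I ?m)) + c" for j
    using fm[OF zD(1)] e0 by (simp_all add: w_def se c_def algebra_simps)
   have c: "c \<ge> 0" "t > 0 ==> c > 0" using t nf[OF zD(1)] by (simp_all add: c_def)
   have D: "e * w (I ?m) > 0 \<or> (\<exists>j<?m. w (I j) \<noteq> 0)" proof (cases "t < 1 \<and> (\<exists>j<?m. snd z (I j) \<noteq> 0)")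
    case True
    then show ?thesis using wj by auto
   next
    case False
    have "e * w (I ?m) > 0" proof (cases "t = 1")
     case True
     then show ?thesis using c wm by simp
    next
     case f: False
     then have "e * snd z (I ?m) > 0" using False t top[OF z] by (auto simp: D_def)
     then have "(1 - t) * (e * snd z (I ?m)) > 0" using f t by simp
     then show ?thesis using wm c by linarith
    qed
    then show ?thesis ..
   qed
   then show nz: "w \<noteq> (\<lambda>i. 0)" by auto
   have wsupp: "w i = 0" if "i \<ge> n" for i using that zD(4) sbundleD(4)[OF continuous_map_mem[OF sz zD(1)]] by (simp add: w_def)
   have ww: "dotn n w w > 0" using wsupp nz by (rule dotn_pos)
   have wV: "w \<in> ?V (fst z)" using zD(2) sbundleD(2)[OF continuous_map_mem[OF sz zD(1)]] lin[of f "Suc ?m" "fst z"]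
    unfolding w_def lin_closed_def by (simp add: sec_def)
   have "normalize_vec n w \<in> ?V (fst z)" unfolding normalize_vec_scale by (intro lin_closed_scale lin wV)
   moreover have "normalize_vec n w i = 0" if "i \<ge> n" for i using wsupp[OF that] by (simp add: normalize_vec_def)
   ultimately have "(fst z, normalize_vec n w) \<in> topspace ?Z" unfolding topspace_sbundle using zD(1) normalize_vec_unit[OF ww] by simp
   then show "(fst z, normalize_vec n w) \<in> D e" using D ww by (auto simp: D_def normalize_vec_def zero_less_divide_iff)
  qed (auto simp: sec_def lin continuous_map_from_subtopology)
  then have "pull ?D (\<lambda>z. z) u + pull ?D (\<lambda>z. sec (fst z)) u \<in> cobs ?D"
   using u by (rule homotopic_pullback_cohomologous)
  moreover have "pull ?D (\<lambda>z. sec (fst z)) u = pull ?D fst (pull X sec u)"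
   by (subst pull_compose) (auto simp: o_def intro!: continuous_map_from_subtopology sbundle_coordinates(1))
  ultimately show ?thesis using pull_ident[OF cocyclesD(1)[OF u]] pull_cocycles[OF u sec] by auto
 qed
 define E where "E = D 1 \<inter> D (-1)"
 let ?M = "subtopology ?Z E"
 have Etop: "z \<in> topspace ?Z" "z \<in> E" if "z \<in> topspace ?M" for z using that by auto
 \<comment> \<open>The component along the last frame vector is removed; over the intersection a
   nonzero vector remains, whose normalization is the retraction \<open>ret\<close>.\<close>
 define red where "red = (\<lambda>z :: 'a \<times> (nat => real). \<lambda>i. snd z i - snd z (I ?m) * f ?m (fst z) i)"
 have redj: "red z (I j) = snd z (I j)" if "fst z \<in> topspace X" "j < ?m" for z j using fm(2)[OF that] by (simp add: red_def)
 have reds: "red z i = 0" if "z \<in> topspace ?Z" "i \<ge> n" for z i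
  using sbundleD(4)[OF that] chartD(2)[OF ch k sbundleD(1)[OF that(1)] that(2)] by (simp add: red_def)
 have redp: "dotn n (red z) (red z) > 0" if z: "z \<in> topspace ?M" for z proof (rule dotn_pos)
  show "red z \<noteq> (\<lambda>i. 0)" using Etop(2)[OF z] redj[OF sbundleD(1)[OF Etop(1)[OF z]]] unfolding E_def DD by fastforce
 qed (use reds Etop(1)[OF z] in auto)
 have redW: "red z \<in> ?W (fst z)" if "z \<in> topspace ?Z" for z
  unfolding red_def using sbundleD[OF that] k by (intro frame_span_Suc_remove[OF ch]) auto
 define ret where "ret = (\<lambda>z. (fst z, normalize_vec n (red z)))"
 have qM: "continuous_map ?M X fst" by (intro continuous_map_from_subtopology sbundle_coordinates(1))
 have ret: "continuous_map ?M ?R ret" unfolding continuous_map_sbundle proof (intro conjI allI ballI impI)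
  show "continuous_map ?M X (\<lambda>z. fst (ret z))" using qM by (simp add: ret_def)
  have "cont_real ?M (\<lambda>z. snd z i)" "cont_real ?M (\<lambda>z. f ?m (fst z) i)" for i
   using continuous_map_comp[OF qM chartD(1)[OF ch k]] by (simp_all add: continuous_map_from_subtopology sbundle_coordinates(2))
  then have "cont_real ?M (\<lambda>z. red z i)" for i unfolding red_def by (intro continuous_map_diff continuous_map_real_mult)
  then show "cont_real ?M (\<lambda>z. snd (ret z) i)" for i unfolding ret_def snd_conv using redp by (intro continuous_normalize_vec) auto
  fix z assume z: "z \<in> topspace ?M"
  show "snd (ret z) \<in> ?W (fst (ret z))" unfolding ret_def fst_conv snd_conv normalize_vec_scale by (intro lin_closed_scale lin redW Etop(1) z)
  show "dotn n (snd (ret z)) (snd (ret z)) = 1" unfolding ret_def snd_conv by (intro normalize_vec_unit redp z)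
  show "snd (ret z) i = 0" if "i \<ge> n" for i using reds[OF Etop(1)[OF z] that] by (simp add: ret_def normalize_vec_def)
 qed
 have RZ: "z \<in> topspace ?Z \<and> z \<in> E" if z: "z \<in> topspace ?R" for z proof -
  note zD = sbundleD[OF z]
  have tz: "z \<in> topspace ?Z" using zD frame_span_mono[OF zD(2)] by (cases z) (simp add: topspace_sbundle)
  have "snd z \<noteq> (\<lambda>i. 0)" using zD(3) by auto
  then show ?thesis using chart_span_nonzero[OF ch _ zD(1,2)] k tz by (simp add: E_def DD)
 qed
 have incZ: "continuous_map ?R ?Z (\<lambda>z. z)" unfolding continuous_map_sbundle
  using RZ sbundleD[of _ n X ?V] by (auto simp: sbundle_coordinates)
 have inc: "continuous_map ?R ?M (\<lambda>z. z)" using incZ RZ by (auto simp: continuous_map_in_subtopology)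
 have hM: "homotopic_with (\<lambda>_. True) ?M ?M (\<lambda>z. z) ret" proof (rule sphere_homotopy)
  show rz: "continuous_map ?M ?Z ret" using continuous_map_comp[OF ret incZ] by simp
  fix z and t :: real assume z: "z \<in> topspace ?M" and t: "0 \<le> t" "t \<le> 1"
  note zD = sbundleD[OF Etop(1)[OF z]]
  define w where "w = (\<lambda>i. (1 - t) * snd z i + t * snd (ret z) i)"
  define c where "c = 1 - t + t / sqrt (dotn n (red z) (red z))"
  have "c > 0" using t redp[OF z] by (cases "t = 1") (auto simp: c_def intro!: add_pos_nonneg)
  have wj: "w (I j) = c * snd z (I j)" if "j < ?m" for j using redj[OF zD(1) that] by (simp add: w_def ret_def normalize_vec_def c_def algebra_simps)
  obtain j where j: "j < ?m" "snd z (I j) \<noteq> 0" using Etop(2)[OF z] by (auto simp: E_def DD)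
  then have wnz: "w (I j) \<noteq> 0" using wj \<open>c > 0\<close> by simp
  then show nz: "w \<noteq> (\<lambda>i. 0)" by auto
  note rD = sbundleD[OF continuous_map_mem[OF rz z]]
  have wsupp: "w i = 0" if "i \<ge> n" for i using zD(4)[OF that] rD(4)[OF that] by (simp add: w_def)
  have ww: "dotn n w w > 0" using wsupp nz by (rule dotn_pos)
  have wV: "w \<in> ?V (fst z)" using zD(2) rD(2) lin[of f "Suc ?m" "fst z"] unfolding w_def lin_closed_def by (simp add: ret_def)
  have "normalize_vec n w \<in> ?V (fst z)" unfolding normalize_vec_scale by (intro lin_closed_scale lin wV)
  moreover have "normalize_vec n w i = 0" if "i \<ge> n" for i using wsupp[OF that] by (simp add: normalize_vec_def)
  ultimately have "(fst z, normalize_vec n w) \<in> topspace ?Z" unfolding topspace_sbundle using zD(1) normalize_vec_unit[OF ww] by simp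
  then show "(fst z, normalize_vec n w) \<in> E" using wnz j(1) ww by (auto simp: E_def DD normalize_vec_def)
 qed (auto simp: ret_def lin continuous_map_from_subtopology)
 obtain s where s: "s \<in> cocycles ?R" "degree_part k s = s" and
  gen: "\<And>u. u \<in> cocycles ?R ==> \<exists>a\<in>cocycles X. \<exists>b\<in>cocycles X.
   u + pull ?R fst a + cup ?R (pull ?R fst b) s \<in> cobs ?R" using S unfolding sphere_classes_def by metis
 define sM where "sM = pull ?M ret s"
 have fst_ret: "pull ?M ret (pull ?R fst a) = pull ?M fst a" for a
  unfolding pull_compose[OF ret] by (simp add: o_def ret_def)
 have genM: "\<exists>a\<in>cocycles X. \<exists>b\<in>cocycles X.
   u + pull ?M fst a + cup ?M (pull ?M fst b) sM \<in> cobs ?M"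
  if u: "u \<in> cocycles ?M" for u proof -
  obtain a b where ab: "a \<in> cocycles X" "b \<in> cocycles X"
   "pull ?R (\<lambda>z. z) u + pull ?R fst a + cup ?R (pull ?R fst b) s \<in> cobs ?R"
   using gen[OF pull_cocycles[OF u inc]] by blast
  have "pull ?M ret (pull ?R (\<lambda>z. z) u + pull ?R fst a + cup ?R (pull ?R fst b) s) \<in> cobs ?M"
   using ab(3) ret by (rule pull_cobs)
  also have "pull ?M ret (pull ?R (\<lambda>z. z) u + pull ?R fst a + cup ?R (pull ?R fst b) s) =
   pull ?M ret u + (pull ?M fst a + cup ?M (pull ?M fst b) sM)"
   by (simp add: pull_add pull_cup[OF ret] fst_ret sM_def)
    (simp add: pull_compose[OF ret] o_def add.assoc)
  finally have 1: "pull ?M ret u + (pull ?M fst a + cup ?M (pull ?M fst b) sM) \<in> cobs ?M" .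
  have "u + pull ?M ret u \<in> cobs ?M"
   using homotopic_pullback_cohomologous[OF hM u] pull_ident[OF cocyclesD(1)[OF u]] by simp
  from cohomologous_trans[OF this 1] show ?thesis using ab by (auto simp: add.assoc)
 qed
 \<comment> \<open>The frame vector f 0 gives a section inside the intersection, so pullback from
   the base is injective there.\<close>
 have inj: "c \<in> cobs X" if c: "c \<in> cocycles X" "pull ?M fst c \<in> cobs ?M" for c proof -
  have sec: "continuous_map X ?M (\<lambda>b. (b, normalize_vec n (f 0 b)))"
   using continuous_map_comp[OF continuous_frame_section[OF fr, of 0 ?m] inc] k by simp
  have "pull X (\<lambda>b. (b, normalize_vec n (f 0 b))) (pull ?M fst c) \<in> cobs X"
   using c(2) sec by (rule pull_cobs)
  then show ?thesis using pull_ident[OF cocyclesD(1)[OF c(1)]] by (simp add: pull_compose[OF sec] o_def)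
 qed
 obtain s' where "s' \<in> cocycles ?Z" "degree_part (Suc k) s' = s'"
  "\<forall>u\<in>cocycles ?Z. \<exists>a\<in>cocycles X. \<exists>b\<in>cocycles X.
   u + pull ?Z fst a + cup ?Z (pull ?Z fst b) s' \<in> cobs ?Z"
 proof (rule fibrewise_suspension[where X = X and Z = ?Z and q = fst and A = "D 1" and B = "D (-1)" and s = sM and d = k])
  show "sM \<in> cocycles (subtopology ?Z (D 1 \<inter> D (-1)))" using pull_cocycles[OF s(1) ret] by (simp add: sM_def E_def)
  show "degree_part k sM = sM" using s(2) by (simp add: sM_def degree_part_pullback)
 qed (use one genM inj opD cover sbundle_coordinates(1) in \<open>simp_all add: E_def\<close>)
 then show ?thesis unfolding sphere_classes_def by blast
qed

theorem chart_sphere_classes: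
 assumes "chart n X r I f" and "k < r"
 shows "sphere_classes n X (frame_span f (Suc k)) k"
 using assms(2) by (induction k) (auto intro: sphere_classes_1[OF assms(1)] sphere_classes_Suc[OF assms(1)])

section \<open>The projective bundle theorem\<close>

lemma cup_pow_2: "\<phi> \<in> cochains X ==> cup_pow X \<phi> 2 = cup X \<phi> \<phi>" by (simp add: numeral_2_eq_2 cup_unit_left)

lemma cup_pow_3: "\<phi> \<in> cochains X ==> cup_pow X \<phi> 3 = cup X \<phi> (cup X \<phi> \<phi>)"
 by (simp add: numeral_3_eq_3 cup_unit_left cup_assoc)

lemma frame_power_zero:
 assumes fr: "frame n X r f" and "k \<le> r"
 shows "cup_pow (pbundle n X (frame_span f k)) (taut n X (frame_span f k)) k
  \<in> cobs (pbundle n X (frame_span f k))" proof (rule framed_power_zero[where f = "\<lambda>j p. f j (fst p)"])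
 let ?P = "pbundle n X (frame_span f k)"
 note lin = lin_closed_frame_span
 have top: "fst p \<in> topspace X" if "p \<in> topspace ?P" for p using continuous_map_mem[OF continuous_pbundle_fst that] .
 show "line_field n ?P (fibre_unit n)" by (rule line_field_pbundle) (rule lin)
 fix j assume j: "j < k"
 then have jr: "j < r" using \<open>k \<le> r\<close> by simp
 show "cont_real ?P (\<lambda>p. f j (fst p) i)" for i
  using fr jr by (intro continuous_map_comp[OF continuous_pbundle_fst]) (auto simp: frame_def)
 show "dotn n (f j (fst p)) (f j (fst p)) > 0" "i \<ge> n ==> f j (fst p) i = 0" if "p \<in> topspace ?P" for p i
  using frame_nonzero(2,3)[OF fr jr top[OF that]] by auto
next
 let ?P = "pbundle n X (frame_span f k)"
 fix p assume p: "p \<in> topspace ?P"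
 note u = fibre_unit_props[OF p lin_closed_frame_span]
 obtain c where c: "fibre_unit n p = (\<lambda>i. \<Sum>j<k. c j * f j (fst p) i)" using u(3) by (auto simp: frame_span_def)
 show "\<exists>j<k. dotn n (fibre_unit n p) (f j (fst p)) \<noteq> 0" proof (rule ccontr)
  assume "\<not> ?thesis"
  then have z: "\<And>j. j < k ==> dotn n (fibre_unit n p) (f j (fst p)) = 0" by blast
  have "dotn n (fibre_unit n p) (fibre_unit n p) = (\<Sum>i<n. \<Sum>j<k. c j * (fibre_unit n p i * f j (fst p) i))"
   by (simp add: dotn_def c sum_distrib_left algebra_simps)
  also have "\<dots> = (\<Sum>j<k. c j * dotn n (fibre_unit n p) (f j (fst p)))" by (subst sum.swap) (simp add: dotn_def sum_distrib_left)
  also have "\<dots> = 0" using z by simp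
  finally show False using u(1) by simp
 qed
qed

lemma cup_degree_0:
 assumes "degree_part 0 \<beta> = \<beta>" "\<beta> \<in> cochains X"
 shows "cup X \<beta> \<beta> = \<beta>" proof (intro ext)
 fix p \<sigma>
 have z: "\<beta> p \<tau> = 0" if "p \<noteq> 0" for p \<tau> using that fun_cong[OF fun_cong[OF assms(1), of p], of \<tau>] by (simp add: degree_part_def)
 show "cup X \<beta> \<beta> p \<sigma> = \<beta> p \<sigma>" proof (cases "ssimplex p X \<sigma>")
  case True
  have "\<beta> i (front_face i \<sigma>) * \<beta> (p - i) (back_face i (p - i) \<sigma>) = (if i = 0 \<and> p = 0 then \<beta> 0 \<sigma> else 0)" if "i \<le> p" for i
  proof (cases "i = 0 \<and> p = 0")
   case p0: True
   have "front_face 0 \<sigma> = \<sigma>" "back_face 0 0 \<sigma> = \<sigma>"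
    using True p0 by (auto simp: front_face_def back_face_def singular_simplex_def extensional_restrict)
   then show ?thesis using p0 by (cases "\<beta> 0 \<sigma>") auto
  next
   case False
   then show ?thesis using z[of i] z[of "p - i"] that by auto
  qed
  then have "cup X \<beta> \<beta> p \<sigma> = (\<Sum>i\<le>p. if i = 0 \<and> p = 0 then \<beta> 0 \<sigma> else 0)"
   unfolding cup_eval[OF True] by (intro sum.cong) auto
  then show ?thesis using z[of p] by (cases "p = 0") simp_all
 next
  case False
  then show ?thesis by (simp add: cup_off cochains_off[OF assms(2)])
 qed
qed

text \<open>
 The generator \<open>s\<close> of the cohomology of the sphere bundle has transfer \<open>x\<^sup>k\<close>: as \<open>x\<^sup>k\<^sup>+\<^sup>1 = 0\<close>, the class \<open>x\<^sup>k\<close> is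
 a multiple of the transfer of \<open>s\<close> by a class of degree \<open>0\<close>, and it is not killed by any class of the base.
\<close>

lemma chart_transfer_generator:
 fixes f :: "nat => 'b => nat => real"
 assumes ch: "chart n X r I f" and k: "k < r"
 defines "V \<equiv> frame_span f (Suc k)"
 assumes s: "s \<in> cocycles (sbundle n X V)" "degree_part k s = s"
  and gen: "\<And>u. u \<in> cocycles (sbundle n X V) ==> \<exists>a\<in>cocycles X. \<exists>b\<in>cocycles X.
   u + pull (sbundle n X V) fst a + cup (sbundle n X V) (pull (sbundle n X V) fst b) s
   \<in> cobs (sbundle n X V)"
 shows "double_covering.transfer (sbundle n X V) (pbundle n X V) line_through s + cup_pow (pbundle n X V) (taut n X V) k
  \<in> cobs (pbundle n X V)" proof -
 let ?S = "sbundle n X V" and ?P = "pbundle n X V"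
 note fr = chart_frame[OF ch]
 have lin: "lin_closed (V b)" for b unfolding V_def by (rule lin_closed_frame_span)
 interpret P: double_covering ?S ?P line_through "sphere_label n" by (rule double_covering_sbundle) (rule lin)
 let ?x = "taut n X V"
 let ?p = "pull ?P fst"
 have x: "?x \<in> cocycles ?P" by (rule taut_cocycle, rule lin)
 have xd: "degree_part 1 ?x = ?x" by (auto simp: degree_part_def line_cocycle_degree fun_eq_iff)
 have pc: "?p a \<in> cocycles ?P" if "a \<in> cocycles X" for a using that continuous_pbundle_fst by (rule pull_cocycles)
 have pull: "pull ?S fst a = pull ?S line_through (?p a)" for a
  unfolding pull_compose[OF P.cont] by (simp add: o_def line_through_eq')
 have trd: "degree_part k (P.transfer s) = P.transfer s" proof -
  have "P.transfer (degree_part k s) = degree_part k (P.transfer s)" by (auto simp: P.transfer_def degree_part_def fun_eq_iff)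
  then show ?thesis using s(2) by simp
 qed
 have powd: "degree_part j (cup_pow ?P ?x j) = cup_pow ?P ?x j" for j proof (induction j)
  case 0
  then show ?case by (auto simp: degree_part_def unit_cochain_def fun_eq_iff)
 next
  case (Suc j)
  then show ?case using degree_part_cup_right[OF xd, of j ?P "cup_pow ?P ?x j"] by simp
 qed
 have "cup ?P (cup_pow ?P ?x k) ?x \<in> cobs ?P" using frame_power_zero[OF fr, of "Suc k"] k by (simp add: V_def)
 then obtain U where U: "U \<in> cocycles ?S" "P.transfer U = cup_pow ?P ?x k"
  using P.gysin_cup_kernel[OF x taut_pullback_sphere cup_pow_cocycles[OF x]] lin by metis
 obtain a b where ab: "a \<in> cocycles X" "b \<in> cocycles X"
  "U + pull ?S fst a + cup ?S (pull ?S fst b) s \<in> cobs ?S" using gen[OF U(1)] by blast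
 have "P.transfer (U + pull ?S fst a + cup ?S (pull ?S fst b) s) \<in> cobs ?P" using ab(3) by (rule P.transfer_cobs)
 then have "cup_pow ?P ?x k + cup ?P (?p b) (P.transfer s) \<in> cobs ?P"
  by (simp only: P.transfer_add pull P.transfer_cup P.transfer_pullback U(2) add_0_right)
 then have "degree_part k (cup_pow ?P ?x k + cup ?P (?p b) (P.transfer s)) \<in> cobs ?P" by (rule degree_part_cobs)
 \<comment> \<open>The power x^k and the transfer of s both have degree k, so only the component of
   b in degree 0 matters.\<close>
 moreover define b0 where "b0 = degree_part 0 b"
 ultimately have 1: "cup_pow ?P ?x k + cup ?P (?p b0) (P.transfer s) \<in> cobs ?P"
  using degree_part_cup_right[OF trd, of 0 ?P "?p b"] by (simp add: degree_part_add powd degree_part_pullback)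
 have b0: "b0 \<in> cocycles X" "degree_part 0 b0 = b0" using ab(2) by (simp_all add: b0_def degree_part_cocycles) (auto simp: degree_part_def)
 have bb: "cup X b0 b0 = b0" using b0 by (intro cup_degree_0) (auto dest: cocyclesD)
 \<comment> \<open>b0 is idempotent, so its complement e kills it. Hence e x^k is exact, e is exact
   by injectivity, and e = 0 because coboundaries have no component in degree 0.\<close>
 define e where "e = unit_cochain X + b0"
 have e: "e \<in> cocycles X" using b0 by (auto simp: e_def)
 have "cup X e b0 = 0" using cup_unit_left[OF cocyclesD(1)[OF b0(1)]] by (simp add: e_def cup_add_left bb cochain_double)
 then have z: "cup ?P (?p e) (?p b0) = 0" by (simp flip: pull_cup[OF continuous_pbundle_fst])
 have "cup ?P (?p e) (cup_pow ?P ?x k + cup ?P (?p b0) (P.transfer s)) \<in> cobs ?P" using pc[OF e] 1 by (rule cobs_cup_right)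
 then have "cup ?P (?p e) (cup_pow ?P ?x k) \<in> cobs ?P" by (simp add: cup_add_right z flip: cup_assoc)
 then have "e \<in> cobs X" using framed_top_power_injective[OF fr, of k e] e k by (simp add: V_def)
 have "degree_part 0 (unit_cochain X) = unit_cochain X" by (auto simp: degree_part_def unit_cochain_def fun_eq_iff)
 then have "degree_part 0 e = e" by (simp add: e_def degree_part_add b0(2))
 moreover obtain \<psi> where "e = coboundary X \<psi>" using \<open>e \<in> cobs X\<close> by (rule cobsE)
 ultimately have "e = 0" using degree_part_0_coboundary by metis
 then have "b0 = unit_cochain X" by (simp add: e_def cochain_add_eq_0_iff)
 then have "?p b0 = unit_cochain ?P" using pull_unit[OF continuous_pbundle_fst] by simp
 then have "cup ?P (?p b0) (P.transfer s) = P.transfer s" using cup_unit_left[OF cocyclesD(1)[OF P.transfer_cocycles[OF s(1)]]] by simp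
 then show ?thesis using 1 cohomologous_sym by metis
qed

text \<open>On the sphere bundle the pullback of y has the form a + b s. Its transfer is 0 and that
  of s is x^k, so b x^k is exact and b drops out. Then y + a is in the kernel of the pullback to the
  sphere bundle and is a multiple of x by the Gysin sequence.\<close>

lemma chart_projective_step:
 fixes f :: "nat => 'b => nat => real"
 assumes ch: "chart n X r I f" and k: "k < r"
 defines "V \<equiv> frame_span f (Suc k)"
 assumes y: "y \<in> cocycles (pbundle n X V)"
 shows "\<exists>a\<in>cocycles X. \<exists>v\<in>cocycles (pbundle n X V).
  y + pull (pbundle n X V) fst a + cup (pbundle n X V) v (taut n X V) \<in> cobs (pbundle n X V)" proof -
 let ?S = "sbundle n X V" and ?P = "pbundle n X V"
 note fr = chart_frame[OF ch]
 have lin: "lin_closed (V b)" for b unfolding V_def by (rule lin_closed_frame_span)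
 interpret P: double_covering ?S ?P line_through "sphere_label n" by (rule double_covering_sbundle) (rule lin)
 let ?x = "taut n X V"
 let ?p = "pull ?P fst" and ?q = "pull ?S line_through"
 have x: "?x \<in> cocycles ?P" by (rule taut_cocycle, rule lin)
 have pc: "?p a \<in> cocycles ?P" if "a \<in> cocycles X" for a using that continuous_pbundle_fst by (rule pull_cocycles)
 have pull: "pull ?S fst a = ?q (?p a)" for a unfolding pull_compose[OF P.cont] by (simp add: o_def line_through_eq')
 obtain s where s: "s \<in> cocycles ?S" "degree_part k s = s" and
  gen: "\<And>u. u \<in> cocycles ?S ==> \<exists>a\<in>cocycles X. \<exists>b\<in>cocycles X.
   u + pull ?S fst a + cup ?S (pull ?S fst b) s \<in> cobs ?S"
  using chart_sphere_classes[OF ch k] unfolding sphere_classes_def V_def by metis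
 have tr: "P.transfer s + cup_pow ?P ?x k \<in> cobs ?P" using chart_transfer_generator[OF ch k, folded V_def, OF s gen] .
 have qy: "?q y \<in> cocycles ?S" using y P.cont by (rule pull_cocycles)
 then obtain a b where ab: "a \<in> cocycles X" "b \<in> cocycles X"
  "?q y + pull ?S fst a + cup ?S (pull ?S fst b) s \<in> cobs ?S" using gen by blast
 have "P.transfer (?q y + pull ?S fst a + cup ?S (pull ?S fst b) s) \<in> cobs ?P"
  using ab(3) by (rule P.transfer_cobs)
 then have "cup ?P (?p b) (P.transfer s) \<in> cobs ?P" by (simp add: P.transfer_add pull P.transfer_cup)
 moreover have "cup ?P (?p b) (P.transfer s + cup_pow ?P ?x k) \<in> cobs ?P" using pc[OF ab(2)] tr by (rule cobs_cup_right)
 ultimately have "cup ?P (?p b) (P.transfer s) + cup ?P (?p b) (P.transfer s + cup_pow ?P ?x k) \<in> cobs ?P" by (rule cobs_add)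
 then have "cup ?P (?p b) (cup_pow ?P ?x k) \<in> cobs ?P" by (simp add: cup_add_right cochain_ac)
 then have "b \<in> cobs X" using framed_top_power_injective[OF fr, of k b] ab(2) k by (simp add: V_def)
 then have "cup ?S (pull ?S fst b) s \<in> cobs ?S"
  using s(1) pull_cobs[OF _ sbundle_coordinates(1)] by (intro cobs_cup_left) auto
 from cobs_add[OF ab(3) this] have "?q (y + ?p a) \<in> cobs ?S" by (simp add: pull_add pull cochain_ac)
 moreover have "y + ?p a \<in> cocycles ?P" using y pc[OF ab(1)] by auto
 ultimately obtain v where "v \<in> cocycles ?P" "y + ?p a + cup ?P v ?x \<in> cobs ?P"
  using P.gysin_pullback_kernel[OF x taut_pullback_sphere] lin by metis
 then show ?thesis using ab(1) by blast
qed

section \<open>Coefficients with respect to 1, x, x^2 in rank 3\<close>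

definition theta :: "nat => 'b topology => ('b => (nat => real) set) => (nat => 'b cochain) => ('b \<times> (nat => real) set) cochain"
 where "theta n X V k = (let P = pbundle n X V; x = taut n X V in
  pull P fst (k 0) + cup P (pull P fst (k 1)) x + cup P (pull P fst (k 2)) (cup P x x))"

text \<open>Exactness of the mapping cone of \<open>theta\<close>. The case k = 0 is surjectivity on
  cohomology, and the existence of k' contains injectivity. In this form both can be patched
  together by a chase of cochains, in place of long exact sequences and the five lemma.\<close>

definition cone_basis :: "nat => 'b topology => ('b => (nat => real) set) => bool"
 where "cone_basis n X V \<longleftrightarrow> (\<forall>k. \<forall>c\<in>cochains (pbundle n X V).
  (\<forall>i<3. k i \<in> cocycles X) \<longrightarrow> coboundary (pbundle n X V) c = theta n X V k \<longrightarrow>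
  (\<exists>k'. \<exists>c'\<in>cochains (pbundle n X V). (\<forall>i<3. k' i \<in> cochains X \<and> coboundary X (k' i) = k i) \<and>
   c = theta n X V k' + coboundary (pbundle n X V) c'))"

lemma theta_add: "theta n X V (\<lambda>i. k i + k' i) = theta n X V k + theta n X V k'"
 by (simp add: theta_def Let_def pull_add cup_add_left ac_simps)

lemma theta_cong: "(\<And>i. i < 3 ==> k i = k' i) ==> theta n X V k = theta n X V k'" by (simp add: theta_def)

lemma theta_cochains:
 assumes "\<And>i. i < 3 ==> k i \<in> cochains X"
 shows "theta n X V k \<in> cochains (pbundle n X V)"
 using assms by (auto simp: theta_def Let_def intro!: cochains_add cup_cochains pull_cochains[where Y = X])

lemma coboundary_theta:
 assumes "\<And>b. b \<in> topspace X ==> lin_closed (V b)"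
 shows "coboundary (pbundle n X V) (theta n X V k) = theta n X V (\<lambda>i. coboundary X (k i))"
 using cocyclesD(2)[OF taut_cocycle[where X = X and n = n and V = V, OF assms]]
 by (simp add: theta_def Let_def coboundary_add coboundary_cup pull_coboundary[OF continuous_pbundle_fst])

lemma theta_cobs:
 assumes "\<And>b. b \<in> topspace X ==> lin_closed (V b)" "\<And>i. i < 3 ==> k i \<in> cobs X"
 shows "theta n X V k \<in> cobs (pbundle n X V)" unfolding theta_def Let_def
 using assms(2)[of 0] assms(2)[of 1] assms(2)[of 2] taut_cocycle[where X = X and n = n and V = V, OF assms(1)]
  continuous_pbundle_fst[of n X V] by (intro cobs_add cobs_cup_left pull_cobs cocycles_cup) simp_all

text \<open>Since x^3 is exact, multiplication by x^2 isolates k 0, and then multiplication by x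
  isolates k 1; each time \<open>framed_top_power_injective\<close> applies to the coefficient of
  x^2.\<close>

lemma chart_theta_injective:
 assumes ch: "chart n X 3 I f" and k: "\<And>i. i < 3 ==> k i \<in> cocycles X"
  and z: "theta n X (frame_span f 3) k \<in> cobs (pbundle n X (frame_span f 3))" and "i < 3"
 shows "k i \<in> cobs X" proof -
 let ?V = "frame_span f 3"
 let ?P = "pbundle n X ?V" and ?x = "taut n X ?V"
 let ?p = "pull ?P fst"
 note fr = chart_frame[OF ch] and lin = lin_closed_frame_span
 have x: "?x \<in> cocycles ?P" by (rule taut_cocycle, rule lin)
 have pc: "?p a \<in> cocycles ?P" if "a \<in> cocycles X" for a using that continuous_pbundle_fst by (rule pull_cocycles)
 have x3: "cup ?P ?x (cup ?P ?x ?x) \<in> cobs ?P" using frame_power_zero[OF fr, of 3] by (simp add: cup_pow_3 cocyclesD(1)[OF x])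
 have top: "a \<in> cobs X" if "a \<in> cocycles X" "cup ?P (?p a) (cup ?P ?x ?x) \<in> cobs ?P" for a
  using framed_top_power_injective[OF fr, of 2 a] that by (simp add: cup_pow_2 cocyclesD(1)[OF x])
 have ax3: "cup ?P a (cup ?P ?x (cup ?P ?x ?x)) \<in> cobs ?P" "cup ?P a (cup ?P ?x (cup ?P ?x (cup ?P ?x ?x))) \<in> cobs ?P"
  if "a \<in> cocycles ?P" for a using that x3 x by (auto intro!: cobs_cup_right)
 let ?k0 = "?p (k 0)" and ?k1 = "?p (k 1)" and ?k2 = "?p (k 2)"
 have kc: "?k0 \<in> cocycles ?P" "?k1 \<in> cocycles ?P" "?k2 \<in> cocycles ?P" using k pc by auto
 have t: "?k0 + cup ?P ?k1 ?x + cup ?P ?k2 (cup ?P ?x ?x) \<in> cobs ?P" using z by (simp add: theta_def Let_def)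
 have "cup ?P (?k0 + cup ?P ?k1 ?x + cup ?P ?k2 (cup ?P ?x ?x)) (cup ?P ?x ?x) \<in> cobs ?P" using t x by (intro cobs_cup_left) auto
 then have "cup ?P ?k0 (cup ?P ?x ?x) + cup ?P ?k1 (cup ?P ?x (cup ?P ?x ?x)) + cup ?P ?k2 (cup ?P ?x (cup ?P ?x (cup ?P ?x ?x))) \<in> cobs ?P"
  by (simp add: cup_add_left cup_assoc)
 from coboundary_transfer[OF coboundary_transfer[OF this ax3(2)[OF kc(3)]] ax3(1)[OF kc(2)]]
 have 0: "k 0 \<in> cobs X" using top k by simp
 then have c0: "?k0 \<in> cobs ?P" using continuous_pbundle_fst by (rule pull_cobs)
 from cobs_add[OF c0 t] have t1: "cup ?P ?k1 ?x + cup ?P ?k2 (cup ?P ?x ?x) \<in> cobs ?P" by (simp add: cochain_ac)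
 have "cup ?P (cup ?P ?k1 ?x + cup ?P ?k2 (cup ?P ?x ?x)) ?x \<in> cobs ?P" using t1 x by (rule cobs_cup_left)
 then have "cup ?P ?k1 (cup ?P ?x ?x) + cup ?P ?k2 (cup ?P ?x (cup ?P ?x ?x)) \<in> cobs ?P" by (simp add: cup_add_left cup_assoc)
 from coboundary_transfer[OF this ax3(1)[OF kc(3)]] have 1: "k 1 \<in> cobs X" using top k by simp
 then have "cup ?P ?k1 ?x \<in> cobs ?P" using x continuous_pbundle_fst by (intro cobs_cup_left pull_cobs)
 from cobs_add[OF this t1] have "cup ?P ?k2 (cup ?P ?x ?x) \<in> cobs ?P" by (simp add: cochain_ac)
 then have 2: "k 2 \<in> cobs X" using top k by simp
 show ?thesis using 0 1 2 \<open>i < 3\<close> by (auto simp: numeral_3_eq_3 less_Suc_eq numeral_2_eq_2)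
qed

text \<open>Division by x with remainder from the base, three times; the last quotient is multiplied
  by x^3, which is exact.\<close>

lemma chart_theta_surjective:
 assumes ch: "chart n X 3 I f" and y: "y \<in> cocycles (pbundle n X (frame_span f 3))"
 obtains k where "\<forall>i<3. k i \<in> cocycles X" "y + theta n X (frame_span f 3) k \<in> cobs (pbundle n X (frame_span f 3))" proof -
 let ?V = "frame_span f 3"
 let ?P = "pbundle n X ?V" and ?x = "taut n X ?V"
 let ?p = "pull ?P fst"
 note fr = chart_frame[OF ch] and lin = lin_closed_frame_span
 have x: "?x \<in> cocycles ?P" by (rule taut_cocycle, rule lin)
 have x3: "cup ?P ?x (cup ?P ?x ?x) \<in> cobs ?P" using frame_power_zero[OF fr, of 3] by (simp add: cup_pow_3 cocyclesD(1)[OF x])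
 have step: "\<exists>a\<in>cocycles X. \<exists>v\<in>cocycles ?P. y + ?p a + cup ?P v ?x \<in> cobs ?P" if "y \<in> cocycles ?P" for y
  using chart_projective_step[OF ch, of 2 y] that by simp
 obtain a0 v0 where 0: "a0 \<in> cocycles X" "v0 \<in> cocycles ?P" "y + ?p a0 + cup ?P v0 ?x \<in> cobs ?P" using step[OF y] by blast
 obtain a1 v1 where 1: "a1 \<in> cocycles X" "v1 \<in> cocycles ?P" "v0 + ?p a1 + cup ?P v1 ?x \<in> cobs ?P" using step[OF 0(2)] by blast
 obtain a2 v2 where 2: "a2 \<in> cocycles X" "v2 \<in> cocycles ?P" "v1 + ?p a2 + cup ?P v2 ?x \<in> cobs ?P" using step[OF 1(2)] by blast
 have e1: "cup ?P (v0 + ?p a1 + cup ?P v1 ?x) ?x \<in> cobs ?P" using 1(3) x by (rule cobs_cup_left)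
 have e2: "cup ?P (v1 + ?p a2 + cup ?P v2 ?x) (cup ?P ?x ?x) \<in> cobs ?P" using 2(3) x by (intro cobs_cup_left) auto
 have 3: "cup ?P v2 (cup ?P ?x (cup ?P ?x ?x)) \<in> cobs ?P" using 2(2) x3 by (rule cobs_cup_right)
 define k where "k = (\<lambda>i::nat. if i = 0 then a0 else if i = 1 then a1 else a2)"
 from cobs_add[OF cobs_add[OF 0(3) e1] cobs_add[OF e2 3]]
 have "y + theta n X ?V k \<in> cobs ?P" by (simp add: theta_def k_def Let_def cup_add_left cup_assoc cochain_ac)
 moreover have "\<forall>i<3. k i \<in> cocycles X" using 0 1 2 by (simp add: k_def)
 ultimately show ?thesis using that by blast
qed

lemma chart_cone_basis:
 assumes ch: "chart n X 3 I f"
 shows "cone_basis n X (frame_span f 3)" unfolding cone_basis_def proof (intro allI ballI impI)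
 let ?V = "frame_span f 3"
 let ?P = "pbundle n X ?V"
 fix k c assume c: "c \<in> cochains ?P" and k: "\<forall>i<3. k i \<in> cocycles X" and eq: "coboundary ?P c = theta n X ?V k"
 note lin = lin_closed_frame_span
 have "theta n X ?V k \<in> cobs ?P" using cobsI[OF c] eq by simp
 then have "\<forall>i<3. k i \<in> cobs X" using chart_theta_injective[OF ch] k by blast
 then have "\<forall>i<3. \<exists>a. a \<in> cochains X \<and> coboundary X a = k i" by (metis cobsE)
 then obtain \<alpha> where \<alpha>: "\<forall>i<3. \<alpha> i \<in> cochains X \<and> coboundary X (\<alpha> i) = k i" by metis
 have "theta n X ?V (\<lambda>i. coboundary X (\<alpha> i)) = theta n X ?V k" using \<alpha> by (intro theta_cong) auto
 then have "c + theta n X ?V \<alpha> \<in> cocycles ?P" using c \<alpha> theta_cochains[of \<alpha> X n ?V]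
  by (intro cocyclesI) (auto simp: coboundary_add eq coboundary_theta lin cochain_double)
 then obtain \<beta> where \<beta>: "\<forall>i<3. \<beta> i \<in> cocycles X" "c + theta n X ?V \<alpha> + theta n X ?V \<beta> \<in> cobs ?P"
  by (rule chart_theta_surjective[OF ch])
 obtain c' where c': "c' \<in> cochains ?P" "c + theta n X ?V \<alpha> + theta n X ?V \<beta> = coboundary ?P c'" using \<beta>(2) by (rule cobsE)
 have "c = theta n X ?V (\<lambda>i. \<alpha> i + \<beta> i) + coboundary ?P c'" by (simp add: theta_add cochain_ac flip: c'(2))
 moreover have "\<forall>i<3. \<alpha> i + \<beta> i \<in> cochains X \<and> coboundary X (\<alpha> i + \<beta> i) = k i"
  using \<alpha> \<beta>(1) by (auto simp: coboundary_add dest: cocyclesD)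
 ultimately show "\<exists>k'. \<exists>c'\<in>cochains ?P. (\<forall>i<3. k' i \<in> cochains X \<and> coboundary X (k' i) = k i) \<and> c = theta n X ?V k' + coboundary ?P c'"
  using c'(1) by (intro exI[of _ "\<lambda>i. \<alpha> i + \<beta> i"]) blast
qed

section \<open>Patching the projective bundle theorem over open sets\<close>

abbreviation over :: "nat => 'b topology => ('b => (nat => real) set) => 'b set => ('b \<times> (nat => real) set) set"
 where "over n X V U \<equiv> {p \<in> topspace (pbundle n X V). fst p \<in> U}"

lemma openin_over: "openin X U ==> openin (pbundle n X V) (over n X V U)"
 using openin_continuous_map_preimage[OF continuous_pbundle_fst] .

lemma over_Int: "over n X V (U \<inter> W) = over n X V U \<inter> over n X V W" by auto

lemma restrict_theta:
 assumes U: "openin X U"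
 shows "restr (subtopology (pbundle n X V) (over n X V U)) (theta n X V k) =
  theta n (subtopology X U) V (\<lambda>i. restr (subtopology X U) (k i))" proof -
 let ?P = "pbundle n (subtopology X U) V"
 note sub = pbundle_subtopology[OF U, of n V]
 have inc: "continuous_map ?P (pbundle n X V) (\<lambda>x. x)"
  using continuous_map_subtopology_ident[of "pbundle n X V" "over n X V U"] by (simp add: sub)
 have "pull ?P fst (restr (subtopology X U) a) = pull ?P fst a" for a :: "'a cochain"
  unfolding pull_compose[OF continuous_pbundle_fst] by (simp add: o_def)
 then show ?thesis unfolding sub by (simp add: theta_def Let_def pull_add pull_cup[OF inc]
   pull_compose[OF inc] line_cocycle_pullback[OF inc] o_def)
qed

lemma cone_basisE:
 assumes "cone_basis n X V" "\<forall>i<3. k i \<in> cocycles X" "c \<in> cochains (pbundle n X V)"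
  "coboundary (pbundle n X V) c = theta n X V k"
 obtains k' c' where "\<forall>i<3. k' i \<in> cochains X" "\<forall>i<3. coboundary X (k' i) = k i"
  "c' \<in> cochains (pbundle n X V)" "c = theta n X V k' + coboundary (pbundle n X V) c'" using assms unfolding cone_basis_def by metis

lemma cochain_exchange:
 fixes a :: "'a cochain"
 assumes "a + c = b + d"
 shows "c + d = a + b" proof -
 have "c + d = a + (a + c) + d" by (simp add: cochain_ac)
 also have "\<dots> = a + b" unfolding assms by (simp add: cochain_ac)
 finally show ?thesis .
qed

text \<open>
 Chasing the Mayer--Vietoris sequences of \<open>X\<close> and of the projective bundle at the level of cochains; \<^const>\<open>cone_basis\<close>
 says that \<open>theta\<close> is a quasi-isomorphism.
\<close>

lemma cone_basis_glue:
 assumes U: "openin X U" and W: "openin X W" and cover: "topspace X \<subseteq> U \<union> W"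
  and lin: "\<And>b. b \<in> topspace X ==> lin_closed (V b)"
  and bU: "cone_basis n (subtopology X U) V" and bW: "cone_basis n (subtopology X W) V"
  and bM: "cone_basis n (subtopology X (U \<inter> W)) V"
 shows "cone_basis n X V" unfolding cone_basis_def proof (intro allI ballI impI)
 let ?P = "pbundle n X V"
 let ?XU = "subtopology X U" and ?XW = "subtopology X W" and ?XM = "subtopology X (U \<inter> W)"
 let ?PU = "subtopology ?P (over n X V U)" and ?PW = "subtopology ?P (over n X V W)" and ?PM = "subtopology ?P (over n X V U \<inter> over n X V W)"
 let ?rU = "restr ?XU" and ?rW = "restr ?XW" and ?rM = "restr ?XM"
 let ?sU = "restr ?PU" and ?sW = "restr ?PW" and ?sM = "restr ?PM"
 have M: "openin X (U \<inter> W)" using U W by auto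
 have PU: "pbundle n ?XU V = ?PU" and PW: "pbundle n ?XW V = ?PW" and PM: "pbundle n ?XM V = ?PM"
  using pbundle_subtopology[OF U, of n V] pbundle_subtopology[OF W, of n V]
   pbundle_subtopology[OF M, of n V] unfolding over_Int by simp_all
 note tU = restrict_theta[OF U, of n V] and tW = restrict_theta[OF W, of n V]
  and tM = restrict_theta[OF M, of n V, unfolded over_Int]
 have rr: "?rM (?rU a) = ?rM a" "?rM (?rW a) = ?rM a" for a by (simp_all add: restrict_restrict)
 have ss: "?sM (?sU a) = ?sM a" "?sM (?sW a) = ?sM a" for a by (simp_all add: restrict_restrict)
 have linS: "lin_closed (V b)" if "b \<in> topspace (subtopology X S)" for b S using that lin by simp
 note dr = pull_coboundary[OF continuous_map_subtopology_ident]
 have MU: "continuous_map ?XM ?XU (\<lambda>x. x)" "continuous_map ?XM ?XW (\<lambda>x. x)"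
  "continuous_map ?PM ?PU (\<lambda>x. x)" "continuous_map ?PM ?PW (\<lambda>x. x)" by (auto simp: continuous_map_in_subtopology)
 note dM = pull_coboundary[OF MU(1)] pull_coboundary[OF MU(2)]
  pull_coboundary[OF MU(3)] pull_coboundary[OF MU(4)]
 have tUM: "?sM (theta n ?XU V a) = theta n ?XM V (\<lambda>i. ?rM (a i))" if "\<forall>i<3. a i \<in> cochains ?XU" for a proof -
  have "?sM (?sU (theta n X V a)) = theta n ?XM V (\<lambda>i. ?rM (a i))" unfolding ss tM ..
  moreover have "?sU (theta n X V a) = theta n ?XU V a" unfolding tU using that by (intro theta_cong pull_ident) auto
  ultimately show ?thesis by simp
 qed
 have tWM: "?sM (theta n ?XW V a) = theta n ?XM V (\<lambda>i. ?rM (a i))" if "\<forall>i<3. a i \<in> cochains ?XW" for a proof -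
  have "?sM (?sW (theta n X V a)) = theta n ?XM V (\<lambda>i. ?rM (a i))" unfolding ss tM ..
  moreover have "?sW (theta n X V a) = theta n ?XW V a" unfolding tW using that by (intro theta_cong pull_ident) auto
  ultimately show ?thesis by simp
 qed
 fix k c assume c: "c \<in> cochains ?P" and k: "\<forall>i<3. k i \<in> cocycles X" and eq: "coboundary ?P c = theta n X V k"
 have kU: "\<forall>i<3. ?rU (k i) \<in> cocycles ?XU" and kW: "\<forall>i<3. ?rW (k i) \<in> cocycles ?XW" using k by (auto intro: pull_cocycles)
 have eqs: "coboundary ?PU (?sU c) = theta n ?XU V (\<lambda>i. ?rU (k i))" "coboundary ?PW (?sW c) = theta n ?XW V (\<lambda>i. ?rW (k i))"
  by (simp_all add: eq tU tW flip: dr)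
 have sc: "?sU c \<in> cochains ?PU" "?sW c \<in> cochains ?PW" using c by auto
 obtain \<alpha> \<gamma> where \<alpha>: "\<forall>i<3. \<alpha> i \<in> cochains ?XU" "\<forall>i<3. coboundary ?XU (\<alpha> i) = ?rU (k i)"
  and \<gamma>: "\<gamma> \<in> cochains ?PU" "?sU c = theta n ?XU V \<alpha> + coboundary ?PU \<gamma>"
  by (rule cone_basisE[OF bU kU, unfolded PU, OF sc(1) eqs(1)])
 obtain \<beta> \<eta> where \<beta>: "\<forall>i<3. \<beta> i \<in> cochains ?XW" "\<forall>i<3. coboundary ?XW (\<beta> i) = ?rW (k i)"
  and \<eta>: "\<eta> \<in> cochains ?PW" "?sW c = theta n ?XW V \<beta> + coboundary ?PW \<eta>"
  by (rule cone_basisE[OF bW kW, unfolded PW, OF sc(2) eqs(2)])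
 \<comment> \<open>The solutions over U and W differ over the intersection by the cone cocycle
   consisting of a and \<open>?sM \<gamma> + ?sM \<eta>\<close>; by \<open>bM\<close> it comes from
   \<mu> and \<nu>.\<close>
 define a where "a = (\<lambda>i. ?rM (\<alpha> i) + ?rM (\<beta> i))"
 have a: "\<forall>i<3. a i \<in> cocycles ?XM" proof (intro allI impI)
  fix i :: nat assume i: "i < 3"
  have "coboundary ?XM (?rM (\<alpha> i)) = ?rM (k i)" "coboundary ?XM (?rM (\<beta> i)) = ?rM (k i)"
   using dM(1)[of "\<alpha> i"] dM(2)[of "\<beta> i"] \<alpha>(2) \<beta>(2) i by (simp_all add: rr)
  then show "a i \<in> cocycles ?XM" unfolding a_def using \<alpha>(1) \<beta>(1) i by (intro cocyclesI) (auto simp: coboundary_add cochain_double)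
 qed
 have e1: "?sM c = theta n ?XM V (\<lambda>i. ?rM (\<alpha> i)) + coboundary ?PM (?sM \<gamma>)"
  using arg_cong[OF \<gamma>(2), of ?sM] by (simp add: pull_add ss tUM[OF \<alpha>(1)] dM)
 have e2: "?sM c = theta n ?XM V (\<lambda>i. ?rM (\<beta> i)) + coboundary ?PM (?sM \<eta>)"
  using arg_cong[OF \<eta>(2), of ?sM] by (simp add: pull_add ss tWM[OF \<beta>(1)] dM)
 have "theta n ?XM V (\<lambda>i. ?rM (\<alpha> i)) + coboundary ?PM (?sM \<gamma>) = theta n ?XM V (\<lambda>i. ?rM (\<beta> i)) + coboundary ?PM (?sM \<eta>)"
  using e1 e2 by (rule trans[OF sym])
 then have e3: "coboundary ?PM (?sM \<gamma> + ?sM \<eta>) = theta n ?XM V a" unfolding a_def theta_add coboundary_add by (rule cochain_exchange)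
 have sge: "?sM \<gamma> + ?sM \<eta> \<in> cochains ?PM" using \<gamma>(1) \<eta>(1) by auto
 obtain \<mu> \<nu> where \<mu>: "\<forall>i<3. \<mu> i \<in> cochains ?XM" "\<forall>i<3. coboundary ?XM (\<mu> i) = a i"
   and \<nu>: "\<nu> \<in> cochains ?PM" "?sM \<gamma> + ?sM \<eta> = theta n ?XM V \<mu> + coboundary ?PM \<nu>"
  by (rule cone_basisE[OF bM a, unfolded PM, OF sge e3])
 have \<mu>X: "\<forall>i<3. \<mu> i \<in> cochains X" "\<forall>i<3. ?rM (\<mu> i) = \<mu> i"
  using \<mu>(1) by (auto intro: cochains_subtopology pull_ident)
 have \<nu>P: "\<nu> \<in> cochains ?P" "?sM \<nu> = \<nu>" using \<nu>(1) by (auto intro: cochains_subtopology pull_ident)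
 \<comment> \<open>With \<mu> extended by zero to X, adding its coboundary to \<beta> makes it agree
   with \<alpha> over the intersection. The glued \<kappa> has the right coboundary only on
   simplices inside U or W; the cochain \<theta>, which vanishes on these, repairs the
   others.\<close>
 have "\<exists>k'. k' \<in> cochains X \<and> coboundary X k' = k i \<and> ?rU k' = \<alpha> i \<and> ?rW k' = \<beta> i + ?rW (coboundary X (\<mu> i))"
  if i: "i < 3" for i proof -
  have "?rM (?rW (coboundary X (\<mu> i))) = a i" unfolding rr unfolding dr using \<mu>(2) \<mu>X(2) i by simp
  then have "?rM (\<alpha> i) = ?rM (\<beta> i + ?rW (coboundary X (\<mu> i)))" unfolding pull_add by (simp add: a_def cochain_ac)
  moreover have "\<beta> i + ?rW (coboundary X (\<mu> i)) \<in> cochains ?XW"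
   using \<beta>(1) \<mu>X(1) i by (intro cochains_add pull_cochains[where Y = X] coboundary_cochains) simp_all
  ultimately obtain \<kappa> where \<kappa>: "\<kappa> \<in> cochains X" "?rU \<kappa> = \<alpha> i" "?rW \<kappa> = \<beta> i + ?rW (coboundary X (\<mu> i))"
   using glue_cochains \<alpha>(1) i by metis
  have "coboundary X \<kappa> + k i \<in> cocycles X" using \<kappa>(1) k i by auto
  moreover have "?rU (coboundary X \<kappa> + k i) = 0" "?rW (coboundary X \<kappa> + k i) = 0"
   using \<alpha>(2) \<beta>(2) i coboundary_coboundary[of X "\<mu> i"] by (simp_all add: pull_add dr \<kappa> coboundary_add cochain_double)
  ultimately obtain \<theta> where "\<theta> \<in> cochains X" "coboundary X \<theta> = coboundary X \<kappa> + k i" "?rU \<theta> = 0" "?rW \<theta> = 0"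
   using two_open_coboundary[OF U W cover] by metis
  then show ?thesis using \<kappa> by (intro exI[of _ "\<kappa> + \<theta>"]) (simp add: cochains_add coboundary_add pull_add cochain_ac)
 qed
 then obtain k' where k': "\<forall>i<3. k' i \<in> cochains X \<and> coboundary X (k' i) = k i \<and> ?rU (k' i) = \<alpha> i \<and>
   ?rW (k' i) = \<beta> i + ?rW (coboundary X (\<mu> i))" by metis
 have tm: "theta n X V \<mu> \<in> cochains ?P" using \<mu>X(1) by (intro theta_cochains) auto
 have "?sM (theta n X V \<mu>) = theta n ?XM V \<mu>" unfolding tM using \<mu>X(2) by (intro theta_cong) auto
 moreover have "?sM \<gamma> = ?sM \<eta> + (theta n ?XM V \<mu> + coboundary ?PM \<nu>)" unfolding \<nu>(2)[symmetric] by (simp add: cochain_ac)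
 ultimately have gm: "?sM \<gamma> = ?sM (\<eta> + (?sW (theta n X V \<mu>) + ?sW (coboundary ?P \<nu>)))"
  unfolding pull_add ss by (simp add: dr \<nu>P(2))
 have go: "\<eta> + (?sW (theta n X V \<mu>) + ?sW (coboundary ?P \<nu>)) \<in> cochains ?PW"
  using \<eta>(1) tm \<nu>P(1) by (intro cochains_add pull_cochains[where Y = ?P] coboundary_cochains)
 obtain \<zeta> where \<zeta>: "\<zeta> \<in> cochains ?P" "?sU \<zeta> = \<gamma>" "?sW \<zeta> = \<eta> + (?sW (theta n X V \<mu>) + ?sW (coboundary ?P \<nu>))"
  by (rule glue_cochains[OF \<gamma>(1) go gm])
 \<comment> \<open>What is left vanishes over both open sets, so \<open>two_open_coboundary\<close>
   makes it exact.\<close>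
 define y where "y = c + theta n X V k' + coboundary ?P \<zeta>"
 have tk: "theta n X V (\<lambda>i. coboundary X (k' i)) = theta n X V k" using k' by (intro theta_cong) auto
 have y: "y \<in> cocycles ?P" proof (rule cocyclesI)
  show "y \<in> cochains ?P" unfolding y_def using c k' \<zeta>(1) by (intro cochains_add theta_cochains coboundary_cochains) auto
  show "coboundary ?P y = 0" by (simp add: y_def coboundary_add eq coboundary_theta[OF lin] tk cochain_double)
 qed
 have "?sU (theta n X V k') = theta n ?XU V \<alpha>" unfolding tU using k' by (intro theta_cong) auto
 then have yU: "?sU y = 0" by (simp add: y_def pull_add \<gamma>(2) dr \<zeta> cochain_ac)
 have "?sW (theta n X V k') = theta n ?XW V (\<lambda>i. \<beta> i + ?rW (coboundary X (\<mu> i)))" unfolding tW using k' by (intro theta_cong) auto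
 also have "\<dots> = theta n ?XW V \<beta> + ?sW (coboundary ?P (theta n X V \<mu>))" by (simp add: theta_add coboundary_theta[OF lin] tW)
 finally have yW: "?sW y = 0" using coboundary_coboundary[of ?P \<nu>]
  by (simp add: y_def pull_add \<eta>(2) dr \<zeta> coboundary_add cochain_ac)
 have "topspace ?P \<subseteq> over n X V U \<union> over n X V W" using cover continuous_map_mem[OF continuous_pbundle_fst, of _ n X V] by blast
 from two_open_coboundary[OF openin_over[OF U] openin_over[OF W] this y yU yW]
 obtain \<phi> where \<phi>: "\<phi> \<in> cochains ?P" "coboundary ?P \<phi> = y" by blast
 have "c = theta n X V k' + coboundary ?P (\<zeta> + \<phi>)" by (simp add: coboundary_add \<phi>(2) y_def cochain_ac)
 then show "\<exists>k'. \<exists>c'\<in>cochains ?P. (\<forall>i<3. k' i \<in> cochains X \<and> coboundary X (k' i) = k i) \<and> c = theta n X V k' + coboundary ?P c'"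
  using k' \<zeta>(1) \<phi>(1) cochains_add by blast
qed

lemma pbundle_cong:
 assumes "\<And>b. b \<in> topspace X ==> V b = V' b"
 shows "pbundle n X V = pbundle n X V'" proof -
 let ?E = "prod_topology X (Euclidean_space n)"
 have "topspace ?E \<inter> {(b, v). v \<in> V b \<and> v \<noteq> (\<lambda>i. 0)} = topspace ?E \<inter> {(b, v). v \<in> V' b \<and> v \<noteq> (\<lambda>i. 0)}"
  using assms by auto
 then have "nonzero_vectors n X V = nonzero_vectors n X V'" unfolding nonzero_vectors_def
  using subtopology_restrict[of ?E "{(b, v). v \<in> V b \<and> v \<noteq> (\<lambda>i. 0)}"] subtopology_restrict[of ?E "{(b, v). v \<in> V' b \<and> v \<noteq> (\<lambda>i. 0)}"]
  by (simp only:)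
 then show ?thesis by (simp add: projective_bundle_def)
qed

lemma cone_basis_cong:
 assumes "\<And>b. b \<in> topspace X ==> V b = V' b"
 shows "cone_basis n X V \<longleftrightarrow> cone_basis n X V'" proof -
 have "pbundle n X V = pbundle n X V'" using assms by (rule pbundle_cong)
 then show ?thesis unfolding cone_basis_def theta_def by (simp only:)
qed

text \<open>The intersection of U with the union of the other sets is again an open subset of the
  single set U; this is why the hypothesis speaks of all open subsets of members of the
  cover.\<close>

lemma cone_basis_cover:
 assumes "finite \<U>" and op: "\<And>U. U \<in> \<U> ==> openin X U"
  and lin: "\<And>b. b \<in> topspace X ==> lin_closed (V b)"
  and small: "\<And>U W. U \<in> \<U> ==> openin X W ==> W \<subseteq> U ==> cone_basis n (subtopology X W) V"
  and ne: "\<U> \<noteq> {}"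
 shows "cone_basis n (subtopology X (\<Union>\<U>)) V" using assms(1) ne op small proof (induction \<U> rule: finite_ne_induct)
 case (singleton U)
 then show ?case by simp
next
 case (insert U F)
 let ?Y = "subtopology X (\<Union>(insert U F))"
 have sub: "subtopology ?Y U = subtopology X U" "subtopology ?Y (\<Union>F) = subtopology X (\<Union>F)"
  "subtopology ?Y (U \<inter> \<Union>F) = subtopology X (U \<inter> \<Union>F)" by (simp_all add: subtopology_subtopology inf.absorb2 le_infI1)
 have "openin X U" "openin X (\<Union>F)" using insert.prems(1) by auto
 then have op': "openin ?Y U" "openin ?Y (\<Union>F)" "openin X (U \<inter> \<Union>F)" by (auto simp: openin_subtopology)
 show ?case proof (rule cone_basis_glue[of ?Y U "\<Union>F"])
  show "cone_basis n (subtopology ?Y U) V" unfolding sub using insert.prems \<open>openin X U\<close> by auto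
  show "cone_basis n (subtopology ?Y (\<Union>F)) V" unfolding sub using insert.IH insert.prems by auto
  show "cone_basis n (subtopology ?Y (U \<inter> \<Union>F)) V" unfolding sub using insert.prems(2)[of U] op' by auto
 qed (use op' lin in auto)
qed

text \<open>Local triviality in rank 3; the cover is finite so that patching can proceed by
  induction.\<close>

definition charted :: "nat => 'b topology => ('b => (nat => real) set) => bool"
 where "charted n X V \<longleftrightarrow> (\<exists>\<U>. finite \<U> \<and> \<U> \<noteq> {} \<and> topspace X \<subseteq> \<Union>\<U> \<and> (\<forall>U\<in>\<U>. openin X U \<and>
  (\<exists>I f. chart n (subtopology X U) 3 I f \<and> (\<forall>b\<in>U. V b = frame_span f 3 b))))"

lemma chart_subtopology:
 assumes "chart n (subtopology X U) r I f" "W \<subseteq> U"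
 shows "chart n (subtopology X W) r I f" proof -
 have W: "subtopology X W = subtopology (subtopology X U) W" using assms(2) by (simp add: subtopology_subtopology inf.absorb2)
 show ?thesis using assms(1) unfolding W chart_def by (auto intro: continuous_map_from_subtopology)
qed

lemma chartedE:
 assumes "charted n X V"
 obtains \<U> where "finite \<U>" "\<U> \<noteq> {}" "topspace X \<subseteq> \<Union>\<U>" "\<forall>U\<in>\<U>. openin X U"
  "\<forall>U\<in>\<U>. \<exists>I f. chart n (subtopology X U) 3 I f \<and> (\<forall>b\<in>U. V b = frame_span f 3 b)"
 using assms unfolding charted_def ball_conj_distrib by (elim exE conjE)

lemma charted_lin_closed:
 assumes "charted n X V" "b \<in> topspace X"
 shows "lin_closed (V b)" using assms(1) proof (rule chartedE)
 fix \<U> assume cov: "topspace X \<subseteq> \<Union>\<U>" and c: "\<forall>U\<in>\<U>. \<exists>I f. chart n (subtopology X U) 3 I f \<and> (\<forall>b\<in>U. V b = frame_span f 3 b)"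
 obtain U where U: "U \<in> \<U>" "b \<in> U" using subsetD[OF cov assms(2)] by (rule UnionE)
 obtain f where "V b = frame_span f 3 b" using bspec[OF c U(1)] U(2) by (elim exE conjE) (drule bspec)
 then show "lin_closed (V b)" using lin_closed_frame_span by metis
qed

theorem charted_cone_basis:
 assumes ch: "charted n X V"
 shows "cone_basis n X V" proof -
 obtain \<U> where \<U>: "finite \<U>" "\<U> \<noteq> {}" "topspace X \<subseteq> \<Union>\<U>" and
  op: "\<forall>U\<in>\<U>. openin X U" and
  c: "\<forall>U\<in>\<U>. \<exists>I f. chart n (subtopology X U) 3 I f \<and> (\<forall>b\<in>U. V b = frame_span f 3 b)" using ch by (rule chartedE)
 have "cone_basis n (subtopology X (\<Union>\<U>)) V" proof (rule cone_basis_cover[OF \<U>(1) bspec[OF op] charted_lin_closed[OF ch] _ \<U>(2)])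
  fix U W assume U: "U \<in> \<U>" and W: "W \<subseteq> U"
  obtain I f where f: "chart n (subtopology X U) 3 I f" "\<forall>b\<in>U. V b = frame_span f 3 b" using bspec[OF c U] by blast
  have "cone_basis n (subtopology X W) (frame_span f 3)" by (rule chart_cone_basis[OF chart_subtopology[OF f(1) W]])
  moreover have "V b = frame_span f 3 b" if "b \<in> topspace (subtopology X W)" for b using that f(2) W by auto
  ultimately show "cone_basis n (subtopology X W) V" using cone_basis_cong by blast
 qed
 then show ?thesis by (simp add: subtopology_superset \<U>(3))
qed

theorem theta_injective:
 assumes ch: "charted n X V" and k: "\<And>i. i < 3 ==> k i \<in> cocycles X"
  and z: "theta n X V k \<in> cobs (pbundle n X V)" and i: "i < 3"
 shows "k i \<in> cobs X" proof -
 obtain c where c: "c \<in> cochains (pbundle n X V)" "theta n X V k = coboundary (pbundle n X V) c" using z by (rule cobsE)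
 obtain k' where "\<forall>i<3. k' i \<in> cochains X" "\<forall>i<3. coboundary X (k' i) = k i"
  using cone_basisE[OF charted_cone_basis[OF ch] _ c(1) c(2)[symmetric]] k by metis
 then show ?thesis using cobsI i by metis
qed

theorem theta_surjective:
 assumes ch: "charted n X V" and y: "y \<in> cocycles (pbundle n X V)"
 obtains k where "\<forall>i<3. k i \<in> cocycles X" "y + theta n X V k \<in> cobs (pbundle n X V)" proof -
 let ?P = "pbundle n X V"
 have "coboundary ?P y = theta n X V (\<lambda>i. 0)" using cocyclesD(2)[OF y] by (simp add: theta_def)
 moreover have "\<forall>i<3. (\<lambda>i. 0) i \<in> cocycles X" by simp
 ultimately obtain k c where k: "\<forall>i<3. k i \<in> cochains X" "\<forall>i<3. coboundary X (k i) = 0"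
  "c \<in> cochains ?P" "y = theta n X V k + coboundary ?P c" using cone_basisE[OF charted_cone_basis[OF ch] _ cocyclesD(1)[OF y]] by metis
 have "y + theta n X V k = coboundary ?P c" by (simp add: k(4) cochain_ac)
 then show ?thesis using that[of k] k by (auto intro: cocyclesI)
qed

lemma charted_pullback:
 assumes ch: "charted n X V" and g: "continuous_map Y X g"
 shows "charted n Y (\<lambda>y. V (g y))" proof -
 obtain \<U> where \<U>: "finite \<U>" "\<U> \<noteq> {}" "topspace X \<subseteq> \<Union>\<U>" and
  op: "\<forall>U\<in>\<U>. openin X U" and
  c: "\<forall>U\<in>\<U>. \<exists>I f. chart n (subtopology X U) 3 I f \<and> (\<forall>b\<in>U. V b = frame_span f 3 b)" using ch by (rule chartedE)
 define G where "G = (\<lambda>U. {y \<in> topspace Y. g y \<in> U})"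
 have "\<exists>I f. chart n (subtopology Y (G U)) 3 I f \<and> (\<forall>y\<in>G U. V (g y) = frame_span f 3 y)" if U: "U \<in> \<U>" for U proof -
  obtain I f where f: "chart n (subtopology X U) 3 I f" "\<forall>b\<in>U. V b = frame_span f 3 b" using bspec[OF c U] by blast
  have gU: "continuous_map (subtopology Y (G U)) (subtopology X U) g"
   using g by (auto simp: continuous_map_in_subtopology G_def continuous_map_from_subtopology)
  have "chart n (subtopology Y (G U)) 3 I (\<lambda>j y. f j (g y))" unfolding chart_def proof (intro conjI allI ballI impI)
   fix j :: nat assume j: "j < 3"
   show "cont_real (subtopology Y (G U)) (\<lambda>y. f j (g y) i)" for i using continuous_map_comp[OF gU chartD(1)[OF f(1) j]] .
   fix y assume "y \<in> topspace (subtopology Y (G U))"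
   then have y: "g y \<in> topspace (subtopology X U)" using continuous_map_mem[OF gU] by blast
   show "f j (g y) i = 0" if "i \<ge> n" for i using chartD(2)[OF f(1) j y that] .
   show "f j (g y) (I k) = (if j = k then 1 else 0)" if "k < 3" for k using chartD(3)[OF f(1) j that y] .
  qed
  moreover have "\<forall>y\<in>G U. V (g y) = frame_span (\<lambda>j y. f j (g y)) 3 y" using f(2) by (auto simp: G_def frame_span_def)
  ultimately show ?thesis by blast
 qed
 moreover have "openin Y (G U)" if "U \<in> \<U>" for U unfolding G_def using openin_continuous_map_preimage[OF g bspec[OF op that]] .
 moreover have "topspace Y \<subseteq> \<Union>(G ` \<U>)" using \<U>(3) continuous_map_mem[OF g] by (fastforce simp: G_def)
 ultimately show ?thesis unfolding charted_def using \<U>(1,2) by (intro exI[of _ "G ` \<U>"]) auto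
qed

section \<open>Triples of independent vectors\<close>

definition det3 :: "(nat => nat => real) => real"
 where "det3 x = x 0 0 * (x 1 1 * x 2 2 - x 1 2 * x 2 1) - x 0 1 * (x 1 0 * x 2 2 - x 1 2 * x 2 0)
  + x 0 2 * (x 1 0 * x 2 1 - x 1 1 * x 2 0)"

definition minor :: "(nat => nat => real) => (nat => nat) => real"
 where "minor g I = det3 (\<lambda>i j. g i (I j))"

definition independent3 :: "(nat => nat => real) => bool"
 where "independent3 g \<longleftrightarrow> (\<forall>a b c. (\<forall>i. a * g 0 i + b * g 1 i + c * g 2 i = 0) \<longrightarrow> a = 0 \<and> b = 0 \<and> c = 0)"

definition span3 :: "(nat => nat => real) => (nat => real) set"
 where "span3 g = {\<lambda>i. a * g 0 i + b * g 1 i + c * g 2 i |a b c. True}"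

text \<open>The column choices for 3 x 3 minors; the fixed value 0 beyond the first three arguments
  makes the set finite.\<close>

definition triples :: "nat => (nat => nat) set"
 where "triples n = {I. \<forall>j. (j \<in> {..<3} \<longrightarrow> I j \<in> {..<n}) \<and> (j \<notin> {..<3} \<longrightarrow> I j = 0)}"

lemma sum3: "(\<Sum>j<3::nat. f j) = f 0 + f 1 + (f 2 :: 'a::comm_monoid_add)" by (simp add: numeral_3_eq_3 numeral_2_eq_2)

lemma less_3_cases: "(j::nat) < 3 \<longleftrightarrow> j = 0 \<or> j = 1 \<or> j = 2" by auto

lemma span3I: "(\<lambda>i. a * g 0 i + b * g 1 i + c * g 2 i) \<in> span3 g" by (auto simp: span3_def)

lemma span3E:
 assumes "v \<in> span3 g"
 obtains a b c where "v = (\<lambda>i. a * g 0 i + b * g 1 i + c * g 2 i)" using assms by (auto simp: span3_def)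

lemma frame_span_3: "frame_span f 3 b = span3 (\<lambda>j. f j b)" proof (rule subset_antisym; rule subsetI)
 fix v assume "v \<in> frame_span f 3 b"
 then show "v \<in> span3 (\<lambda>j. f j b)" unfolding frame_span_def sum3 using span3I[where g = "\<lambda>j. f j b"] by auto
next
 fix v assume "v \<in> span3 (\<lambda>j. f j b)"
 then obtain x y z where "v = (\<lambda>i. x * f 0 b i + y * f 1 b i + z * f 2 b i)" by (rule span3E)
 then show "v \<in> frame_span f 3 b"
  using frame_spanI[where k = 3 and c = "\<lambda>j. if j = 0 then x else if j = 1 then y else z" and f = f and b = b] by (simp add: sum3)
qed

lemma lin_closed_span3 [simp]: "lin_closed (span3 g)" using lin_closed_frame_span[of "\<lambda>j b. g j" 3 undefined] by (simp add: frame_span_3)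

lemma span3_subset:
 assumes W: "lin_closed W" and g: "\<And>j. j < 3 ==> g j \<in> W"
 shows "span3 g \<subseteq> W" proof
 fix v assume "v \<in> span3 g"
 then obtain a b c where v: "v = (\<lambda>i. a * g 0 i + b * g 1 i + c * g 2 i)" by (rule span3E)
 have "(\<lambda>i. a * g 0 i + b * g 1 i) \<in> W" using W g[of 0] g[of 1] unfolding lin_closed_def by simp
 then have "(\<lambda>i. 1 * (a * g 0 i + b * g 1 i) + c * g 2 i) \<in> W"
  using W[unfolded lin_closed_def, rule_format, of "\<lambda>i. a * g 0 i + b * g 1 i" "g 2" 1 c] g[of 2] by simp
 then show "v \<in> W" by (simp add: v)
qed

lemma span3_base: "j < 3 ==> g j \<in> span3 g" using span3I[of 1 g 0 0] span3I[of 0 g 1 0] span3I[of 0 g 0 1] by (auto simp: less_3_cases)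

lemma finite_triples: "finite (triples n)" unfolding triples_def by (rule finite_set_of_finite_funs) auto

text \<open>The columns are found one at a time: a nonzero entry, a nonzero 2 x 2 minor containing
  it, and a column on which the combination of the rows with the cofactors A, B, C does not
  vanish.\<close>

lemma independent3_minor:
 assumes ind: "independent3 g"
 obtains I where "\<forall>j\<ge>3. I j = 0" "minor g I \<noteq> 0" proof -
 have ind': "a = 0 \<and> b = 0 \<and> c = 0" if "\<And>i. a * g 0 i + b * g 1 i + c * g 2 i = 0" for a b c using ind that unfolding independent3_def by blast
 obtain p where p: "g 0 p \<noteq> 0" using ind'[of 1 0 0] by auto
 obtain q where q: "g 0 p * g 1 q - g 0 q * g 1 p \<noteq> 0" using ind'[of "- g 1 p" "g 0 p" 0] p by (auto simp: algebra_simps)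
 define A B C where "A = g 1 p * g 2 q - g 1 q * g 2 p" and "B = g 0 q * g 2 p - g 0 p * g 2 q"
  and "C = g 0 p * g 1 q - g 0 q * g 1 p"
 obtain r where r: "A * g 0 r + B * g 1 r + C * g 2 r \<noteq> 0" using ind'[of A B C] q by (auto simp: C_def)
 define I where "I = (\<lambda>j::nat. if j = 0 then p else if j = 1 then q else if j = 2 then r else 0)"
 have nz: "minor g I \<noteq> 0" using r by (simp add: minor_def det3_def I_def A_def B_def C_def algebra_simps)
 then show ?thesis using that[of I] by (simp add: I_def)
qed

lemma minor_nonzero:
 assumes ind: "independent3 g" and supp: "\<And>j i. j < 3 ==> i \<ge> n ==> g j i = 0"
 obtains I where "I \<in> triples n" "minor g I \<noteq> 0" proof -
 obtain I where I: "\<forall>j\<ge>3. I j = 0" and nz: "minor g I \<noteq> 0" using ind by (rule independent3_minor)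
 have "I j < n" if "j < 3" for j proof (rule ccontr)
  assume "\<not> I j < n"
  then have "g 0 (I j) = 0" "g 1 (I j) = 0" "g 2 (I j) = 0" using supp by auto
  then show False using nz that by (auto simp: less_3_cases minor_def det3_def)
 qed
 then have "I \<in> triples n" using I by (auto simp: triples_def)
 then show ?thesis using nz that by blast
qed

lemma minor_replace:
 "minor g (I(0 := k)) = g 0 k * (g 1 (I 1) * g 2 (I 2) - g 1 (I 2) * g 2 (I 1))
  + g 1 k * (g 0 (I 2) * g 2 (I 1) - g 0 (I 1) * g 2 (I 2)) + g 2 k * (g 0 (I 1) * g 1 (I 2) - g 0 (I 2) * g 1 (I 1))"
 "minor g (I(1 := k)) = g 0 k * (g 1 (I 2) * g 2 (I 0) - g 1 (I 0) * g 2 (I 2))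
  + g 1 k * (g 0 (I 0) * g 2 (I 2) - g 0 (I 2) * g 2 (I 0)) + g 2 k * (g 0 (I 2) * g 1 (I 0) - g 0 (I 0) * g 1 (I 2))"
 "minor g (I(2 := k)) = g 0 k * (g 1 (I 0) * g 2 (I 1) - g 1 (I 1) * g 2 (I 0))
  + g 1 k * (g 0 (I 1) * g 2 (I 0) - g 0 (I 0) * g 2 (I 1)) + g 2 k * (g 0 (I 0) * g 1 (I 1) - g 0 (I 1) * g 1 (I 0))"
 by (simp_all add: minor_def det3_def algebra_simps)

text \<open>Cramer's rule for column k in terms of the columns of I, multiplied by the
  determinant.\<close>

lemma minor_expand:
 assumes "j < 3"
 shows "minor g I * g j k = g j (I 0) * minor g (I(0 := k)) + g j (I 1) * minor g (I(1 := k)) + g j (I 2) * minor g (I(2 := k))"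
 using assms unfolding minor_replace by (auto simp: less_3_cases minor_def det3_def algebra_simps)

lemma minor_delta:
 assumes "j < 3" "k < 3"
 shows "minor g (I(j := I k)) = (if j = k then minor g I else 0)" using assms by (auto simp: less_3_cases minor_def det3_def algebra_simps)

text \<open>f is the reduced echelon form of g, that is, g multiplied by the inverse of its block in
  the columns I. Its entries are ratios of minors, insensitive to a common factor; hence continuity
  is asked only of products of two minors divided by N.\<close>

lemma chart_of_minors:
 assumes nz: "\<And>b. b \<in> topspace X ==> minor (g b) I \<noteq> 0"
  and supp: "\<And>b j i. b \<in> topspace X ==> j < 3 ==> i \<ge> n ==> g b j i = 0"
  and N: "\<And>b. b \<in> topspace X ==> N b \<noteq> 0"
  and cont: "\<And>I J. cont_real X (\<lambda>b. minor (g b) I * minor (g b) J / N b)"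
 defines "f \<equiv> \<lambda>j b k. minor (g b) (I(j := k)) / minor (g b) I"
 shows "chart n X 3 I f" "\<And>b. b \<in> topspace X ==> span3 (g b) = frame_span f 3 b" proof -
 show "chart n X 3 I f" unfolding chart_def proof (intro conjI allI ballI impI)
  fix j :: nat assume j: "j < 3"
  have "cont_real X (\<lambda>b. (minor (g b) (I(j := k)) * minor (g b) I / N b) / (minor (g b) I * minor (g b) I / N b))" for k
   using nz N by (intro continuous_map_real_divide cont) auto
  then show "cont_real X (\<lambda>b. f j b k)" for k by (rule continuous_map_eq) (use nz N in \<open>simp add: f_def\<close>)
  fix b assume b: "b \<in> topspace X"
  show "f j b i = 0" if "i \<ge> n" for i using supp[OF b _ that] j minor_replace[of "g b" I i] by (auto simp: f_def less_3_cases)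
  show "f j b (I k) = (if j = k then 1 else 0)" if "k < 3" for k using minor_delta[OF j that] nz[OF b] by (simp add: f_def)
 qed
 fix b assume b: "b \<in> topspace X"
 let ?D = "minor (g b) I"
 have "f j b \<in> span3 (g b)" if "j < 3" for j proof -
  have "\<exists>x y z. \<forall>k. minor (g b) (I(j := k)) = g b 0 k * x + g b 1 k * y + g b 2 k * z"
   using that minor_replace[of "g b" I] by (auto simp: less_3_cases)
  then obtain x y z where "\<And>k. minor (g b) (I(j := k)) = g b 0 k * x + g b 1 k * y + g b 2 k * z" by blast
  then have "f j b = (\<lambda>k. x / ?D * g b 0 k + y / ?D * g b 1 k + z / ?D * g b 2 k)" by (auto simp: f_def add_divide_distrib algebra_simps)
  then show ?thesis by (simp only: span3I)
 qed
 moreover have "g b j \<in> span3 (\<lambda>j. f j b)" if "j < 3" for j proof -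
  have "g b j k = g b j (I 0) * f 0 b k + g b j (I 1) * f 1 b k + g b j (I 2) * f 2 b k" for k proof -
   have "g b j k = ?D * g b j k / ?D" using nz[OF b] by simp
   then show ?thesis unfolding minor_expand[OF that] by (simp add: f_def add_divide_distrib)
  qed
  then have "g b j = (\<lambda>k. g b j (I 0) * f 0 b k + g b j (I 1) * f 1 b k + g b j (I 2) * f 2 b k)" by (rule ext)
  then show ?thesis using span3I[of "g b j (I 0)" "\<lambda>j. f j b" "g b j (I 1)" "g b j (I 2)"] by simp
 qed
 ultimately show "span3 (g b) = frame_span f 3 b" unfolding frame_span_3 by (intro subset_antisym span3_subset lin_closed_span3)
qed

lemma charted_of_minors:
 assumes ind: "\<And>b. b \<in> topspace X ==> independent3 (g b)"
  and supp: "\<And>b j i. b \<in> topspace X ==> j < 3 ==> i \<ge> n ==> g b j i = 0"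
  and V: "\<And>b. b \<in> topspace X ==> V b = span3 (g b)"
  and N: "\<And>b. b \<in> topspace X ==> N b \<noteq> 0"
  and cont: "\<And>I J. cont_real X (\<lambda>b. minor (g b) I * minor (g b) J / N b)"
 shows "charted n X V" proof -
 define U where "U = (\<lambda>I. {b \<in> topspace X. minor (g b) I * minor (g b) I / N b \<in> - {0}})"
 have op: "openin X (U I)" for I unfolding U_def by (rule openin_continuous_map_preimage[OF cont]) auto
 have "\<exists>I' f. chart n (subtopology X (U I)) 3 I' f \<and> (\<forall>b\<in>U I. V b = frame_span f 3 b)" for I proof -
  have nz: "minor (g b) I \<noteq> 0" if "b \<in> topspace (subtopology X (U I))" for b using that by (auto simp: U_def)
  have sub: "b \<in> topspace X" if "b \<in> topspace (subtopology X (U I))" for b using that by simp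
  define f where "f = (\<lambda>j b k. minor (g b) (I(j := k)) / minor (g b) I)"
  have "chart n (subtopology X (U I)) 3 I f"
   unfolding f_def using nz supp[OF sub] N[OF sub] continuous_map_from_subtopology[OF cont] by (rule chart_of_minors(1))
  moreover have "V b = frame_span f 3 b" if b: "b \<in> U I" for b proof -
   have "b \<in> topspace (subtopology X (U I))" using b by (auto simp: U_def)
   then have "span3 (g b) = frame_span f 3 b"
    unfolding f_def using nz supp[OF sub] N[OF sub] continuous_map_from_subtopology[OF cont] by (intro chart_of_minors(2))
   then show ?thesis using V b by (simp add: U_def)
  qed
  ultimately show ?thesis by blast
 qed
 \<comment> \<open>The constant index keeps the cover nonempty also when \<open>triples n\<close> is
   empty.\<close>
 moreover have "topspace X \<subseteq> \<Union>(U ` insert (\<lambda>_. 0) (triples n))" proof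
  fix b assume b: "b \<in> topspace X"
  obtain I where "I \<in> triples n" "minor (g b) I \<noteq> 0" using minor_nonzero[OF ind[OF b] supp[OF b]] by blast
  then show "b \<in> \<Union>(U ` insert (\<lambda>_. 0) (triples n))" using b N[OF b] by (auto simp: U_def)
 qed
 ultimately show ?thesis unfolding charted_def using op finite_triples[of n] by (intro exI[of _ "U ` insert (\<lambda>_. 0) (triples n)"]) auto
qed

section \<open>The canonical bundle over the oriented Grassmannian\<close>

text \<open>The elements of the type \<open>3\<close> are written 1, 2, 3, where 3 = 0; they become
  the positions 0, 1, 2.\<close>

definition triple :: "(3 => nat => real) => nat => nat => real"
 where "triple f = (\<lambda>i. f (if i = 0 then 1 else if i = 1 then 2 else 3))"

lemma triple_simps [simp]: "triple f 0 = f 1" "triple f (Suc 0) = f 2" "triple f 2 = f 3" by (simp_all add: triple_def)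

lemma forall_type_3: "(\<forall>j::3. P j) \<longleftrightarrow> P 1 \<and> P 2 \<and> P 3" by (metis exhaust_3)

lemma lin_independent_triple: "lin_independent f \<longleftrightarrow> independent3 (triple f)" proof
 assume f: "lin_independent f"
 show "independent3 (triple f)" unfolding independent3_def proof (intro allI impI)
  fix a b c assume "\<forall>i. a * triple f 0 i + b * triple f 1 i + c * triple f 2 i = 0"
  then have "\<forall>j::3. (if j = 1 then a else if j = 2 then b else c) = 0"
   using spec[OF f[unfolded lin_independent_def], of "\<lambda>j. if j = 1 then a else if j = 2 then b else c"] by (simp add: sum_3)
  then show "a = 0 \<and> b = 0 \<and> c = 0" by (simp add: forall_type_3)
 qed
next
 assume f: "independent3 (triple f)"
 show "lin_independent f" unfolding lin_independent_def sum_3 proof (intro allI impI)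
  fix c :: "3 => real" and j :: 3 assume "\<forall>i. c 1 * f 1 i + c 2 * f 2 i + c 3 * f 3 i = 0"
  then have "c 1 = 0 \<and> c 2 = 0 \<and> c 3 = 0" using f[unfolded independent3_def, rule_format, of "c 1" "c 2" "c 3"] by simp
  then show "c j = 0" using exhaust_3[of j] by auto
 qed
qed

lemma linear_span_triple: "linear_span f = span3 (triple f)" proof (rule subset_antisym; rule subsetI)
 fix v assume "v \<in> span3 (triple f)"
 then obtain a b c where v: "v = (\<lambda>i. a * triple f 0 i + b * triple f 1 i + c * triple f 2 i)" by (rule span3E)
 then show "v \<in> linear_span f"
  unfolding linear_span_def by (intro CollectI exI[of _ "\<lambda>j. if j = 1 then a else if j = 2 then b else c"]) (simp add: sum_3)
qed (auto simp: linear_span_def span3_def sum_3)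

definition act :: "real^3^3 => (3 => nat => real) => 3 => nat => real"
 where "act A f = (\<lambda>j i. \<Sum>l\<in>UNIV. A $ j $ l * f l i)"

lemma oriented_span_act: "oriented_span f = {act A f |A. 0 < det A}" by (simp add: oriented_span_def act_def)

lemma act_act: "act A (act B f) = act (A ** B) f" by (auto simp: act_def matrix_matrix_mult_def sum_3 algebra_simps)

lemma act_mat: "act (mat 1) f = f" by (auto simp: act_def mat_def if_distrib[of "\<lambda>x. x * _"] cong: if_cong)

lemma minor_det: "minor (triple f) I = det (\<chi> i j. f i (I (if j = (1::3) then 0 else if j = 2 then 1 else 2)))"
 by (simp add: minor_def det3_def det_3 algebra_simps)

lemma minor_act: "minor (triple (act A f)) I = det A * minor (triple f) I" proof -
 have "(\<chi> i j. act A f i (I (if j = (1::3) then 0 else if j = 2 then 1 else 2))) =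
  A ** (\<chi> i j. f i (I (if j = (1::3) then 0 else if j = 2 then 1 else 2)))" by (simp add: vec_eq_iff matrix_matrix_mult_def act_def)
 then show ?thesis by (simp add: minor_det det_mul)
qed

lemma oriented_span_self: "(f :: 3 => nat => real) \<in> oriented_span f"
 unfolding oriented_span_act using act_mat[of f] by (intro CollectI exI[of _ "mat 1"]) simp

lemma matrix_inverse_exists:
 assumes "det A \<noteq> 0"
 obtains B :: "real^3^3" where "B ** A = mat 1" "det B * det A = 1" proof -
 obtain B where "B ** A = mat 1" using assms invertible_det_nz[of A] by (auto simp: invertible_def)
 then show ?thesis using that det_mul[of B A] by simp
qed

lemma oriented_span_act_eq:
 assumes "0 < det A"
 shows "oriented_span (act A f) = oriented_span f" proof (rule subset_antisym; rule subsetI)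
 fix h assume "h \<in> oriented_span (act A f)"
 then obtain C where "h = act (C ** A) f" "0 < det C" by (auto simp: oriented_span_act act_act)
 then show "h \<in> oriented_span f" using assms unfolding oriented_span_act by (intro CollectI exI[of _ "C ** A"]) (simp add: det_mul)
next
 obtain B where B: "B ** A = mat 1" "det B * det A = 1" using assms by (auto intro: matrix_inverse_exists[of A])
 fix h assume "h \<in> oriented_span f"
 then obtain C where C: "h = act C f" "0 < det C" by (auto simp: oriented_span_act)
 have "det B > 0" using B(2) assms by (metis zero_less_mult_pos2 zero_less_one)
 moreover have "h = act (C ** B) (act A f)" by (simp add: C act_act B(1) flip: matrix_mul_assoc)
 ultimately show "h \<in> oriented_span (act A f)" using C unfolding oriented_span_act by (intro CollectI exI[of _ "C ** B"]) (simp add: det_mul)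
qed

lemma span3_act_subset: "span3 (triple (act A f)) \<subseteq> span3 (triple f)" proof (rule span3_subset)
 fix j :: nat assume "j < 3"
 then obtain k where k: "triple (act A f) j = act A f k" by (auto simp: less_3_cases)
 show "triple (act A f) j \<in> span3 (triple f)" unfolding k using span3I[of "A $ k $ 1" "triple f" "A $ k $ 2" "A $ k $ 3"] by (simp add: act_def sum_3)
qed simp

lemma span3_act:
 assumes "det A \<noteq> 0"
 shows "span3 (triple (act A f)) = span3 (triple f)" proof -
 obtain B where "B ** A = mat 1" using assms by (rule matrix_inverse_exists)
 then have "span3 (triple f) \<subseteq> span3 (triple (act A f))" using span3_act_subset[of B "act A f"] by (simp add: act_act act_mat)
 then show ?thesis using span3_act_subset by blast
qed

lemma underlying_oriented_span: "underlying_subspace (oriented_span f) = span3 (triple f)" proof -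
 have "linear_span h = span3 (triple f)" if "h \<in> oriented_span f" for h using that unfolding oriented_span_act linear_span_triple by (auto simp: span3_act)
 moreover have "f \<in> oriented_span f" by (rule oriented_span_self)
 ultimately show ?thesis unfolding underlying_subspace_def by blast
qed

lemma independent_subspace_matrix:
 assumes "independent3 (triple h)" "\<And>j. j < 3 ==> triple h j \<in> span3 (triple f)"
 obtains A where "h = act A f" "det A \<noteq> 0" proof -
 have "\<exists>a. h k = (\<lambda>i. \<Sum>l\<in>UNIV. a $ l * f l i)" for k :: 3 proof -
  have "h k \<in> linear_span f" using assms(2)[of 0] assms(2)[of 1] assms(2)[of 2] exhaust_3[of k] by (auto simp: linear_span_triple)
  then obtain c where "h k = (\<lambda>i. \<Sum>l\<in>UNIV. c l * f l i)" by (auto simp: linear_span_def)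
  then show ?thesis by (intro exI[of _ "\<chi> l. c l"]) simp
 qed
 then obtain a where a: "\<And>k. h k = (\<lambda>i. \<Sum>l\<in>UNIV. a k $ l * f l i)" by metis
 define A where "A = (\<chi> k. a k)"
 have hA: "h = act A f" using a by (auto simp: act_def A_def)
 obtain I where "minor (triple h) I \<noteq> 0" using assms(1) by (rule independent3_minor)
 then have "det A \<noteq> 0" by (auto simp: hA minor_act)
 then show ?thesis using that hA by blast
qed

abbreviation grass :: "nat => 3 oriented_subspace topology"
 where "grass n \<equiv> oriented_grassmannian TYPE(3) n"

lemma topspace_stiefel:
 "f \<in> topspace (stiefel_manifold n :: (3 => nat => real) topology) \<longleftrightarrow> (\<forall>j. \<forall>i\<ge>n. f j i = 0) \<and> independent3 (triple f)"
 by (auto simp: stiefel_manifold_def topspace_Euclidean_space lin_independent_triple)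

lemma continuous_map_stiefel:
 "continuous_map Z (stiefel_manifold n :: (3 => nat => real) topology) f \<longleftrightarrow>
  (\<forall>j i. cont_real Z (\<lambda>z. f z j i)) \<and>
  (\<forall>z\<in>topspace Z. (\<forall>j. \<forall>i\<ge>n. f z j i = 0) \<and> independent3 (triple (f z)))"
 unfolding stiefel_manifold_def continuous_map_in_subtopology continuous_map_componentwise_UNIV continuous_map_Euclidean_space_eq
 by (auto simp: lin_independent_triple)

lemma quotient_map_oriented_span: "quotient_map (stiefel_manifold n) (grass n) oriented_span"
 unfolding oriented_grassmannian_def by (rule quotient_map_quotient_topology)

definition basis :: "nat => 3 oriented_subspace => 3 => nat => real"
 where "basis n b = inv_into (topspace (stiefel_manifold n)) oriented_span b"

lemma basis:
 assumes "b \<in> topspace (grass n)"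
 shows "basis n b \<in> topspace (stiefel_manifold n)" "oriented_span (basis n b) = b" using assms unfolding oriented_grassmannian_def basis_def
 by (auto simp: inv_into_into f_inv_into_f)

definition minor_norm :: "nat => (nat => nat => real) => real"
 where "minor_norm n g = sqrt (\<Sum>I\<in>triples n. (minor g I)\<^sup>2)"

lemma minor_norm_pos:
 assumes "f \<in> topspace (stiefel_manifold n)"
 shows "0 < minor_norm n (triple f)" proof -
 obtain I where I: "I \<in> triples n" "minor (triple f) I \<noteq> 0"
  by (rule minor_nonzero[of "triple f" n]) (use assms in \<open>auto simp: topspace_stiefel triple_def\<close>)
 have "0 < (minor (triple f) I)\<^sup>2" using I by simp
 also have "\<dots> \<le> (\<Sum>I\<in>triples n. (minor (triple f) I)\<^sup>2)" by (intro member_le_sum I finite_triples) auto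
 finally show ?thesis by (simp add: minor_norm_def)
qed

text \<open>Pluecker coordinates scaled to a unit vector. A change of basis with positive
  determinant multiplies all minors by the same positive factor, so they depend only on the oriented
  subspace.\<close>

definition pluecker :: "nat => (nat => nat) => 3 oriented_subspace => real"
 where "pluecker n I b = minor (triple (basis n b)) I / minor_norm n (triple (basis n b))"

lemma pluecker_oriented_span:
 assumes f: "f \<in> topspace (stiefel_manifold n)"
 shows "pluecker n I (oriented_span f) = minor (triple f) I / minor_norm n (triple f)" proof -
 have "oriented_span f \<in> topspace (grass n)" using f by (simp add: oriented_grassmannian_def)
 then have "f \<in> oriented_span (basis n (oriented_span f))" using basis(2) oriented_span_self by metis
 then obtain A where A: "f = act A (basis n (oriented_span f))" "0 < det A" by (auto simp: oriented_span_act)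
 let ?g = "triple (basis n (oriented_span f))"
 have m: "minor (triple f) J = det A * minor ?g J" for J by (subst A(1)) (rule minor_act)
 have "minor_norm n (triple f) = det A * minor_norm n ?g" using A(2) by (simp add: minor_norm_def m power_mult_distrib real_sqrt_mult flip: sum_distrib_left)
 then show ?thesis using A(2) by (simp add: pluecker_def m)
qed

lemma continuous_minor:
 assumes "\<And>j i. j < 3 ==> cont_real Z (\<lambda>z. g z j i)"
 shows "cont_real Z (\<lambda>z. minor (g z) I)" unfolding minor_def det3_def using assms
 by (intro continuous_map_add continuous_map_diff continuous_map_real_mult) simp_all

lemma continuous_pluecker: "cont_real (grass n) (pluecker n I)" proof -
 let ?S = "stiefel_manifold n :: (3 => nat => real) topology"
 have c: "cont_real ?S (\<lambda>f. minor (triple f) J)" for J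
  using continuous_map_stiefel[of ?S n "\<lambda>f. f"] by (intro continuous_minor) (simp add: triple_def)
 have "cont_real ?S (\<lambda>f. \<Sum>J\<in>triples n. (minor (triple f) J)\<^sup>2)"
  by (intro continuous_map_sum continuous_map_real_pow c finite_triples)
 moreover have "cont_real euclideanreal sqrt" by (simp add: continuous_on_real_sqrt)
 ultimately have "cont_real ?S (\<lambda>f. minor_norm n (triple f))" unfolding minor_norm_def by (rule continuous_map_comp)
 then have "cont_real ?S (\<lambda>f. minor (triple f) I / minor_norm n (triple f))"
  using minor_norm_pos c by (intro continuous_map_real_divide) (auto simp: less_imp_neq[symmetric])
 then have "cont_real ?S (pluecker n I \<circ> oriented_span)" by (rule continuous_map_eq) (simp add: pluecker_oriented_span)
 then show ?thesis using continuous_compose_quotient_map_eq[OF quotient_map_oriented_span] by blast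
qed

theorem charted_grass: "charted n (grass n) underlying_subspace"
proof (rule charted_of_minors[where g = "\<lambda>b. triple (basis n b)" and N = "\<lambda>b. minor_norm n (triple (basis n b)) * minor_norm n (triple (basis n b))"])
 fix b assume b: "b \<in> topspace (grass n)"
 note B = basis[OF b]
 show "independent3 (triple (basis n b))" "minor_norm n (triple (basis n b)) * minor_norm n (triple (basis n b)) \<noteq> 0"
  using B(1) minor_norm_pos[OF B(1)] by (simp_all add: topspace_stiefel)
 show "triple (basis n b) j i = 0" if "i \<ge> n" for j i using B(1) that by (simp add: topspace_stiefel triple_def)
 show "underlying_subspace b = span3 (triple (basis n b))" using underlying_oriented_span[of "basis n b"] by (simp add: B(2))
next
 fix I J
 have "cont_real (grass n) (\<lambda>b. pluecker n I b * pluecker n J b)" by (intro continuous_map_real_mult continuous_pluecker)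
 then show "cont_real (grass n) (\<lambda>b. minor (triple (basis n b)) I * minor (triple (basis n b)) J /
   (minor_norm n (triple (basis n b)) * minor_norm n (triple (basis n b))))" by (simp add: pluecker_def)
qed

section \<open>Triples of lines in the fibres\<close>

definition line_triple :: "nat => 'y topology => ('y => nat => nat => real) => bool"
 where "line_triple n Y u \<longleftrightarrow> (\<forall>j<3. line_field n Y (\<lambda>y. u y j))"

abbreviation root :: "'y topology => ('y => nat => nat => real) => nat => 'y cochain"
 where "root Y u j \<equiv> line_cocycle Y (\<lambda>y. u y j)"

text \<open>With squared cosines below 1/4 the Gram matrix of three unit vectors is strictly
  diagonally dominant, and the condition is still open. All pairwise orthogonal triples belong to
  the set, so its complement is covered by the sets where two of the lines are not
  orthogonal.\<close>

definition nearly_orthogonal :: "nat => 'y topology => ('y => nat => nat => real) => 'y set"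
 where "nearly_orthogonal n Y u =
  {y \<in> topspace Y. \<forall>i j. i < j \<and> j < 3 \<longrightarrow> (dotn n (u y i) (u y j))\<^sup>2 \<in> {..<1/4}}"

lemma line_tripleD: "line_triple n Y u ==> j < 3 ==> line_field n Y (\<lambda>y. u y j)" by (simp add: line_triple_def)

lemma root_cocycles: "line_triple n Y u ==> j < 3 ==> root Y u j \<in> cocycles Y"
 by (rule line_cocycle_cocycles) (rule line_tripleD)

lemma root_commute: "line_triple n Y u ==> i < 3 ==> j < 3 ==> cup Y (root Y u i) (root Y u j) + cup Y (root Y u j) (root Y u i) \<in> cobs Y"
 by (intro degree_1_cup_commute root_cocycles) (auto simp: line_cocycle_degree)

lemma continuous_dotn_square:
 assumes "line_field n Y u" "line_field n Y u'"
 shows "cont_real Y (\<lambda>y. (dotn n (u y) (u' y))\<^sup>2)" unfolding dotn_square using assms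
 by (intro continuous_map_sum continuous_map_real_mult[where f = "\<lambda>y. u y _ * u y _"]) (auto simp: line_field_def)

lemma openin_nearly_orthogonal:
 assumes u: "line_triple n Y u"
 shows "openin Y (nearly_orthogonal n Y u)" proof -
 have "nearly_orthogonal n Y u = {y \<in> topspace Y. (dotn n (u y 0) (u y 1))\<^sup>2 \<in> {..<1/4}} \<inter>
  {y \<in> topspace Y. (dotn n (u y 0) (u y 2))\<^sup>2 \<in> {..<1/4}} \<inter> {y \<in> topspace Y. (dotn n (u y 1) (u y 2))\<^sup>2 \<in> {..<1/4}}"
  by (auto simp: nearly_orthogonal_def less_3_cases less_2_cases_iff)
 also have "openin Y \<dots>" by (intro openin_Int openin_continuous_map_preimage[where Y = euclideanreal] continuous_dotn_square line_tripleD[OF u]) auto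
 finally show ?thesis .
qed

lemma dotn_add3: "dotn n (\<lambda>i. a * v i + b * w i + c * z i) y = a * dotn n v y + b * dotn n w y + c * dotn n z y"
 by (simp add: dotn_def sum.distrib sum_distrib_left algebra_simps)

lemma abs_mult_half:
 fixes d :: real
 assumes "d\<^sup>2 < 1/4"
 shows "\<bar>a * d\<bar> \<le> \<bar>a\<bar> / 2" "a \<noteq> 0 ==> \<bar>a * d\<bar> < \<bar>a\<bar> / 2" proof -
 have d: "\<bar>d\<bar> < 1/2" using assms abs_square_less_1[of "2 * d"] by (simp add: power_mult_distrib)
 show "\<bar>a * d\<bar> \<le> \<bar>a\<bar> / 2" using mult_left_mono[of "\<bar>d\<bar>" "1/2" "\<bar>a\<bar>"] d by (simp add: abs_mult)
 show "\<bar>a * d\<bar> < \<bar>a\<bar> / 2" if "a \<noteq> 0" using mult_strict_left_mono[OF d, of "\<bar>a\<bar>"] that by (simp add: abs_mult)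
qed

lemma balanced:
 fixes a b c p q r s t w :: real
 assumes "a \<le> q + r" "b \<le> p + s" "c \<le> t + w" "p \<le> a / 2" "t \<le> a / 2" "q \<le> b / 2" "w \<le> b / 2" "r \<le> c / 2" "s \<le> c / 2"
 shows "p = a / 2 \<and> q = b / 2 \<and> r = c / 2" using assms by linarith

text \<open>Scalar products with the three vectors bound the absolute value of each coefficient by
  half the sum of the other two. Adding the three bounds forces equality everywhere, which
  strictness excludes for a nonzero coefficient.\<close>

lemma nearly_orthogonal_independent:
 assumes u: "line_triple n Y u" and y: "y \<in> nearly_orthogonal n Y u"
 shows "independent3 (u y)" unfolding independent3_def proof (intro allI impI)
 fix a b c assume z: "\<forall>i. a * u y 0 i + b * u y 1 i + c * u y 2 i = 0"
 define d01 d02 d12 where "d01 = dotn n (u y 0) (u y 1)" and "d02 = dotn n (u y 0) (u y 2)" and "d12 = dotn n (u y 1) (u y 2)"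
 have d: "d01\<^sup>2 < 1/4" "d02\<^sup>2 < 1/4" "d12\<^sup>2 < 1/4" using y by (auto simp: nearly_orthogonal_def d01_def d02_def d12_def)
 have one: "dotn n (u y j) (u y j) = 1" if "j < 3" for j using line_tripleD[OF u that] y by (simp add: line_field_def nearly_orthogonal_def)
 have "dotn n (\<lambda>i. a * u y 0 i + b * u y 1 i + c * u y 2 i) (u y j) = 0" for j using z by simp
 then have E: "a * dotn n (u y 0) (u y j) + b * dotn n (u y 1) (u y j) + c * dotn n (u y 2) (u y j) = 0" for j unfolding dotn_add3 .
 have "a + b * d01 + c * d02 = 0" "a * d01 + b + c * d12 = 0" "a * d02 + b * d12 + c = 0"
  using E[of 0] E[of 1] E[of 2] one[of 0] one[of 1] one[of 2] by (simp_all add: d01_def d02_def d12_def dotn_commute)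
 then have e: "\<bar>a\<bar> \<le> \<bar>b * d01\<bar> + \<bar>c * d02\<bar>" "\<bar>b\<bar> \<le> \<bar>a * d01\<bar> + \<bar>c * d12\<bar>" "\<bar>c\<bar> \<le> \<bar>a * d02\<bar> + \<bar>b * d12\<bar>"
  by linarith+
 have "\<bar>a * d01\<bar> = \<bar>a\<bar> / 2 \<and> \<bar>b * d01\<bar> = \<bar>b\<bar> / 2 \<and> \<bar>c * d02\<bar> = \<bar>c\<bar> / 2"
  by (rule balanced[OF e]) (rule abs_mult_half(1), rule d)+
 then show "a = 0 \<and> b = 0 \<and> c = 0" using abs_mult_half(2)[OF d(1), of a] abs_mult_half(2)[OF d(1), of b] abs_mult_half(2)[OF d(2), of c]
  by (metis less_irrefl)
qed

text \<open>
 The differences of the roots vanish where the lines are not orthogonal; this makes up for the restriction to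
 the open set of nearly orthogonal triples.
\<close>

theorem nearly_orthogonal_kernel:
 assumes u: "line_triple n Y u" and c: "c \<in> cocycles Y"
  and z: "restr (subtopology Y (nearly_orthogonal n Y u)) c \<in> cobs (subtopology Y (nearly_orthogonal n Y u))"
 shows "cup Y c (cup Y (root Y u 0 + root Y u 1) (cup Y (root Y u 0 + root Y u 2) (root Y u 1 + root Y u 2))) \<in> cobs Y" proof -
 define U where "U = (\<lambda>i j. {y \<in> topspace Y. (dotn n (u y i) (u y j))\<^sup>2 \<in> - {0}})"
 have U: "root Y u i + root Y u j \<in> cocycles Y \<and> openin Y (U i j) \<and>
   restr (subtopology Y (U i j)) (root Y u i + root Y u j) \<in> cobs (subtopology Y (U i j))" if ij: "i < 3" "j < 3" for i j
 proof (intro conjI)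
  show "root Y u i + root Y u j \<in> cocycles Y" using root_cocycles[OF u] ij by blast
  show "openin Y (U i j)" unfolding U_def using ij
   by (intro openin_continuous_map_preimage[where Y = euclideanreal] continuous_dotn_square line_tripleD[OF u]) auto
  have "line_cocycle (subtopology Y (U i j)) (\<lambda>y. u y i) + line_cocycle (subtopology Y (U i j)) (\<lambda>y. u y j) \<in> cobs (subtopology Y (U i j))"
   using ij by (intro line_cocycle_nonorthogonal[of n] line_field_subtopology line_tripleD[OF u]) (auto simp: U_def)
  then show "restr (subtopology Y (U i j)) (root Y u i + root Y u j) \<in> cobs (subtopology Y (U i j))"
   by (simp add: pull_add line_cocycle_pullback)
 qed
 have "cup_list Y [c, root Y u 0 + root Y u 1, root Y u 0 + root Y u 2, root Y u 1 + root Y u 2] \<in> cobs Y" proof (rule cover_product_coboundary)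
  show "list_all2 (\<lambda>\<phi> U. \<phi> \<in> cocycles Y \<and> openin Y U \<and> restr (subtopology Y U) \<phi> \<in> cobs (subtopology Y U))
   [c, root Y u 0 + root Y u 1, root Y u 0 + root Y u 2, root Y u 1 + root Y u 2]
   [nearly_orthogonal n Y u, U 0 1, U 0 2, U 1 2]" using c z openin_nearly_orthogonal[OF u] U[of 0 1] U[of 0 2] U[of 1 2] by simp
  show "topspace Y \<subseteq> \<Union>(set [nearly_orthogonal n Y u, U 0 1, U 0 2, U 1 2])"
   by (auto simp: nearly_orthogonal_def U_def less_3_cases less_2_cases_iff)
 qed
 moreover have "root Y u 1 + root Y u 2 \<in> cochains Y" using root_cocycles[OF u] by (auto dest: cocyclesD)
 ultimately show ?thesis by (simp add: cup_unit_right)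
qed

text \<open>The lines are chosen independently in the same fibre of V: each stage is the projective
  bundle of a pullback of V, not of a quotient or complement.\<close>

abbreviation flag2 :: "nat => 'b topology => ('b => (nat => real) set) => (('b \<times> (nat => real) set) \<times> (nat => real) set) topology"
 where "flag2 n X V \<equiv> pbundle n (pbundle n X V) (\<lambda>p. V (fst p))"

abbreviation flag3 :: "nat => 'b topology => ('b => (nat => real) set) =>
  ((('b \<times> (nat => real) set) \<times> (nat => real) set) \<times> (nat => real) set) topology"
 where "flag3 n X V \<equiv> pbundle n (flag2 n X V) (\<lambda>p. V (fst (fst p)))"

definition flag_lines :: "nat => (('b \<times> (nat => real) set) \<times> (nat => real) set) \<times> (nat => real) set => nat => nat => real"
 where "flag_lines n p j = (if j = 0 then fibre_unit n (fst (fst p)) else if j = 1 then fibre_unit n (fst p) else fibre_unit n p)"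

lemma flag_projections:
 "continuous_map (flag3 n X V) (flag2 n X V) fst"
 "continuous_map (flag3 n X V) (pbundle n X V) (\<lambda>p. fst (fst p))"
 "continuous_map (flag3 n X V) X (\<lambda>p. fst (fst (fst p)))"
 by (intro continuous_pbundle_fst continuous_map_comp[OF continuous_pbundle_fst])+

lemma line_triple_flag:
 assumes lin: "\<And>b. b \<in> topspace X ==> lin_closed (V b)"
 shows "line_triple n (flag3 n X V) (flag_lines n)" unfolding line_triple_def proof (intro allI impI)
 fix j :: nat assume j: "j < 3"
 have 1: "line_field n (pbundle n X V) (fibre_unit n)" by (rule line_field_pbundle[OF lin])
 have 2: "line_field n (flag2 n X V) (fibre_unit n)"
  using continuous_map_mem[OF continuous_pbundle_fst] lin by (intro line_field_pbundle) blast
 have 3: "line_field n (flag3 n X V) (fibre_unit n)"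
  using continuous_map_mem[OF continuous_map_comp[OF continuous_pbundle_fst continuous_pbundle_fst]] lin
  by (intro line_field_pbundle) blast
 show "line_field n (flag3 n X V) (\<lambda>p. flag_lines n p j)"
  using j line_field_compose[OF 1 flag_projections(2)] line_field_compose[OF 2 flag_projections(1)] 3 by (auto simp: flag_lines_def less_3_cases)
qed

lemma theta_injective':
 assumes "charted n X V" "k0 \<in> cocycles X" "k1 \<in> cocycles X" "k2 \<in> cocycles X"
  and "pull (pbundle n X V) fst k0 + cup (pbundle n X V) (pull (pbundle n X V) fst k1) (taut n X V)
   + cup (pbundle n X V) (pull (pbundle n X V) fst k2) (cup (pbundle n X V) (taut n X V) (taut n X V))
   \<in> cobs (pbundle n X V)"
 shows "k0 \<in> cobs X" "k1 \<in> cobs X" "k2 \<in> cobs X" proof -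
 let ?k = "\<lambda>i::nat. if i = 0 then k0 else if i = 1 then k1 else k2"
 have "?k i \<in> cobs X" if "i < 3" for i by (rule theta_injective[OF assms(1) _ _ that]) (use assms in \<open>auto simp: theta_def Let_def\<close>)
 from this[of 0] this[of 1] this[of 2] show "k0 \<in> cobs X" "k1 \<in> cobs X" "k2 \<in> cobs X" by simp_all
qed

text \<open>On all triples, c times (x0 + x1)(x0 + x2)(x1 + x2) is exact. The coefficient of x2^2 in
  this product is x0 + x1, and that of x1 therein is 1; so two applications of the projective bundle
  theorem extract c, and a third one brings it down to X.\<close>

theorem nearly_orthogonal_injective:
 assumes ch: "charted n X V" and c: "c \<in> cocycles X"
  and z: "pull (subtopology (flag3 n X V) (nearly_orthogonal n (flag3 n X V) (flag_lines n))) (\<lambda>p. fst (fst (fst p))) c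
   \<in> cobs (subtopology (flag3 n X V) (nearly_orthogonal n (flag3 n X V) (flag_lines n)))"
 shows "c \<in> cobs X" proof -
 let ?P1 = "pbundle n X V" and ?P2 = "flag2 n X V" and ?P3 = "flag3 n X V"
 have ch2: "charted n ?P1 (\<lambda>p. V (fst p))" and ch3: "charted n ?P2 (\<lambda>p. V (fst (fst p)))"
  using charted_pullback[OF ch continuous_pbundle_fst]
   charted_pullback[OF ch continuous_map_comp[OF continuous_pbundle_fst continuous_pbundle_fst]] by auto
 have lt: "line_triple n ?P3 (flag_lines n)" by (rule line_triple_flag[OF charted_lin_closed[OF ch]])
 let ?x = "\<lambda>j. root ?P3 (flag_lines n) j"
 let ?y0 = "line_cocycle ?P2 (\<lambda>p. fibre_unit n (fst p))" and ?y1 = "line_cocycle ?P2 (fibre_unit n)"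
 let ?z = "line_cocycle ?P1 (fibre_unit n)"
 let ?c1 = "pull ?P1 fst c"
 let ?c2 = "pull ?P2 fst ?c1"
 let ?c3 = "pull ?P3 fst ?c2"
 note fst_c = continuous_pbundle_fst
 have c1: "?c1 \<in> cocycles ?P1" using c fst_c by (rule pull_cocycles)
 have c2: "?c2 \<in> cocycles ?P2" using c1 fst_c by (rule pull_cocycles)
 have c3: "?c3 \<in> cocycles ?P3" using c2 fst_c by (rule pull_cocycles)
 have zc: "?z \<in> cocycles ?P1" by (rule taut_cocycle[OF charted_lin_closed[OF ch]])
 have yc: "?y1 \<in> cocycles ?P2" "?y0 \<in> cocycles ?P2" using taut_cocycle[OF charted_lin_closed[OF ch2]] pull_cocycles[OF zc fst_c]
  by (simp_all add: line_cocycle_pullback[OF fst_c])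
 have pull: "pull ?P3 fst ?y0 = ?x 0" "pull ?P3 fst ?y1 = ?x 1" "line_cocycle ?P3 (fibre_unit n) = ?x 2"
  "pull ?P2 fst ?z = ?y0" by (simp_all add: line_cocycle_pullback[OF fst_c] flag_lines_def)
 have c3eq: "?c3 = pull ?P3 (\<lambda>p. fst (fst (fst p))) c" unfolding pull_compose[OF fst_c] by (simp add: o_def)
 have "cup ?P3 ?c3 (cup ?P3 (?x 0 + ?x 1) (cup ?P3 (?x 0 + ?x 2) (?x 1 + ?x 2))) \<in> cobs ?P3"
  by (rule nearly_orthogonal_kernel[OF lt c3]) (unfold c3eq restrict_pullback, rule z)
 \<comment> \<open>The added commutator replaces x2 x1 by x1 x2, so that x2 stands on the right as
   in \<open>theta\<close>.\<close>
 moreover have "cup ?P3 ?c3 (cup ?P3 (?x 0 + ?x 1) (cup ?P3 (?x 2) (?x 1) + cup ?P3 (?x 1) (?x 2))) \<in> cobs ?P3"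
  using c3 root_cocycles[OF lt] by (intro cobs_cup_right root_commute[OF lt]) auto
 ultimately have "cup ?P3 ?c3 (cup ?P3 (?x 0 + ?x 1) (cup ?P3 (?x 0 + ?x 2) (?x 1 + ?x 2))) +
   cup ?P3 ?c3 (cup ?P3 (?x 0 + ?x 1) (cup ?P3 (?x 2) (?x 1) + cup ?P3 (?x 1) (?x 2))) \<in> cobs ?P3" by (rule cobs_add)
 then have t: "pull ?P3 fst (cup ?P2 ?c2 (cup ?P2 (?y0 + ?y1) (cup ?P2 ?y0 ?y1))) +
   cup ?P3 (pull ?P3 fst (cup ?P2 ?c2 (cup ?P2 (?y0 + ?y1) (?y0 + ?y1)))) (line_cocycle ?P3 (fibre_unit n)) +
   cup ?P3 (pull ?P3 fst (cup ?P2 ?c2 (?y0 + ?y1))) (cup ?P3 (line_cocycle ?P3 (fibre_unit n)) (line_cocycle ?P3 (fibre_unit n))) \<in> cobs ?P3"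
  unfolding pull_cup[OF fst_c] pull_add pull by (simp only: cup_add_left cup_add_right cup_assoc cochain_ac)
 have "cup ?P2 ?c2 (?y0 + ?y1) \<in> cobs ?P2" by (rule theta_injective'(3)[OF ch3 _ _ _ t]) (use c2 yc in auto)
 then have t2: "pull ?P2 fst (cup ?P1 ?c1 ?z) + cup ?P2 (pull ?P2 fst ?c1) ?y1 + cup ?P2 (pull ?P2 fst 0) (cup ?P2 ?y1 ?y1) \<in> cobs ?P2"
  by (simp add: pull_cup[OF fst_c] pull cup_add_right)
 have "?c1 \<in> cobs ?P1" by (rule theta_injective'(2)[OF ch2 _ _ _ t2]) (use c1 zc in auto)
 then show ?thesis using theta_injective'(1)[OF ch c, of 0 0] by simp
qed

section \<open>Top classes of products of projective spaces\<close>

definition euclid :: "nat => (nat => real) set"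
 where "euclid n = {v. \<forall>i\<ge>n. v i = 0}"

lemma frame_span_vertex: "frame_span (\<lambda>j _. vertex j) n b = euclid n" proof (rule subset_antisym; rule subsetI)
 fix v assume v: "v \<in> euclid n"
 have "v = (\<lambda>i. \<Sum>j<n. v j * vertex j i)" using v by (auto simp: euclid_def if_distrib[of "\<lambda>x. _ * x"] cong: if_cong)
 then show "v \<in> frame_span (\<lambda>j _. vertex j) n b" unfolding frame_span_def by blast
qed (auto simp: frame_span_def euclid_def intro!: sum.neutral)

lemma lin_closed_euclid: "lin_closed (euclid n)" by (simp add: lin_closed_def euclid_def)

lemma frame_vertex: "frame n X n (\<lambda>j _. vertex j)" by (auto simp: frame_def if_distrib[of "\<lambda>x. _ * x"] cong: if_cong)

lemma euclid_top_power:
 assumes "a \<in> cocycles X" and "cup (pbundle (Suc n) X (\<lambda>_. euclid (Suc n))) (pull (pbundle (Suc n) X (\<lambda>_. euclid (Suc n))) fst a)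
   (cup_pow (pbundle (Suc n) X (\<lambda>_. euclid (Suc n))) (taut (Suc n) X (\<lambda>_. euclid (Suc n))) n)
   \<in> cobs (pbundle (Suc n) X (\<lambda>_. euclid (Suc n)))"
 shows "a \<in> cobs X" using framed_top_power_injective[OF frame_vertex order_refl assms(1)] assms(2) unfolding frame_span_vertex by blast

text \<open>The n standard basis vectors serve as constant vector fields: no line is orthogonal to
  all of them.\<close>

lemma line_field_power_zero:
 assumes u: "line_field n Y u"
 shows "cup_pow Y (line_cocycle Y u) n \<in> cobs Y" proof (rule framed_power_zero[where f = "\<lambda>j _. vertex j", OF u])
 fix y assume y: "y \<in> topspace Y"
 show "\<exists>j<n. dotn n (u y) (vertex j) \<noteq> 0" proof (rule ccontr)
  assume "\<not> ?thesis"
  moreover have "dotn n (u y) (vertex j) = u y j" if "j < n" for j using that by (simp add: dotn_def if_distrib[of "\<lambda>x. _ * x"] cong: if_cong)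
  ultimately have "dotn n (u y) (u y) = 0" by (simp add: dotn_def)
  then show False using u y by (simp add: line_field_def)
 qed
qed (simp_all add: dotn_def if_distrib[of "\<lambda>x. _ * x"] cong: if_cong)

abbreviation point :: "unit topology"
 where "point \<equiv> discrete_topology {()}"

lemma unit_not_coboundary: "unit_cochain point \<notin> cobs point" proof
 assume "unit_cochain point \<in> cobs point"
 then obtain \<psi> where "unit_cochain point = coboundary point \<psi>" by (rule cobsE)
 then have z: "unit_cochain point 0 \<sigma> = 0" for \<sigma> by (simp add: coboundary_def)
 have "ssimplex 0 point (restrict (\<lambda>_. ()) (std_simplex 0))" by (simp add: singular_simplex_def)
 then show False using z[of "restrict (\<lambda>_. ()) (std_simplex 0)"] by (simp add: unit_cochain_def)
qed

text \<open>Over a point, \<open>flag3\<close> is a product of three projective spaces of dimension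
  n. Injectivity of multiplication by the top power removes one factor at a time, down to the class
  1 of the point.\<close>

theorem flag_top_class:
 fixes n :: nat
 defines "P \<equiv> flag3 (Suc n) point (\<lambda>_. euclid (Suc n))"
 shows "cup P (cup P (cup_pow P (root P (flag_lines (Suc n)) 0) n) (cup_pow P (root P (flag_lines (Suc n)) 1) n))
  (cup_pow P (root P (flag_lines (Suc n)) 2) n) \<notin> cobs P" proof
 assume z: "cup P (cup P (cup_pow P (root P (flag_lines (Suc n)) 0) n) (cup_pow P (root P (flag_lines (Suc n)) 1) n))
  (cup_pow P (root P (flag_lines (Suc n)) 2) n) \<in> cobs P"
 let ?n = "Suc n" and ?V = "\<lambda>_. euclid (Suc n)"
 let ?P1 = "pbundle ?n point ?V" and ?P2 = "flag2 ?n point ?V" and ?P3 = "flag3 ?n point ?V"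
 let ?y0 = "line_cocycle ?P2 (\<lambda>p. fibre_unit ?n (fst p))" and ?y1 = "line_cocycle ?P2 (fibre_unit ?n)"
 let ?z = "line_cocycle ?P1 (fibre_unit ?n)"
 note fst_c = continuous_pbundle_fst
 have zc: "?z \<in> cocycles ?P1" by (rule taut_cocycle[OF lin_closed_euclid])
 have yc: "?y1 \<in> cocycles ?P2" "?y0 \<in> cocycles ?P2" using taut_cocycle[OF lin_closed_euclid] pull_cocycles[OF zc fst_c]
  by (simp_all add: line_cocycle_pullback[OF fst_c])
 have "cup ?P2 (cup_pow ?P2 ?y0 n) (cup_pow ?P2 ?y1 n) \<in> cobs ?P2" by (rule euclid_top_power)
   (use z yc in \<open>auto simp: P_def pull_cup[OF fst_c] cup_pow_pullback[OF fst_c] line_cocycle_pullback[OF fst_c] flag_lines_def\<close>)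
 then have "cup ?P2 (pull ?P2 fst (cup_pow ?P1 ?z n)) (cup_pow ?P2 ?y1 n) \<in> cobs ?P2"
  by (simp add: cup_pow_pullback[OF fst_c] line_cocycle_pullback[OF fst_c])
 then have "cup_pow ?P1 ?z n \<in> cobs ?P1" by (rule euclid_top_power[OF cup_pow_cocycles[OF zc]])
 then have "cup ?P1 (pull ?P1 fst (unit_cochain point)) (cup_pow ?P1 ?z n) \<in> cobs ?P1"
  using cup_pow_cocycles[OF zc, of n] by (simp add: pull_unit[OF fst_c] cup_unit_left cocyclesD)
 then have "unit_cochain point \<in> cobs point" by (rule euclid_top_power[OF unit_cochain_cocycles])
 then show False using unit_not_coboundary by blast
qed

text \<open>Applied to two minors of one triple of vectors, this gives a determinant whose entries
  are sums of \<open>u y i p * u y i q\<close>; hence the product of the minors is continuous for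
  line fields, although each minor depends on signs.\<close>

lemma det3_mult: "det3 x * det3 y = det3 (\<lambda>p q. \<Sum>i<3. x i p * y i q)" proof -
 define c where "c = (\<lambda>j::3. if j = 1 then 0 else if j = 2 then 1 else 2 :: nat)"
 have d: "det3 z = det (\<chi> i j. z (c i) (c j))" for z by (simp add: det3_def det_3 c_def algebra_simps)
 let ?X = "\<chi> i j. x (c i) (c j)" and ?Y = "\<chi> i j. y (c i) (c j)"
 have "transpose ?X ** ?Y = (\<chi> p q. \<Sum>i<3. x i (c p) * y i (c q))" by (simp add: vec_eq_iff matrix_matrix_mult_def transpose_def sum_3 sum3 c_def)
 moreover have "det ?X * det ?Y = det (transpose ?X ** ?Y)" by (simp add: det_mul det_transpose)
 ultimately show ?thesis by (simp only: d)
qed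

section \<open>Evaluating polynomials at the roots\<close>

definition cohomologous :: "'a topology => 'a cochain => 'a cochain => bool"
 where "cohomologous X \<phi> \<psi> \<longleftrightarrow> \<phi> + \<psi> \<in> cobs X"

lemma cohomologous_refl [simp]: "cohomologous X \<phi> \<phi>" by (simp add: cohomologous_def cochain_double)

lemma cohomologous_commute: "cohomologous X \<phi> \<psi> ==> cohomologous X \<psi> \<phi>" by (simp add: cohomologous_def add.commute)

lemma cohomologous_transitive [trans]: "cohomologous X \<phi> \<psi> ==> cohomologous X \<psi> \<theta> ==> cohomologous X \<phi> \<theta>"
 unfolding cohomologous_def by (rule cohomologous_trans)

lemma cohomologous_cups:
 "cohomologous X \<phi> \<phi>' ==> cohomologous X \<psi> \<psi>' ==> \<phi>' \<in> cocycles X ==> \<psi> \<in> cocycles X ==> cohomologous X (cup X \<phi> \<psi>) (cup X \<phi>' \<psi>')"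
 unfolding cohomologous_def by (rule cohomologous_cup)

lemma cohomologous_adds:
 assumes "cohomologous X \<phi> \<phi>'" "cohomologous X \<psi> \<psi>'"
 shows "cohomologous X (\<phi> + \<psi>) (\<phi>' + \<psi>')"
 using cobs_add[OF assms[unfolded cohomologous_def]] by (simp add: cohomologous_def add_ac)

lemma cohomologous_exact: "cohomologous X \<phi> \<psi> ==> \<psi> \<in> cobs X ==> \<phi> \<in> cobs X"
 unfolding cohomologous_def by (rule coboundary_transfer)

definition cup_commutes :: "'a topology => 'a cochain => 'a cochain => bool"
 where "cup_commutes X \<phi> \<psi> \<longleftrightarrow> \<phi> \<in> cocycles X \<and> \<psi> \<in> cocycles X \<and> cohomologous X (cup X \<phi> \<psi>) (cup X \<psi> \<phi>)"

lemma cup_commutes_sym: "cup_commutes X \<phi> \<psi> ==> cup_commutes X \<psi> \<phi>"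
 by (auto simp: cup_commutes_def intro: cohomologous_commute)

lemma cup_commutes_middle:
 assumes "cup_commutes X \<phi> \<psi>" "\<alpha> \<in> cocycles X" "\<beta> \<in> cocycles X"
 shows "cohomologous X (cup X \<alpha> (cup X (cup X \<phi> \<psi>) \<beta>)) (cup X \<alpha> (cup X (cup X \<psi> \<phi>) \<beta>))"
proof (rule cohomologous_cups)
 show "cohomologous X (cup X (cup X \<phi> \<psi>) \<beta>) (cup X (cup X \<psi> \<phi>) \<beta>)"
  using assms by (intro cohomologous_cups[where \<psi> = \<beta>]) (auto simp: cup_commutes_def)
qed (use assms in \<open>auto simp: cup_commutes_def\<close>)

lemma cup_commutes_cup:
 assumes "cup_commutes X \<phi> \<psi>" "cup_commutes X \<phi> \<theta>"
 shows "cup_commutes X \<phi> (cup X \<psi> \<theta>)" proof -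
 have "cohomologous X (cup X (cup X \<phi> \<psi>) \<theta>) (cup X (cup X \<psi> \<phi>) \<theta>)"
  "cohomologous X (cup X \<psi> (cup X \<phi> \<theta>)) (cup X \<psi> (cup X \<theta> \<phi>))"
  using assms by (auto simp: cup_commutes_def intro!: cohomologous_cups)
 then show ?thesis using assms cohomologous_transitive by (auto simp: cup_commutes_def cup_assoc)
qed

lemma cup_commutes_pow: "cup_commutes X \<phi> \<psi> ==> cup_commutes X \<phi> (cup_pow X \<psi> k)" proof (induction k)
 case 0
 then show ?case by (auto simp: cup_commutes_def cup_unit_left cup_unit_right dest: cocyclesD(1))
qed (auto intro: cup_commutes_cup)

lemma cup_pow_cochains: "\<phi> \<in> cochains X ==> cup_pow X \<phi> k \<in> cochains X" by (induction k) auto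

lemma cup_pow_add: "\<phi> \<in> cochains X ==> cup_pow X \<phi> (k + l) = cup X (cup_pow X \<phi> k) (cup_pow X \<phi> l)"
 by (induction l) (simp_all add: cup_assoc cup_unit_right cup_pow_cochains)

section \<open>Polynomials over the field with two elements and their values\<close>

type_synonym poly3 = "(nat \<times> nat \<times> nat) \<Rightarrow>\<^sub>0 bit"

definition monomial :: "'a topology => (nat => 'a cochain) => nat \<times> nat \<times> nat => 'a cochain"
 where "monomial X x = (\<lambda>(i, j, k). cup X (cup X (cup_pow X (x 0) i) (cup_pow X (x 1) j)) (cup_pow X (x 2) k))"

text \<open>The values are cochains with the factors of each monomial in a fixed order, so products
  are respected only up to coboundaries (\<open>evaluate_mult\<close>). All keys have coefficient
  1.\<close>

definition evaluate :: "'a topology => (nat => 'a cochain) => poly3 => 'a cochain"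
 where "evaluate X x p = (\<Sum>m\<in>Poly_Mapping.keys p. monomial X x m)"

definition var :: "nat => poly3"
 where "var j = Poly_Mapping.single (if j = 0 then (1, 0, 0) else if j = 1 then (0, 1, 0) else (0, 0, 1)) 1"

definition commuting :: "'a topology => (nat => 'a cochain) => bool"
 where "commuting X x \<longleftrightarrow> (\<forall>i<3. \<forall>j<3. cup_commutes X (x i) (x j))"

lemma commutingD: "commuting X x ==> i < 3 ==> j < 3 ==> cup_commutes X (x i) (x j)" by (simp add: commuting_def)

lemma commuting_cocycles: "commuting X x ==> i < 3 ==> x i \<in> cocycles X" by (auto simp: commuting_def cup_commutes_def)

lemma monomial_cocycles:
 assumes "commuting X x"
 shows "monomial X x m \<in> cocycles X" using commuting_cocycles[OF assms, of 0] commuting_cocycles[OF assms, of 1] commuting_cocycles[OF assms, of 2]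
 by (auto simp: monomial_def split: prod.splits)

lemma evaluate_0 [simp]: "evaluate X x 0 = 0" by (simp add: evaluate_def)

lemma evaluate_superset:
 assumes "finite S" "Poly_Mapping.keys p \<subseteq> S"
 shows "evaluate X x p = (\<Sum>m\<in>S. if Poly_Mapping.lookup p m = 0 then 0 else monomial X x m)"
 unfolding evaluate_def using assms by (intro sum.mono_neutral_cong_left) (auto simp: in_keys_iff)

lemma evaluate_add: "evaluate X x (p + q) = evaluate X x p + evaluate X x q" proof -
 let ?S = "Poly_Mapping.keys p \<union> Poly_Mapping.keys q"
 have bit: "(if a + b = 0 then 0 else M) = (if a = 0 then 0 else M) + (if b = 0 then 0 else M :: 'a cochain)" for a b :: bit and M
  by (cases a; cases b) (simp_all add: bit_double cochain_double)
 show ?thesis using keys_add[of p q] evaluate_superset[of ?S p X x] evaluate_superset[of ?S q X x] evaluate_superset[of ?S "p + q" X x]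
  by (simp add: lookup_add bit sum.distrib)
qed

lemma evaluate_single [simp]: "evaluate X x (Poly_Mapping.single m 1) = monomial X x m" by (simp add: evaluate_def)

lemma evaluate_one: "evaluate X x 1 = unit_cochain X" proof -
 have "evaluate X x 1 = evaluate X x (Poly_Mapping.single 0 1)" by (simp only: single_one)
 also have "\<dots> = monomial X x (0, 0, 0)" by (simp only: evaluate_single zero_prod_def)
 finally show ?thesis by (simp add: monomial_def cup_unit_left)
qed

lemma poly3_induct [case_names zero add]:
 fixes p :: poly3
 assumes "P 0" and "\<And>m p. P p ==> P (Poly_Mapping.single m 1 + p)"
 shows "P p" proof (induction "card (Poly_Mapping.keys p)" arbitrary: p)
 case 0
 then show ?case using assms(1) by simp
next
 case (Suc k)
 then obtain m where m: "m \<in> Poly_Mapping.keys p" by (metis card.empty equals0I nat.distinct(1))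
 \<comment> \<open>With coefficients mod 2, adding the monomial removes it from the keys, and adding
   it once more restores p.\<close>
 define q where "q = Poly_Mapping.single m 1 + p"
 have one: "Poly_Mapping.lookup p m = 1" using m by (cases "Poly_Mapping.lookup p m") (auto simp: in_keys_iff)
 have "m' \<in> Poly_Mapping.keys q \<longleftrightarrow> m' \<in> Poly_Mapping.keys p - {m}" for m'
  using one by (cases "m' = m") (auto simp: q_def in_keys_iff lookup_add lookup_single bit_double)
 then have "Poly_Mapping.keys q = Poly_Mapping.keys p - {m}" by (intro subset_antisym subsetI) blast+
 then have "P q" using Suc m by (intro Suc(1)) simp
 then have "P (Poly_Mapping.single m 1 + q)" by (rule assms(2))
 moreover have "Poly_Mapping.single m 1 + q = p" by (rule poly_mapping_eqI) (simp only: q_def lookup_add bit_cancel_left)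
 ultimately show ?case by simp
qed

lemma poly3_double [simp]: "(p::poly3) + p = 0" by (rule poly_mapping_eqI) (simp only: lookup_add bit_double lookup_zero)

lemma poly3_two [simp]: "(2::poly3) = 0" by (metis one_add_one poly3_double)

lemma poly3_cancel [simp]: "(p::poly3) + (p + q) = q" by (metis add.assoc add.left_neutral poly3_double)

lemma poly3_shift: "(p::poly3) + q + r + p + q = r" by (metis add.assoc add.commute poly3_cancel)

lemma poly3_swap: "(p::poly3) + q * r + r * q = p" by (simp only: mult.commute[of r q] add.assoc poly3_double add_0_right)

lemma evaluate_cocycles:
 assumes "commuting X x"
 shows "evaluate X x p \<in> cocycles X" proof (induction p rule: poly3_induct)
 case (add m p)
 then show ?case unfolding evaluate_add evaluate_single by (intro cocycles_add monomial_cocycles assms)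
qed (simp only: evaluate_0 cocycles_0)

lemma monomial_add:
 assumes x: "commuting X x"
 shows "cohomologous X (monomial X x (m + m')) (cup X (monomial X x m) (monomial X x m'))" proof -
 obtain i j k i' j' k' where m: "m = (i, j, k)" "m' = (i', j', k')" by (metis prod_cases3)
 have c: "x l \<in> cocycles X" if "l < 3" for l using commuting_cocycles[OF x that] .
 define p where "p = (\<lambda>l e. cup_pow X (x l) e)"
 have pc: "p l e \<in> cocycles X" if "l < 3" for l e using c[OF that] by (auto simp: p_def)
 have comm: "cup_commutes X (p a e) (p b f)" if "a < 3" "b < 3" for a b e f
  using cup_commutes_pow[OF cup_commutes_sym[OF cup_commutes_pow[OF commutingD[OF x that(2,1)]]]] by (simp add: p_def)
 note pc3 = pc[of 0] pc[of 1] pc[of 2]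
 have "cohomologous X (cup X (cup X (p 0 i) (p 1 j)) (cup X (cup X (p 2 k) (cup X (p 0 i') (p 1 j'))) (p 2 k')))
  (cup X (cup X (p 0 i) (p 1 j)) (cup X (cup X (cup X (p 0 i') (p 1 j')) (p 2 k)) (p 2 k')))"
  using pc3 by (intro cup_commutes_middle cup_commutes_cup comm cocycles_cup) auto
 moreover have "cohomologous X (cup X (p 0 i) (cup X (cup X (p 1 j) (p 0 i')) (cup X (p 1 j') (cup X (p 2 k) (p 2 k')))))
  (cup X (p 0 i) (cup X (cup X (p 0 i') (p 1 j)) (cup X (p 1 j') (cup X (p 2 k) (p 2 k')))))" using pc3 by (intro cup_commutes_middle comm cocycles_cup) auto
 ultimately have "cohomologous X (cup X (monomial X x m) (monomial X x m')) (cup X (p 0 i) (cup X (cup X (p 0 i') (p 1 j)) (cup X (p 1 j') (cup X (p 2 k) (p 2 k')))))"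
  by (simp add: monomial_def m p_def cup_assoc cohomologous_transitive)
 moreover have "cup X (p 0 i) (cup X (cup X (p 0 i') (p 1 j)) (cup X (p 1 j') (cup X (p 2 k) (p 2 k')))) = monomial X x (m + m')"
  using c[of 0] c[of 1] c[of 2] by (simp add: monomial_def m p_def cup_pow_add cup_assoc cocyclesD(1))
 ultimately show ?thesis by (simp add: cohomologous_commute)
qed

theorem evaluate_mult:
 assumes x: "commuting X x"
 shows "cohomologous X (evaluate X x (p * q)) (cup X (evaluate X x p) (evaluate X x q))" proof (induction p rule: poly3_induct)
 case (add m p)
 have "cohomologous X (evaluate X x (Poly_Mapping.single m 1 * q)) (cup X (monomial X x m) (evaluate X x q))" proof (induction q rule: poly3_induct)
  case (add m' q)
  then show ?case unfolding distrib_left evaluate_add cup_add_right mult_single mult_1_left evaluate_single by (intro cohomologous_adds monomial_add x)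
 qed (simp only: mult_zero_right evaluate_0 cup_0_right cohomologous_refl)
 then show ?case using add unfolding distrib_right evaluate_add cup_add_left evaluate_single by (intro cohomologous_adds)
qed (simp only: mult_zero_left evaluate_0 cup_0_left cohomologous_refl)

definition exact_ideal :: "'a topology => (nat => 'a cochain) => poly3 set"
 where "exact_ideal X x = {p. evaluate X x p \<in> cobs X}"

lemma exact_ideal_add: "p \<in> exact_ideal X x ==> q \<in> exact_ideal X x ==> p + q \<in> exact_ideal X x"
 by (auto simp: exact_ideal_def evaluate_add)

lemma exact_ideal_mult:
 assumes "commuting X x" "p \<in> exact_ideal X x"
 shows "p * q \<in> exact_ideal X x" proof -
 have "cup X (evaluate X x p) (evaluate X x q) \<in> cobs X"
  using assms evaluate_cocycles by (intro cobs_cup_left) (auto simp: exact_ideal_def)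
 then show ?thesis using cohomologous_exact[OF evaluate_mult[OF assms(1)]] by (simp add: exact_ideal_def)
qed

lemma evaluate_var:
 assumes "commuting X x" "j < 3"
 shows "evaluate X x (var j) = x j" using assms(2) commuting_cocycles[OF assms]
 by (auto simp: var_def monomial_def less_3_cases cup_unit_left cup_unit_right cocyclesD(1))

lemma evaluate_pullback:
 assumes "continuous_map Z X f"
 shows "pull Z f (evaluate X x p) = evaluate Z (\<lambda>j. pull Z f (x j)) p" proof (induction p rule: poly3_induct)
 case (add m p)
 have "pull Z f (monomial X x m) = monomial Z (\<lambda>j. pull Z f (x j)) m"
  by (simp add: monomial_def pull_cup[OF assms] cup_pow_pullback[OF assms] split: prod.splits)
 then show ?case using add by (simp only: evaluate_add evaluate_single pull_add)
qed (simp only: evaluate_0 pull_0)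

lemma commuting_roots:
 assumes "line_triple n Y u"
 shows "commuting Y (root Y u)" using assms root_cocycles root_commute by (auto simp: commuting_def cup_commutes_def cohomologous_def)

abbreviation elem1 :: poly3
 where "elem1 \<equiv> var 0 + var 1 + var 2"
abbreviation elem2 :: poly3
 where "elem2 \<equiv> var 0 * var 1 + var 0 * var 2 + var 1 * var 2"
abbreviation elem3 :: poly3
 where "elem3 \<equiv> var 0 * (var 1 * var 2)"

section \<open>Relations between the roots\<close>

abbreviation theta3 :: "nat => 'b topology => ('b => (nat => real) set) => 'b cochain => 'b cochain => 'b cochain => ('b \<times> (nat => real) set) cochain"
 where "theta3 n X V k0 k1 k2 \<equiv> theta n X V (\<lambda>i. if i = 0 then k0 else if i = 1 then k1 else k2)"

lemma theta3_eq: "theta3 n X V k0 k1 k2 = pull (pbundle n X V) fst k0 +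
  cup (pbundle n X V) (pull (pbundle n X V) fst k1) (taut n X V) +
  cup (pbundle n X V) (pull (pbundle n X V) fst k2) (cup (pbundle n X V) (taut n X V) (taut n X V))"
 by (simp add: theta_def Let_def)

text \<open>The tautological line lies in the span of the three lines and so is not orthogonal to
  all of them. Hence the product of the sums of x with the roots is exact by
  \<open>line_fields_product\<close>, and its expansion is the cubic with the elementary symmetric
  polynomials as coefficients.\<close>

theorem span_cubic_relation:
 assumes u: "line_triple n Y u" and ind: "\<And>y. y \<in> topspace Y ==> independent3 (u y)"
 defines "Q \<equiv> pbundle n Y (\<lambda>y. span3 (u y))"
 shows "cohomologous Q (cup_pow Q (taut n Y (\<lambda>y. span3 (u y))) 3)
  (theta3 n Y (\<lambda>y. span3 (u y)) (cup Y (root Y u 0) (cup Y (root Y u 1) (root Y u 2)))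
   (cup Y (root Y u 0) (root Y u 1) + cup Y (root Y u 0) (root Y u 2) + cup Y (root Y u 1) (root Y u 2))
   (root Y u 0 + root Y u 1 + root Y u 2))" proof -
 let ?V = "\<lambda>y. span3 (u y)"
 let ?x = "taut n Y ?V"
 note fst_c = continuous_pbundle_fst
 have lf: "line_field n Q (fibre_unit n)" unfolding Q_def by (rule line_field_pbundle) simp
 have lj: "line_field n Q (\<lambda>p. u (fst p) j)" if "j < 3" for j unfolding Q_def using line_field_compose[OF line_tripleD[OF u that] fst_c] .
 have x: "?x \<in> cocycles Q" unfolding Q_def by (rule taut_cocycle) simp
 define a b c where "a = line_cocycle Q (\<lambda>p. u (fst p) 0)" and "b = line_cocycle Q (\<lambda>p. u (fst p) 1)" and "c = line_cocycle Q (\<lambda>p. u (fst p) 2)"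
 have cc: "a \<in> cocycles Q" "b \<in> cocycles Q" "c \<in> cocycles Q" unfolding a_def b_def c_def by (rule line_cocycle_cocycles[OF lj], simp)+
 have K: "cup Q ?x y + cup Q y ?x \<in> cobs Q" if "y \<in> {a, b, c}" for y
  using that x cc unfolding Q_def by (intro degree_1_cup_commute) (auto simp: line_cocycle_degree a_def b_def c_def)
 have "cup_list Q (map (\<lambda>u'. line_cocycle Q (fibre_unit n) + line_cocycle Q u') [\<lambda>p. u (fst p) 0, \<lambda>p. u (fst p) 1, \<lambda>p. u (fst p) 2]) \<in> cobs Q"
 proof (rule line_fields_product[OF lf])
  show "line_field n Q u'" if "u' \<in> set [\<lambda>p. u (fst p) 0, \<lambda>p. u (fst p) 1, \<lambda>p. u (fst p) 2]" for u' using that lj by auto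
  fix p assume p: "p \<in> topspace Q"
  have one: "dotn n (fibre_unit n p) (fibre_unit n p) = 1" "fibre_unit n p \<in> span3 (u (fst p))"
   using fibre_unit_props[of p n Y ?V] p by (simp_all add: Q_def)
  show "\<exists>u'\<in>set [\<lambda>p. u (fst p) 0, \<lambda>p. u (fst p) 1, \<lambda>p. u (fst p) 2]. dotn n (fibre_unit n p) (u' p) \<noteq> 0"
  proof (rule ccontr)
   assume "\<not> ?thesis"
   then have z: "dotn n (u (fst p) 0) (fibre_unit n p) = 0" "dotn n (u (fst p) 1) (fibre_unit n p) = 0" "dotn n (u (fst p) 2) (fibre_unit n p) = 0"
    by (simp_all add: dotn_commute)
   obtain r s t where eq: "fibre_unit n p = (\<lambda>i. r * u (fst p) 0 i + s * u (fst p) 1 i + t * u (fst p) 2 i)" using one(2) by (rule span3E)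
   have "dotn n (fibre_unit n p) (fibre_unit n p) = r * dotn n (u (fst p) 0) (fibre_unit n p) + s * dotn n (u (fst p) 1) (fibre_unit n p) + t * dotn n (u (fst p) 2) (fibre_unit n p)"
    by (subst (1) eq) (rule dotn_add3)
   then show False using one(1) z by simp
  qed
 qed
 then have "cup_list Q [?x + a, ?x + b, ?x + c] \<in> cobs Q" by (simp add: a_def b_def c_def Q_def)
 then have prod: "cup Q (?x + a) (cup Q (?x + b) (?x + c)) \<in> cobs Q" using x cc by (simp add: cup_unit_right cochains_add cocyclesD(1))
 have Kb: "cup Q ?x b + cup Q b ?x \<in> cobs Q" and Kc: "cup Q ?x c + cup Q c ?x \<in> cobs Q" using K by simp_all
 note add = cobs_add
 \<comment> \<open>The added terms are multiples of the commutators of x with the roots; they move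
   every x to the right.\<close>
 from add[OF add[OF add[OF prod cobs_cup_right[OF x Kc]] add[OF cobs_cup_left[OF Kc x] cobs_cup_left[OF Kb x]]]
  add[OF cobs_cup_left[OF Kb cc(3)] add[OF cobs_cup_right[OF cc(2) Kc] cobs_cup_right[OF cc(1) Kc]]]]
 have "cup Q ?x (cup Q ?x ?x) + (cup Q a (cup Q b c) + cup Q (cup Q a b + cup Q a c + cup Q b c) ?x + cup Q (a + b + c) (cup Q ?x ?x)) \<in> cobs Q"
  by (simp add: cup_add_left cup_add_right cup_assoc cochain_ac)
 then show ?thesis unfolding cohomologous_def theta3_eq Q_def[symmetric]
  by (simp add: cup_pow_3 cocyclesD(1)[OF x] pull_add pull_cup[OF fst_c, of n Y ?V, folded Q_def]
   line_cocycle_pullback[OF fst_c, of n Y ?V, folded Q_def] a_def b_def c_def)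
qed

text \<open>Multiplication by x produces the term c2 x^3, which the cubic relation reduces.\<close>

lemma power_step:
 fixes n :: nat
 assumes ch: "\<And>b. b \<in> topspace X ==> lin_closed (V b)" and e: "e0 \<in> cocycles X" "e1 \<in> cocycles X" "e2 \<in> cocycles X"
  and c: "c0 \<in> cocycles X" "c1 \<in> cocycles X" "c2 \<in> cocycles X"
 defines "Q \<equiv> pbundle n X V" and "x \<equiv> taut n X V"
 assumes 3: "cohomologous Q (cup_pow Q x 3) (theta3 n X V e0 e1 e2)"
  and k: "cohomologous Q (cup_pow Q x k) (theta3 n X V c0 c1 c2)"
 shows "cohomologous Q (cup_pow Q x (Suc k)) (theta3 n X V (cup X c2 e0) (c0 + cup X c2 e1) (c1 + cup X c2 e2))" proof -
 have x: "x \<in> cocycles Q" unfolding x_def Q_def by (rule taut_cocycle[OF ch])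
 have xQ: "line_cocycle Q (fibre_unit n) = x" by (simp add: x_def Q_def)
 note fst_c = continuous_pbundle_fst[of n X V, folded Q_def]
 have pc: "pull Q fst a \<in> cocycles Q" if "a \<in> cocycles X" for a using that fst_c by (rule pull_cocycles)
 have "cup Q (cup_pow Q x k + theta3 n X V c0 c1 c2) x \<in> cobs Q" using k x unfolding cohomologous_def by (rule cobs_cup_left)
 moreover have "cup Q (pull Q fst c2) (cup_pow Q x 3 + theta3 n X V e0 e1 e2) \<in> cobs Q"
  using pc[OF c(3)] 3 unfolding cohomologous_def by (rule cobs_cup_right)
 ultimately have "cup Q (cup_pow Q x k + theta3 n X V c0 c1 c2) x + cup Q (pull Q fst c2) (cup_pow Q x 3 + theta3 n X V e0 e1 e2) \<in> cobs Q"
  by (rule cobs_add)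
 then show ?thesis unfolding cohomologous_def theta3_eq Q_def[symmetric] xQ cup_pow_3[OF cocyclesD(1)[OF x]]
  by (simp add: cup_add_left cup_add_right cup_assoc pull_add pull_cup[OF fst_c] cochain_ac)
qed

text \<open>Complete symmetric polynomials in terms of the elementary ones, by the recursion of
  characteristic 2, without signs.\<close>

fun complete_sym :: "'a::comm_ring_1 => 'a => 'a => nat => 'a"
 where "complete_sym e1 e2 e3 0 = 1" | "complete_sym e1 e2 e3 (Suc 0) = e1" | "complete_sym e1 e2 e3 (Suc (Suc 0)) = e1 * e1 + e2"
 | "complete_sym e1 e2 e3 (Suc (Suc (Suc k))) = e1 * complete_sym e1 e2 e3 (Suc (Suc k)) + e2 * complete_sym e1 e2 e3 (Suc k) + e3 * complete_sym e1 e2 e3 k"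

lemma charted_lines_span:
 assumes u: "line_triple n Y u" and ind: "\<And>y. y \<in> topspace Y ==> independent3 (u y)"
 shows "charted n Y (\<lambda>y. span3 (u y))" proof (rule charted_of_minors[where g = u and N = "\<lambda>_. 1"])
 fix I J :: "nat => nat"
 have "cont_real Y (\<lambda>y. \<Sum>i<3. u y i (I p) * u y i (J q))" for p q
  using u unfolding line_triple_def line_field_def by (intro continuous_map_sum) auto
 then show "cont_real Y (\<lambda>y. minor (u y) I * minor (u y) J / 1)" unfolding minor_def det3_mult unfolding det3_def
  unfolding div_by_1 by (intro continuous_map_add continuous_map_diff continuous_map_real_mult)
qed (use ind u in \<open>auto simp: line_triple_def line_field_def\<close>)

text \<open>Reducing x^(k + 2) modulo the cubic leaves the complete symmetric polynomial of degree k
  as the coefficient of x^2. As x^n is exact, this coefficient is exact once k + 2 is at least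
  n.\<close>

theorem complete_sym_exact:
 assumes u: "line_triple n Y u" and ind: "\<And>y. y \<in> topspace Y ==> independent3 (u y)" and k: "n \<le> k + 2"
 shows "complete_sym elem1 elem2 elem3 k \<in> exact_ideal Y (root Y u)" proof -
 let ?V = "\<lambda>y. span3 (u y)"
 define Q where "Q = pbundle n Y ?V"
 define x where "x = taut n Y ?V"
 define h where "h = complete_sym elem1 elem2 elem3"
 let ?ev = "evaluate Y (root Y u)"
 note cm = commuting_roots[OF u]
 note rc = root_cocycles[OF u]
 have evc: "?ev p \<in> cocycles Y" for p using evaluate_cocycles[OF cm] .
 have v: "?ev (var 0) = root Y u 0" "?ev (var 1) = root Y u 1" "?ev (var 2) = root Y u 2" using evaluate_var[OF cm] by simp_all
 have m: "cohomologous Y (cup Y (root Y u i) (root Y u j)) (?ev (var i * var j))" if "i < 3" "j < 3" for i j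
  using cohomologous_commute[OF evaluate_mult[OF cm, of "var i" "var j"]] that evaluate_var[OF cm] by simp
 have e3: "cohomologous Y (cup Y (root Y u 0) (cup Y (root Y u 1) (root Y u 2))) (?ev elem3)" proof -
  have "cohomologous Y (cup Y (root Y u 0) (cup Y (root Y u 1) (root Y u 2))) (cup Y (root Y u 0) (?ev (var 1 * var 2)))"
   using rc m by (intro cohomologous_cups) auto
  also have "cohomologous Y \<dots> (?ev elem3)" using cohomologous_commute[OF evaluate_mult[OF cm, of "var 0" "var 1 * var 2"]] v by simp
  finally show ?thesis .
 qed
 have e2: "cohomologous Y (cup Y (root Y u 0) (root Y u 1) + cup Y (root Y u 0) (root Y u 2) + cup Y (root Y u 1) (root Y u 2)) (?ev elem2)"
  unfolding evaluate_add using m by (intro cohomologous_adds) simp_all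
 have e1: "root Y u 0 + root Y u 1 + root Y u 2 = ?ev elem1" by (simp only: evaluate_add v)
 have lin: "lin_closed (?V y)" for y by simp
 have thc: "cohomologous Q (theta3 n Y ?V a b c) (theta3 n Y ?V a' b' c')"
  if "cohomologous Y a a'" "cohomologous Y b b'" "cohomologous Y c c'" for a b c a' b' c' proof -
  have "theta n Y ?V (\<lambda>i. (if i = 0 then a else if i = 1 then b else c) + (if i = 0 then a' else if i = 1 then b' else c')) \<in> cobs Q"
   unfolding Q_def using that by (intro theta_cobs lin) (auto simp: cohomologous_def)
  then show ?thesis by (simp only: cohomologous_def theta_add)
 qed
 have "cohomologous Q (cup_pow Q x 3) (theta3 n Y ?V (cup Y (root Y u 0) (cup Y (root Y u 1) (root Y u 2)))
   (cup Y (root Y u 0) (root Y u 1) + cup Y (root Y u 0) (root Y u 2) + cup Y (root Y u 1) (root Y u 2))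
   (root Y u 0 + root Y u 1 + root Y u 2))" unfolding Q_def x_def using u ind by (rule span_cubic_relation)
 also have "cohomologous Q \<dots> (theta3 n Y ?V (?ev elem3) (?ev elem2) (?ev elem1))" unfolding e1 by (intro thc e3 e2 cohomologous_refl)
 finally have 3: "cohomologous Q (cup_pow Q x 3) (theta3 n Y ?V (?ev elem3) (?ev elem2) (?ev elem1))" .
 have xc: "x \<in> cocycles Q" unfolding Q_def x_def by (rule taut_cocycle) simp
 have h3: "h (l + 3) = elem1 * h (l + 2) + elem2 * h (l + 1) + elem3 * h l" for l by (simp add: h_def numeral_2_eq_2 numeral_3_eq_3)
 \<comment> \<open>For l >= 1 the coefficient of 1 is e3 times the complete symmetric polynomial of
   degree l - 1; expressing the lower coefficients through higher degrees avoids negative indices at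
   l = 0.\<close>
 have pow: "cohomologous Q (cup_pow Q x (l + 2)) (theta3 n Y ?V (?ev (h (l + 2) + elem1 * h (l + 1) + elem2 * h l)) (?ev (h (l + 1) + elem1 * h l)) (?ev (h l)))" for l
 proof (induction l)
  case 0
  note evaluate_one[of Y "root Y u"]
  moreover have "h (0 + 2) + elem1 * h (0 + 1) + elem2 * h 0 = 0" "h (0 + 1) + elem1 * h 0 = 0" "h 0 = 1"
   using poly3_double[of "elem1 * elem1 + elem2"] by (simp_all add: h_def numeral_2_eq_2 add_ac)
  ultimately show ?case using xc unfolding theta3_eq Q_def[symmetric] x_def[folded Q_def, symmetric]
   by (simp add: pull_unit[OF continuous_pbundle_fst, of n Y ?V, folded Q_def] cup_unit_left cup_pow_2 cup_cochains cocyclesD(1) flip: numeral_2_eq_2)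
 next
  case (Suc l)
  have i: "Suc l + 2 = l + 3" "Suc l + 1 = l + 2" "Suc l = l + 1" by simp_all
  have "cohomologous Q (cup_pow Q x (Suc (l + 2))) (theta3 n Y ?V (cup Y (?ev (h l)) (?ev elem3))
    (?ev (h (l + 2) + elem1 * h (l + 1) + elem2 * h l) + cup Y (?ev (h l)) (?ev elem2))
    (?ev (h (l + 1) + elem1 * h l) + cup Y (?ev (h l)) (?ev elem1)))"
   using power_step[OF lin evc evc evc evc evc evc 3[unfolded Q_def x_def] Suc[unfolded Q_def x_def]] by (simp only: Q_def x_def)
  also have "cohomologous Q \<dots> (theta3 n Y ?V (?ev (h l * elem3))
    (?ev (h (l + 2) + elem1 * h (l + 1) + elem2 * h l + h l * elem2)) (?ev (h (l + 1) + elem1 * h l + h l * elem1)))"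
   unfolding evaluate_add[of Y "root Y u" _ "h l * elem2"] evaluate_add[of Y "root Y u" _ "h l * elem1"]
   by (intro thc cohomologous_adds cohomologous_refl cohomologous_commute[OF evaluate_mult[OF cm]])
  also have "h l * elem3 = h (Suc l + 2) + elem1 * h (Suc l + 1) + elem2 * h (Suc l)"
   unfolding i(1) unfolding i(2) unfolding i(3) h3 poly3_shift by (rule mult.commute)
  also have "h (l + 2) + elem1 * h (l + 1) + elem2 * h l + h l * elem2 = h (Suc l + 1) + elem1 * h (Suc l)" unfolding i(2) unfolding i(3) by (rule poly3_swap)
  also have "h (l + 1) + elem1 * h l + h l * elem1 = h (Suc l)" unfolding i(3) by (rule poly3_swap)
  finally show ?case by simp
 qed
 have "cup_pow Q x n \<in> cobs Q" unfolding Q_def x_def by (intro line_field_power_zero line_field_pbundle lin)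
 then have "cup Q (cup_pow Q x n) (cup_pow Q x (k + 2 - n)) \<in> cobs Q" using xc by (intro cobs_cup_left) auto
 then have "cup_pow Q x (k + 2) \<in> cobs Q" using k by (simp flip: cup_pow_add[OF cocyclesD(1)[OF xc]])
 then have z: "theta3 n Y ?V (?ev (h (k + 2) + elem1 * h (k + 1) + elem2 * h k)) (?ev (h (k + 1) + elem1 * h k)) (?ev (h k)) \<in> cobs Q"
  using cohomologous_exact[OF cohomologous_commute[OF pow]] by blast
 have "charted n Y ?V" using u ind by (rule charted_lines_span)
 then have "?ev (h k) \<in> cobs Y" using theta_injective'(3)[of n Y ?V] evc z unfolding theta3_eq Q_def by blast
 then show ?thesis by (simp add: exact_ideal_def h_def)
qed

section \<open>Stiefel--Whitney classes\<close>

text \<open>The definition uses rays and nonzero vectors chosen by \<open>inv_into\<close>.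
  Normalizing that choice gives a line field u of which it is literally the
  \<open>line_cocycle\<close>; u and \<open>fibre_unit\<close> span the same lines and are thus
  never orthogonal.\<close>

lemma tautological_cocycle_cohomologous:
 assumes lin: "\<And>b. b \<in> topspace X ==> lin_closed (V b)"
 shows "tautological_cocycle n X V \<in> cocycles (pbundle n X V)"
  "cohomologous (pbundle n X V) (tautological_cocycle n X V) (taut n X V)" proof -
 let ?P = "pbundle n X V" and ?E = "nonzero_vectors n X V"
 define s where "s = inv_into (topspace ?E) line_through"
 define u where "u = (\<lambda>p. normalize_vec n (snd (s p)))"
 have s: "s p \<in> topspace ?E" "line_through (s p) = p" if "p \<in> topspace ?P" for p
  using that unfolding topspace_pbundle s_def by (auto simp: inv_into_into f_inv_into_f)
 have sp: "fst (s p) = fst p" "line_of (snd (s p)) = snd p" "dotn n (snd (s p)) (snd (s p)) > 0" if "p \<in> topspace ?P" for p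
  using arg_cong[OF s(2)[OF that], of fst] arg_cong[OF s(2)[OF that], of snd] nonzero_vectors_dotn[of "fst (s p)" "snd (s p)" n X V, unfolded prod.collapse, OF s(1)[OF that]]
  by (simp_all add: line_through_eq')
 have one: "dotn n (u p) (u p) = 1" "line_of (u p) = snd p" "i \<ge> n ==> u p i = 0" if "p \<in> topspace ?P" for p i
  using normalize_vec_unit[OF sp(3)[OF that]] line_of_normalize[OF sp(3)[OF that]] sp(2)[OF that] s(1)[OF that]
  by (auto simp: u_def topspace_nonzero_vectors normalize_vec_def)
 have pm: "fibre_unit n p = u p \<or> fibre_unit n p = (\<lambda>i. - u p i)" if "p \<in> topspace ?P" for p
  using unit_of_line_of_unit[OF one(1)[OF that]] one(2)[OF that] by simp
 have lf: "line_field n ?P (fibre_unit n)" by (rule line_field_pbundle[OF lin])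
 have lu: "line_field n ?P u" unfolding line_field_def proof (intro conjI allI ballI impI)
  fix i j
  have "cont_real ?P (\<lambda>p. fibre_unit n p i * fibre_unit n p j)" using lf by (simp add: line_field_def)
  then show "cont_real ?P (\<lambda>p. u p i * u p j)" proof (rule continuous_map_eq)
   fix p assume p: "p \<in> topspace ?P"
   show "fibre_unit n p i * fibre_unit n p j = u p i * u p j" using pm[OF p] by (elim disjE) simp_all
  qed
 qed (use one in auto)
 have "tautological_cocycle n X V p \<sigma> = line_cocycle ?P u p \<sigma>" for p \<sigma> proof (cases "p = 1 \<and> ssimplex 1 ?P \<sigma>")
  case True
  then have \<sigma>: "ssimplex 1 ?P \<sigma>" by simp
  have top: "\<sigma> x \<in> topspace ?P" if "x \<in> std_simplex 1" for x using \<sigma> that by (auto simp: singular_simplex_def continuous_map_def)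
  note v = vertex_in_simplex[of 0 1] vertex_in_simplex[of 1 1]
  let ?v = "vertex :: nat => nat => real"
  have "(\<exists>\<tau>. ssimplex 1 ?E \<tau> \<and> simplex_map 1 line_through \<tau> = \<sigma> \<and>
    same_ray (\<tau> (vertex 0)) (s (\<sigma> (vertex 0))) \<and> same_ray (\<tau> (vertex 1)) (s (\<sigma> (vertex 1)))) \<longleftrightarrow>
   (\<exists>v. is_lift 1 (u \<circ> \<sigma>) v \<and> v (vertex 0) = u (\<sigma> (vertex 0)) \<and> v (vertex 1) = u (\<sigma> (vertex 1)))" (is "?L \<longleftrightarrow> ?R")
  proof
   assume ?L
   then obtain \<tau> where \<tau>: "ssimplex 1 ?E \<tau>" "simplex_map 1 line_through \<tau> = \<sigma>"
    "same_ray (\<tau> (vertex 0)) (s (\<sigma> (vertex 0)))" "same_ray (\<tau> (vertex 1)) (s (\<sigma> (vertex 1)))" by blast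
   have c\<tau>: "continuous_map (simplex_top 1) ?E \<tau>" using \<tau>(1) by (simp add: singular_simplex_def)
   have pos: "dotn n (snd (\<tau> x)) (snd (\<tau> x)) > 0" if "x \<in> std_simplex 1" for x
    using continuous_map_mem[OF c\<tau>, of x] that nonzero_vectors_dotn[of "fst (\<tau> x)" "snd (\<tau> x)"] by simp
   have ln: "line_of (normalize_vec n (snd (\<tau> x))) = snd (\<sigma> x)" if "x \<in> std_simplex 1" for x
    using line_of_normalize[OF pos[OF that]] that unfolding \<tau>(2)[symmetric] by (simp add: simplex_map_def line_through_eq')
   have ray: "normalize_vec n (snd a) = normalize_vec n (snd b)" if "same_ray a b" for a b :: "'a \<times> (nat => real)" proof -
    obtain c where c: "c > 0" "snd a = (\<lambda>i. c * snd b i)" using \<open>same_ray a b\<close> by (auto simp: same_ray_def)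
    then have "sqrt (dotn n (snd a) (snd a)) = c * sqrt (dotn n (snd b) (snd b))" by (simp add: real_sqrt_mult flip: mult.assoc)
    then show ?thesis unfolding normalize_vec_def using c by simp
   qed
   show ?R proof (intro exI[of _ "\<lambda>x. normalize_vec n (snd (\<tau> x))"] conjI)
    show "is_lift 1 (u \<circ> \<sigma>) (\<lambda>x. normalize_vec n (snd (\<tau> x)))" unfolding is_lift_def proof (intro conjI allI ballI)
     show "cont_real (simplex_top 1) (\<lambda>x. normalize_vec n (snd (\<tau> x)) i)" for i
      using continuous_map_comp[OF c\<tau> nonzero_vectors_coordinates(2)] pos by (intro continuous_normalize_vec) auto
     fix x assume x: "x \<in> std_simplex 1"
     have "unit_of n (snd (\<sigma> x)) = normalize_vec n (snd (\<tau> x)) \<or> unit_of n (snd (\<sigma> x)) = (\<lambda>i. - normalize_vec n (snd (\<tau> x)) i)"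
      using unit_of_line_of_unit[OF normalize_vec_unit[OF pos[OF x]]] ln[OF x] by simp
     then show "normalize_vec n (snd (\<tau> x)) = (u \<circ> \<sigma>) x \<or> normalize_vec n (snd (\<tau> x)) = (\<lambda>i. - (u \<circ> \<sigma>) x i)"
      using pm[OF top[OF x]] by (auto simp: fun_eq_iff)
    qed
   qed (use ray[OF \<tau>(3)] ray[OF \<tau>(4)] in \<open>simp_all add: u_def\<close>)
  next
   assume ?R
   then obtain v where v: "is_lift 1 (u \<circ> \<sigma>) v" "v (vertex 0) = u (\<sigma> (vertex 0))" "v (vertex 1) = u (\<sigma> (vertex 1))" by blast
   have vu: "v x = u (\<sigma> x) \<or> v x = (\<lambda>i. - u (\<sigma> x) i)" if "x \<in> std_simplex 1" for x
    using v(1) that by (simp add: is_lift_def)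
   have vl: "line_of (v x) = snd (\<sigma> x)" "dotn n (v x) (v x) = 1" "i \<ge> n ==> v x i = 0" if "x \<in> std_simplex 1" for x i
    using vu[OF that] one[OF top[OF that]] by (auto simp: line_of_minus)
   have vV: "v x \<in> V (fst (\<sigma> x))" if x: "x \<in> std_simplex 1" for x proof -
    have "fibre_unit n (\<sigma> x) = v x \<or> fibre_unit n (\<sigma> x) = (\<lambda>i. - v x i)"
     using vu[OF x] pm[OF top[OF x]] by (auto simp: fun_eq_iff)
    moreover have "fibre_unit n (\<sigma> x) \<in> V (fst (\<sigma> x))" "lin_closed (V (fst (\<sigma> x)))"
     using fibre_unit_props(3)[OF top[OF x] lin] lin continuous_map_mem[OF continuous_pbundle_fst top[OF x]] by auto
    ultimately show ?thesis using lin_closed_minus[of "V (fst (\<sigma> x))" "fibre_unit n (\<sigma> x)"] by auto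
   qed
   define \<tau> where "\<tau> = restrict (\<lambda>x. (fst (\<sigma> x), v x)) (std_simplex 1)"
   have "continuous_map (simplex_top 1) ?E (\<lambda>x. (fst (\<sigma> x), v x))" unfolding continuous_map_nonzero_vectors proof (intro conjI allI ballI)
    show "continuous_map (simplex_top 1) X (\<lambda>x. fst (fst (\<sigma> x), v x))"
     using \<sigma> continuous_map_comp[OF _ continuous_pbundle_fst] by (auto simp: singular_simplex_def)
    fix x assume "x \<in> topspace (simplex_top 1)"
    then have x: "x \<in> std_simplex 1" by simp
    show "snd (fst (\<sigma> x), v x) \<noteq> (\<lambda>i. 0)" using vl(2)[OF x] by auto
   qed (use v(1) vV vl in \<open>auto simp: is_lift_def\<close>)
   then have "ssimplex 1 ?E \<tau>" by (simp add: \<tau>_def singular_simplex_def continuous_map_eq)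
   moreover have "simplex_map 1 line_through \<tau> x = \<sigma> x" for x
    using \<sigma> vl(1) by (cases "x \<in> std_simplex 1") (auto simp: simplex_map_def \<tau>_def line_through_eq singular_simplex_def extensional_def)
   moreover have "same_ray (\<tau> w) (s (\<sigma> w))" if w: "w \<in> std_simplex 1" "v w = u (\<sigma> w)" for w unfolding same_ray_def
   proof (intro conjI exI)
    show "0 < 1 / sqrt (dotn n (snd (s (\<sigma> w))) (snd (s (\<sigma> w))))" using sp(3)[OF top[OF w(1)]] by simp
   qed (use w sp(1)[OF top[OF w(1)]] in \<open>simp_all add: \<tau>_def u_def normalize_vec_scale\<close>)
   ultimately show ?L using v(2,3) vertex_in_simplex[of 0 1] vertex_in_simplex[of 1 1] by (intro exI[of _ \<tau>] conjI ext) auto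
  qed
  then show ?thesis using True unfolding tautological_cocycle_def line_cocycle_def Let_def s_def[symmetric] simplicial_vertex_def by simp
 qed (auto simp: tautological_cocycle_def line_cocycle_def Let_def)
 then have eq: "tautological_cocycle n X V = line_cocycle ?P u" by (intro ext)
 show "tautological_cocycle n X V \<in> cocycles ?P" unfolding eq by (rule line_cocycle_cocycles[OF lu])
 show "cohomologous ?P (tautological_cocycle n X V) (taut n X V)" unfolding eq cohomologous_def proof (rule line_cocycle_nonorthogonal[OF lu lf])
  fix p assume p: "p \<in> topspace ?P"
  show "dotn n (u p) (fibre_unit n p) \<noteq> 0" using pm[OF p] one(1)[OF p] by (elim disjE) simp_all
 qed
qed

lemma class_pow:
 assumes "\<phi> \<in> cocycles X"
 shows "cohomology_class X \<phi> [^]\<^bsub>cohomology_ring X\<^esub> (m::nat) = cohomology_class X (cup_pow X \<phi> m)" proof -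
 interpret ring "cohomology_ring X" by (rule ring_cohomology_ring)
 show ?thesis by (induction m) (simp_all add: one_cohomology_ring cohomology_class_mult assms cup_pow_cocycles)
qed

lemma stiefel_whitney_sum:
 fixes X :: "'b topology" and \<phi> :: "nat => 'b cochain" and n :: nat
 assumes \<phi>: "\<And>i. i < 4 ==> \<phi> i \<in> cocycles X" "\<And>i. i < 4 ==> w i = cohomology_class X (\<phi> i)" "\<phi> 0 = unit_cochain X"
  and lin: "\<And>b. b \<in> topspace X ==> lin_closed (V b)"
 defines "P \<equiv> pbundle n X V"
 shows "(\<Oplus>\<^bsub>cohomology_ring P\<^esub>i\<in>{..3}. cohomology_pullback P fst (w i) \<otimes>\<^bsub>cohomology_ring P\<^esub>
   tautological_class n X V [^]\<^bsub>cohomology_ring P\<^esub> (3 - i)) = \<zero>\<^bsub>cohomology_ring P\<^esub> \<longleftrightarrow>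
  cohomologous P (cup_pow P (taut n X V) 3) (theta3 n X V (\<phi> 3) (\<phi> 2) (\<phi> 1))" proof -
 interpret ring "cohomology_ring P" by (rule ring_cohomology_ring)
 let ?x = "taut n X V"
 note fst_c = continuous_pbundle_fst[of n X V, folded P_def]
 have x: "?x \<in> cocycles P" unfolding P_def by (rule taut_cocycle[OF lin])
 have xc: "tautological_class n X V = cohomology_class P ?x" using tautological_cocycle_cohomologous[OF lin, where n = n]
  by (simp add: tautological_class_def cohomologous_def P_def cohomology_class_eq_iff)
 have pc: "pull P fst (\<phi> i) \<in> cocycles P" if "i < 4" for i using \<phi>(1)[OF that] fst_c by (rule pull_cocycles)
 define t where "t = (\<lambda>i. cup P (pull P fst (\<phi> i)) (cup_pow P ?x (3 - i)))"
 have t: "t i \<in> cocycles P" if "i < 4" for i unfolding t_def using pc[OF that] x by auto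
 define T where "T = (\<lambda>i. cohomology_pullback P fst (w i) \<otimes>\<^bsub>cohomology_ring P\<^esub> tautological_class n X V [^]\<^bsub>cohomology_ring P\<^esub> (3 - i))"
 have T: "T i = cohomology_class P (t i)" if "i < 4" for i unfolding T_def t_def xc class_pow[OF x] \<phi>(2)[OF that] cohomology_pullback_class[OF fst_c]
  using pc[OF that] x by (intro cohomology_class_mult) auto
 have cl: "T i \<in> carrier (cohomology_ring P)" if "i < 4" for i using T[OF that] cohomology_class_closed[OF t[OF that]] by simp
 have "{..3::nat} = {0, 1, 2, 3}" by auto
 then have "finsum (cohomology_ring P) T {..3} = T 0 \<oplus>\<^bsub>cohomology_ring P\<^esub> (T 1 \<oplus>\<^bsub>cohomology_ring P\<^esub> (T 2 \<oplus>\<^bsub>cohomology_ring P\<^esub> T 3))"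
  using cl by (simp add: finsum_insert)
 also have "\<dots> = cohomology_class P (t 0 + (t 1 + (t 2 + t 3)))" using t by (simp add: T cohomology_class_add cocycles_add)
 also have "t 0 + (t 1 + (t 2 + t 3)) = cup_pow P ?x 3 + theta3 n X V (\<phi> 3) (\<phi> 2) (\<phi> 1)"
  using pc[of 3] x cup_pow_2[OF cocyclesD(1)[OF x]] unfolding theta3_eq P_def[symmetric] t_def \<phi>(3) pull_unit[OF fst_c]
  by (simp add: cup_unit_left cup_unit_right cup_pow_cochains cocyclesD(1) add_ac numeral_2_eq_2 flip: P_def)
 finally show ?thesis unfolding T_def cohomologous_def by (simp only: cohomology_class_eq_0_iff)
qed

text \<open>The defining equation expands x^3 in 1, x, x^2: existence comes from
  \<open>theta_surjective\<close> and uniqueness from \<open>theta_injective'\<close>, so the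
  definite description denotes this solution. Representing cocycles are returned because the later
  arguments work with cochains.\<close>

theorem stiefel_whitney_charted:
 assumes ch: "charted n X V"
 obtains w1 w2 w3 where "w1 \<in> cocycles X" "w2 \<in> cocycles X" "w3 \<in> cocycles X"
  "cohomologous (pbundle n X V) (cup_pow (pbundle n X V) (taut n X V) 3) (theta3 n X V w3 w2 w1)"
  "stiefel_whitney 3 n X V 3 = cohomology_class X w3" proof -
 let ?P = "pbundle n X V" and ?x = "taut n X V"
 note lin = charted_lin_closed[OF ch]
 have x: "?x \<in> cocycles ?P" by (rule taut_cocycle[OF lin])
 have xd: "degree_part 1 ?x = ?x" by (auto simp: degree_part_def line_cocycle_degree fun_eq_iff)
 have xd2: "degree_part 2 (cup ?P ?x ?x) = cup ?P ?x ?x" using degree_part_cup_right[OF xd, of 1 ?P ?x] xd by (simp add: numeral_2_eq_2)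
 obtain k where k: "\<forall>i<3. k i \<in> cocycles X" "cup_pow ?P ?x 3 + theta n X V k \<in> cobs ?P"
  using theta_surjective[OF ch cup_pow_cocycles[OF x]] by blast
 define \<phi> where "\<phi> = (\<lambda>i::nat. if i = 0 then unit_cochain X else degree_part i (k (3 - i)))"
 have \<phi>: "\<phi> i \<in> cocycles X" if "i < 4" for i using k(1) that by (simp add: \<phi>_def degree_part_cocycles)
 have d: "degree_part 3 (cup ?P y (cup ?P ?x ?x)) = cup ?P (degree_part 1 y) (cup ?P ?x ?x)"
  "degree_part 3 (cup ?P y ?x) = cup ?P (degree_part 2 y) ?x" for y using degree_part_cup_right[OF xd2, of 1 ?P y] degree_part_cup_right[OF xd, of 2 ?P y]
  by (simp_all add: numeral_2_eq_2 numeral_3_eq_3)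
 \<comment> \<open>The coefficients supplied by surjectivity may have mixed degree; passing to the
   component of degree 3 of the equation makes them homogeneous.\<close>
 then have "degree_part 3 (cup_pow ?P ?x 3 + theta n X V k) = cup_pow ?P ?x 3 + theta3 n X V (\<phi> 3) (\<phi> 2) (\<phi> 1)"
  using xd by (simp add: degree_part_add theta_def Let_def \<phi>_def cup_pow_3 cocyclesD(1)[OF x] flip: degree_part_pullback)
 then have rel: "cohomologous ?P (cup_pow ?P ?x 3) (theta3 n X V (\<phi> 3) (\<phi> 2) (\<phi> 1))"
  using degree_part_cobs[OF k(2), of 3] by (simp add: cohomologous_def)
 define w where "w = (\<lambda>i. if i < 4 then cohomology_class X (\<phi> i) else \<zero>\<^bsub>cohomology_ring X\<^esub>)"
 have zero: "\<zero>\<^bsub>cohomology_ring X\<^esub> \<in> cohomology i X" for i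
  unfolding cohomology_def zero_cohomology_ring using cocycles_0[of X] by (intro imageI) (simp add: cocycle_ring_simps zero_fun_def)
 have "w i \<in> cohomology i X" for i proof (cases "i < 4")
  case True
  have "\<phi> i q = (\<lambda>_. 0)" if "q \<noteq> i" for q using that by (auto simp: \<phi>_def degree_part_def unit_cochain_def)
  then show ?thesis using True \<phi> [OF True] unfolding w_def cohomology_def by (simp add: cocycle_ring_simps)
 qed (simp add: w_def zero)
 then have sw: "is_stiefel_whitney 3 n X V w" using stiefel_whitney_sum[of \<phi> X w V n, OF \<phi>] rel lin unfolding is_stiefel_whitney_def Let_def
  by (auto simp: w_def \<phi>_def one_cohomology_ring)
 have "w' = w" if w': "is_stiefel_whitney 3 n X V w'" for w' proof -
  have "\<exists>\<psi>. \<psi> \<in> cocycles X \<and> w' i = cohomology_class X \<psi> \<and> (i = 0 \<longrightarrow> \<psi> = unit_cochain X)" for i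
  proof (cases "i = 0")
   case True
   then show ?thesis using w' by (auto simp: is_stiefel_whitney_def Let_def one_cohomology_ring)
  next
   case False
   have "w' i \<in> cohomology i X" using w' by (simp add: is_stiefel_whitney_def Let_def)
   then show ?thesis using False by (auto simp: cohomology_def cocycle_ring_simps)
  qed
  then obtain \<psi> where \<psi>: "\<And>i. \<psi> i \<in> cocycles X" "\<And>i. w' i = cohomology_class X (\<psi> i)" "\<psi> 0 = unit_cochain X" by metis
  have "cohomologous ?P (cup_pow ?P ?x 3) (theta3 n X V (\<psi> 3) (\<psi> 2) (\<psi> 1))"
   using stiefel_whitney_sum[of \<psi> X w' V n, OF \<psi> lin] w' by (simp add: is_stiefel_whitney_def Let_def)
  then have "cohomologous ?P (theta3 n X V (\<phi> 3) (\<phi> 2) (\<phi> 1)) (theta3 n X V (\<psi> 3) (\<psi> 2) (\<psi> 1))"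
   using rel cohomologous_transitive cohomologous_commute by blast
  then have "theta3 n X V (\<phi> 3 + \<psi> 3) (\<phi> 2 + \<psi> 2) (\<phi> 1 + \<psi> 1) \<in> cobs ?P"
   unfolding cohomologous_def theta3_eq by (simp add: pull_add cup_add_left add_ac)
  from theta_injective'[OF ch cocycles_add[OF \<phi> \<psi>(1)] cocycles_add[OF \<phi> \<psi>(1)] cocycles_add[OF \<phi> \<psi>(1)] this[unfolded theta3_eq]]
  have c: "\<phi> 3 + \<psi> 3 \<in> cobs X" "\<phi> 2 + \<psi> 2 \<in> cobs X" "\<phi> 1 + \<psi> 1 \<in> cobs X" by simp_all
  have "w' i = w i" for i proof (cases "i < 4")
   case True
   then have "i = 0 \<or> i = 1 \<or> i = 2 \<or> i = 3" by auto
   then have "cohomology_class X (\<phi> i) = cohomology_class X (\<psi> i)"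
    using c \<psi>(3) by (auto simp: cohomology_class_eq_iff \<phi>_def cochain_double)
   then show ?thesis using \<psi>(2) True by (simp add: w_def)
  next
   case False
   then show ?thesis using w' by (simp add: is_stiefel_whitney_def Let_def w_def)
  qed
  then show ?thesis by (rule ext)
 qed
 then have "stiefel_whitney 3 n X V = w" unfolding stiefel_whitney_def using sw by (intro the_equality)
 then show ?thesis using that[OF \<phi> \<phi> \<phi> rel] by (simp add: w_def)
qed

text \<open>Splitting principle: over a space with three independent line fields, \<open>w\<^sub>i\<close> is the elementary symmetric polynomial.\<close>

theorem stiefel_whitney_roots:
 assumes w: "w1 \<in> cocycles X" "w2 \<in> cocycles X" "w3 \<in> cocycles X"
  and rel: "cohomologous (pbundle n X V) (cup_pow (pbundle n X V) (taut n X V) 3) (theta3 n X V w3 w2 w1)"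
  and lin: "\<And>b. b \<in> topspace X ==> lin_closed (V b)"
  and g: "continuous_map Y X g" and u: "line_triple n Y u" and ind: "\<And>y. y \<in> topspace Y ==> independent3 (u y)"
  and uV: "\<And>y j. y \<in> topspace Y ==> j < 3 ==> u y j \<in> V (g y)"
 shows "cohomologous Y (pull Y g w3) (cup Y (root Y u 0) (cup Y (root Y u 1) (root Y u 2)))" proof -
 let ?V = "\<lambda>y. span3 (u y)"
 let ?P = "pbundle n X V" and ?Q = "pbundle n Y ?V"
 \<comment> \<open>The bundle map given by the inclusion of the span of the lines into V. It pulls
   the relation for w1, w2, w3 back to one that can be compared, coefficient by coefficient, with
   \<open>span_cubic_relation\<close>.\<close>
 define G where "G = (\<lambda>p :: 'b \<times> (nat => real) set. (g (fst p), snd p))"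
 note fst_c = continuous_pbundle_fst
 have lin': "lin_closed (?V y)" for y by simp
 have sub: "fibre_unit n p \<in> V (g (fst p))" if p: "p \<in> topspace ?Q" for p proof -
  have y: "fst p \<in> topspace Y" using continuous_map_mem[OF fst_c p] .
  then have "span3 (u (fst p)) \<subseteq> V (g (fst p))" by (intro span3_subset lin continuous_map_mem[OF g] uV)
  then show ?thesis using fibre_unit_props(3)[OF p lin'] by blast
 qed
 have "continuous_map ?Q ?P (\<lambda>p. (g (fst p), line_of (fibre_unit n p)))"
  by (intro continuous_map_pbundle continuous_map_comp[OF fst_c g] line_field_pbundle sub lin lin')
 then have G: "continuous_map ?Q ?P G" by (rule continuous_map_eq) (simp add: G_def fibre_unit_props(4)[OF _ lin'])
 have tG: "pull ?Q G (taut n X V) = taut n Y ?V" unfolding line_cocycle_pullback[OF G] by (simp add: G_def)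
 have pG: "pull ?Q G (pull ?P fst a) = pull ?Q fst (pull Y g a)" for a
  unfolding pull_compose[OF G] pull_compose[OF fst_c] by (simp add: o_def G_def)
 have "pull ?Q G (cup_pow ?P (taut n X V) 3 + theta3 n X V w3 w2 w1) \<in> cobs ?Q"
  using rel G unfolding cohomologous_def by (rule pull_cobs)
 then have "cohomologous ?Q (cup_pow ?Q (taut n Y ?V) 3) (theta3 n Y ?V (pull Y g w3) (pull Y g w2) (pull Y g w1))"
  by (simp only: cohomologous_def theta3_eq pull_add pull_cup[OF G] cup_pow_pullback[OF G] tG pG)
 from cohomologous_transitive[OF cohomologous_commute[OF this] span_cubic_relation[OF u ind]]
 have "pull ?Q fst (pull Y g w3 + cup Y (root Y u 0) (cup Y (root Y u 1) (root Y u 2))) +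
   cup ?Q (pull ?Q fst (pull Y g w2 + (cup Y (root Y u 0) (root Y u 1) + cup Y (root Y u 0) (root Y u 2) + cup Y (root Y u 1) (root Y u 2)))) (taut n Y ?V) +
   cup ?Q (pull ?Q fst (pull Y g w1 + (root Y u 0 + root Y u 1 + root Y u 2))) (cup ?Q (taut n Y ?V) (taut n Y ?V)) \<in> cobs ?Q"
  by (simp add: cohomologous_def theta3_eq pull_add cup_add_left add_ac)
 then show ?thesis unfolding cohomologous_def by (rule theta_injective'(1)[OF charted_lines_span[OF u ind], rotated -1])
   (assumption | (intro cocycles_add cocycles_cup root_cocycles[OF u] pull_cocycles[OF _ g] w; simp))+
qed

section \<open>The characteristic rings\<close>

definition poly_ideal :: "poly3 set => bool"
 where "poly_ideal J \<longleftrightarrow> (\<forall>p\<in>J. \<forall>q\<in>J. p + q \<in> J) \<and> (\<forall>p\<in>J. \<forall>q. p * q \<in> J)"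

lemma poly_idealD:
 assumes "poly_ideal J"
 shows "p \<in> J ==> q \<in> J ==> p + q \<in> J" "p \<in> J ==> p * q \<in> J" "p \<in> J ==> q * p \<in> J"
 using assms mult.commute[of q p] by (auto simp only: poly_ideal_def)

lemma poly_ideal_cong:
 assumes "poly_ideal J" "p + q \<in> J" "q \<in> J"
 shows "p \<in> J" using poly_idealD(1)[OF assms] by (simp add: add.assoc)

lemma square_add: "((p::poly3) + q)\<^sup>2 = p\<^sup>2 + q\<^sup>2" by (simp add: power2_sum)

lemma power_2_power_add: "((p::poly3) + q) ^ 2 ^ s = p ^ 2 ^ s + q ^ 2 ^ s" proof (induction s)
 case (Suc s)
 have "(p + q) ^ 2 ^ Suc s = ((p + q) ^ 2 ^ s)\<^sup>2" by (simp flip: power_mult add: mult.commute)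
 then show ?case by (simp add: Suc square_add flip: power_mult) (simp add: mult.commute)
qed simp

text \<open>
 For \<open>e\<^sub>1 = 0\<close> and \<open>\<gamma> = 0\<close> these are the complete symmetric polynomials in \<open>a, b, c\<close>; in general they are those in
 \<open>a, b, c, a + b + c\<close>, whose elementary symmetric polynomials are \<open>0, \<alpha>, \<beta>, \<gamma>\<close>.
\<close>

fun four_sym :: "poly3 => poly3 => poly3 => nat => poly3"
 where "four_sym \<alpha> \<beta> \<gamma> 0 = 1" | "four_sym \<alpha> \<beta> \<gamma> (Suc 0) = 0" | "four_sym \<alpha> \<beta> \<gamma> (Suc (Suc 0)) = \<alpha>" | "four_sym \<alpha> \<beta> \<gamma> (Suc (Suc (Suc 0))) = \<beta>"
 | "four_sym \<alpha> \<beta> \<gamma> (Suc (Suc (Suc (Suc k)))) = \<alpha> * four_sym \<alpha> \<beta> \<gamma> (Suc (Suc k)) + \<beta> * four_sym \<alpha> \<beta> \<gamma> (Suc k) + \<gamma> * four_sym \<alpha> \<beta> \<gamma> k"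

lemma poly3_numeral [simp]: "numeral (Num.Bit0 k) = (0::poly3)" "numeral (Num.Bit1 k) = (1::poly3)" by (simp_all only: numeral.simps poly3_double add_0_left)

text \<open>The generating series F of the sequence is the inverse of 1 + \<alpha> x^2 + \<beta> x^3
  + \<gamma> x^4, so F equals this polynomial times F^2. In characteristic 2, F^2 has the squares of
  the coefficients at the even powers of x, and the formulas are the coefficients of degrees 2 l + 4
  and 2 l + 3.\<close>

lemma four_sym_doubling:
 fixes \<alpha> \<beta> \<gamma> :: poly3
 defines "f \<equiv> four_sym \<alpha> \<beta> \<gamma>"
 shows "f (2 * l + 4) = (f (l + 2))\<^sup>2 + \<alpha> * (f (l + 1))\<^sup>2 + \<gamma> * (f l)\<^sup>2 \<and> f (2 * l + 3) = \<beta> * (f l)\<^sup>2"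
proof (induction l rule: less_induct)
 case (less l)
 have rec: "f (k + 4) = \<alpha> * f (k + 2) + \<beta> * f (k + 1) + \<gamma> * f k" for k by (simp add: f_def eval_nat_numeral)
 have f: "f 0 = 1" "f 1 = 0" "f 2 = \<alpha>" "f 3 = \<beta>" by (simp_all add: f_def eval_nat_numeral)
 have f4: "f 4 = \<alpha>\<^sup>2 + \<gamma>" and f5: "f 5 = 0" by (simp_all add: f_def eval_nat_numeral mult.commute[of \<beta> \<alpha>])
 consider "l = 0" | "l = 1" | k where "l = k + 2" by (metis One_nat_def add_2_eq_Suc' not0_implies_Suc)
 then show ?case proof cases
  case 2
  have "f 6 = \<beta>\<^sup>2 + \<alpha> * \<alpha>\<^sup>2" by (simp add: f_def eval_nat_numeral algebra_simps)
  then show ?thesis unfolding 2 using f f5 by (simp add: eval_nat_numeral)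
 next
  case 3
  have IH: "f (2 * k + 4) = (f (k + 2))\<^sup>2 + \<alpha> * (f (k + 1))\<^sup>2 + \<gamma> * (f k)\<^sup>2" "f (2 * k + 3) = \<beta> * (f k)\<^sup>2"
   "f (2 * k + 6) = (f (k + 3))\<^sup>2 + \<alpha> * (f (k + 2))\<^sup>2 + \<gamma> * (f (k + 1))\<^sup>2" "f (2 * k + 5) = \<beta> * (f (k + 1))\<^sup>2"
   using less[of k] less[of "k + 1"] 3 by (simp_all add: eval_nat_numeral)
  have o: "f (2 * k + 7) = \<alpha> * f (2 * k + 5) + \<beta> * f (2 * k + 4) + \<gamma> * f (2 * k + 3)"
   "f (2 * k + 8) = \<alpha> * f (2 * k + 6) + \<beta> * f (2 * k + 5) + \<gamma> * f (2 * k + 4)"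
   using rec[of "2 * k + 3"] rec[of "2 * k + 4"] by (simp_all add: eval_nat_numeral)
  have "f (2 * k + 7) = \<beta> * (f (k + 2))\<^sup>2" unfolding o IH by (simp add: algebra_simps)
  moreover have "f (2 * k + 8) = (f (k + 4))\<^sup>2 + \<alpha> * (f (k + 3))\<^sup>2 + \<gamma> * (f (k + 2))\<^sup>2"
   unfolding o IH rec[of k] square_add power_mult_distrib by (simp add: algebra_simps power2_eq_square)
  ultimately show ?thesis using 3 by (simp add: eval_nat_numeral)
 next
  case 1
  show ?thesis unfolding 1 using f f4 by (simp add: eval_nat_numeral)
 qed
qed

text \<open>The odd doubling formula leads from degree 3 (2^s - 1) to degree 3 (2^(s+1) - 1) by
  squaring and multiplying with \<beta>.\<close>

lemma four_sym_power: "four_sym \<alpha> \<beta> 0 (3 * (2 ^ s - 1)) = \<beta> ^ (2 ^ s - 1)" proof (induction s)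
 case (Suc s)
 obtain p where p: "2 ^ s = Suc (p::nat)" using not0_implies_Suc[of "2 ^ s"] by auto
 have i: "3 * (2 ^ Suc s - 1) = 2 * (3 * (2 ^ s - 1)) + (3::nat)" "2 ^ Suc s - 1 = Suc (2 * (2 ^ s - 1) :: nat)" using p by simp_all
 show ?case unfolding i(1) unfolding i(2) conjunct2[OF four_sym_doubling] Suc by (simp only: power_Suc power_mult[symmetric] mult.commute[of _ 2])
qed simp

text \<open>The term of degree 1 is zero, and the odd doubling formula leads from degree 2^(s+2) - 3
  to degree 2^(s+3) - 3.\<close>

lemma four_sym_zero: "four_sym \<alpha> \<beta> \<gamma> (2 ^ (s + 2) - 3) = 0" proof (induction s)
 case (Suc s)
 obtain p where "2 ^ s = Suc (p::nat)" using not0_implies_Suc[of "2 ^ s"] by auto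
 then have "2 ^ (Suc s + 2) - 3 = 2 * (2 ^ (s + 2) - 3) + (3::nat)" by simp
 then show ?case using four_sym_doubling[of \<alpha> \<beta> \<gamma> "2 ^ (s + 2) - 3"] Suc by simp
qed simp

text \<open>In terms of generating series, 1 / (1 + e1 x + e2 x^2 + e3 x^3) is extended by the
  factor 1 + e1 x. This adjoins the root a + b + c and removes the linear term of the
  denominator.\<close>

lemma complete_four_sym:
 "complete_sym e1 e2 e3 (k + 1) = four_sym (e2 + e1 * e1) (e3 + e1 * e2) (e1 * e3) (k + 1) + e1 * four_sym (e2 + e1 * e1) (e3 + e1 * e2) (e1 * e3) k"
  (is "?h (k + 1) = ?f (k + 1) + _") proof (induction k rule: less_induct)
 case (less k)
 consider "k = 0" | "k = 1" | "k = 2" | j where "k = j + 3" by (metis One_nat_def add.commute add_0 less_3_cases linorder_not_less le_iff_add)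
 then show ?case proof cases
  case 4
  have "?h (j + 3) = ?f (j + 3) + e1 * ?f (j + 2)" "?h (j + 2) = ?f (j + 2) + e1 * ?f (j + 1)" "?h (j + 1) = ?f (j + 1) + e1 * ?f j"
   using less[of j] less[of "j + 1"] less[of "j + 2"] 4 by (simp_all add: eval_nat_numeral)
  moreover have "?h (j + 4) = e1 * ?h (j + 3) + e2 * ?h (j + 2) + e3 * ?h (j + 1)" by (simp add: eval_nat_numeral)
  moreover have "?f (j + 4) = (e2 + e1 * e1) * ?f (j + 2) + (e3 + e1 * e2) * ?f (j + 1) + e1 * e3 * ?f j" by (simp add: eval_nat_numeral)
  ultimately have "?h (j + 4) = ?f (j + 4) + e1 * ?f (j + 3)" by (simp add: algebra_simps)
  then show ?thesis using 4 by (simp add: eval_nat_numeral)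
 qed (simp_all add: eval_nat_numeral algebra_simps)
qed

lemma complete_sym_cong:
 assumes J: "poly_ideal J" and e: "e1 \<in> J"
 shows "complete_sym e1 e2 e3 k + four_sym e2 e3 0 k \<in> J" proof (induction k rule: less_induct)
 case (less k)
 let ?h = "complete_sym e1 e2 e3" and ?g = "four_sym e2 e3 0"
 have 0: "0 \<in> J" using poly_idealD(2)[OF J e, of 0] by simp
 consider "k = 0" | "k = 1" | "k = 2" | j where "k = j + 3" by (metis One_nat_def add.commute add_0 less_3_cases linorder_not_less le_iff_add)
 then show ?case proof cases
  case 4
  have "?g (j + 3) = e2 * ?g (j + 1) + e3 * ?g j" by (cases j) (simp_all add: eval_nat_numeral)
  then have "?h k + ?g k = e1 * ?h (j + 2) + (e2 * (?h (j + 1) + ?g (j + 1)) + e3 * (?h j + ?g j))" by (simp add: 4 algebra_simps eval_nat_numeral)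
  also have "\<dots> \<in> J"
   using 4 by (intro poly_idealD(1)[OF J poly_idealD(2)[OF J e]] poly_idealD(1)[OF J poly_idealD(3)[OF J] poly_idealD(3)[OF J]] less) simp_all
  finally show ?thesis .
 next
  case 3
  have "?h 2 + ?g 2 = e1 * e1" by (simp add: numeral_2_eq_2 add_ac)
  then show ?thesis using poly_idealD(2)[OF J e] 3 by simp
 qed (use 0 e in simp_all)
qed

text \<open>With g the sequence modulo e1, e3 g_k = g_(k+3) + e2 g_(k+1). So each factor e3 lowers
  by one the degree from which on g lies in J, and in degree 3 (2^s - 1) the value of g is itself a
  power of e3.\<close>

lemma elem3_power_exact:
 assumes J: "poly_ideal J" and e: "e1 \<in> J" and h: "\<And>k. k \<ge> M ==> complete_sym e1 e2 e3 k \<in> J"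
  and M: "M \<le> 3 * (2 ^ s - 1) + j"
 shows "e3 ^ (j + (2 ^ s - 1)) \<in> J" proof -
 let ?g = "four_sym e2 e3 0"
 have g: "?g k \<in> J" if "k \<ge> M" for k
  using poly_ideal_cong[OF J, of "?g k" "complete_sym e1 e2 e3 k"] complete_sym_cong[OF J e] h[OF that] by (simp add: add.commute)
 have "e3 ^ j * ?g k \<in> J" if "k + j \<ge> M" for j k using that proof (induction j arbitrary: k)
  case (Suc j)
  have "?g (k + 3) = e2 * ?g (k + 1) + e3 * ?g k" by (cases k) (simp_all add: eval_nat_numeral)
  then have "e3 ^ Suc j * ?g k = e3 ^ j * ?g (k + 3) + e2 * (e3 ^ j * ?g (k + 1))" by (simp add: algebra_simps)
  also have "\<dots> \<in> J" using poly_idealD(1)[OF J Suc.IH[of "k + 3"] poly_idealD(3)[OF J Suc.IH[of "k + 1"]]] Suc.prems by simp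
  finally show ?case .
 qed (simp add: g)
 from this[OF M] show ?thesis unfolding four_sym_power power_add .
qed

text \<open>Partial fractions for the four roots a, b, c, a + b + c: in characteristic 2, for each
  of them the product of its differences to the other three is the same polynomial (a + b)(a + c)(b
  + c), so this one factor clears all denominators. The proof compares linear recursions and their
  initial values.\<close>

lemma four_sym_power_sum:
 defines "\<alpha> \<equiv> elem2 + elem1 * elem1" and "\<beta> \<equiv> elem3 + elem1 * elem2" and "\<gamma> \<equiv> elem1 * elem3"
 shows "(var 0 + var 1) * ((var 0 + var 2) * (var 1 + var 2)) * four_sym \<alpha> \<beta> \<gamma> k =
  elem1 ^ (k + 3) + var 0 ^ (k + 3) + var 1 ^ (k + 3) + var 2 ^ (k + 3)" proof (induction k rule: less_induct)
 case (less k)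
 let ?\<Delta> = "(var 0 + var 1) * ((var 0 + var 2) * (var 1 + var 2))" and ?f = "four_sym \<alpha> \<beta> \<gamma>"
 define N where "N = (\<lambda>k. elem1 ^ k + var 0 ^ k + var 1 ^ k + var 2 ^ k)"
 have quartic: "x ^ (k + 4) = \<alpha> * x ^ (k + 2) + \<beta> * x ^ (k + 1) + \<gamma> * x ^ k" if "x \<in> {elem1, var 0, var 1, var 2}" for x k proof -
  have "x ^ 4 = \<alpha> * x ^ 2 + \<beta> * x + \<gamma>" using that unfolding \<alpha>_def \<beta>_def \<gamma>_def insert_iff empty_iff
   by (elim disjE FalseE; simp only:) (simp_all add: eval_nat_numeral algebra_simps)
  then have "x ^ k * x ^ 4 = x ^ k * (\<alpha> * x ^ 2 + \<beta> * x + \<gamma>)" by simp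
  then show ?thesis by (simp add: power_add algebra_simps power2_eq_square)
 qed
 have rec: "N (k + 4) = \<alpha> * N (k + 2) + \<beta> * N (k + 1) + \<gamma> * N k" for k
  unfolding N_def using quartic[of elem1 k] quartic[of "var 0" k] quartic[of "var 1" k] quartic[of "var 2" k]
  by (simp only: insert_iff simp_thms distrib_left add_ac)
 have N: "N 0 = 0" "N 1 = 0" "N 2 = 0" "N 3 = ?\<Delta>" by (simp_all add: N_def eval_nat_numeral algebra_simps)
 have "?\<Delta> * ?f k = N (k + 3)" proof -
  consider "k = 0" | "k = 1" | "k = 2" | "k = 3" | j where "k = j + 4"
   by (metis add.commute le_Suc_ex less_Suc_eq linorder_not_less less_3_cases eval_nat_numeral(3) numeral_eq_Suc semiring_norm(2) semiring_norm(8) add_Suc Suc_numeral)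
  then show ?thesis proof cases
   case 5
   have "?\<Delta> * ?f (j + 4) = \<alpha> * (?\<Delta> * ?f (j + 2)) + \<beta> * (?\<Delta> * ?f (j + 1)) + \<gamma> * (?\<Delta> * ?f j)"
    by (simp add: eval_nat_numeral algebra_simps)
   also have "\<dots> = N (j + 3 + 4)" unfolding rec using less[of j] less[of "j + 1"] less[of "j + 2"] 5 by (simp add: N_def add_ac eval_nat_numeral)
   finally show ?thesis using 5 by (simp add: add_ac)
  next
   case 1 then show ?thesis using N by simp
  next
   case 2 then show ?thesis using rec[of 0] N by (simp add: eval_nat_numeral)
  next
   case 3 then show ?thesis using rec[of 1] N by (simp add: mult_ac eval_nat_numeral)
  next
   case 4 then show ?thesis using rec[of 0] rec[of 2] N by (simp add: mult_ac eval_nat_numeral)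
  qed
 qed
 then show ?case by (simp only: N_def)
qed

text \<open>After multiplication by x^M, every term of (x + y)^j that contains x lies in K.\<close>

lemma top_power_reduce:
 assumes K: "poly_ideal K" and x: "x ^ Suc M \<in> K"
 shows "x ^ M * (x + y) ^ j + x ^ M * y ^ j \<in> K" proof (induction j)
 case 0
 then show ?case using poly_idealD(2)[OF K x, of 0] by simp
next
 case (Suc j)
 have "x ^ M * (x + y) ^ Suc j + x ^ M * y ^ Suc j = x ^ Suc M * (x + y) ^ j + (x ^ M * (x + y) ^ j + x ^ M * y ^ j) * y" by (simp add: algebra_simps)
 then show ?case using poly_idealD(1)[OF K poly_idealD(2)[OF K x] poly_idealD(2)[OF K Suc]] by simp
qed

theorem top_power_exact:
 assumes K: "poly_ideal K" and x: "\<And>j. j < 3 ==> var j ^ Suc M \<in> K" and M: "M = m + 2 ^ r" and r: "r \<ge> 1"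
  and z: "elem3 ^ m * (elem1 ^ (2 * 2 ^ r - 1) + var 0 ^ (2 * 2 ^ r - 1) + var 1 ^ (2 * 2 ^ r - 1) + var 2 ^ (2 * 2 ^ r - 1)) \<in> K"
 shows "var 0 ^ M * var 1 ^ M * var 2 ^ M \<in> K" proof -
 define Q where "Q = (2::nat) ^ r"
 have Q: "Q \<ge> 2" "M = m + Q" using r M self_le_power[of "2::nat" r] by (auto simp: Q_def)
 define a b c where "a = var 0" and "b = var 1" and "c = var 2"
 have big: "v ^ k * p \<in> K" if "v \<in> {a, b, c}" "k \<ge> Suc M" for v k p proof -
  have "v ^ Suc M \<in> K" using that(1) x[of 0] x[of 1] x[of 2] by (auto simp: a_def b_def c_def)
  then have "v ^ Suc M * (v ^ (k - Suc M) * p) \<in> K" by (rule poly_idealD(2)[OF K])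
  also have "v ^ Suc M * (v ^ (k - Suc M) * p) = v ^ k * p" using that(2) by (simp only: mult.assoc[symmetric] power_add[symmetric] le_add_diff_inverse)
  finally show ?thesis .
 qed
 have top: "v ^ Suc M \<in> K" if "v \<in> {a, b, c}" for v using big[OF that order_refl, of 1] by simp
 let ?w = "(a * (b * c)) ^ m * (b * c ^ Q)"
 have e: "2 * 2 ^ r - 1 = 2 * Q - 1" "2 * Q - 1 + m \<ge> Suc M" using Q by (auto simp: Q_def)
 have "(a * (b * c)) ^ m * ((a + b + c) ^ (2 * Q - 1) + a ^ (2 * Q - 1) + b ^ (2 * Q - 1) + c ^ (2 * Q - 1)) * (b * c ^ Q) \<in> K"
  using poly_idealD(2)[OF K z] unfolding e a_def b_def c_def .
 \<comment> \<open>Here r >= 1 enters: as Q >= 2, the exponent m + 2 Q - 1 exceeds M = m +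
   Q.\<close>
 moreover have "?w * v ^ (2 * Q - 1) \<in> K" if v: "v \<in> {a, b, c}" for v proof -
  have "v dvd a * (b * c)" using v by auto
  then have "v ^ m dvd ?w" by (rule dvd_mult2[OF dvd_power_same])
  then obtain p where "?w = v ^ m * p" by (rule dvdE)
  then have "?w * v ^ (2 * Q - 1) = v ^ (2 * Q - 1 + m) * p" by (simp add: power_add mult_ac)
  then show ?thesis using big[OF v e(2)] by simp
 qed
 ultimately have "(a * (b * c)) ^ m * ((a + b + c) ^ (2 * Q - 1) + a ^ (2 * Q - 1) + b ^ (2 * Q - 1) + c ^ (2 * Q - 1)) * (b * c ^ Q)
   + (?w * a ^ (2 * Q - 1) + (?w * b ^ (2 * Q - 1) + ?w * c ^ (2 * Q - 1))) \<in> K" by (intro poly_idealD(1)[OF K]) simp_all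
 also have "(a * (b * c)) ^ m * ((a + b + c) ^ (2 * Q - 1) + a ^ (2 * Q - 1) + b ^ (2 * Q - 1) + c ^ (2 * Q - 1)) * (b * c ^ Q)
   + (?w * a ^ (2 * Q - 1) + (?w * b ^ (2 * Q - 1) + ?w * c ^ (2 * Q - 1))) = (a ^ m * b ^ Suc m) * (c ^ M * (c + (a + b)) ^ (2 * Q - 1))"
  unfolding Q(2) by (simp add: algebra_simps power_add power_mult_distrib)
 finally have 1: "(a ^ m * b ^ Suc m) * (c ^ M * (c + (a + b)) ^ (2 * Q - 1)) \<in> K" .
 have "(a ^ m * b ^ Suc m) * (c ^ M * (c + (a + b)) ^ (2 * Q - 1) + c ^ M * (a + b) ^ (2 * Q - 1)) \<in> K"
  using top by (intro poly_idealD(3)[OF K] top_power_reduce[OF K]) simp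
 from poly_idealD(1)[OF K 1 this] have 2: "(a ^ m * b ^ Suc m) * (c ^ M * (a + b) ^ (2 * Q - 1)) \<in> K" by (simp add: distrib_left)
 \<comment> \<open>In the sum a^Q + b^Q the second term leads to b^(m + 1 + Q), which lies in
   K.\<close>
 have "(a + b) ^ (2 * Q - 1) = (a + b) ^ (Q - 1) * (a + b) ^ Q" unfolding power_add[symmetric] using Q by (intro arg_cong[of _ _ "(^) (a + b)"]) simp
 also have "(a + b) ^ Q = a ^ Q + b ^ Q" unfolding Q_def by (rule power_2_power_add)
 finally have "(a ^ m * b ^ Suc m) * (c ^ M * (a + b) ^ (2 * Q - 1)) =
   (b ^ Suc m * c ^ M) * (a ^ M * (a + b) ^ (Q - 1)) + b ^ Suc M * (a ^ m * c ^ M * (a + b) ^ (Q - 1))" unfolding Q(2) by (simp add: algebra_simps power_add)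
 from poly_ideal_cong[OF K _ big[of b "Suc M"], of "(b ^ Suc m * c ^ M) * (a ^ M * (a + b) ^ (Q - 1))"] 2 this
 have 3: "(b ^ Suc m * c ^ M) * (a ^ M * (a + b) ^ (Q - 1)) \<in> K" by simp
 have "(b ^ Suc m * c ^ M) * (a ^ M * (a + b) ^ (Q - 1) + a ^ M * b ^ (Q - 1)) \<in> K" using top by (intro poly_idealD(3)[OF K] top_power_reduce[OF K]) simp
 from poly_idealD(1)[OF K 3 this] have "(b ^ Suc m * c ^ M) * (a ^ M * b ^ (Q - 1)) \<in> K" by (simp add: distrib_left)
 also have "(b ^ Suc m * c ^ M) * (a ^ M * b ^ (Q - 1)) = a ^ M * b ^ M * c ^ M" proof -
  have "b ^ M = b ^ Suc m * b ^ (Q - 1)" unfolding power_add[symmetric] using Q by (intro arg_cong[of _ _ "(^) b"]) simp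
  then show ?thesis by (simp add: mult_ac)
 qed
 finally show ?thesis by (simp only: a_def b_def c_def)
qed

section \<open>Orientations\<close>

text \<open>The scalar product of the Pluecker vector of b with the vector of minors of u. For u
  inside the subspace it is the determinant of u with respect to an oriented basis, times a positive
  factor.\<close>

definition orientation :: "nat => 3 oriented_subspace => (nat => nat => real) => real"
 where "orientation n b u = (\<Sum>I\<in>triples n. pluecker n I b * minor u I)"

definition orientation_bit :: "nat => 3 oriented_subspace => (nat => nat => real) => bit"
 where "orientation_bit n b u = (if orientation n b u > 0 then 0 else 1)"

definition untriple :: "(nat => nat => real) => 3 => nat => real"
 where "untriple u = (\<lambda>k. if k = 1 then u 0 else if k = 2 then u 1 else u 2)"

lemma triple_untriple: "j < 3 ==> triple (untriple u) j = u j" by (auto simp: triple_def untriple_def less_3_cases)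

lemma minor_cong: "(\<And>j. j < 3 ==> u j = v j) ==> minor u I = minor v I" by (simp add: minor_def det3_def)

lemma independent3_cong: "(\<And>j. j < 3 ==> u j = v j) ==> independent3 u \<longleftrightarrow> independent3 v"
 by (simp add: independent3_def)

lemma independent3_untriple: "independent3 (triple (untriple u)) \<longleftrightarrow> independent3 u" by (rule independent3_cong) (rule triple_untriple)

lemma orientation_cong: "(\<And>j. j < 3 ==> u j = v j) ==> orientation n b u = orientation n b v"
 unfolding orientation_def by (metis (no_types, lifting) minor_cong sum.cong)

lemma orientation_scale: "orientation n b (\<lambda>j i. e j * u j i) = e 0 * e 1 * e 2 * orientation n b u" proof -
 have "minor (\<lambda>j i. e j * u j i) I = e 0 * e 1 * e 2 * minor u I" for I by (simp add: minor_def det3_def algebra_simps)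
 then show ?thesis by (simp add: orientation_def sum_distrib_left algebra_simps)
qed

lemma independent3_scale:
 assumes "independent3 u" "\<And>j. e j \<noteq> 0"
 shows "independent3 (\<lambda>j i. e j * u j i)" unfolding independent3_def proof (intro allI impI)
 fix a b c assume "\<forall>i. a * (e 0 * u 0 i) + b * (e 1 * u 1 i) + c * (e 2 * u 2 i) = 0"
 then show "a = 0 \<and> b = 0 \<and> c = 0"
  using assms(1)[unfolded independent3_def, rule_format, of "a * e 0" "b * e 1" "c * e 2"] assms(2) by (simp add: mult.assoc)
qed

lemma orientation_subspace:
 assumes b: "b \<in> topspace (grass n)" and ind: "independent3 u" and u: "\<And>j. j < 3 ==> u j \<in> underlying_subspace b"
 shows "orientation n b u \<noteq> 0" "orientation n b u > 0 ==> oriented_span (untriple u) = b" proof -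
 let ?f = "basis n b" and ?h = "untriple u"
 let ?N = "minor_norm n (triple ?f)"
 note B = basis[OF b]
 have V: "underlying_subspace b = span3 (triple ?f)" using underlying_oriented_span[of ?f] by (simp add: B(2))
 obtain A where A: "?h = act A ?f" "det A \<noteq> 0"
  by (rule independent_subspace_matrix[of ?h ?f]) (use ind u V in \<open>auto simp: triple_untriple independent3_untriple\<close>)
 have m: "minor u I = det A * minor (triple ?f) I" for I proof -
  have "minor (triple ?h) I = minor u I" by (rule minor_cong[OF triple_untriple])
  then show ?thesis by (simp add: A(1) minor_act)
 qed
 have N: "?N > 0" "?N * ?N = (\<Sum>I\<in>triples n. (minor (triple ?f) I)\<^sup>2)" using minor_norm_pos[OF B(1)] by (auto simp: minor_norm_def sum_nonneg)
 have "orientation n b u = det A * (\<Sum>I\<in>triples n. (minor (triple ?f) I)\<^sup>2) / ?N"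
  by (simp add: orientation_def m pluecker_def sum_distrib_left sum_divide_distrib power2_eq_square algebra_simps)
 then have o: "orientation n b u = det A * ?N" using N(1) unfolding N(2)[symmetric] by simp
 show "orientation n b u \<noteq> 0" using o A(2) N(1) by simp
 assume "orientation n b u > 0"
 then have "det A > 0" using o N(1) by (simp add: zero_less_mult_iff)
 then show "oriented_span ?h = b" using oriented_span_act_eq[of A ?f] by (simp add: A(1) B(2))
qed

lemma orientation_oriented_span:
 assumes "untriple u \<in> topspace (stiefel_manifold n)"
 shows "orientation n (oriented_span (untriple u)) u > 0" proof -
 let ?N = "minor_norm n (triple (untriple u))"
 have m: "minor (triple (untriple u)) I = minor u I" for I by (rule minor_cong[OF triple_untriple])
 have N: "?N > 0" "?N * ?N = (\<Sum>I\<in>triples n. (minor u I)\<^sup>2)" using minor_norm_pos[OF assms] by (auto simp: minor_norm_def sum_nonneg m)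
 have "orientation n (oriented_span (untriple u)) u = (\<Sum>I\<in>triples n. (minor u I)\<^sup>2) / ?N"
  by (simp add: orientation_def pluecker_oriented_span[OF assms] m sum_divide_distrib power2_eq_square)
 then show ?thesis using N(1) unfolding N(2)[symmetric] by simp
qed

lemma orientation_sign_constant:
 assumes b: "continuous_map (simplex_top p) (grass n) \<beta>" and v: "\<And>j i. j < 3 ==> cont_real (simplex_top p) (\<lambda>x. v x j i)"
  and nz: "\<And>x. x \<in> std_simplex p ==> orientation n (\<beta> x) (v x) \<noteq> 0"
 shows "(\<forall>x\<in>std_simplex p. orientation n (\<beta> x) (v x) > 0) \<or> (\<forall>x\<in>std_simplex p. orientation n (\<beta> x) (v x) < 0)"
proof -
 have "cont_real (simplex_top p) (\<lambda>x. orientation n (\<beta> x) (v x))" unfolding orientation_def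
  by (intro continuous_map_sum continuous_map_real_mult continuous_minor v continuous_map_comp[OF b continuous_pluecker] finite_triples)
 then show ?thesis unfolding continuous_map_simplex using nz by (intro nonvanishing_constant_sign connected_std_simplex)
qed

text \<open>The orientation is multiplied by the product of the three signs relating v to u, and in
  bits products of signs become sums.\<close>

lemma orientation_bit_sign:
 assumes v: "\<And>j. j < 3 ==> v j = u j \<or> v j = (\<lambda>i. - u j i)" and u: "\<And>j. j < 3 ==> (\<lambda>i. - u j i) \<noteq> u j" and nz: "orientation n b u \<noteq> 0"
 shows "orientation_bit n b v = orientation_bit n b u + (sign_bit (v 0) (u 0) + sign_bit (v 1) (u 1) + sign_bit (v 2) (u 2))" proof -
 define e where "e = (\<lambda>j. if v j = u j then 1 else - 1 :: real)"
 have "v j = (\<lambda>i. e j * u j i)" if "j < 3" for j using v[OF that] by (auto simp: e_def)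
 then have o: "orientation n b v = e 0 * e 1 * e 2 * orientation n b u" using orientation_cong[of v "\<lambda>j i. e j * u j i"] orientation_scale by simp
 have s: "sign_bit (v j) (u j) = (if e j = 1 then 0 else 1)" "e j = 1 \<or> e j = -1" for j by (auto simp: sign_bit_def e_def)
 show ?thesis using s(2)[of 0] s(2)[of 1] s(2)[of 2] nz unfolding orientation_bit_def o s(1) by (elim disjE) (auto simp: bit_double)
qed

text \<open>The sum of the roots is the first Stiefel--Whitney class: it vanishes, as the bundle is oriented.\<close>

theorem root_sum:
 assumes g: "continuous_map Y (grass n) g" and u: "line_triple n Y u" and ind: "\<And>y. y \<in> topspace Y ==> independent3 (u y)"
  and uV: "\<And>y j. y \<in> topspace Y ==> j < 3 ==> u y j \<in> underlying_subspace (g y)"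
 shows "root Y u 0 + root Y u 1 + root Y u 2 = coboundary Y (point_cochain Y (\<lambda>y. orientation_bit n (g y) (u y)))" proof (intro ext)
 fix p \<sigma>
 show "(root Y u 0 + root Y u 1 + root Y u 2) p \<sigma> = coboundary Y (point_cochain Y (\<lambda>y. orientation_bit n (g y) (u y))) p \<sigma>"
 proof (cases "p = 1 \<and> ssimplex 1 Y \<sigma>")
  case True
  then have \<sigma>: "ssimplex 1 Y \<sigma>" and p: "p = 1" by auto
  have c\<sigma>: "continuous_map (simplex_top 1) Y \<sigma>" using \<sigma> by (simp add: singular_simplex_def)
  have "\<exists>v. is_lift 1 ((\<lambda>y. u y j) \<circ> \<sigma>) v" if "j < 3" for j
   using is_lift_exists[OF line_field_simplex[OF line_tripleD[OF u that] \<sigma>]] by metis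
  then obtain v where v: "\<And>j. j < 3 ==> is_lift 1 ((\<lambda>y. u y j) \<circ> \<sigma>) (v j)" by metis
  have top: "\<sigma> x \<in> topspace Y" if "x \<in> std_simplex 1" for x using continuous_map_mem[OF c\<sigma>] that by simp
  have vu: "v j x = u (\<sigma> x) j \<or> v j x = (\<lambda>i. - u (\<sigma> x) j i)" if "j < 3" "x \<in> std_simplex 1" for j x
   using v[OF that(1)] that(2) by (simp add: is_lift_def)
  have nz: "orientation n (g (\<sigma> x)) (u (\<sigma> x)) \<noteq> 0" if "x \<in> std_simplex 1" for x
   using top[OF that] by (intro orientation_subspace(1) ind uV continuous_map_mem[OF g])
  have neg: "(\<lambda>i. - u (\<sigma> x) j i) \<noteq> u (\<sigma> x) j" if "j < 3" "x \<in> std_simplex 1" for j x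
   using minus_vector_neq[of n "u (\<sigma> x) j" "u (\<sigma> x) j"] line_tripleD[OF u that(1)] top[OF that(2)] by (simp add: line_field_def)
  define Ob where "Ob = (\<lambda>x. orientation_bit n (g (\<sigma> x)) (u (\<sigma> x)))"
  define S where "S = (\<lambda>x. sign_bit (v 0 x) (u (\<sigma> x) 0) + sign_bit (v 1 x) (u (\<sigma> x) 1) + sign_bit (v 2 x) (u (\<sigma> x) 2))"
  have bit: "orientation_bit n (g (\<sigma> x)) (\<lambda>j. v j x) = orientation_bit n (g (\<sigma> x)) (u (\<sigma> x)) +
    (sign_bit (v 0 x) (u (\<sigma> x) 0) + sign_bit (v 1 x) (u (\<sigma> x) 1) + sign_bit (v 2 x) (u (\<sigma> x) 2))" if "x \<in> std_simplex 1" for x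
   using vu neg nz that by (intro orientation_bit_sign)
  have "orientation n (g (\<sigma> x)) (\<lambda>j. v j x) \<noteq> 0" if x: "x \<in> std_simplex 1" for x proof -
   define e where "e = (\<lambda>j. if v j x = u (\<sigma> x) j then 1 else - 1 :: real)"
   have "v j x = (\<lambda>i. e j * u (\<sigma> x) j i)" if "j < 3" for j using vu[OF that x] by (auto simp: e_def)
   then have "orientation n (g (\<sigma> x)) (\<lambda>j. v j x) = e 0 * e 1 * e 2 * orientation n (g (\<sigma> x)) (u (\<sigma> x))"
    using orientation_cong[of "\<lambda>j. v j x" "\<lambda>j i. e j * u (\<sigma> x) j i"] orientation_scale by simp
   then show ?thesis using nz[OF x] by (simp add: e_def)
  qed
  then have "(\<forall>x\<in>std_simplex 1. orientation n (g (\<sigma> x)) (\<lambda>j. v j x) > 0) \<or> (\<forall>x\<in>std_simplex 1. orientation n (g (\<sigma> x)) (\<lambda>j. v j x) < 0)"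
   using v continuous_map_comp[OF c\<sigma> g] by (intro orientation_sign_constant) (auto simp: is_lift_def)
  then have "orientation_bit n (g (\<sigma> (vertex 0))) (\<lambda>j. v j (vertex 0)) = orientation_bit n (g (\<sigma> (vertex 1))) (\<lambda>j. v j (vertex 1))"
  proof (elim disjE)
   assume a: "\<forall>x\<in>std_simplex 1. orientation n (g (\<sigma> x)) (\<lambda>j. v j x) > 0"
   show ?thesis using bspec[OF a vertex_in_simplex, of 0] bspec[OF a vertex_in_simplex, of 1] by (simp add: orientation_bit_def)
  next
   assume a: "\<forall>x\<in>std_simplex 1. orientation n (g (\<sigma> x)) (\<lambda>j. v j x) < 0"
   show ?thesis using bspec[OF a vertex_in_simplex, of 0] bspec[OF a vertex_in_simplex, of 1] by (simp add: orientation_bit_def)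
  qed
  \<comment> \<open>The lifted vectors have constant orientation along the path, so the orientation
    bit of the chosen vectors changes exactly with the signs relating them to the lifts.\<close>
  then have "Ob (vertex 0) + S (vertex 0) = Ob (vertex 1) + S (vertex 1)"
   using bit[OF vertex_in_simplex, of 0] bit[OF vertex_in_simplex, of 1] by (simp add: Ob_def S_def)
  moreover have "a + s = b + t ==> s + t = a + b" for a b s t :: bit by (cases a; cases b; cases s; cases t) (simp_all add: add_bit_eq_xor)
  ultimately have st: "S (vertex 0) + S (vertex 1) = Ob (vertex 0) + Ob (vertex 1)" by blast
  have r: "root Y u j 1 \<sigma> = sign_bit (v j (vertex 0)) (u (\<sigma> (vertex 0)) j) + sign_bit (v j (vertex 1)) (u (\<sigma> (vertex 1)) j)" if "j < 3" for j
   by (rule line_cocycle_lift[OF line_tripleD[OF u that] \<sigma> v[OF that]])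
  have "(root Y u 0 + root Y u 1 + root Y u 2) 1 \<sigma> = S (vertex 0) + S (vertex 1)" using r[of 0] r[of 1] r[of 2] by (simp add: S_def add_ac)
  moreover have "coboundary Y (point_cochain Y (\<lambda>y. orientation_bit n (g y) (u y))) 1 \<sigma> = Ob (vertex 0) + Ob (vertex 1)"
   unfolding coboundary_point_cochain using \<sigma> by (simp add: Ob_def)
  ultimately show ?thesis unfolding p st by simp
 next
  case False
  then show ?thesis unfolding coboundary_point_cochain by (auto simp: line_cocycle_def)
 qed
qed

text \<open>Y consists of triples together with an orientation of their span. Lifting the three
  lines over a simplex to vectors determines one orientation, and reversing the first vector gives
  the other.\<close>

theorem double_covering_oriented:
 assumes u: "line_triple n Z u" and ind: "\<And>z. z \<in> topspace Z ==> independent3 (u z)"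
 defines "Y \<equiv> subtopology (prod_topology Z (grass n)) {(z, b). \<forall>j<3. u z j \<in> underlying_subspace b}"
 shows "double_covering Y Z fst (\<lambda>y. orientation_bit n (snd y) (u (fst y)))" proof
 show "continuous_map Y Z fst" unfolding Y_def by (intro continuous_map_from_subtopology continuous_map_fst)
 fix p \<sigma> assume \<sigma>: "ssimplex p Z \<sigma>"
 have c\<sigma>: "continuous_map (simplex_top p) Z \<sigma>" using \<sigma> by (simp add: singular_simplex_def)
 have "\<exists>v. is_lift p ((\<lambda>y. u y j) \<circ> \<sigma>) v" if "j < 3" for j
  using is_lift_exists[OF line_field_simplex[OF line_tripleD[OF u that] \<sigma>]] by metis
 then obtain v where v: "\<And>j. j < 3 ==> is_lift p ((\<lambda>y. u y j) \<circ> \<sigma>) (v j)" by metis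
 define w where "w = (\<lambda>e::real. \<lambda>x j i. (if j = 0 then e else 1) * v j x i)"
 define \<beta> where "\<beta> = (\<lambda>e x. oriented_span (untriple (w e x)))"
 define \<tau> where "\<tau> = (\<lambda>e. restrict (\<lambda>x. (\<sigma> x, \<beta> e x)) (std_simplex p))"
 have top: "\<sigma> x \<in> topspace Z" if "x \<in> std_simplex p" for x using continuous_map_mem[OF c\<sigma>] that by simp
 have wu: "w e x j = u (\<sigma> x) j \<or> w e x j = (\<lambda>i. - u (\<sigma> x) j i)" if "j < 3" "x \<in> std_simplex p" "e\<^sup>2 = 1" for e j x
  using v[OF that(1)] that(2,3) by (auto simp: is_lift_def w_def power2_eq_1_iff fun_eq_iff)
 have neg: "(\<lambda>i. - u (\<sigma> x) j i) \<noteq> u (\<sigma> x) j" if "j < 3" "x \<in> std_simplex p" for j x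
  using minus_vector_neq[of n "u (\<sigma> x) j" "u (\<sigma> x) j"] line_tripleD[OF u that(1)] top[OF that(2)] by (simp add: line_field_def)
 have wi: "independent3 (w e x)" if x: "x \<in> std_simplex p" and e: "e\<^sup>2 = 1" for e x proof -
  define s where "s = (\<lambda>j. if w e x j = u (\<sigma> x) j then 1 else - 1 :: real)"
  have "w e x j = (\<lambda>i. s j * u (\<sigma> x) j i)" if "j < 3" for j using wu[OF that x e] by (auto simp: s_def)
  then have "independent3 (w e x) \<longleftrightarrow> independent3 (\<lambda>j i. s j * u (\<sigma> x) j i)" by (rule independent3_cong)
  moreover have "independent3 (\<lambda>j i. s j * u (\<sigma> x) j i)" by (rule independent3_scale[OF ind[OF top[OF x]]]) (simp add: s_def)
  ultimately show ?thesis by (rule iffD2)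
 qed
 have wc: "cont_real (simplex_top p) (\<lambda>x. w e x j i)" if "j < 3" for e j i
  using v[OF that] unfolding w_def is_lift_def by (intro continuous_map_real_mult) simp_all
 have cs: "continuous_map (simplex_top p) (stiefel_manifold n) (\<lambda>x. untriple (w e x))" if e: "e\<^sup>2 = 1" for e unfolding continuous_map_stiefel
 proof (intro conjI allI ballI impI)
  show "cont_real (simplex_top p) (\<lambda>x. untriple (w e x) j i)" for j i
   using wc[of 0] wc[of 1] wc[of 2] by (cases "j = 1"; cases "j = 2") (simp_all add: untriple_def)
  fix x assume "x \<in> topspace (simplex_top p)"
  then have x: "x \<in> std_simplex p" by simp
  show "independent3 (triple (untriple (w e x)))" using wi[OF x e] by (simp add: independent3_untriple)
  have z: "w e x j i = 0" if "j < 3" "i \<ge> n" for j i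
   using wu[OF that(1) x e] line_tripleD[OF u that(1)] top[OF x] that(2) by (auto simp: line_field_def)
  show "untriple (w e x) j i = 0" if "i \<ge> n" for j i using z[of 0 i] z[of 1 i] z[of 2 i] that by (simp add: untriple_def)
 qed
 have c\<beta>: "continuous_map (simplex_top p) (grass n) (\<beta> e)" if e: "e\<^sup>2 = 1" for e
  unfolding \<beta>_def using continuous_map_comp[OF cs[OF e] quotient_imp_continuous_map[OF quotient_map_oriented_span]] .
 have u\<beta>: "u (\<sigma> x) j \<in> underlying_subspace (\<beta> e x)" if "j < 3" "x \<in> std_simplex p" "e\<^sup>2 = 1" for e j x proof -
  have "w e x j \<in> span3 (triple (untriple (w e x)))" using span3_base[OF that(1), of "triple (untriple (w e x))"] triple_untriple[OF that(1)] by simp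
  then show ?thesis using wu[OF that] lin_closed_minus[OF lin_closed_span3, of "w e x j"] unfolding \<beta>_def underlying_oriented_span by auto
 qed
 have \<tau>: "ssimplex p Y (\<tau> e)" "simplex_map p fst (\<tau> e) = \<sigma>" if e: "e\<^sup>2 = 1" for e proof -
  have "continuous_map (simplex_top p) Y (\<lambda>x. (\<sigma> x, \<beta> e x))" unfolding Y_def continuous_map_in_subtopology continuous_map_pairwise o_def
   using c\<sigma> c\<beta> [OF e] u\<beta> [OF _ _ e] by auto
  then show "ssimplex p Y (\<tau> e)" by (simp add: \<tau>_def singular_simplex_def continuous_map_eq)
  show "simplex_map p fst (\<tau> e) = \<sigma>"
   using \<sigma> by (intro ext) (auto simp: simplex_map_def \<tau>_def singular_simplex_def extensional_def restrict_def)
 qed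
 have lifts: "\<rho> = \<tau> 1 \<or> \<rho> = \<tau> (-1)" if \<rho>: "ssimplex p Y \<rho>" "simplex_map p fst \<rho> = \<sigma>" for \<rho> proof -
  have c\<rho>: "continuous_map (simplex_top p) Y \<rho>" and ext: "\<rho> \<in> extensional (std_simplex p)"
   using \<rho>(1) by (auto simp: singular_simplex_def)
  have fst\<rho>: "fst (\<rho> x) = \<sigma> x" if "x \<in> std_simplex p" for x
   using that unfolding \<rho>(2)[symmetric] by (simp add: simplex_map_def)
  have cb: "continuous_map (simplex_top p) (grass n) (\<lambda>x. snd (\<rho> x))"
   using c\<rho> unfolding Y_def continuous_map_in_subtopology continuous_map_pairwise o_def by simp
  have mem: "snd (\<rho> x) \<in> topspace (grass n)" "j < 3 ==> u (\<sigma> x) j \<in> underlying_subspace (snd (\<rho> x))" if "x \<in> std_simplex p" for x j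
   using continuous_map_mem[OF c\<rho>, of x] fst\<rho> [OF that] that by (auto simp: Y_def)
  have wV: "w e x j \<in> underlying_subspace (snd (\<rho> x))" if "j < 3" "x \<in> std_simplex p" "e\<^sup>2 = 1" for e j x
   using wu[OF that] mem[OF that(2)] that(1) lin_closed_minus[OF charted_lin_closed[OF charted_grass mem(1)[OF that(2)]]] by auto
  have "orientation n (snd (\<rho> x)) (w 1 x) \<noteq> 0" if "x \<in> std_simplex p" for x using that by (intro orientation_subspace(1) mem wi wV) auto
  then have "(\<forall>x\<in>std_simplex p. orientation n (snd (\<rho> x)) (w 1 x) > 0) \<or> (\<forall>x\<in>std_simplex p. orientation n (snd (\<rho> x)) (w 1 x) < 0)"
   using wc by (intro orientation_sign_constant cb)
  then consider "\<forall>x\<in>std_simplex p. orientation n (snd (\<rho> x)) (w 1 x) > 0" | "\<forall>x\<in>std_simplex p. orientation n (snd (\<rho> x)) (w 1 x) < 0"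
   by blast
  \<comment> \<open>The sign of the orientation of the lifted vectors decides which of the two
    standard lifts \<rho> is.\<close>
  then have "\<exists>e. e \<in> {1, -1} \<and> (\<forall>x\<in>std_simplex p. orientation n (snd (\<rho> x)) (w e x) > 0)" proof cases
   case 2
   have "orientation n b (w (-1) x) = - orientation n b (w 1 x)" for b x using orientation_scale[of n b "\<lambda>j. if j = 0 then -1 else 1" "w 1 x"]
     orientation_cong[of "w (-1) x" "\<lambda>j i. (if j = 0 then -1 else 1) * w 1 x j i" n b] by (simp add: w_def)
   then show ?thesis using 2 by (intro exI[of _ "-1"]) simp
  qed blast
  then obtain e where e: "e \<in> {1, -1}" "\<forall>x\<in>std_simplex p. orientation n (snd (\<rho> x)) (w e x) > 0" by blast
  then have e2: "e\<^sup>2 = 1" by auto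
  have "\<rho> x = \<tau> e x" for x proof (cases "x \<in> std_simplex p")
   case x: True
   have "\<beta> e x = snd (\<rho> x)"
    unfolding \<beta>_def using bspec[OF e(2) x] by (intro orientation_subspace(2)[OF mem(1)[OF x] wi[OF x e2] wV[OF _ x e2]])
   then show ?thesis using x fst\<rho> [OF x] by (simp add: \<tau>_def prod_eq_iff)
  next
   case False
   then show ?thesis using ext by (simp add: \<tau>_def extensional_def)
  qed
  then show ?thesis using e(1) by auto
 qed
 have bit: "orientation_bit n (\<beta> e x) (u (\<sigma> x)) = sign_bit (w e x 0) (u (\<sigma> x) 0) + sign_bit (w e x 1) (u (\<sigma> x) 1) + sign_bit (w e x 2) (u (\<sigma> x) 2)"
  if x: "x \<in> std_simplex p" and e: "e\<^sup>2 = 1" for e x proof -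
  have nz: "orientation n (\<beta> e x) (u (\<sigma> x)) \<noteq> 0"
   using continuous_map_mem[OF c\<beta> [OF e], of x] x e u\<beta> by (intro orientation_subspace(1) ind top) auto
  have "orientation_bit n (\<beta> e x) (w e x) = orientation_bit n (\<beta> e x) (u (\<sigma> x)) +
    (sign_bit (w e x 0) (u (\<sigma> x) 0) + sign_bit (w e x 1) (u (\<sigma> x) 1) + sign_bit (w e x 2) (u (\<sigma> x) 2))"
   by (rule orientation_bit_sign[OF wu[OF _ x e] neg[OF _ x] nz])
  moreover have "orientation n (\<beta> e x) (w e x) > 0"
   unfolding \<beta>_def using continuous_map_mem[OF cs[OF e], of x] x by (intro orientation_oriented_span) simp
  then have "orientation_bit n (\<beta> e x) (w e x) = 0" by (simp add: orientation_bit_def)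
  ultimately have "0 = orientation_bit n (\<beta> e x) (u (\<sigma> x)) +
    (sign_bit (w e x 0) (u (\<sigma> x) 0) + sign_bit (w e x 1) (u (\<sigma> x) 1) + sign_bit (w e x 2) (u (\<sigma> x) 2))" by (simp only:)
  moreover have "0 = a + b ==> a = b" for a b :: bit by (cases a; cases b) simp_all
  ultimately show ?thesis by blast
 qed
 have "orientation_bit n (snd (\<tau> 1 (vertex i))) (u (fst (\<tau> 1 (vertex i)))) + orientation_bit n (snd (\<tau> (-1) (vertex i))) (u (fst (\<tau> (-1) (vertex i)))) = 1"
  if "i \<le> p" for i proof -
  note x = vertex_in_simplex[OF that]
  have "v 0 (vertex i) = u (\<sigma> (vertex i)) 0 \<or> v 0 (vertex i) = (\<lambda>k. - u (\<sigma> (vertex i)) 0 k)"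
   using wu[of 0 "vertex i" 1] x by (simp add: w_def)
  then have "sign_bit (w 1 (vertex i) 0) (u (\<sigma> (vertex i)) 0) + sign_bit (w (-1) (vertex i) 0) (u (\<sigma> (vertex i)) 0) = 1"
   using neg[of 0 "vertex i"] x by (auto simp: w_def sign_bit_def)
  moreover have "w (-1) (vertex i) 1 = w 1 (vertex i) 1" "w (-1) (vertex i) 2 = w 1 (vertex i) 2" by (simp_all add: w_def)
  moreover have "a + b = 1 ==> a + c + d + (b + c + d) = 1" for a b c d :: bit
   by (cases a; cases b; cases c; cases d) (simp_all add: add_bit_eq_xor)
  moreover have t: "fst (\<tau> e (vertex i)) = \<sigma> (vertex i)" "snd (\<tau> e (vertex i)) = \<beta> e (vertex i)" for e
   using x by (simp_all add: \<tau>_def)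
  moreover have "(1::real)\<^sup>2 = 1" "(-1::real)\<^sup>2 = 1" by simp_all
  ultimately show ?thesis unfolding t by (simp only: bit[OF x])
 qed
 then show "\<exists>\<tau>1 \<tau>2. {\<rho>. ssimplex p Y \<rho> \<and> simplex_map p fst \<rho> = \<sigma>} = {\<tau>1, \<tau>2} \<and>
   (\<forall>i\<le>p. orientation_bit n (snd (\<tau>1 (vertex i))) (u (fst (\<tau>1 (vertex i)))) + orientation_bit n (snd (\<tau>2 (vertex i))) (u (fst (\<tau>2 (vertex i)))) = 1)"
  using lifts \<tau> by (intro exI[of _ "\<tau> 1"] exI[of _ "\<tau> (-1)"] conjI) auto
qed

section \<open>The height of \<open>w\<^sub>3\<close>\<close>

lemma cup_pow_cohomologous:
 assumes "cohomologous X \<phi> \<psi>" "\<phi> \<in> cocycles X" "\<psi> \<in> cocycles X"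
 shows "cohomologous X (cup_pow X \<phi> k) (cup_pow X \<psi> k)" by (induction k) (auto intro!: cohomologous_cups assms cup_pow_cocycles)

lemma evaluate_power:
 assumes x: "commuting X x"
 shows "cohomologous X (evaluate X x (p ^ k)) (cup_pow X (evaluate X x p) k)" proof (induction k)
 case (Suc k)
 have "cohomologous X (evaluate X x (p ^ Suc k)) (cup X (evaluate X x (p ^ k)) (evaluate X x p))" unfolding power_Suc2 by (rule evaluate_mult[OF x])
 also have "cohomologous X \<dots> (cup_pow X (evaluate X x p) (Suc k))"
  unfolding cup_pow.simps by (intro cohomologous_cups Suc cohomologous_refl cup_pow_cocycles evaluate_cocycles x)
 finally show ?case .
qed (simp only: power_0 evaluate_one cup_pow.simps cohomologous_refl)

lemma poly_ideal_exact: "commuting X x ==> poly_ideal (exact_ideal X x)"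
 using exact_ideal_add exact_ideal_mult by (auto simp only: poly_ideal_def)

lemma evaluate_elem3:
 assumes x: "commuting X x"
 shows "cohomologous X (cup X (x 0) (cup X (x 1) (x 2))) (evaluate X x elem3)" proof -
 note v = evaluate_var[OF x]
 have "cohomologous X (evaluate X x elem3) (cup X (evaluate X x (var 0)) (evaluate X x (var 1 * var 2)))" by (rule evaluate_mult[OF x])
 also have "cohomologous X \<dots> (cup X (evaluate X x (var 0)) (cup X (evaluate X x (var 1)) (evaluate X x (var 2))))"
  by (intro cohomologous_cups cohomologous_refl evaluate_mult evaluate_cocycles x)
 finally show ?thesis using v[of 0] v[of 1] v[of 2] by (simp add: cohomologous_commute)
qed

lemma evaluate_elem1: "commuting X x ==> evaluate X x elem1 = x 0 + x 1 + x 2"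
 by (simp only: evaluate_add evaluate_var zero_less_numeral one_less_numeral_iff semiring_norm lessI numeral_less_iff)

lemma w3_power_roots:
 assumes w: "w1 \<in> cocycles (grass n)" "w2 \<in> cocycles (grass n)" "w3 \<in> cocycles (grass n)"
  and rel: "cohomologous (pbundle n (grass n) underlying_subspace) (cup_pow (pbundle n (grass n) underlying_subspace)
   (taut n (grass n) underlying_subspace) 3) (theta3 n (grass n) underlying_subspace w3 w2 w1)"
  and g: "continuous_map Y (grass n) g" and u: "line_triple n Y u" and ind: "\<And>y. y \<in> topspace Y ==> independent3 (u y)"
  and uV: "\<And>y j. y \<in> topspace Y ==> j < 3 ==> u y j \<in> underlying_subspace (g y)"
 shows "cohomologous Y (pull Y g (cup_pow (grass n) w3 k)) (evaluate Y (root Y u) (elem3 ^ k))" proof -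
 note x = commuting_roots[OF u]
 have gw: "pull Y g w3 \<in> cocycles Y" using w(3) g by (rule pull_cocycles)
 have "cohomologous Y (pull Y g w3) (cup Y (root Y u 0) (cup Y (root Y u 1) (root Y u 2)))"
  by (rule stiefel_whitney_roots[OF w rel charted_lin_closed[OF charted_grass] g u ind uV])
 also have "cohomologous Y \<dots> (evaluate Y (root Y u) elem3)" by (rule evaluate_elem3[OF x])
 finally have "cohomologous Y (cup_pow Y (pull Y g w3) k) (cup_pow Y (evaluate Y (root Y u) elem3) k)"
  by (intro cup_pow_cohomologous gw evaluate_cocycles[OF x])
 also have "cohomologous Y \<dots> (evaluate Y (root Y u) (elem3 ^ k))" by (rule cohomologous_commute[OF evaluate_power[OF x]])
 finally show ?thesis unfolding cup_pow_pullback[OF g] .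
qed

text \<open>The number n - 2 is the degree from which on \<open>complete_sym_exact\<close> applies;
  s and j are left free so that both ranges of n can be served.\<close>

theorem w3_power_zero:
 assumes w: "w1 \<in> cocycles (grass n)" "w2 \<in> cocycles (grass n)" "w3 \<in> cocycles (grass n)"
  and rel: "cohomologous (pbundle n (grass n) underlying_subspace) (cup_pow (pbundle n (grass n) underlying_subspace)
   (taut n (grass n) underlying_subspace) 3) (theta3 n (grass n) underlying_subspace w3 w2 w1)"
  and M: "n - 2 \<le> 3 * (2 ^ s - 1) + j"
 shows "cup_pow (grass n) w3 (j + (2 ^ s - 1)) \<in> cobs (grass n)" proof -
 let ?V = "underlying_subspace :: 3 oriented_subspace => _"
 let ?P = "flag3 n (grass n) ?V" and ?u = "flag_lines n" and ?g = "\<lambda>p. fst (fst (fst p))"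
 let ?Y = "subtopology ?P (nearly_orthogonal n ?P ?u)"
 note lin = charted_lin_closed[OF charted_grass]
 have uP: "line_triple n ?P ?u" by (rule line_triple_flag[OF lin])
 then have u: "line_triple n ?Y ?u" by (simp add: line_triple_def line_field_subtopology)
 have ind: "independent3 (?u y)" if "y \<in> topspace ?Y" for y using that nearly_orthogonal_independent[OF uP] by simp
 have g: "continuous_map ?Y (grass n) ?g" by (intro continuous_map_from_subtopology flag_projections(3))
 have uV: "?u y j \<in> ?V (?g y)" if y: "y \<in> topspace ?Y" for y j proof -
  have P1: "y \<in> topspace ?P" using y by simp
  have P: "y \<in> topspace ?P" "fst y \<in> topspace (flag2 n (grass n) ?V)" "fst (fst y) \<in> topspace (pbundle n (grass n) ?V)"
   using P1 continuous_map_mem[OF flag_projections(1) P1] continuous_map_mem[OF flag_projections(2) P1] .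
  have l2: "lin_closed (?V (fst p))" if "p \<in> topspace (pbundle n (grass n) ?V)" for p
   using lin continuous_map_mem[OF continuous_pbundle_fst that] by blast
  have l3: "lin_closed (?V (fst (fst p)))" if "p \<in> topspace (flag2 n (grass n) ?V)" for p
   using l2 continuous_map_mem[OF continuous_pbundle_fst that] by blast
  show ?thesis using fibre_unit_props(3)[OF P(1) l3] fibre_unit_props(3)[OF P(2) l2] fibre_unit_props(3)[OF P(3) lin] by (simp add: flag_lines_def)
 qed
 note x = commuting_roots[OF u]
 have "root ?Y ?u 0 + root ?Y ?u 1 + root ?Y ?u 2 = coboundary ?Y (point_cochain ?Y (\<lambda>y. orientation_bit n (?g y) (?u y)))"
  by (rule root_sum[OF g u ind uV])
 then have "evaluate ?Y (root ?Y ?u) elem1 \<in> cobs ?Y" unfolding evaluate_elem1[OF x] by (rule ssubst) (intro cobsI point_cochain_cochains)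
 then have e1: "elem1 \<in> exact_ideal ?Y (root ?Y ?u)" by (simp only: exact_ideal_def mem_Collect_eq)
 have "elem3 ^ (j + (2 ^ s - 1)) \<in> exact_ideal ?Y (root ?Y ?u)"
  by (rule elem3_power_exact[OF poly_ideal_exact[OF x] e1 _ M]) (rule complete_sym_exact[OF u ind], simp_all)
 then have "evaluate ?Y (root ?Y ?u) (elem3 ^ (j + (2 ^ s - 1))) \<in> cobs ?Y" by (simp only: exact_ideal_def mem_Collect_eq)
 with w3_power_roots[OF w rel g u ind uV] have "pull ?Y ?g (cup_pow (grass n) w3 (j + (2 ^ s - 1))) \<in> cobs ?Y"
  by (rule cohomologous_exact)
 then show ?thesis by (rule nearly_orthogonal_injective[OF charted_grass cup_pow_cocycles[OF w(3)]])
qed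

lemma line_field_mono:
 assumes "line_field m Y u" "m \<le> n"
 shows "line_field n Y u" proof -
 have "dotn n (u y) (u y) = dotn m (u y) (u y)" if "y \<in> topspace Y" for y
  unfolding dotn_def using assms that by (intro sum.mono_neutral_right) (auto simp: line_field_def)
 then show ?thesis using assms by (auto simp: line_field_def)
qed

text \<open>
 If \<open>w\<^sub>3\<^sup>m = 0\<close>, the Gysin sequence of the double covering by the orientations gives \<open>e\<^sub>3\<^sup>m = v e\<^sub>1\<close> on the space of triples of lines.
 Multiplication by a polynomial \<open>z\<close> with \<open>e\<^sub>1 z = 0\<close> and by the differences of the roots leads to the top class of the flag bundle.
\<close>

theorem w3_power_nonzero:
 assumes w: "w1 \<in> cocycles (grass n)" "w2 \<in> cocycles (grass n)" "w3 \<in> cocycles (grass n)"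
  and rel: "cohomologous (pbundle n (grass n) underlying_subspace) (cup_pow (pbundle n (grass n) underlying_subspace)
   (taut n (grass n) underlying_subspace) 3) (theta3 n (grass n) underlying_subspace w3 w2 w1)"
  and M: "Suc M \<le> n" "M = m + 2 ^ r" "r \<ge> 1" "Suc M \<le> 2 * 2 ^ r - 1"
 shows "cup_pow (grass n) w3 m \<notin> cobs (grass n)" proof
 assume zero: "cup_pow (grass n) w3 m \<in> cobs (grass n)"
 \<comment> \<open>The lines are taken in dimension M + 1, which may be smaller than n, so that the
   top class lies in the power M of each root.\<close>
 let ?l = "Suc M" and ?V = "\<lambda>_. euclid (Suc M)"
 let ?P = "flag3 ?l point ?V" and
  ?u = "flag_lines (Suc M) :: ((unit \<times> (nat => real) set) \<times> (nat => real) set) \<times> (nat => real) set => nat => nat => real"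
 let ?Z = "subtopology ?P (nearly_orthogonal ?l ?P ?u)"
 have uP: "line_triple ?l ?P ?u" by (rule line_triple_flag) (rule lin_closed_euclid)
 then have uZ: "line_triple ?l ?Z ?u" by (simp add: line_triple_def line_field_subtopology)
 have uZ': "line_triple n ?Z ?u" using line_field_mono[OF line_tripleD[OF uZ] M(1)] by (simp add: line_triple_def)
 have ind: "independent3 (?u z)" if "z \<in> topspace ?Z" for z using that nearly_orthogonal_independent[OF uP] by simp
 \<comment> \<open>The triples with an orientation of their span: Y maps to the Grassmannian by
   \<open>snd\<close>, and by \<open>root_sum\<close> the class of the covering \<open>fst\<close>
   is e1.\<close>
 define Y where "Y = subtopology (prod_topology ?Z (grass n)) {(z, b). \<forall>j<3. ?u z j \<in> underlying_subspace b}"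
 define \<epsilon> where "\<epsilon> = (\<lambda>y. orientation_bit n (snd y) (?u (fst y)))"
 interpret cov: double_covering Y ?Z fst \<epsilon> unfolding Y_def \<epsilon>_def using uZ' ind by (rule double_covering_oriented)
 have g: "continuous_map Y (grass n) snd" unfolding Y_def by (intro continuous_map_from_subtopology continuous_map_snd)
 let ?u' = "\<lambda>y. ?u (fst y)"
 have uY: "line_triple n Y ?u'" using line_field_compose[OF line_tripleD[OF uZ'] cov.cont] by (simp add: line_triple_def)
 have indY: "independent3 (?u' y)" if "y \<in> topspace Y" for y using ind continuous_map_mem[OF cov.cont that] by blast
 have uV: "?u' y j \<in> underlying_subspace (snd y)" if "y \<in> topspace Y" "j < 3" for y j using that by (auto simp: Y_def)
 have rZ: "pull Y fst (root ?Z ?u j) = root Y ?u' j" for j by (rule line_cocycle_pullback[OF cov.cont])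
 note xZ = commuting_roots[OF uZ] and xP = commuting_roots[OF uP]
 let ?ev = "evaluate ?Z (root ?Z ?u)"
 have evc: "?ev p \<in> cocycles ?Z" for p by (rule evaluate_cocycles[OF xZ])
 have "pull Y snd (cup_pow (grass n) w3 m) \<in> cobs Y" using zero g by (rule pull_cobs)
 with cohomologous_commute[OF w3_power_roots[OF w rel g uY indY uV]]
 have "evaluate Y (root Y ?u') (elem3 ^ m) \<in> cobs Y" by (rule cohomologous_exact)
 then have "pull Y fst (?ev (elem3 ^ m)) \<in> cobs Y" unfolding evaluate_pullback[OF cov.cont] rZ .
 moreover have sumc: "root ?Z ?u 0 + root ?Z ?u 1 + root ?Z ?u 2 \<in> cocycles ?Z" by (intro cocycles_add root_cocycles[OF uZ]) simp_all
 moreover have "pull Y fst (root ?Z ?u 0 + root ?Z ?u 1 + root ?Z ?u 2) = coboundary Y (point_cochain Y \<epsilon>)"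
  unfolding pull_add rZ \<epsilon>_def by (rule root_sum[OF g uY indY uV])
 ultimately obtain v where v: "v \<in> cocycles ?Z" "?ev (elem3 ^ m) + cup ?Z v (root ?Z ?u 0 + root ?Z ?u 1 + root ?Z ?u 2) \<in> cobs ?Z"
  using cov.gysin_pullback_kernel evc by metis
 then have v': "cohomologous ?Z (?ev (elem3 ^ m)) (cup ?Z v (?ev elem1))" unfolding evaluate_elem1[OF xZ] cohomologous_def by simp
 define f where "f = four_sym (elem2 + elem1 * elem1) (elem3 + elem1 * elem2) (elem1 * elem3)"
 \<comment> \<open>With this k, f (k + 1) is zero by \<open>four_sym_zero\<close>, so the complete
   symmetric polynomial of degree k + 1 is e1 times f k, and it vanishes on \<open>?Z\<close> since
   k + 3 is at least M + 1. Moreover k + 3 = 2 * 2 ^ r - 1 is the exponent in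
   \<open>top_power_exact\<close>.\<close>
 define k where "k = (2::nat) * 2 ^ r - 4"
 obtain r' where r': "r = Suc r'" using M(3) by (metis Suc_le_D One_nat_def)
 obtain p where "2 ^ r' = Suc (p::nat)" using not0_implies_Suc[of "2 ^ r'"] by auto
 then have kk: "k + 1 = 2 ^ (r' + 2) - 3" "k + 3 = 2 * 2 ^ r - 1" "Suc M \<le> (k + 1) + 2" using M(4) by (auto simp: k_def r')
 have "complete_sym elem1 elem2 elem3 (k + 1) = elem1 * f k"
  unfolding complete_four_sym f_def[symmetric] using four_sym_zero[of _ _ _ r'] by (simp only: kk(1) f_def add_0_left)
 then have "elem1 * f k \<in> exact_ideal ?Z (root ?Z ?u)" using complete_sym_exact[OF uZ ind kk(3)] by simp
 then have e1: "cup ?Z (?ev elem1) (?ev (f k)) \<in> cobs ?Z"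
  using cohomologous_exact[OF cohomologous_commute[OF evaluate_mult[OF xZ]]] by (simp only: exact_ideal_def mem_Collect_eq)
 have "cohomologous ?Z (?ev (elem3 ^ m * f k)) (cup ?Z (?ev (elem3 ^ m)) (?ev (f k)))" by (rule evaluate_mult[OF xZ])
 also have "cohomologous ?Z \<dots> (cup ?Z (cup ?Z v (?ev elem1)) (?ev (f k)))" by (intro cohomologous_cups v' cohomologous_refl cocycles_cup v(1) evc)
 finally have "?ev (elem3 ^ m * f k) \<in> cobs ?Z" by (rule cohomologous_exact) (unfold cup_assoc, rule cobs_cup_right[OF v(1) e1])
 moreover have "?ev p = restr ?Z (evaluate ?P (root ?P ?u) p)" for p
  by (simp only: evaluate_pullback[OF continuous_map_subtopology_ident] line_cocycle_pullback[OF continuous_map_subtopology_ident])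
 ultimately have res: "restr ?Z (evaluate ?P (root ?P ?u) (elem3 ^ m * f k)) \<in> cobs ?Z" by simp
 let ?ep = "evaluate ?P (root ?P ?u)"
 have epc: "?ep p \<in> cocycles ?P" for p by (rule evaluate_cocycles[OF xP])
 have vs: "root ?P ?u i + root ?P ?u j = ?ep (var i + var j)" if "i < 3" "j < 3" for i j
  by (simp only: evaluate_add evaluate_var[OF xP that(1)] evaluate_var[OF xP that(2)])
 \<comment> \<open>\<Delta> serves twice: it passes from nearly orthogonal triples to all of
   \<open>?P\<close>, and it turns f k into the sum of powers of
   \<open>four_sym_power_sum\<close>.\<close>
 define \<Delta> where "\<Delta> = (var 0 + var 1) * ((var 0 + var 2) * (var 1 + var 2))"
 have "cohomologous ?P (?ep (elem3 ^ m * f k * \<Delta>)) (cup ?P (?ep (elem3 ^ m * f k)) (?ep \<Delta>))" by (rule evaluate_mult[OF xP])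
 also have "cohomologous ?P \<dots> (cup ?P (?ep (elem3 ^ m * f k)) (cup ?P (?ep (var 0 + var 1)) (?ep ((var 0 + var 2) * (var 1 + var 2)))))"
  unfolding \<Delta>_def by (intro cohomologous_cups cohomologous_refl evaluate_mult[OF xP] epc)
 also have "cohomologous ?P \<dots> (cup ?P (?ep (elem3 ^ m * f k)) (cup ?P (?ep (var 0 + var 1)) (cup ?P (?ep (var 0 + var 2)) (?ep (var 1 + var 2)))))"
  by (intro cohomologous_cups cohomologous_refl evaluate_mult[OF xP] cocycles_cup epc)
 finally have "?ep (elem3 ^ m * f k * \<Delta>) \<in> cobs ?P"
  by (rule cohomologous_exact) (use nearly_orthogonal_kernel[OF uP epc res] in \<open>simp add: vs\<close>)
 moreover have "elem3 ^ m * f k * \<Delta> = elem3 ^ m * (elem1 ^ (2 * 2 ^ r - 1) + var 0 ^ (2 * 2 ^ r - 1) + var 1 ^ (2 * 2 ^ r - 1) + var 2 ^ (2 * 2 ^ r - 1))"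
  using four_sym_power_sum[of k] unfolding kk(2) f_def \<Delta>_def by (simp only: mult.assoc mult.commute mult.left_commute)
 ultimately have top: "elem3 ^ m * (elem1 ^ (2 * 2 ^ r - 1) + var 0 ^ (2 * 2 ^ r - 1) + var 1 ^ (2 * 2 ^ r - 1) + var 2 ^ (2 * 2 ^ r - 1)) \<in> exact_ideal ?P (root ?P ?u)"
  by (simp only: exact_ideal_def mem_Collect_eq)
 have pow: "cohomologous ?P (?ep (var j ^ l)) (cup_pow ?P (root ?P ?u j) l)" if "j < 3" for j l
  using evaluate_power[OF xP, of "var j" l] unfolding evaluate_var[OF xP that] .
 have "var j ^ Suc M \<in> exact_ideal ?P (root ?P ?u)" if "j < 3" for j unfolding exact_ideal_def mem_Collect_eq
  by (rule cohomologous_exact[OF pow[OF that] line_field_power_zero[OF line_tripleD[OF uP that]]])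
 then have "var 0 ^ M * var 1 ^ M * var 2 ^ M \<in> exact_ideal ?P (root ?P ?u)" by (rule top_power_exact[OF poly_ideal_exact[OF xP] _ M(2,3) top])
 then have "?ep (var 0 ^ M * var 1 ^ M * var 2 ^ M) \<in> cobs ?P" by (simp only: exact_ideal_def mem_Collect_eq)
 moreover have "cohomologous ?P (?ep (var 0 ^ M * var 1 ^ M * var 2 ^ M)) (cup ?P (cup ?P (cup_pow ?P (root ?P ?u 0) M) (cup_pow ?P (root ?P ?u 1) M)) (cup_pow ?P (root ?P ?u 2) M))"
 proof -
  have rc: "cup_pow ?P (root ?P ?u j) l \<in> cocycles ?P" if "j < 3" for j l using root_cocycles[OF uP that] by (rule cup_pow_cocycles)
  have "cohomologous ?P (?ep (var 0 ^ M * var 1 ^ M)) (cup ?P (cup_pow ?P (root ?P ?u 0) M) (cup_pow ?P (root ?P ?u 1) M))"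
   by (rule cohomologous_transitive[OF evaluate_mult[OF xP] cohomologous_cups]) (use pow rc epc in simp_all)
  then show ?thesis by (intro cohomologous_transitive[OF evaluate_mult[OF xP] cohomologous_cups] pow cocycles_cup rc epc) simp_all
 qed
 ultimately show False using flag_top_class[of M] cohomologous_exact cohomologous_commute by blast
qed

theorem theorem1p3:
 fixes n t :: nat
 assumes "7 \<le> n" and "3 \<le> t" and "2 ^ t - 1 \<le> n" and "n < 2 ^ (t + 1) - 1"
 shows "height (cohomology_ring (oriented_grassmannian TYPE(3) n)) (canonical_sw TYPE(3) n 3) =
  enat (nat (max (2 ^ (t - 1) - 2) (int n - 2 ^ t - 1)))" proof -
 obtain w1 w2 w3 where w: "w1 \<in> cocycles (grass n)" "w2 \<in> cocycles (grass n)" "w3 \<in> cocycles (grass n)"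
  and rel: "cohomologous (pbundle n (grass n) underlying_subspace) (cup_pow (pbundle n (grass n) underlying_subspace)
   (taut n (grass n) underlying_subspace) 3) (theta3 n (grass n) underlying_subspace w3 w2 w1)"
  and sw: "stiefel_whitney 3 n (grass n) underlying_subspace 3 = cohomology_class (grass n) w3" by (rule stiefel_whitney_charted[OF charted_grass])
 \<comment> \<open>In terms of q the entries of the maximum are q - 2 and n - 2 q - 1. They agree
   for n = 3 q - 1, hence the distinction n < 3 q below.\<close>
 define q where "q = (2::nat) ^ (t - 1)"
 have t: "2 ^ t = 2 * q" "2 ^ (t + 1) = 4 * q" "(2::int) ^ (t - 1) = int q" "(2::int) ^ t = 2 * int q"
  using \<open>3 \<le> t\<close> by (cases t; simp add: q_def)+
 have q: "q \<ge> 4" using power_increasing[of 2 "t - 1" "2::nat"] \<open>3 \<le> t\<close> by (simp add: q_def)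
 define K where "K = nat (max (2 ^ (t - 1) - 2) (int n - 2 ^ t - 1))"
 have n: "2 * q \<le> n + 1" "n + 1 < 4 * q" using assms(3,4) unfolding t by auto
 \<comment> \<open>With s = t - 1, the least j that satisfies the bound of
   \<open>w3_power_zero\<close> is the excess of n over 3 q - 1, or 0 if there is none.\<close>
 have upper: "cup_pow (grass n) w3 (Suc K) \<in> cobs (grass n)" proof (cases "n < 3 * q")
  case True
  then have "Suc K = 0 + (2 ^ (t - 1) - 1)" "n - 2 \<le> 3 * (2 ^ (t - 1) - 1) + 0" using q unfolding K_def t q_def[symmetric] by auto
  then show ?thesis using w3_power_zero[OF w rel] by metis
 next
  case False
  then have "Suc K = (n + 1 - 3 * q) + (2 ^ (t - 1) - 1)" "n - 2 \<le> 3 * (2 ^ (t - 1) - 1) + (n + 1 - 3 * q)"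
   using q unfolding K_def t q_def[symmetric] by auto
  then show ?thesis using w3_power_zero[OF w rel] by metis
 qed
 \<comment> \<open>For n < 3 q the lines are taken in dimension 2 q - 1, with r = t - 1; otherwise
   in the full dimension n, with r = t.\<close>
 have lower: "cup_pow (grass n) w3 K \<notin> cobs (grass n)" proof (cases "n < 3 * q")
  case True
  then have "K = q - 2" using q unfolding K_def t by auto
  then have "Suc (2 * q - 2) \<le> n" "2 * q - 2 = K + 2 ^ (t - 1)" "1 \<le> t - 1" "Suc (2 * q - 2) \<le> 2 * 2 ^ (t - 1) - 1"
   using q n \<open>3 \<le> t\<close> unfolding q_def[symmetric] by auto
  then show ?thesis by (rule w3_power_nonzero[OF w rel])
 next
  case False
  then have "K = n - 2 * q - 1" using q unfolding K_def t by auto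
  then have "Suc (n - 1) \<le> n" "n - 1 = K + 2 ^ t" "1 \<le> t" "Suc (n - 1) \<le> 2 * 2 ^ t - 1"
   using q n False \<open>3 \<le> t\<close> unfolding t by auto
  then show ?thesis by (rule w3_power_nonzero[OF w rel])
 qed
 let ?H = "cohomology_ring (grass n)"
 have S: "cohomology_class (grass n) w3 [^]\<^bsub>?H\<^esub> m \<noteq> \<zero>\<^bsub>?H\<^esub> \<longleftrightarrow> cup_pow (grass n) w3 m \<notin> cobs (grass n)" for m :: nat
  by (simp only: class_pow[OF w(3)] cohomology_class_eq_0_iff)
 have le: "m \<le> K" if "cup_pow (grass n) w3 m \<notin> cobs (grass n)" for m proof (rule ccontr)
  assume "\<not> m \<le> K"
  then have "m = Suc K + (m - Suc K)" by simp
  moreover have "cup_pow (grass n) w3 (Suc K + (m - Suc K)) \<in> cobs (grass n)"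
   unfolding cup_pow_add[OF cocyclesD(1)[OF w(3)]] by (rule cobs_cup_left[OF upper cup_pow_cocycles[OF w(3)]])
  ultimately show False using that by simp
 qed
 have "height ?H (cohomology_class (grass n) w3) = enat K" unfolding height_def S proof (rule antisym)
  show "(SUP m\<in>{m. cup_pow (grass n) w3 m \<notin> cobs (grass n)}. enat m) \<le> enat K" using le by (intro SUP_least) simp
  show "enat K \<le> (SUP m\<in>{m. cup_pow (grass n) w3 m \<notin> cobs (grass n)}. enat m)" using lower by (intro SUP_upper) simp
 qed
 then show ?thesis by (simp add: canonical_sw_def sw K_def)
qed

end
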